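(* Let $k$ be a field of characteristic different from 2, and assume that $\delta=-(q-q^{-1})$ for $q\in k^\times$ that is not a root of unity. Then $\mathrm{SKar}(\mathcal{STL}(\delta))$ is a semisimple Abelian category. Moreover, as a based ring with canonical basis coming from the isomorphism classes of irreducible objects, $K_0(\mathrm{SKar}(\mathcal{STL}(\delta)))$ is isomorphic to the subring of $\mathbb Z^\pi[x,x^{-1}]$ spanned over $\mathbb Z$ by the basis $\{[n+1]_{x,\pi},\ \pi[n+1]_{x,\pi}\mid n\in\mathbb N\}$, where $$[n+1]_{x,\pi}:=x^n+\pi x^{n-2}+\cdots+\pi^nx^{-n}.$$
   Context: $\mathbb N=\{0,1,2,\dots\}$; $\mathbb Z^\pi:=\mathbb Z[\pi]/(\pi^2-1)$. An isomorphism of based rings is a ring isomorphism mapping the given basis bijectively onto the given basis. A superspace is a $\mathbb Z/2$-graded $k$-vector space, $|v|$ denoting parity. A supercategory is a category whose morphism sets are superspaces with bilinear composition that is an even map. A strict monoidal supercategory is a supercategory with a strictly associative and unital tensor product on objects and bilinear, parity-additive tensor product on morphisms, preserving identities and satisfying the super interchange law $(f\otimes g)\circ(h\otimes k)=(-1)^{|g||h|}(f\circ h)\otimes(g\circ k)$. The odd Temperley-Lieb supercategory $\mathcal{STL}(\delta)$ is the strict monoidal ($k$-linear) supercategory with one generating object $\cdot$ and two odd generating morphisms $\mathrm{cup}:\mathbf 1\to\cdot\otimes\cdot$ and $\mathrm{cap}:\cdot\otimes\cdot\to\mathbf 1$, subject to the relations $$(\mathrm{cap}\otimes1)\circ(1\otimes\mathrm{cup})=1,\quad(1\otimes\mathrm{cap})\circ(\mathrm{cup}\otimes1)=-1,\quad\mathrm{cap}\circ\mathrm{cup}=\delta,$$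 where $1$ denotes the identity morphism of $\cdot$. For a monoidal supercategory $\mathcal A$, the $\Pi$-envelope $\mathcal A_\pi$ has objects $\Pi^a\lambda$ ($\lambda\in\mathrm{ob}\,\mathcal A$, $a\in\mathbb Z/2$); $\mathrm{Hom}_{\mathcal A_\pi}(\Pi^a\lambda,\Pi^b\mu)$ is $\mathrm{Hom}_{\mathcal A}(\lambda,\mu)$ with parity shifted by $a+b$, a homogeneous $f$ being written $f_a^b$ (parity $|f|+a+b$). Composition is $f_b^c\circ g_a^b=(f\circ g)_a^c$, and the tensor product is $(\Pi^a\lambda)\otimes(\Pi^b\mu)=\Pi^{a+b}(\lambda\otimes\mu)$, $f_a^b\otimes g_c^d=(-1)^{a|g|+|f|d+ad+ac}(f\otimes g)_{a+c}^{b+d}$. The underlying category $\underline{\mathcal A}_\pi$ has the same objects but only the even morphisms. $\mathrm{SKar}(\mathcal A):=\mathrm{Kar}(\underline{\mathcal A}_\pi)$ is the additive Karoubi envelope (idempotent completion of the additive envelope) of $\underline{\mathcal A}_\pi$, with the extended monoidal structure. $K_0$ of an additive category is the Abelian group generated by isomorphism classes of objects modulo $[V]+[W]=[V\oplus W]$; here it is a ring via $[V]\cdot[W]=[V\otimes W]$. *)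

theory Defs
  imports
    "Jordan_Normal_Form.Matrix"
    "HOL-Algebra.QuotRing"
    "HOL-Algebra.Algebraic_Closure_Type"
    "HOL-Library.Poly_Mapping"
    "HOL-Library.Z2"
begin

section \<open>Categories enriched in vector spaces\<close>

text \<open>
  Morphism sets are indexed by source and target and need not be disjoint. All operations on
  morphisms therefore take the objects involved as arguments: for \<open>f : x \<rightarrow> y\<close> and
  \<open>g : y \<rightarrow> z\<close> the composite \<open>g \<circ> f\<close> is \<open>comp_mor C x y z g f\<close>, and for
  \<open>f : x \<rightarrow> x'\<close>, \<open>g : y \<rightarrow> y'\<close> the tensor product \<open>f \<otimes> g\<close> is \<open>tensor_mor C x x' y y' f g\<close>.
\<close>

record ('o, 'm, 'k) lin_moncat =
  Ob :: "'o set"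
  Mor :: "'o \<Rightarrow> 'o \<Rightarrow> 'm set"
  id_mor :: "'o \<Rightarrow> 'm"
  comp_mor :: "'o \<Rightarrow> 'o \<Rightarrow> 'o \<Rightarrow> 'm \<Rightarrow> 'm \<Rightarrow> 'm"
  zero_mor :: "'o \<Rightarrow> 'o \<Rightarrow> 'm"
  add_mor :: "'o \<Rightarrow> 'o \<Rightarrow> 'm \<Rightarrow> 'm \<Rightarrow> 'm"
  scale_mor :: "'o \<Rightarrow> 'o \<Rightarrow> 'k \<Rightarrow> 'm \<Rightarrow> 'm"
  unit_ob :: "'o"
  tensor_ob :: "'o \<Rightarrow> 'o \<Rightarrow> 'o"
  tensor_mor :: "'o \<Rightarrow> 'o \<Rightarrow> 'o \<Rightarrow> 'o \<Rightarrow> 'm \<Rightarrow> 'm \<Rightarrow> 'm"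

text \<open>\<open>homog A x y p\<close> is the set of homogeneous morphisms \<open>x \<rightarrow> y\<close> of parity \<open>p\<close>
  (zero included).\<close>

record ('o, 'm, 'k) supercat = "('o, 'm, 'k) lin_moncat" +
  homog :: "'o \<Rightarrow> 'o \<Rightarrow> bit \<Rightarrow> 'm set"

definition sum_mor :: "('o, 'm, 'k, 'z) lin_moncat_scheme \<Rightarrow> 'o \<Rightarrow> 'o \<Rightarrow> 'm list \<Rightarrow> 'm" where
  "sum_mor C x y fs = foldr (add_mor C x y) fs (zero_mor C x y)"

locale preadditive_category =
  fixes C :: "('o, 'm, 'k, 'z) lin_moncat_scheme"
  assumes id_closed: "x \<in> Ob C \<Longrightarrow> id_mor C x \<in> Mor C x x"
    and comp_closed: "\<lbrakk>x \<in> Ob C; y \<in> Ob C; z \<in> Ob C; g \<in> Mor C y z; f \<in> Mor C x y\<rbrakk>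
      \<Longrightarrow> comp_mor C x y z g f \<in> Mor C x z"
    and comp_assoc: "\<lbrakk>w \<in> Ob C; x \<in> Ob C; y \<in> Ob C; z \<in> Ob C;
        h \<in> Mor C y z; g \<in> Mor C x y; f \<in> Mor C w x\<rbrakk>
      \<Longrightarrow> comp_mor C w x z (comp_mor C x y z h g) f = comp_mor C w y z h (comp_mor C w x y g f)"
    and comp_id_left: "\<lbrakk>x \<in> Ob C; y \<in> Ob C; f \<in> Mor C x y\<rbrakk>
      \<Longrightarrow> comp_mor C x y y (id_mor C y) f = f"
    and comp_id_right: "\<lbrakk>x \<in> Ob C; y \<in> Ob C; f \<in> Mor C x y\<rbrakk>
      \<Longrightarrow> comp_mor C x x y f (id_mor C x) = f"
    and mor_group: "\<lbrakk>x \<in> Ob C; y \<in> Ob C\<rbrakk>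
      \<Longrightarrow> comm_group \<lparr>carrier = Mor C x y, monoid.mult = add_mor C x y, one = zero_mor C x y\<rparr>"
    and comp_add_left: "\<lbrakk>x \<in> Ob C; y \<in> Ob C; z \<in> Ob C;
        g \<in> Mor C y z; g' \<in> Mor C y z; f \<in> Mor C x y\<rbrakk>
      \<Longrightarrow> comp_mor C x y z (add_mor C y z g g') f
          = add_mor C x z (comp_mor C x y z g f) (comp_mor C x y z g' f)"
    and comp_add_right: "\<lbrakk>x \<in> Ob C; y \<in> Ob C; z \<in> Ob C;
        g \<in> Mor C y z; f \<in> Mor C x y; f' \<in> Mor C x y\<rbrakk>
      \<Longrightarrow> comp_mor C x y z g (add_mor C x y f f')
          = add_mor C x z (comp_mor C x y z g f) (comp_mor C x y z g f')"

locale linear_category = preadditive_category C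
  for C :: "('o, 'm, 'k::field, 'z) lin_moncat_scheme" +
  assumes scale_closed: "\<lbrakk>x \<in> Ob C; y \<in> Ob C; f \<in> Mor C x y\<rbrakk>
      \<Longrightarrow> scale_mor C x y a f \<in> Mor C x y"
    and scale_one: "\<lbrakk>x \<in> Ob C; y \<in> Ob C; f \<in> Mor C x y\<rbrakk> \<Longrightarrow> scale_mor C x y 1 f = f"
    and scale_scale: "\<lbrakk>x \<in> Ob C; y \<in> Ob C; f \<in> Mor C x y\<rbrakk>
      \<Longrightarrow> scale_mor C x y a (scale_mor C x y b f) = scale_mor C x y (a * b) f"
    and scale_add_scalar: "\<lbrakk>x \<in> Ob C; y \<in> Ob C; f \<in> Mor C x y\<rbrakk>
      \<Longrightarrow> scale_mor C x y (a + b) f = add_mor C x y (scale_mor C x y a f) (scale_mor C x y b f)"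
    and scale_add: "\<lbrakk>x \<in> Ob C; y \<in> Ob C; f \<in> Mor C x y; g \<in> Mor C x y\<rbrakk>
      \<Longrightarrow> scale_mor C x y a (add_mor C x y f g)
          = add_mor C x y (scale_mor C x y a f) (scale_mor C x y a g)"
    and comp_scale_left: "\<lbrakk>x \<in> Ob C; y \<in> Ob C; z \<in> Ob C; g \<in> Mor C y z; f \<in> Mor C x y\<rbrakk>
      \<Longrightarrow> comp_mor C x y z (scale_mor C y z a g) f = scale_mor C x z a (comp_mor C x y z g f)"
    and comp_scale_right: "\<lbrakk>x \<in> Ob C; y \<in> Ob C; z \<in> Ob C; g \<in> Mor C y z; f \<in> Mor C x y\<rbrakk>
      \<Longrightarrow> comp_mor C x y z g (scale_mor C x y a f) = scale_mor C x z a (comp_mor C x y z g f)"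


section \<open>Strict monoidal supercategories\<close>

definition koszul :: "bit \<Rightarrow> 'k::ring_1" where
  "koszul p = (if p = 0 then 1 else - 1)"

locale supercategory = linear_category A
  for A :: "('o, 'm, 'k::field, 'z) supercat_scheme" +
  assumes homog_subset: "\<lbrakk>x \<in> Ob A; y \<in> Ob A\<rbrakk> \<Longrightarrow> homog A x y p \<subseteq> Mor A x y"
    and homog_zero: "\<lbrakk>x \<in> Ob A; y \<in> Ob A\<rbrakk> \<Longrightarrow> zero_mor A x y \<in> homog A x y p"
    and homog_add: "\<lbrakk>x \<in> Ob A; y \<in> Ob A; f \<in> homog A x y p; g \<in> homog A x y p\<rbrakk>
      \<Longrightarrow> add_mor A x y f g \<in> homog A x y p"
    and homog_scale: "\<lbrakk>x \<in> Ob A; y \<in> Ob A; f \<in> homog A x y p\<rbrakk>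
      \<Longrightarrow> scale_mor A x y a f \<in> homog A x y p"
    and homog_decomp: "\<lbrakk>x \<in> Ob A; y \<in> Ob A; f \<in> Mor A x y\<rbrakk>
      \<Longrightarrow> \<exists>!(g, h). g \<in> homog A x y 0 \<and> h \<in> homog A x y 1 \<and> f = add_mor A x y g h"
    and homog_comp: "\<lbrakk>x \<in> Ob A; y \<in> Ob A; z \<in> Ob A; g \<in> homog A y z p; f \<in> homog A x y q\<rbrakk>
      \<Longrightarrow> comp_mor A x y z g f \<in> homog A x z (p + q)"
    and homog_id: "x \<in> Ob A \<Longrightarrow> id_mor A x \<in> homog A x x 0"

locale strict_monoidal_supercategory = supercategory A
  for A :: "('o, 'm, 'k::field, 'z) supercat_scheme" +
  assumes unit_closed: "unit_ob A \<in> Ob A"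
    and tensor_ob_closed: "\<lbrakk>x \<in> Ob A; y \<in> Ob A\<rbrakk> \<Longrightarrow> tensor_ob A x y \<in> Ob A"
    and tensor_ob_assoc: "\<lbrakk>x \<in> Ob A; y \<in> Ob A; z \<in> Ob A\<rbrakk>
      \<Longrightarrow> tensor_ob A (tensor_ob A x y) z = tensor_ob A x (tensor_ob A y z)"
    and tensor_ob_unit: "x \<in> Ob A \<Longrightarrow> tensor_ob A (unit_ob A) x = x"
      "x \<in> Ob A \<Longrightarrow> tensor_ob A x (unit_ob A) = x"
    and tensor_homog: "\<lbrakk>x \<in> Ob A; x' \<in> Ob A; y \<in> Ob A; y' \<in> Ob A;
        f \<in> homog A x x' p; g \<in> homog A y y' q\<rbrakk>
      \<Longrightarrow> tensor_mor A x x' y y' f g \<in> homog A (tensor_ob A x y) (tensor_ob A x' y') (p + q)"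
    and tensor_assoc: "\<lbrakk>x \<in> Ob A; x' \<in> Ob A; y \<in> Ob A; y' \<in> Ob A; z \<in> Ob A; z' \<in> Ob A;
        f \<in> Mor A x x'; g \<in> Mor A y y'; h \<in> Mor A z z'\<rbrakk>
      \<Longrightarrow> tensor_mor A (tensor_ob A x y) (tensor_ob A x' y') z z' (tensor_mor A x x' y y' f g) h
          = tensor_mor A x x' (tensor_ob A y z) (tensor_ob A y' z') f (tensor_mor A y y' z z' g h)"
    and tensor_unit_left: "\<lbrakk>x \<in> Ob A; x' \<in> Ob A; f \<in> Mor A x x'\<rbrakk>
      \<Longrightarrow> tensor_mor A (unit_ob A) (unit_ob A) x x' (id_mor A (unit_ob A)) f = f"
    and tensor_unit_right: "\<lbrakk>x \<in> Ob A; x' \<in> Ob A; f \<in> Mor A x x'\<rbrakk>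
      \<Longrightarrow> tensor_mor A x x' (unit_ob A) (unit_ob A) f (id_mor A (unit_ob A)) = f"
    and tensor_id: "\<lbrakk>x \<in> Ob A; y \<in> Ob A\<rbrakk>
      \<Longrightarrow> tensor_mor A x x y y (id_mor A x) (id_mor A y) = id_mor A (tensor_ob A x y)"
    and tensor_add_left: "\<lbrakk>x \<in> Ob A; x' \<in> Ob A; y \<in> Ob A; y' \<in> Ob A;
        f \<in> Mor A x x'; f' \<in> Mor A x x'; g \<in> Mor A y y'\<rbrakk>
      \<Longrightarrow> tensor_mor A x x' y y' (add_mor A x x' f f') g
          = add_mor A (tensor_ob A x y) (tensor_ob A x' y')
              (tensor_mor A x x' y y' f g) (tensor_mor A x x' y y' f' g)"
    and tensor_add_right: "\<lbrakk>x \<in> Ob A; x' \<in> Ob A; y \<in> Ob A; y' \<in> Ob A;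
        f \<in> Mor A x x'; g \<in> Mor A y y'; g' \<in> Mor A y y'\<rbrakk>
      \<Longrightarrow> tensor_mor A x x' y y' f (add_mor A y y' g g')
          = add_mor A (tensor_ob A x y) (tensor_ob A x' y')
              (tensor_mor A x x' y y' f g) (tensor_mor A x x' y y' f g')"
    and tensor_scale_left: "\<lbrakk>x \<in> Ob A; x' \<in> Ob A; y \<in> Ob A; y' \<in> Ob A;
        f \<in> Mor A x x'; g \<in> Mor A y y'\<rbrakk>
      \<Longrightarrow> tensor_mor A x x' y y' (scale_mor A x x' a f) g
          = scale_mor A (tensor_ob A x y) (tensor_ob A x' y') a (tensor_mor A x x' y y' f g)"
    and tensor_scale_right: "\<lbrakk>x \<in> Ob A; x' \<in> Ob A; y \<in> Ob A; y' \<in> Ob A;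
        f \<in> Mor A x x'; g \<in> Mor A y y'\<rbrakk>
      \<Longrightarrow> tensor_mor A x x' y y' f (scale_mor A y y' a g)
          = scale_mor A (tensor_ob A x y) (tensor_ob A x' y') a (tensor_mor A x x' y y' f g)"
    and super_interchange: "\<lbrakk>x \<in> Ob A; x' \<in> Ob A; x'' \<in> Ob A; y \<in> Ob A; y' \<in> Ob A; y'' \<in> Ob A;
        f \<in> Mor A x' x''; g \<in> homog A y' y'' p; h \<in> homog A x x' q; k \<in> Mor A y y'\<rbrakk>
      \<Longrightarrow> comp_mor A (tensor_ob A x y) (tensor_ob A x' y') (tensor_ob A x'' y'')
            (tensor_mor A x' x'' y' y'' f g) (tensor_mor A x x' y y' h k)
          = scale_mor A (tensor_ob A x y) (tensor_ob A x'' y'') (koszul (p * q))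
              (tensor_mor A x x'' y y'' (comp_mor A x x' x'' f h) (comp_mor A y y' y'' g k))"


section \<open>The odd Temperley--Lieb supercategory\<close>

text \<open>
  The presentation is made literal. Objects are tensor powers of the generating object, i.e.
  natural numbers; morphisms are formal expressions in the generators modulo the smallest
  congruence containing the axioms of a strict monoidal supercategory and the defining relations.
\<close>

datatype 'k stl_term =
    Ident nat
  | Cup
  | Cap
  | Comp "'k stl_term" "'k stl_term"
  | Tens "'k stl_term" "'k stl_term"
  | Zero nat nat
  | Add "'k stl_term" "'k stl_term"
  | Scale 'k "'k stl_term"

inductive stl_typed :: "'k stl_term \<Rightarrow> nat \<Rightarrow> nat \<Rightarrow> bool" where
  "stl_typed (Ident n) n n"
| "stl_typed Cup 0 2"
| "stl_typed Cap 2 0"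
| "\<lbrakk>stl_typed g m n; stl_typed f l m\<rbrakk> \<Longrightarrow> stl_typed (Comp g f) l n"
| "\<lbrakk>stl_typed f m m'; stl_typed g n n'\<rbrakk> \<Longrightarrow> stl_typed (Tens f g) (m + n) (m' + n')"
| "stl_typed (Zero m n) m n"
| "\<lbrakk>stl_typed f m n; stl_typed g m n\<rbrakk> \<Longrightarrow> stl_typed (Add f g) m n"
| "stl_typed f m n \<Longrightarrow> stl_typed (Scale a f) m n"

inductive stl_parity :: "'k stl_term \<Rightarrow> bit \<Rightarrow> bool" where
  "stl_parity (Ident n) 0"
| "stl_parity Cup 1"
| "stl_parity Cap 1"
| "\<lbrakk>stl_parity g p; stl_parity f q\<rbrakk> \<Longrightarrow> stl_parity (Comp g f) (p + q)"
| "\<lbrakk>stl_parity f p; stl_parity g q\<rbrakk> \<Longrightarrow> stl_parity (Tens f g) (p + q)"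
| "stl_parity (Zero m n) p"
| "\<lbrakk>stl_parity f p; stl_parity g p\<rbrakk> \<Longrightarrow> stl_parity (Add f g) p"
| "stl_parity f p \<Longrightarrow> stl_parity (Scale a f) p"

inductive stl_eq :: "'k::field \<Rightarrow> nat \<Rightarrow> nat \<Rightarrow> 'k stl_term \<Rightarrow> 'k stl_term \<Rightarrow> bool"
  for \<delta> :: 'k where
  refl: "stl_typed f m n \<Longrightarrow> stl_eq \<delta> m n f f"
| sym: "stl_eq \<delta> m n f g \<Longrightarrow> stl_eq \<delta> m n g f"
| trans: "\<lbrakk>stl_eq \<delta> m n f g; stl_eq \<delta> m n g h\<rbrakk> \<Longrightarrow> stl_eq \<delta> m n f h"
| comp_cong: "\<lbrakk>stl_eq \<delta> m n g g'; stl_eq \<delta> l m f f'\<rbrakk> \<Longrightarrow> stl_eq \<delta> l n (Comp g f) (Comp g' f')"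
| tens_cong: "\<lbrakk>stl_eq \<delta> m m' f f'; stl_eq \<delta> n n' g g'\<rbrakk>
    \<Longrightarrow> stl_eq \<delta> (m + n) (m' + n') (Tens f g) (Tens f' g')"
| add_cong: "\<lbrakk>stl_eq \<delta> m n f f'; stl_eq \<delta> m n g g'\<rbrakk> \<Longrightarrow> stl_eq \<delta> m n (Add f g) (Add f' g')"
| scale_cong: "stl_eq \<delta> m n f f' \<Longrightarrow> stl_eq \<delta> m n (Scale a f) (Scale a f')"
  \<comment> \<open>vector spaces\<close>
| add_assoc: "\<lbrakk>stl_typed f m n; stl_typed g m n; stl_typed h m n\<rbrakk>
    \<Longrightarrow> stl_eq \<delta> m n (Add (Add f g) h) (Add f (Add g h))"
| add_commute: "\<lbrakk>stl_typed f m n; stl_typed g m n\<rbrakk> \<Longrightarrow> stl_eq \<delta> m n (Add f g) (Add g f)"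
| add_zero: "stl_typed f m n \<Longrightarrow> stl_eq \<delta> m n (Add (Zero m n) f) f"
| add_inverse: "stl_typed f m n \<Longrightarrow> stl_eq \<delta> m n (Add f (Scale (- 1) f)) (Zero m n)"
| scale_one: "stl_typed f m n \<Longrightarrow> stl_eq \<delta> m n (Scale 1 f) f"
| scale_scale: "stl_typed f m n \<Longrightarrow> stl_eq \<delta> m n (Scale a (Scale b f)) (Scale (a * b) f)"
| scale_add_scalar: "stl_typed f m n
    \<Longrightarrow> stl_eq \<delta> m n (Scale (a + b) f) (Add (Scale a f) (Scale b f))"
| scale_add: "\<lbrakk>stl_typed f m n; stl_typed g m n\<rbrakk>
    \<Longrightarrow> stl_eq \<delta> m n (Scale a (Add f g)) (Add (Scale a f) (Scale a g))"
  \<comment> \<open>category with bilinear composition\<close>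
| comp_assoc: "\<lbrakk>stl_typed h n r; stl_typed g m n; stl_typed f l m\<rbrakk>
    \<Longrightarrow> stl_eq \<delta> l r (Comp (Comp h g) f) (Comp h (Comp g f))"
| comp_id_left: "stl_typed f m n \<Longrightarrow> stl_eq \<delta> m n (Comp (Ident n) f) f"
| comp_id_right: "stl_typed f m n \<Longrightarrow> stl_eq \<delta> m n (Comp f (Ident m)) f"
| comp_add_left: "\<lbrakk>stl_typed g m n; stl_typed g' m n; stl_typed f l m\<rbrakk>
    \<Longrightarrow> stl_eq \<delta> l n (Comp (Add g g') f) (Add (Comp g f) (Comp g' f))"
| comp_add_right: "\<lbrakk>stl_typed g m n; stl_typed f l m; stl_typed f' l m\<rbrakk>
    \<Longrightarrow> stl_eq \<delta> l n (Comp g (Add f f')) (Add (Comp g f) (Comp g f'))"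
| comp_scale_left: "\<lbrakk>stl_typed g m n; stl_typed f l m\<rbrakk>
    \<Longrightarrow> stl_eq \<delta> l n (Comp (Scale a g) f) (Scale a (Comp g f))"
| comp_scale_right: "\<lbrakk>stl_typed g m n; stl_typed f l m\<rbrakk>
    \<Longrightarrow> stl_eq \<delta> l n (Comp g (Scale a f)) (Scale a (Comp g f))"
  \<comment> \<open>strict monoidal structure\<close>
| tens_assoc: "\<lbrakk>stl_typed f l l'; stl_typed g m m'; stl_typed h n n'\<rbrakk>
    \<Longrightarrow> stl_eq \<delta> (l + m + n) (l' + m' + n') (Tens (Tens f g) h) (Tens f (Tens g h))"
| tens_unit_left: "stl_typed f m n \<Longrightarrow> stl_eq \<delta> m n (Tens (Ident 0) f) f"
| tens_unit_right: "stl_typed f m n \<Longrightarrow> stl_eq \<delta> m n (Tens f (Ident 0)) f"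
| tens_id: "stl_eq \<delta> (m + n) (m + n) (Tens (Ident m) (Ident n)) (Ident (m + n))"
| tens_add_left: "\<lbrakk>stl_typed f m m'; stl_typed f' m m'; stl_typed g n n'\<rbrakk>
    \<Longrightarrow> stl_eq \<delta> (m + n) (m' + n') (Tens (Add f f') g) (Add (Tens f g) (Tens f' g))"
| tens_add_right: "\<lbrakk>stl_typed f m m'; stl_typed g n n'; stl_typed g' n n'\<rbrakk>
    \<Longrightarrow> stl_eq \<delta> (m + n) (m' + n') (Tens f (Add g g')) (Add (Tens f g) (Tens f g'))"
| tens_scale_left: "\<lbrakk>stl_typed f m m'; stl_typed g n n'\<rbrakk>
    \<Longrightarrow> stl_eq \<delta> (m + n) (m' + n') (Tens (Scale a f) g) (Scale a (Tens f g))"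
| tens_scale_right: "\<lbrakk>stl_typed f m m'; stl_typed g n n'\<rbrakk>
    \<Longrightarrow> stl_eq \<delta> (m + n) (m' + n') (Tens f (Scale a g)) (Scale a (Tens f g))"
| super_interchange: "\<lbrakk>stl_typed f m' m''; stl_typed g n' n''; stl_typed h m m'; stl_typed k n n';
      stl_parity g p; stl_parity h q\<rbrakk>
    \<Longrightarrow> stl_eq \<delta> (m + n) (m'' + n'') (Comp (Tens f g) (Tens h k))
          (Scale (koszul (p * q)) (Tens (Comp f h) (Comp g k)))"
  \<comment> \<open>defining relations\<close>
| zigzag: "stl_eq \<delta> 1 1 (Comp (Tens Cap (Ident 1)) (Tens (Ident 1) Cup)) (Ident 1)"
| zigzag': "stl_eq \<delta> 1 1 (Comp (Tens (Ident 1) Cap) (Tens Cup (Ident 1))) (Scale (- 1) (Ident 1))"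
| circle: "stl_eq \<delta> 0 0 (Comp Cap Cup) (Scale \<delta> (Ident 0))"

definition stl_class :: "'k::field \<Rightarrow> nat \<Rightarrow> nat \<Rightarrow> 'k stl_term \<Rightarrow> 'k stl_term set" where
  "stl_class \<delta> m n f = {g. stl_eq \<delta> m n f g}"

definition STL :: "'k::field \<Rightarrow> (nat, 'k stl_term set, 'k) supercat" where
  "STL \<delta> = \<lparr>
     Ob = UNIV,
     Mor = (\<lambda>m n. stl_class \<delta> m n ` {f. stl_typed f m n}),
     id_mor = (\<lambda>n. stl_class \<delta> n n (Ident n)),
     comp_mor = (\<lambda>l m n G F. \<Union>g\<in>G. \<Union>f\<in>F. stl_class \<delta> l n (Comp g f)),
     zero_mor = (\<lambda>m n. stl_class \<delta> m n (Zero m n)),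
     add_mor = (\<lambda>m n F G. \<Union>f\<in>F. \<Union>g\<in>G. stl_class \<delta> m n (Add f g)),
     scale_mor = (\<lambda>m n a F. \<Union>f\<in>F. stl_class \<delta> m n (Scale a f)),
     unit_ob = 0,
     tensor_ob = (+),
     tensor_mor = (\<lambda>m m' n n' F G. \<Union>f\<in>F. \<Union>g\<in>G. stl_class \<delta> (m + n) (m' + n') (Tens f g)),
     homog = (\<lambda>m n p. stl_class \<delta> m n ` {f. stl_typed f m n \<and> stl_parity f p})\<rparr>"


section \<open>The \<open>\<Pi>\<close>-envelope and the super Karoubi envelope\<close>

text \<open>The component of parity \<open>p\<close>, unique by \<open>homog_decomp\<close>.\<close>

definition homog_part :: "('o, 'm, 'k, 'z) supercat_scheme \<Rightarrow> 'o \<Rightarrow> 'o \<Rightarrow> bit \<Rightarrow> 'm \<Rightarrow> 'm" where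
  "homog_part A x y p f =
     (THE g. g \<in> homog A x y p \<and> (\<exists>h\<in>homog A x y (p + 1). f = add_mor A x y g h))"

text \<open>
  The object \<open>\<Pi>\<^sup>a x\<close> is the pair \<open>(a, x)\<close>, and \<open>f\<^sub>a\<^sup>b\<close> is \<open>f\<close> itself,
  the labels being recorded by its source and target. In the tensor product, \<open>p\<close> and \<open>q\<close>
  are the parities of the homogeneous parts of \<open>f\<close> and \<open>g\<close> in the original
  supercategory, not the shifted ones.
\<close>

definition Pi_envelope :: "('o, 'm, 'k::field) supercat \<Rightarrow> (bit \<times> 'o, 'm, 'k) supercat" where
  "Pi_envelope A = \<lparr>
     Ob = UNIV \<times> Ob A,
     Mor = (\<lambda>(a, x) (b, y). Mor A x y),
     id_mor = (\<lambda>(a, x). id_mor A x),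
     comp_mor = (\<lambda>(a, x) (b, y) (c, z) g f. comp_mor A x y z g f),
     zero_mor = (\<lambda>(a, x) (b, y). zero_mor A x y),
     add_mor = (\<lambda>(a, x) (b, y). add_mor A x y),
     scale_mor = (\<lambda>(a, x) (b, y). scale_mor A x y),
     unit_ob = (0, unit_ob A),
     tensor_ob = (\<lambda>(a, x) (b, y). (a + b, tensor_ob A x y)),
     tensor_mor = (\<lambda>(a, x) (b, x') (c, y) (d, y') f g.
       sum_mor A (tensor_ob A x y) (tensor_ob A x' y')
         [scale_mor A (tensor_ob A x y) (tensor_ob A x' y') (koszul (a * q + p * d + a * d + a * c))
            (tensor_mor A x x' y y' (homog_part A x x' p f) (homog_part A y y' q g)).
          p \<leftarrow> [0, 1], q \<leftarrow> [0, 1]]),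
     homog = (\<lambda>(a, x) (b, y) p. homog A x y (p + a + b))\<rparr>"

definition underlying :: "('o, 'm, 'k) supercat \<Rightarrow> ('o, 'm, 'k) lin_moncat" where
  "underlying A = (lin_moncat.truncate A)\<lparr>Mor := \<lambda>x y. homog A x y 0\<rparr>"

text \<open>
  Objects of the additive envelope are finite formal direct sums, given as lists. A morphism
  \<open>xs \<rightarrow> ys\<close> is a matrix whose entry in row \<open>i\<close> and column \<open>j\<close> is a morphism
  \<open>xs ! j \<rightarrow> ys ! i\<close>. Tensor products of matrices are Kronecker products.
\<close>

definition additive_envelope :: "('o, 'm, 'k) lin_moncat \<Rightarrow> ('o list, 'm mat, 'k) lin_moncat" where
  "additive_envelope C = \<lparr>
     Ob = lists (Ob C),
     Mor = (\<lambda>xs ys. {M \<in> carrier_mat (length ys) (length xs).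
       \<forall>i<length ys. \<forall>j<length xs. M $$ (i, j) \<in> Mor C (xs ! j) (ys ! i)}),
     id_mor = (\<lambda>xs. mat (length xs) (length xs)
       (\<lambda>(i, j). if i = j then id_mor C (xs ! i) else zero_mor C (xs ! j) (xs ! i))),
     comp_mor = (\<lambda>xs ys zs N M. mat (length zs) (length xs)
       (\<lambda>(i, j). sum_mor C (xs ! j) (zs ! i)
         [comp_mor C (xs ! j) (ys ! l) (zs ! i) (N $$ (i, l)) (M $$ (l, j)).
          l \<leftarrow> [0..<length ys]])),
     zero_mor = (\<lambda>xs ys. mat (length ys) (length xs) (\<lambda>(i, j). zero_mor C (xs ! j) (ys ! i))),
     add_mor = (\<lambda>xs ys M N. mat (length ys) (length xs)
       (\<lambda>(i, j). add_mor C (xs ! j) (ys ! i) (M $$ (i, j)) (N $$ (i, j)))),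
     scale_mor = (\<lambda>xs ys a M. mat (length ys) (length xs)
       (\<lambda>(i, j). scale_mor C (xs ! j) (ys ! i) a (M $$ (i, j)))),
     unit_ob = [unit_ob C],
     tensor_ob = (\<lambda>xs ys. [tensor_ob C x y. x \<leftarrow> xs, y \<leftarrow> ys]),
     tensor_mor = (\<lambda>xs xs' ys ys' M N.
       mat (length xs' * length ys') (length xs * length ys)
         (\<lambda>(i, j).
           let i1 = i div length ys'; i2 = i mod length ys';
               j1 = j div length ys; j2 = j mod length ys
           in tensor_mor C (xs ! j1) (xs' ! i1) (ys ! j2) (ys' ! i2)
                (M $$ (i1, j1)) (N $$ (i2, j2))))\<rparr>"

text \<open>An object \<open>(x, e)\<close> of the idempotent completion is the image of the idempotent
  \<open>e : x \<rightarrow> x\<close>.\<close>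

definition idempotent_completion ::
    "('o, 'm, 'k) lin_moncat \<Rightarrow> ('o \<times> 'm, 'm, 'k) lin_moncat" where
  "idempotent_completion C = \<lparr>
     Ob = {(x, e). x \<in> Ob C \<and> e \<in> Mor C x x \<and> comp_mor C x x x e e = e},
     Mor = (\<lambda>(x, e) (y, e').
       {f \<in> Mor C x y. comp_mor C x y y e' f = f \<and> comp_mor C x x y f e = f}),
     id_mor = (\<lambda>(x, e). e),
     comp_mor = (\<lambda>(x, _) (y, _) (z, _). comp_mor C x y z),
     zero_mor = (\<lambda>(x, _) (y, _). zero_mor C x y),
     add_mor = (\<lambda>(x, _) (y, _). add_mor C x y),
     scale_mor = (\<lambda>(x, _) (y, _). scale_mor C x y),
     unit_ob = (unit_ob C, id_mor C (unit_ob C)),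
     tensor_ob = (\<lambda>(x, e) (y, e'). (tensor_ob C x y, tensor_mor C x x y y e e')),
     tensor_mor = (\<lambda>(x, _) (x', _) (y, _) (y', _). tensor_mor C x x' y y')\<rparr>"

definition Kar :: "('o, 'm, 'k) lin_moncat \<Rightarrow> ('o list \<times> 'm mat, 'm mat, 'k) lin_moncat" where
  "Kar C = idempotent_completion (additive_envelope C)"

definition SKar ::
    "('o, 'm, 'k::field) supercat \<Rightarrow> ((bit \<times> 'o) list \<times> 'm mat, 'm mat, 'k) lin_moncat" where
  "SKar A = Kar (underlying (Pi_envelope A))"


section \<open>Semisimple Abelian categories\<close>

definition iso_mor :: "('o, 'm, 'k, 'z) lin_moncat_scheme \<Rightarrow> 'o \<Rightarrow> 'o \<Rightarrow> 'm \<Rightarrow> bool" where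
  "iso_mor C x y f \<longleftrightarrow> f \<in> Mor C x y \<and>
     (\<exists>g\<in>Mor C y x. comp_mor C x y x g f = id_mor C x \<and> comp_mor C y x y f g = id_mor C y)"

definition isomorphic :: "('o, 'm, 'k, 'z) lin_moncat_scheme \<Rightarrow> 'o \<Rightarrow> 'o \<Rightarrow> bool" where
  "isomorphic C x y \<longleftrightarrow> (\<exists>f. iso_mor C x y f)"

definition mono_mor :: "('o, 'm, 'k, 'z) lin_moncat_scheme \<Rightarrow> 'o \<Rightarrow> 'o \<Rightarrow> 'm \<Rightarrow> bool" where
  "mono_mor C x y f \<longleftrightarrow> f \<in> Mor C x y \<and>
     (\<forall>z\<in>Ob C. \<forall>g\<in>Mor C z x. \<forall>h\<in>Mor C z x. comp_mor C z x y f g = comp_mor C z x y f h \<longrightarrow> g = h)"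

definition epi_mor :: "('o, 'm, 'k, 'z) lin_moncat_scheme \<Rightarrow> 'o \<Rightarrow> 'o \<Rightarrow> 'm \<Rightarrow> bool" where
  "epi_mor C x y f \<longleftrightarrow> f \<in> Mor C x y \<and>
     (\<forall>z\<in>Ob C. \<forall>g\<in>Mor C y z. \<forall>h\<in>Mor C y z. comp_mor C x y z g f = comp_mor C x y z h f \<longrightarrow> g = h)"

definition zero_ob :: "('o, 'm, 'k, 'z) lin_moncat_scheme \<Rightarrow> 'o \<Rightarrow> bool" where
  "zero_ob C x \<longleftrightarrow> x \<in> Ob C \<and> (\<forall>y\<in>Ob C. (\<exists>!f. f \<in> Mor C x y) \<and> (\<exists>!f. f \<in> Mor C y x))"

text \<open>\<open>x\<close> is a direct sum (biproduct) of the finite family \<open>ys\<close>.\<close>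

definition direct_sum :: "('o, 'm, 'k, 'z) lin_moncat_scheme \<Rightarrow> 'o \<Rightarrow> 'o list \<Rightarrow> bool" where
  "direct_sum C x ys \<longleftrightarrow> x \<in> Ob C \<and> set ys \<subseteq> Ob C \<and>
     (\<exists>\<iota> \<rho>. (\<forall>i<length ys. \<iota> i \<in> Mor C (ys ! i) x \<and> \<rho> i \<in> Mor C x (ys ! i)) \<and>
       (\<forall>i<length ys. \<forall>j<length ys. comp_mor C (ys ! i) x (ys ! j) (\<rho> j) (\<iota> i)
          = (if i = j then id_mor C (ys ! i) else zero_mor C (ys ! i) (ys ! j))) \<and>
       sum_mor C x x [comp_mor C x (ys ! i) x (\<iota> i) (\<rho> i). i \<leftarrow> [0..<length ys]] = id_mor C x)"

definition is_kernel :: "('o, 'm, 'k, 'z) lin_moncat_scheme \<Rightarrow> 'o \<Rightarrow> 'o \<Rightarrow> 'm \<Rightarrow> 'o \<Rightarrow> 'm \<Rightarrow> bool" where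
  "is_kernel C x y f w k \<longleftrightarrow> w \<in> Ob C \<and> k \<in> Mor C w x \<and> comp_mor C w x y f k = zero_mor C w y \<and>
     (\<forall>z\<in>Ob C. \<forall>g\<in>Mor C z x. comp_mor C z x y f g = zero_mor C z y
        \<longrightarrow> (\<exists>!h. h \<in> Mor C z w \<and> comp_mor C z w x k h = g))"

definition is_cokernel :: "('o, 'm, 'k, 'z) lin_moncat_scheme \<Rightarrow> 'o \<Rightarrow> 'o \<Rightarrow> 'm \<Rightarrow> 'o \<Rightarrow> 'm \<Rightarrow> bool" where
  "is_cokernel C x y f w k \<longleftrightarrow> w \<in> Ob C \<and> k \<in> Mor C y w \<and> comp_mor C x y w k f = zero_mor C x w \<and>
     (\<forall>z\<in>Ob C. \<forall>g\<in>Mor C y z. comp_mor C x y z g f = zero_mor C x z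
        \<longrightarrow> (\<exists>!h. h \<in> Mor C w z \<and> comp_mor C y w z h k = g))"

locale abelian_category = preadditive_category C
  for C :: "('o, 'm, 'k, 'z) lin_moncat_scheme" +
  assumes has_zero_ob: "\<exists>x. zero_ob C x"
    and has_direct_sums: "\<lbrakk>x \<in> Ob C; y \<in> Ob C\<rbrakk> \<Longrightarrow> \<exists>z. direct_sum C z [x, y]"
    and has_kernels: "\<lbrakk>x \<in> Ob C; y \<in> Ob C; f \<in> Mor C x y\<rbrakk> \<Longrightarrow> \<exists>w k. is_kernel C x y f w k"
    and has_cokernels: "\<lbrakk>x \<in> Ob C; y \<in> Ob C; f \<in> Mor C x y\<rbrakk> \<Longrightarrow> \<exists>w k. is_cokernel C x y f w k"
    and mono_is_kernel: "\<lbrakk>x \<in> Ob C; y \<in> Ob C; mono_mor C x y f\<rbrakk>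
      \<Longrightarrow> \<exists>z\<in>Ob C. \<exists>g\<in>Mor C y z. is_kernel C y z g x f"
    and epi_is_cokernel: "\<lbrakk>x \<in> Ob C; y \<in> Ob C; epi_mor C x y f\<rbrakk>
      \<Longrightarrow> \<exists>z\<in>Ob C. \<exists>g\<in>Mor C z x. is_cokernel C z x g y f"

definition irreducible_ob :: "('o, 'm, 'k, 'z) lin_moncat_scheme \<Rightarrow> 'o \<Rightarrow> bool" where
  "irreducible_ob C x \<longleftrightarrow> x \<in> Ob C \<and> \<not> zero_ob C x \<and>
     (\<forall>y\<in>Ob C. \<forall>f. mono_mor C y x f \<longrightarrow> zero_ob C y \<or> iso_mor C y x f)"

locale semisimple_abelian_category = abelian_category C
  for C :: "('o, 'm, 'k, 'z) lin_moncat_scheme" +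
  assumes semisimple: "x \<in> Ob C \<Longrightarrow> \<exists>ys. (\<forall>y\<in>set ys. irreducible_ob C y) \<and> direct_sum C x ys"


section \<open>The split Grothendieck ring\<close>

definition iso_class :: "('o, 'm, 'k, 'z) lin_moncat_scheme \<Rightarrow> 'o \<Rightarrow> 'o set" where
  "iso_class C x = {y \<in> Ob C. isomorphic C x y}"

definition tensor_class :: "('o, 'm, 'k, 'z) lin_moncat_scheme \<Rightarrow> 'o set \<Rightarrow> 'o set \<Rightarrow> 'o set" where
  "tensor_class C V W = {z \<in> Ob C. \<exists>x\<in>V. \<exists>y\<in>W. isomorphic C (tensor_ob C x y) z}"

text \<open>The free Abelian group on the isomorphism classes of objects, with the multiplication
  bilinearly extending the tensor product.\<close>

definition K0_free :: "('o, 'm, 'k, 'z) lin_moncat_scheme \<Rightarrow> ('o set \<Rightarrow>\<^sub>0 int) ring" where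
  "K0_free C = \<lparr>
     carrier = {c. Poly_Mapping.keys c \<subseteq> iso_class C ` Ob C},
     monoid.mult = (\<lambda>c d. \<Sum>V\<in>Poly_Mapping.keys c. \<Sum>W\<in>Poly_Mapping.keys d.
       Poly_Mapping.single (tensor_class C V W) (Poly_Mapping.lookup c V * Poly_Mapping.lookup d W)),
     one = Poly_Mapping.single (iso_class C (unit_ob C)) 1,
     ring.zero = 0,
     add = (+)\<rparr>"

definition K0_relations :: "('o, 'm, 'k, 'z) lin_moncat_scheme \<Rightarrow> ('o set \<Rightarrow>\<^sub>0 int) set" where
  "K0_relations C = generate (add_monoid (K0_free C))
     {Poly_Mapping.single (iso_class C x) 1 + Poly_Mapping.single (iso_class C y) 1
        - Poly_Mapping.single (iso_class C z) 1 | x y z. direct_sum C z [x, y]}"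

definition K0 :: "('o, 'm, 'k, 'z) lin_moncat_scheme \<Rightarrow> ('o set \<Rightarrow>\<^sub>0 int) set ring" where
  "K0 C = K0_free C Quot K0_relations C"

definition K0_class :: "('o, 'm, 'k, 'z) lin_moncat_scheme \<Rightarrow> 'o \<Rightarrow> ('o set \<Rightarrow>\<^sub>0 int) set" where
  "K0_class C x = K0_relations C +>\<^bsub>K0_free C\<^esub> Poly_Mapping.single (iso_class C x) 1"


section \<open>Based rings\<close>

text \<open>A ring whose additive group is free on \<open>B\<close>.\<close>

definition based_ring :: "('a, 'z) ring_scheme \<Rightarrow> 'a set \<Rightarrow> bool" where
  "based_ring R B \<longleftrightarrow> ring R \<and> B \<subseteq> carrier R \<and>
     (\<forall>r\<in>carrier R. \<exists>!c :: 'a \<Rightarrow>\<^sub>0 int. Poly_Mapping.keys c \<subseteq> B \<and>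
        r = (\<Oplus>\<^bsub>R\<^esub>b\<in>Poly_Mapping.keys c. [Poly_Mapping.lookup c b] \<cdot>\<^bsub>R\<^esub> b))"

definition based_ring_isomorphic ::
    "('a, 'y) ring_scheme \<Rightarrow> 'a set \<Rightarrow> ('b, 'z) ring_scheme \<Rightarrow> 'b set \<Rightarrow> bool" where
  "based_ring_isomorphic R B S B' \<longleftrightarrow> (\<exists>h\<in>ring_iso R S. bij_betw h B B')"


section \<open>The ring of Laurent polynomials over \<open>\<int>[\<pi>]/(\<pi>\<^sup>2 - 1)\<close>\<close>

quotient_type zpi = "int poly" / "\<lambda>p q. [:- 1, 0, 1:] dvd p - q"
proof (rule equivpI)
  let ?m = "[:- 1, 0, 1:] :: int poly"
  show "reflp (\<lambda>p q. ?m dvd p - q)"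
    by (rule reflpI) simp
  show "symp (\<lambda>p q. ?m dvd p - q)"
    by (rule sympI) (subst dvd_minus_iff[symmetric], simp)
  show "transp (\<lambda>p q. ?m dvd p - q)"
  proof (rule transpI)
    fix x y z assume "?m dvd x - y" "?m dvd y - z"
    from dvd_add[OF this] show "?m dvd x - z" by simp
  qed
qed

instantiation zpi :: comm_ring_1
begin

lift_definition zero_zpi :: zpi is 0 .
lift_definition one_zpi :: zpi is 1 .
lift_definition plus_zpi :: "zpi \<Rightarrow> zpi \<Rightarrow> zpi" is "(+)"
  by (simp only: add_diff_add dvd_add)
lift_definition uminus_zpi :: "zpi \<Rightarrow> zpi" is uminus
  by (simp only: minus_diff_minus dvd_minus_iff)
lift_definition minus_zpi :: "zpi \<Rightarrow> zpi \<Rightarrow> zpi" is "(-)"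
proof -
  fix a b c d :: "int poly"
  assume "[:- 1, 0, 1:] dvd a - b" "[:- 1, 0, 1:] dvd c - d"
  from dvd_diff[OF this] show "[:- 1, 0, 1:] dvd a - c - (b - d)"
    by (simp add: algebra_simps)
qed
lift_definition times_zpi :: "zpi \<Rightarrow> zpi \<Rightarrow> zpi" is "(*)"
  by (simp only: mult_diff_mult dvd_add dvd_mult dvd_mult2)

instance
proof
  show "(0::zpi) \<noteq> 1"
    by transfer (auto dest: dvd_imp_degree_le)
qed (transfer, simp add: algebra_simps)+

end

lift_definition zpi_pi :: zpi is "[:0, 1:]" .

text \<open>\<^term>\<open>zpi_pi\<close> is the class of the indeterminate, and \<open>single k c\<close> is the monomial \<open>c x\<^sup>k\<close>; the multiplication of \<^typ>\<open>int \<Rightarrow>\<^sub>0 zpi\<close>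
  is convolution.\<close>

type_synonym zpi_laurent = "int \<Rightarrow>\<^sub>0 zpi"

text \<open>Note the shift: \<open>qint n\<close> is \<open>[n + 1]\<close>.\<close>

definition qint :: "nat \<Rightarrow> zpi_laurent" where
  "qint n = (\<Sum>i\<le>n. Poly_Mapping.single (int n - 2 * int i) (zpi_pi ^ i))"

definition qint_basis :: "zpi_laurent set" where
  "qint_basis = {qint n | n. True} \<union> {Poly_Mapping.single 0 zpi_pi * qint n | n. True}"

definition qint_span :: "zpi_laurent set" where
  "qint_span = generate (add_monoid ring_of_type_algebra) qint_basis"

definition qint_ring :: "zpi_laurent ring" where
  "qint_ring = ring_of_type_algebra\<lparr>carrier := qint_span\<rparr>"

section \<open>\<open>STL\<close> is a strict monoidal supercategory\<close>

lemma stl_typed_CompI: "\<lbrakk>stl_typed g m n; stl_typed f l m'; m = m'\<rbrakk> \<Longrightarrow> stl_typed (Comp g f) l n"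
  using stl_typed.intros(4) by blast

lemma stl_typed_TensI: "\<lbrakk>stl_typed f m m'; stl_typed g n n'; a = m + n; b = m' + n'\<rbrakk>
    \<Longrightarrow> stl_typed (Tens f g) a b"
  using stl_typed.intros(5) by blast

lemma stl_eq_typed: "stl_eq \<delta> m n f g \<Longrightarrow> stl_typed f m n \<and> stl_typed g m n"
proof (induction rule: stl_eq.induct)
  case zigzag
  have "stl_typed (Tens Cap (Ident 1)) (2 + 1) (0 + 1)" "stl_typed (Tens (Ident 1) Cup) (1 + 0) (1 + 2)"
    by (intro stl_typed.intros)+
  from stl_typed_CompI[OF this] show ?case by (simp add: stl_typed.intros)
next
  case zigzag'
  have "stl_typed (Tens (Ident 1) Cap) (1 + 2) (1 + 0)" "stl_typed (Tens Cup (Ident 1)) (0 + 1) (2 + 1)"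
    by (intro stl_typed.intros)+
  from stl_typed_CompI[OF this] show ?case by (simp add: stl_typed.intros)
next
  case (tens_assoc f l l' g m m' h n n')
  then show ?case by (auto intro!: stl_typed_TensI)
next
  case (tens_unit_left f m n)
  then show ?case using stl_typed.intros(5)[OF stl_typed.intros(1)[of 0]] by fastforce
next
  case (tens_unit_right f m n)
  then show ?case using stl_typed.intros(5)[OF _ stl_typed.intros(1)[of 0]] by fastforce
qed (blast intro: stl_typed.intros)+

lemma stl_class_eqI: "stl_eq \<delta> m n f g \<Longrightarrow> stl_class \<delta> m n f = stl_class \<delta> m n g"
  unfolding stl_class_def by (blast intro: stl_eq.sym stl_eq.trans)

lemma stl_class_eqD: "\<lbrakk>stl_class \<delta> m n f = stl_class \<delta> m n g; stl_typed g m n\<rbrakk> \<Longrightarrow> stl_eq \<delta> m n f g"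
  unfolding stl_class_def by (blast intro: stl_eq.refl)

lemma stl_class_UN:
  assumes "stl_typed f m n" "\<And>f'. stl_eq \<delta> m n f f' \<Longrightarrow> Q f' = Q f"
  shows "(\<Union>f'\<in>stl_class \<delta> m n f. Q f') = Q f"
  using assms stl_eq.refl[OF assms(1)] unfolding stl_class_def by blast

lemma STL_ops:
  shows "\<lbrakk>stl_typed g m n; stl_typed f l m\<rbrakk>
      \<Longrightarrow> comp_mor (STL \<delta>) l m n (stl_class \<delta> m n g) (stl_class \<delta> l m f) = stl_class \<delta> l n (Comp g f)"
    and "\<lbrakk>stl_typed f m n; stl_typed g m n\<rbrakk>
      \<Longrightarrow> add_mor (STL \<delta>) m n (stl_class \<delta> m n f) (stl_class \<delta> m n g) = stl_class \<delta> m n (Add f g)"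
    and "stl_typed f m n
      \<Longrightarrow> scale_mor (STL \<delta>) m n a (stl_class \<delta> m n f) = stl_class \<delta> m n (Scale a f)"
    and "\<lbrakk>stl_typed f m m'; stl_typed g n n'\<rbrakk>
      \<Longrightarrow> tensor_mor (STL \<delta>) m m' n n' (stl_class \<delta> m m' f) (stl_class \<delta> n n' g)
          = stl_class \<delta> (m + n) (m' + n') (Tens f g)"
proof -
  have two: "(\<Union>f'\<in>stl_class \<delta> m n f. \<Union>g'\<in>stl_class \<delta> m' n' g. Q f' g') = Q f g"
    if "stl_typed f m n" "stl_typed g m' n'"
      "\<And>f' g'. \<lbrakk>stl_eq \<delta> m n f f'; stl_eq \<delta> m' n' g g'\<rbrakk> \<Longrightarrow> Q f' g' = Q f g"
    for m n f m' n' g and Q :: "'a stl_term \<Rightarrow> 'a stl_term \<Rightarrow> 'a stl_term set"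
  proof -
    have "(\<Union>f'\<in>stl_class \<delta> m n f. \<Union>g'\<in>stl_class \<delta> m' n' g. Q f' g')
        = (\<Union>f'\<in>stl_class \<delta> m n f. \<Union>g'\<in>stl_class \<delta> m' n' g. Q f g)"
      by (intro SUP_cong HOL.refl that(3)) (simp_all add: stl_class_def)
    moreover have "stl_class \<delta> m n f \<noteq> {}" "stl_class \<delta> m' n' g \<noteq> {}"
      using stl_eq.refl[OF that(1)] stl_eq.refl[OF that(2)] by (auto simp: stl_class_def)
    ultimately show ?thesis by simp
  qed
  show "\<lbrakk>stl_typed g m n; stl_typed f l m\<rbrakk>
      \<Longrightarrow> comp_mor (STL \<delta>) l m n (stl_class \<delta> m n g) (stl_class \<delta> l m f) = stl_class \<delta> l n (Comp g f)"
    unfolding STL_def supercat.simps lin_moncat.simps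
    by (rule two, assumption+, rule stl_class_eqI, rule stl_eq.sym, rule stl_eq.comp_cong)
  show "\<lbrakk>stl_typed f m n; stl_typed g m n\<rbrakk>
      \<Longrightarrow> add_mor (STL \<delta>) m n (stl_class \<delta> m n f) (stl_class \<delta> m n g) = stl_class \<delta> m n (Add f g)"
    unfolding STL_def supercat.simps lin_moncat.simps
    by (rule two, assumption+, rule stl_class_eqI, rule stl_eq.sym, rule stl_eq.add_cong)
  show "stl_typed f m n
      \<Longrightarrow> scale_mor (STL \<delta>) m n a (stl_class \<delta> m n f) = stl_class \<delta> m n (Scale a f)"
    unfolding STL_def supercat.simps lin_moncat.simps
    by (rule stl_class_UN, assumption, rule stl_class_eqI, rule stl_eq.sym, rule stl_eq.scale_cong)
  show "\<lbrakk>stl_typed f m m'; stl_typed g n n'\<rbrakk>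
      \<Longrightarrow> tensor_mor (STL \<delta>) m m' n n' (stl_class \<delta> m m' f) (stl_class \<delta> n n' g)
          = stl_class \<delta> (m + n) (m' + n') (Tens f g)"
    unfolding STL_def supercat.simps lin_moncat.simps
    by (rule two, assumption+, rule stl_class_eqI, rule stl_eq.sym, rule stl_eq.tens_cong)
qed

lemma STL_simps:
  "Ob (STL \<delta>) = UNIV"
  "Mor (STL \<delta>) m n = stl_class \<delta> m n ` {f. stl_typed f m n}"
  "id_mor (STL \<delta>) n = stl_class \<delta> n n (Ident n)"
  "zero_mor (STL \<delta>) m n = stl_class \<delta> m n (Zero m n)"
  "unit_ob (STL \<delta>) = 0"
  "tensor_ob (STL \<delta>) m n = m + n"
  "homog (STL \<delta>) m n p = stl_class \<delta> m n ` {f. stl_typed f m n \<and> stl_parity f p}"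
  by (simp_all add: STL_def)

lemma stl_add_idem:
  assumes "stl_eq \<delta> m n (Add x x) x"
  shows "stl_eq \<delta> m n x (Zero m n)"
proof -
  have x: "stl_typed x m n" using stl_eq_typed[OF assms] by blast
  let ?y = "Scale (- 1) x" and ?E = "stl_eq \<delta> m n"
  have y: "stl_typed ?y m n" using x by (rule stl_typed.intros)
  have "?E x (Add (Zero m n) x)" by (intro stl_eq.sym[OF stl_eq.add_zero] x)
  moreover have "?E (Add (Zero m n) x) (Add (Add x ?y) x)"
    by (intro stl_eq.add_cong stl_eq.sym[OF stl_eq.add_inverse] stl_eq.refl x)
  moreover have "?E (Add (Add x ?y) x) (Add x (Add x ?y))"
    by (intro stl_eq.add_commute stl_typed.intros x)
  moreover have "?E (Add x (Add x ?y)) (Add (Add x x) ?y)"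
    by (intro stl_eq.sym[OF stl_eq.add_assoc] x y)
  moreover have "?E (Add (Add x x) ?y) (Add x ?y)"
    by (intro stl_eq.add_cong assms stl_eq.refl y)
  moreover have "?E (Add x ?y) (Zero m n)" by (intro stl_eq.add_inverse x)
  ultimately show ?thesis by (meson stl_eq.trans)
qed

lemma stl_zero_zero: "stl_eq \<delta> m n (Add (Zero m n) (Zero m n)) (Zero m n)"
  by (intro stl_eq.add_zero stl_typed.intros)

lemma stl_comp_zero_left: "stl_typed f l m \<Longrightarrow> stl_eq \<delta> l n (Comp (Zero m n) f) (Zero l n)"
  by (rule stl_add_idem,
      rule stl_eq.trans[OF stl_eq.sym[OF stl_eq.comp_add_left] stl_eq.comp_cong[OF stl_zero_zero stl_eq.refl]])
     (auto intro: stl_typed.intros)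

lemma stl_comp_zero_right: "stl_typed f m n \<Longrightarrow> stl_eq \<delta> l n (Comp f (Zero l m)) (Zero l n)"
  by (rule stl_add_idem,
      rule stl_eq.trans[OF stl_eq.sym[OF stl_eq.comp_add_right] stl_eq.comp_cong[OF stl_eq.refl stl_zero_zero]])
     (auto intro: stl_typed.intros)

lemma stl_tens_zero_left:
  "stl_typed g n n' \<Longrightarrow> stl_eq \<delta> (m + n) (m' + n') (Tens (Zero m m') g) (Zero (m + n) (m' + n'))"
  by (rule stl_add_idem,
      rule stl_eq.trans[OF stl_eq.sym[OF stl_eq.tens_add_left] stl_eq.tens_cong[OF stl_zero_zero stl_eq.refl]])
     (auto intro: stl_typed.intros)

lemma stl_tens_zero_right:
  "stl_typed f m m' \<Longrightarrow> stl_eq \<delta> (m + n) (m' + n') (Tens f (Zero n n')) (Zero (m + n) (m' + n'))"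
  by (rule stl_add_idem,
      rule stl_eq.trans[OF stl_eq.sym[OF stl_eq.tens_add_right] stl_eq.tens_cong[OF stl_eq.refl stl_zero_zero]])
     (auto intro: stl_typed.intros)

lemma stl_scale_zero: "stl_eq \<delta> m n (Scale a (Zero m n)) (Zero m n)"
  by (rule stl_add_idem,
      rule stl_eq.trans[OF stl_eq.sym[OF stl_eq.scale_add] stl_eq.scale_cong[OF stl_zero_zero]])
     (auto intro: stl_typed.intros)

text \<open>The parity of a nonzero homogeneous morphism is determined by its source and target.\<close>

definition stl_degree :: "nat \<Rightarrow> nat \<Rightarrow> bit \<Rightarrow> bool" where
  "stl_degree m n p \<longleftrightarrow> (int n - int m) mod 4 = (if p = 0 then 0 else 2)"

lemma stl_degree_unique: "\<lbrakk>stl_degree m n p; stl_degree m n q\<rbrakk> \<Longrightarrow> p = q"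
  by (cases p; cases q) (auto simp: stl_degree_def)

lemma stl_degree_comp: "\<lbrakk>stl_degree m n p; stl_degree l m q\<rbrakk> \<Longrightarrow> stl_degree l n (p + q)"
  by (cases p; cases q) (simp_all add: stl_degree_def, presburger+)

lemma stl_degree_tens: "\<lbrakk>stl_degree m m' p; stl_degree n n' q\<rbrakk> \<Longrightarrow> stl_degree (m + n) (m' + n') (p + q)"
  by (cases p; cases q) (simp_all add: stl_degree_def, presburger+)

lemma stl_comp_eq_zero:
  assumes "stl_typed g m n" "stl_typed f l m"
    and "stl_eq \<delta> m n g (Zero m n) \<or> stl_eq \<delta> l m f (Zero l m)"
  shows "stl_eq \<delta> l n (Comp g f) (Zero l n)"
  using assms(3)
proof
  assume "stl_eq \<delta> m n g (Zero m n)"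
  from stl_eq.comp_cong[OF this stl_eq.refl[OF assms(2)]] stl_comp_zero_left[OF assms(2)]
  show ?thesis by (rule stl_eq.trans)
next
  assume "stl_eq \<delta> l m f (Zero l m)"
  from stl_eq.comp_cong[OF stl_eq.refl[OF assms(1)] this] stl_comp_zero_right[OF assms(1)]
  show ?thesis by (rule stl_eq.trans)
qed

lemma stl_tens_eq_zero:
  assumes "stl_typed f m m'" "stl_typed g n n'"
    and "stl_eq \<delta> m m' f (Zero m m') \<or> stl_eq \<delta> n n' g (Zero n n')"
  shows "stl_eq \<delta> (m + n) (m' + n') (Tens f g) (Zero (m + n) (m' + n'))"
  using assms(3)
proof
  assume "stl_eq \<delta> m m' f (Zero m m')"
  from stl_eq.tens_cong[OF this stl_eq.refl[OF assms(2)]] stl_tens_zero_left[OF assms(2)]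
  show ?thesis by (rule stl_eq.trans)
next
  assume "stl_eq \<delta> n n' g (Zero n n')"
  from stl_eq.tens_cong[OF stl_eq.refl[OF assms(1)] this] stl_tens_zero_right[OF assms(1)]
  show ?thesis by (rule stl_eq.trans)
qed

lemma stl_add_eq_zero:
  assumes "stl_eq \<delta> m n f (Zero m n)" "stl_eq \<delta> m n g (Zero m n)"
  shows "stl_eq \<delta> m n (Add f g) (Zero m n)"
  using stl_eq.add_cong[OF assms] stl_zero_zero by (rule stl_eq.trans)

lemma stl_scale_eq_zero:
  assumes "stl_eq \<delta> m n f (Zero m n)"
  shows "stl_eq \<delta> m n (Scale a f) (Zero m n)"
  using stl_eq.scale_cong[OF assms] stl_scale_zero by (rule stl_eq.trans)

lemma stl_parity_degree:
  "\<lbrakk>stl_typed f m n; stl_parity f p\<rbrakk> \<Longrightarrow> stl_degree m n p \<or> stl_eq \<delta> m n f (Zero m n)"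
proof (induction arbitrary: p rule: stl_typed.induct)
  case (4 g m n f l)
  from 4(5) obtain r s where "stl_parity g r" "stl_parity f s" "p = r + s" by cases auto
  with 4 show ?case by (metis stl_degree_comp stl_comp_eq_zero)
next
  case (5 f m m' g n n')
  from 5(5) obtain r s where "stl_parity f r" "stl_parity g s" "p = r + s" by cases auto
  with 5 show ?case by (metis stl_degree_tens stl_tens_eq_zero)
next
  case (7 f m n g)
  from 7(5) have "stl_parity f p" "stl_parity g p" by (cases, auto)+
  with 7 show ?case by (metis stl_add_eq_zero)
next
  case (8 f m n a)
  from 8(3) have "stl_parity f p" by cases auto
  with 8 show ?case by (metis stl_scale_eq_zero)
qed (auto elim: stl_parity.cases simp: stl_degree_def intro: stl_eq.refl stl_typed.intros)

lemma stl_homogeneous: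
  "stl_typed f m n \<Longrightarrow>
     (\<exists>p g. stl_degree m n p \<and> stl_parity g p \<and> stl_eq \<delta> m n f g) \<or> stl_eq \<delta> m n f (Zero m n)"
proof (induction rule: stl_typed.induct)
  case (1 n)
  have "stl_degree n n 0" by (simp add: stl_degree_def)
  then show ?case by (blast intro: stl_eq.refl stl_typed.intros stl_parity.intros)
next
  case 2
  have "stl_degree 0 2 1" by (simp add: stl_degree_def)
  then show ?case by (blast intro: stl_eq.refl stl_typed.intros stl_parity.intros)
next
  case 3
  have "stl_degree 2 0 1" by (simp add: stl_degree_def)
  then show ?case by (blast intro: stl_eq.refl stl_typed.intros stl_parity.intros)
next
  case (4 g m n f l)
  then show ?case
    by (meson stl_comp_eq_zero stl_degree_comp stl_parity.intros stl_eq.comp_cong)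
next
  case (5 f m m' g n n')
  then show ?case
    by (meson stl_tens_eq_zero stl_degree_tens stl_parity.intros stl_eq.tens_cong)
next
  case (6 m n)
  then show ?case by (blast intro: stl_eq.refl stl_typed.intros)
next
  case (7 f m n g)
  from 7(3,4) show ?case
  proof (elim disjE exE conjE)
    fix p p' f' g'
    assume a: "stl_degree m n p" "stl_parity f' p" "stl_eq \<delta> m n f f'"
      "stl_degree m n p'" "stl_parity g' p'" "stl_eq \<delta> m n g g'"
    then have "p' = p" by (metis stl_degree_unique)
    with a show ?thesis by (blast intro: stl_parity.intros stl_eq.add_cong)
  next
    fix p f'
    assume "stl_degree m n p" "stl_parity f' p" "stl_eq \<delta> m n f f'" "stl_eq \<delta> m n g (Zero m n)"
    then show ?thesis by (blast intro: stl_parity.intros stl_eq.add_cong)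
  next
    fix p g'
    assume "stl_degree m n p" "stl_parity g' p" "stl_eq \<delta> m n g g'" "stl_eq \<delta> m n f (Zero m n)"
    then show ?thesis by (blast intro: stl_parity.intros stl_eq.add_cong)
  next
    assume "stl_eq \<delta> m n f (Zero m n)" "stl_eq \<delta> m n g (Zero m n)"
    then show ?thesis by (blast intro: stl_add_eq_zero)
  qed
next
  case (8 f m n a)
  then show ?case by (meson stl_scale_eq_zero stl_parity.intros stl_eq.scale_cong)
qed

lemma stl_add_zero_right:
  assumes "stl_typed f m n"
  shows "stl_eq \<delta> m n (Add f (Zero m n)) f"
  using stl_eq.add_commute[OF assms stl_typed.intros(6)] stl_eq.add_zero[OF assms]
  by (rule stl_eq.trans)

lemma stl_decomp:
  assumes "stl_typed f m n"
  shows "\<exists>g h. stl_typed g m n \<and> stl_typed h m n \<and> stl_parity g 0 \<and> stl_parity h 1 \<and> stl_eq \<delta> m n f (Add g h)"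
  using stl_homogeneous[OF assms, of \<delta>]
proof (elim disjE exE conjE)
  fix p g assume g: "stl_parity g p" "stl_eq \<delta> m n f g"
  then have t: "stl_typed g m n" using stl_eq_typed by blast
  show ?thesis
  proof (cases "p = 0")
    case True
    have "stl_eq \<delta> m n f (Add g (Zero m n))"
      using g(2) stl_eq.sym[OF stl_add_zero_right[OF t]] by (rule stl_eq.trans)
    with True g t show ?thesis by (blast intro: stl_typed.intros stl_parity.intros)
  next
    case False
    then have "p = 1" by simp
    have "stl_eq \<delta> m n f (Add (Zero m n) g)"
      using g(2) stl_eq.sym[OF stl_eq.add_zero[OF t]] by (rule stl_eq.trans)
    with \<open>p = 1\<close> g t show ?thesis by (blast intro: stl_typed.intros stl_parity.intros)
  qed
next
  assume "stl_eq \<delta> m n f (Zero m n)"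
  from stl_eq.trans[OF this stl_eq.sym[OF stl_zero_zero]]
  show ?thesis by (blast intro: stl_typed.intros stl_parity.intros)
qed

lemma stl_decomp_unique:
  assumes "stl_typed g m n" "stl_typed h m n" "stl_parity g 0" "stl_parity h 1" "stl_eq \<delta> m n f (Add g h)"
  shows "stl_eq \<delta> m n g (if stl_degree m n 0 then f else Zero m n)"
    and "stl_eq \<delta> m n h (if stl_degree m n 1 then f else Zero m n)"
proof -
  have g: "stl_degree m n 0 \<or> stl_eq \<delta> m n g (Zero m n)"
    and h: "stl_degree m n 1 \<or> stl_eq \<delta> m n h (Zero m n)"
    using stl_parity_degree assms by blast+
  have n: "\<not> (stl_degree m n 0 \<and> stl_degree m n 1)"
    using stl_degree_unique[of m n 0 1] by auto
  have z: "stl_eq \<delta> m n h (Zero m n) \<Longrightarrow> stl_eq \<delta> m n g f"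
    using stl_eq.add_cong[OF stl_eq.refl[OF assms(1)]] stl_add_zero_right[OF assms(1)] assms(5)
    by (meson stl_eq.sym stl_eq.trans)
  have z': "stl_eq \<delta> m n g (Zero m n) \<Longrightarrow> stl_eq \<delta> m n h f"
    using stl_eq.add_cong[OF _ stl_eq.refl[OF assms(2)]] stl_eq.add_zero[OF assms(2)] assms(5)
    by (meson stl_eq.sym stl_eq.trans)
  show "stl_eq \<delta> m n g (if stl_degree m n 0 then f else Zero m n)" using g h n z by auto
  show "stl_eq \<delta> m n h (if stl_degree m n 1 then f else Zero m n)" using g h n z' by auto
qed

lemma STL_strict_monoidal_supercategory: "strict_monoidal_supercategory (STL \<delta>)"
proof -
  note [simp] = STL_simps STL_ops stl_typed.intros
  note tens_assoc' = stl_eq.tens_assoc[where \<delta> = \<delta>, unfolded add.assoc]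
  note eqs = stl_eq.intros(8-31)[where \<delta> = \<delta>, THEN stl_class_eqI] tens_assoc'[THEN stl_class_eqI]
  have grp: "comm_group \<lparr>carrier = Mor (STL \<delta>) m n, monoid.mult = add_mor (STL \<delta>) m n,
      one = zero_mor (STL \<delta>) m n\<rparr>" for m n
  proof (rule comm_groupI, goal_cases)
    case (6 F)
    then obtain f where f: "stl_typed f m n" "F = stl_class \<delta> m n f" by auto
    have "stl_eq \<delta> m n (Add (Scale (- 1) f) f) (Zero m n)"
      using stl_eq.add_commute[OF stl_typed.intros(8) f(1)] stl_eq.add_inverse f(1)
      by (blast intro: stl_eq.trans)
    with f show ?case by (auto intro!: exI[of _ "Scale (- 1) f"] stl_class_eqI)
  qed (auto del: equalityI intro!: imageI intro: eqs)
  have pre: "preadditive_category (STL \<delta>)"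
    by (intro preadditive_category.intro grp)
       (auto del: equalityI intro!: imageI intro: eqs)
  have lin: "linear_category (STL \<delta>)"
    by (intro linear_category.intro pre linear_category_axioms.intro)
       (auto del: equalityI intro!: imageI intro: eqs)
  have decomp: "\<exists>!(g, h). g \<in> homog (STL \<delta>) m n 0 \<and> h \<in> homog (STL \<delta>) m n 1 \<and> F = add_mor (STL \<delta>) m n g h"
    if F: "F \<in> Mor (STL \<delta>) m n" for m n F
  proof -
    from F obtain f where f: "stl_typed f m n" "F = stl_class \<delta> m n f" by auto
    let ?g = "stl_class \<delta> m n (if stl_degree m n 0 then f else Zero m n)"
    let ?h = "stl_class \<delta> m n (if stl_degree m n 1 then f else Zero m n)"
    have uniq: "G = ?g \<and> H = ?h"
      if GH: "G \<in> homog (STL \<delta>) m n 0" "H \<in> homog (STL \<delta>) m n 1" "F = add_mor (STL \<delta>) m n G H" for G H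
    proof -
      from GH(1,2) obtain g h where gh: "stl_typed g m n" "stl_parity g 0" "G = stl_class \<delta> m n g"
        "stl_typed h m n" "stl_parity h 1" "H = stl_class \<delta> m n h" by auto
      with GH(3) f(2) have "stl_class \<delta> m n f = stl_class \<delta> m n (Add g h)" by simp
      with gh have "stl_eq \<delta> m n f (Add g h)" by (intro stl_class_eqD) auto
      from stl_decomp_unique[OF gh(1,4,2,5) this] gh show ?thesis by (simp add: stl_class_eqI)
    qed
    from stl_decomp[OF f(1), of \<delta>] obtain g h where gh: "stl_typed g m n" "stl_typed h m n"
      "stl_parity g 0" "stl_parity h 1" "stl_eq \<delta> m n f (Add g h)" by blast
    then have "F = add_mor (STL \<delta>) m n (stl_class \<delta> m n g) (stl_class \<delta> m n h)"
      using f(2) by (simp add: stl_class_eqI)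
    with gh have ex: "stl_class \<delta> m n g \<in> homog (STL \<delta>) m n 0 \<and> stl_class \<delta> m n h \<in> homog (STL \<delta>) m n 1
        \<and> F = add_mor (STL \<delta>) m n (stl_class \<delta> m n g) (stl_class \<delta> m n h)" by auto
    show ?thesis
    proof (rule ex1I[of _ "(stl_class \<delta> m n g, stl_class \<delta> m n h)"], goal_cases)
      case 1
      show ?case using ex by simp
    next
      case (2 P)
      then obtain G H where "P = (G, H)" "G \<in> homog (STL \<delta>) m n 0" "H \<in> homog (STL \<delta>) m n 1"
        "F = add_mor (STL \<delta>) m n G H" by (cases P) auto
      with uniq[of G H] uniq[of "stl_class \<delta> m n g" "stl_class \<delta> m n h"] ex show ?case by simp
    qed
  qed
  have hcomp: "comp_mor (STL \<delta>) l m n G F \<in> homog (STL \<delta>) l n (p + q)"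
    if "G \<in> homog (STL \<delta>) m n p" "F \<in> homog (STL \<delta>) l m q" for l m n p q F G
  proof -
    from that obtain f g where "stl_typed g m n" "stl_parity g p" "G = stl_class \<delta> m n g"
      "stl_typed f l m" "stl_parity f q" "F = stl_class \<delta> l m f" by auto
    then show ?thesis using stl_parity.intros(4)[of g p f q] by auto
  qed
  have htens: "tensor_mor (STL \<delta>) m m' n n' F G
      \<in> homog (STL \<delta>) (tensor_ob (STL \<delta>) m n) (tensor_ob (STL \<delta>) m' n') (p + q)"
    if "F \<in> homog (STL \<delta>) m m' p" "G \<in> homog (STL \<delta>) n n' q" for m m' n n' p q F G
  proof -
    from that obtain f g where "stl_typed f m m'" "stl_parity f p" "F = stl_class \<delta> m m' f"
      "stl_typed g n n'" "stl_parity g q" "G = stl_class \<delta> n n' g" by auto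
    then show ?thesis using stl_parity.intros(5)[of f p g q] by auto
  qed
  have "supercategory (STL \<delta>)"
    by (intro supercategory.intro lin supercategory_axioms.intro decomp hcomp)
       (auto intro!: imageI intro: stl_parity.intros stl_typed.intros)
  moreover have hinter: "comp_mor (STL \<delta>) (tensor_ob (STL \<delta>) x y) (tensor_ob (STL \<delta>) x' y') (tensor_ob (STL \<delta>) x'' y'')
            (tensor_mor (STL \<delta>) x' x'' y' y'' F G) (tensor_mor (STL \<delta>) x x' y y' H K)
          = scale_mor (STL \<delta>) (tensor_ob (STL \<delta>) x y) (tensor_ob (STL \<delta>) x'' y'') (koszul (p * q))
              (tensor_mor (STL \<delta>) x x'' y y'' (comp_mor (STL \<delta>) x x' x'' F H) (comp_mor (STL \<delta>) y y' y'' G K))"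
    if "F \<in> Mor (STL \<delta>) x' x''" "G \<in> homog (STL \<delta>) y' y'' p"
      "H \<in> homog (STL \<delta>) x x' q" "K \<in> Mor (STL \<delta>) y y'" for x x' x'' y y' y'' p q F G H K
  proof -
    from that obtain f g h k where "stl_typed f x' x''" "F = stl_class \<delta> x' x'' f"
      "stl_typed g y' y''" "stl_parity g p" "G = stl_class \<delta> y' y'' g"
      "stl_typed h x x'" "stl_parity h q" "H = stl_class \<delta> x x' h"
      "stl_typed k y y'" "K = stl_class \<delta> y y' k" by auto
    then show ?thesis
      using stl_eq.super_interchange[of f x' x'' g y' y'' h x k y p q, THEN stl_class_eqI]
      by simp
  qed
  moreover have "strict_monoidal_supercategory_axioms (STL \<delta>)"
    by (intro strict_monoidal_supercategory_axioms.intro htens hinter)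
       (auto simp: add.assoc del: equalityI intro!: imageI intro: eqs)
  ultimately show ?thesis by (blast intro: strict_monoidal_supercategory.intro)
qed

end

theory Submission
  imports Defs "Jordan_Normal_Form.Determinant"
begin

text \<open>
  Because \<open>q\<close> is not a root of unity, the loop values \<open>\<delta>\<close>, \<open>\<delta> + 1 / \<delta>\<close>, ... of the odd Jones--Wenzl
  projectors, \<open>l\<^sub>n\<^sub>+\<^sub>1 = \<delta> + 1 / l\<^sub>n\<close>, never vanish, so the projectors exist by the usual recursion.
  They are killed by caps and cups, and morphisms are combinations of caps followed by cups, so their
  images and the parity shifts of these are pairwise orthogonal with endomorphism algebra \<open>k\<close> or \<open>0\<close>;
  the latter is excluded by a representation on tensor powers of a super plane of dimension \<open>(1, 1)\<close>.
  Tensoring the \<open>n\<close>-th image with the generating object splits off the \<open>(n + 1)\<close>-st and, since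
  cups and caps are odd, the parity shift of the \<open>(n - 1)\<close>-st. Hence these simple objects generate
  everything under direct sums and summands, and a category so generated is semisimple Abelian.
  The same splitting is the recursion \<open>[n + 1][2] = [n + 2] + \<pi>[n]\<close>, so that sending simple objects
  to quantum integers is multiplicative against the generator, hence against all objects.
\<close>

section \<open>Preadditive categories\<close>

text \<open>No basis theorem for the Hom spaces enters. Diagrams are only shown to span, which
  bounds the endomorphisms of each projector by the scalars. Nonvanishing is checked at the unit
  object alone, since closing the last strand of a projector returns a nonzero multiple of the
  preceding one. The plus sign in the recursion of the loop values, where ordinary Temperley-Lieb
  theory has a minus, comes from the second zigzag relation. The characteristic equation becomes
  \<open>x^2 = \<delta> x + 1\<close>, with roots \<open>1/q\<close> and \<open>-q\<close>; this
  explains the shape of \<delta> and the condition on \<open>q\<close>. Semisimplicity is deduced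
  from an elementary property: every identity is a finite sum of composites through simple objects.
  It is inherited by tensor products and summands before any decomposition is known, and it makes
  every morphism von Neumann regular, so that kernels and cokernels are images of idempotents. The
  relations of \<open>K0\<close> are given as an additive subgroup. That they form an ideal is read
  off from the character, whose kernel they are.\<close>

definition neg_mor :: "('o, 'm, 'k, 'z) lin_moncat_scheme \<Rightarrow> 'o \<Rightarrow> 'o \<Rightarrow> 'm \<Rightarrow> 'm" where
  "neg_mor C x y f = m_inv \<lparr>carrier = Mor C x y, monoid.mult = add_mor C x y, one = zero_mor C x y\<rparr> f"

text \<open>The two-summand case of \<open>direct_sum\<close> with named injections
  \<open>i\<close>, \<open>j\<close> and projections \<open>p\<close>, \<open>q\<close>, so that its
  equations can serve as rewrite rules; \<open>direct_sum_pair\<close> translates.\<close>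

definition biproduct ::
    "('o, 'm, 'k, 'z) lin_moncat_scheme \<Rightarrow> 'o \<Rightarrow> 'o \<Rightarrow> 'o \<Rightarrow> 'm \<Rightarrow> 'm \<Rightarrow> 'm \<Rightarrow> 'm \<Rightarrow> bool" where
  "biproduct C z x y i j p q \<longleftrightarrow> z \<in> Ob C \<and> x \<in> Ob C \<and> y \<in> Ob C \<and>
     i \<in> Mor C x z \<and> j \<in> Mor C y z \<and> p \<in> Mor C z x \<and> q \<in> Mor C z y \<and>
     comp_mor C x z x p i = id_mor C x \<and> comp_mor C y z y q j = id_mor C y \<and>
     comp_mor C y z x p j = zero_mor C y x \<and> comp_mor C x z y q i = zero_mor C x y \<and>
     add_mor C z z (comp_mor C z x z i p) (comp_mor C z y z j q) = id_mor C z"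

lemma sum_mor_Nil [simp]: "sum_mor C x y [] = zero_mor C x y"
  and sum_mor_Cons [simp]: "sum_mor C x y (f # fs) = add_mor C x y f (sum_mor C x y fs)"
  by (simp_all add: sum_mor_def)

context preadditive_category
begin

context
  fixes x y assumes ob: "x \<in> Ob C" "y \<in> Ob C"
begin

interpretation G: comm_group "\<lparr>carrier = Mor C x y, monoid.mult = add_mor C x y, one = zero_mor C x y\<rparr>"
  by (rule mor_group[OF ob])

lemma zero_closed: "zero_mor C x y \<in> Mor C x y"
  using G.one_closed by simp
lemma add_closed: "\<lbrakk>f \<in> Mor C x y; g \<in> Mor C x y\<rbrakk> \<Longrightarrow> add_mor C x y f g \<in> Mor C x y"
  using G.m_closed by simp
lemma add_assoc: "\<lbrakk>f \<in> Mor C x y; g \<in> Mor C x y; h \<in> Mor C x y\<rbrakk>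
    \<Longrightarrow> add_mor C x y (add_mor C x y f g) h = add_mor C x y f (add_mor C x y g h)"
  using G.m_assoc by simp
lemma add_commute: "\<lbrakk>f \<in> Mor C x y; g \<in> Mor C x y\<rbrakk> \<Longrightarrow> add_mor C x y f g = add_mor C x y g f"
  using G.m_comm by simp
lemma add_left_commute: "\<lbrakk>f \<in> Mor C x y; g \<in> Mor C x y; h \<in> Mor C x y\<rbrakk>
    \<Longrightarrow> add_mor C x y f (add_mor C x y g h) = add_mor C x y g (add_mor C x y f h)"
  using G.m_lcomm by simp
lemma add_zero_left: "f \<in> Mor C x y \<Longrightarrow> add_mor C x y (zero_mor C x y) f = f"
  using G.l_one by simp
lemma add_zero_right: "f \<in> Mor C x y \<Longrightarrow> add_mor C x y f (zero_mor C x y) = f"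
  using G.r_one by simp
lemma neg_closed: "f \<in> Mor C x y \<Longrightarrow> neg_mor C x y f \<in> Mor C x y"
  using G.inv_closed by (simp add: neg_mor_def)
lemma add_neg_right: "f \<in> Mor C x y \<Longrightarrow> add_mor C x y f (neg_mor C x y f) = zero_mor C x y"
  using G.r_inv by (simp add: neg_mor_def)
lemma add_neg_left: "f \<in> Mor C x y \<Longrightarrow> add_mor C x y (neg_mor C x y f) f = zero_mor C x y"
  using G.l_inv by (simp add: neg_mor_def)
lemma add_left_cancel: "\<lbrakk>f \<in> Mor C x y; g \<in> Mor C x y; h \<in> Mor C x y\<rbrakk>
    \<Longrightarrow> add_mor C x y f g = add_mor C x y f h \<longleftrightarrow> g = h"
  using G.l_cancel by auto

end

lemmas add_simps = zero_closed add_closed add_assoc add_zero_left add_zero_right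
  neg_closed add_neg_right add_neg_left id_closed comp_closed

text \<open>Most vanishing statements below are reduced to this: bilinearity gives
  \<open>f + f = f\<close>, and one copy of \<open>f\<close> cancels.\<close>

lemma add_idem_zero:
  assumes "x \<in> Ob C" "y \<in> Ob C" "f \<in> Mor C x y" "add_mor C x y f f = f"
  shows "f = zero_mor C x y"
  using add_left_cancel[of x y f f "zero_mor C x y"] assms by (simp add: add_simps)

lemma neg_unique:
  assumes "x \<in> Ob C" "y \<in> Ob C" "f \<in> Mor C x y" "g \<in> Mor C x y" "add_mor C x y f g = zero_mor C x y"
  shows "g = neg_mor C x y f"
  using add_left_cancel[of x y f g "neg_mor C x y f"] assms by (simp add: add_simps)

lemma diff_zero_iff:
  assumes "x \<in> Ob C" "y \<in> Ob C" "f \<in> Mor C x y" "g \<in> Mor C x y"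
  shows "add_mor C x y f (neg_mor C x y g) = zero_mor C x y \<longleftrightarrow> f = g"
proof
  assume "add_mor C x y f (neg_mor C x y g) = zero_mor C x y"
  then have "add_mor C x y (neg_mor C x y g) f = add_mor C x y (neg_mor C x y g) g"
    using assms by (simp add: add_simps add_commute[of x y f])
  then show "f = g" using assms add_left_cancel neg_closed by metis
qed (use assms in \<open>simp add: add_simps\<close>)

lemma comp_zero_left: "\<lbrakk>x \<in> Ob C; y \<in> Ob C; z \<in> Ob C; f \<in> Mor C x y\<rbrakk>
    \<Longrightarrow> comp_mor C x y z (zero_mor C y z) f = zero_mor C x z"
  by (rule add_idem_zero) (simp_all add: add_simps flip: comp_add_left)

lemma comp_zero_right: "\<lbrakk>x \<in> Ob C; y \<in> Ob C; z \<in> Ob C; f \<in> Mor C y z\<rbrakk>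
    \<Longrightarrow> comp_mor C x y z f (zero_mor C x y) = zero_mor C x z"
  by (rule add_idem_zero) (simp_all add: add_simps flip: comp_add_right)

lemma comp_neg_left: "\<lbrakk>x \<in> Ob C; y \<in> Ob C; z \<in> Ob C; g \<in> Mor C y z; f \<in> Mor C x y\<rbrakk>
    \<Longrightarrow> comp_mor C x y z (neg_mor C y z g) f = neg_mor C x z (comp_mor C x y z g f)"
  by (rule neg_unique) (simp_all add: add_simps comp_zero_left flip: comp_add_left)

lemma comp_neg_right: "\<lbrakk>x \<in> Ob C; y \<in> Ob C; z \<in> Ob C; g \<in> Mor C y z; f \<in> Mor C x y\<rbrakk>
    \<Longrightarrow> comp_mor C x y z g (neg_mor C x y f) = neg_mor C x z (comp_mor C x y z g f)"
  by (rule neg_unique) (simp_all add: add_simps comp_zero_right flip: comp_add_right)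

lemma neg_zero: "\<lbrakk>x \<in> Ob C; y \<in> Ob C\<rbrakk> \<Longrightarrow> neg_mor C x y (zero_mor C x y) = zero_mor C x y"
  by (rule neg_unique[symmetric]) (simp_all add: add_simps)

lemmas cat_simps = add_simps neg_zero comp_id_left comp_id_right comp_zero_left comp_zero_right
  comp_neg_left comp_neg_right comp_add_left comp_add_right

text \<open>A morphism into or out of \<open>x\<close> is unchanged by composing it with the
  identity of \<open>x\<close>, so it vanishes as soon as that identity does.\<close>

lemma zero_ob_iff:
  assumes "x \<in> Ob C"
  shows "zero_ob C x \<longleftrightarrow> id_mor C x = zero_mor C x x"
proof
  assume "zero_ob C x"
  with assms have "\<exists>!f. f \<in> Mor C x x" by (simp add: zero_ob_def)
  then show "id_mor C x = zero_mor C x x" using assms by (blast intro: id_closed zero_closed)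
next
  assume id: "id_mor C x = zero_mor C x x"
  have "f = zero_mor C x y" if "f \<in> Mor C x y" "y \<in> Ob C" for f y
    using comp_id_right[OF assms that(2,1)] that assms by (simp add: id comp_zero_right)
  moreover have "f = zero_mor C y x" if "f \<in> Mor C y x" "y \<in> Ob C" for f y
    using comp_id_left[OF that(2) assms that(1)] that assms by (simp add: id comp_zero_left)
  ultimately show "zero_ob C x"
    using assms zero_closed unfolding zero_ob_def by (metis (no_types, lifting))
qed

section \<open>Finite sums of morphisms\<close>

lemma sum_mor_closed: "\<lbrakk>x \<in> Ob C; y \<in> Ob C; set fs \<subseteq> Mor C x y\<rbrakk> \<Longrightarrow> sum_mor C x y fs \<in> Mor C x y"
  by (induction fs) (auto simp: add_simps)

lemma sum_mor_append: "\<lbrakk>x \<in> Ob C; y \<in> Ob C; set fs \<subseteq> Mor C x y; set gs \<subseteq> Mor C x y\<rbrakk>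
    \<Longrightarrow> sum_mor C x y (fs @ gs) = add_mor C x y (sum_mor C x y fs) (sum_mor C x y gs)"
  by (induction fs) (auto simp: add_simps sum_mor_closed)

lemma sum_mor_add:
  "\<lbrakk>x \<in> Ob C; y \<in> Ob C; \<And>l. l \<in> set ls \<Longrightarrow> f l \<in> Mor C x y; \<And>l. l \<in> set ls \<Longrightarrow> g l \<in> Mor C x y\<rbrakk>
    \<Longrightarrow> sum_mor C x y (map (\<lambda>l. add_mor C x y (f l) (g l)) ls)
      = add_mor C x y (sum_mor C x y (map f ls)) (sum_mor C x y (map g ls))"
proof (induction ls)
  case (Cons l ls)
  have "sum_mor C x y (map f ls) \<in> Mor C x y" "sum_mor C x y (map g ls) \<in> Mor C x y"
    using Cons.prems by (auto intro!: sum_mor_closed)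
  with Cons show ?case by (simp add: add_simps add_left_commute)
qed (simp add: add_simps)

lemma sum_mor_zeros: "\<lbrakk>x \<in> Ob C; y \<in> Ob C\<rbrakk>
    \<Longrightarrow> sum_mor C x y (map (\<lambda>l. zero_mor C x y) ls) = zero_mor C x y"
  by (induction ls) (auto simp: add_simps)

text \<open>Associativity of matrix composition in the additive envelope rests on this interchange
  of two finite sums.\<close>

lemma sum_mor_swap:
  assumes "x \<in> Ob C" "y \<in> Ob C" "\<And>l k. \<lbrakk>l \<in> set ls; k \<in> set ks\<rbrakk> \<Longrightarrow> f l k \<in> Mor C x y"
  shows "sum_mor C x y (map (\<lambda>l. sum_mor C x y (map (f l) ks)) ls)
    = sum_mor C x y (map (\<lambda>k. sum_mor C x y (map (\<lambda>l. f l k) ls)) ks)"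
  using assms(3)
proof (induction ls)
  case (Cons l ls)
  have "sum_mor C x y (map (\<lambda>l. f l k) ls) \<in> Mor C x y" if "k \<in> set ks" for k
    using Cons.prems that assms by (auto intro!: sum_mor_closed)
  with Cons show ?case by (simp add: sum_mor_add assms)
qed (simp add: sum_mor_zeros assms)

lemma comp_sum_left: "\<lbrakk>x \<in> Ob C; y \<in> Ob C; z \<in> Ob C; set gs \<subseteq> Mor C y z; f \<in> Mor C x y\<rbrakk>
    \<Longrightarrow> comp_mor C x y z (sum_mor C y z gs) f = sum_mor C x z (map (\<lambda>g. comp_mor C x y z g f) gs)"
  by (induction gs) (auto simp: cat_simps sum_mor_closed)

lemma comp_sum_right: "\<lbrakk>x \<in> Ob C; y \<in> Ob C; z \<in> Ob C; g \<in> Mor C y z; set fs \<subseteq> Mor C x y\<rbrakk>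
    \<Longrightarrow> comp_mor C x y z g (sum_mor C x y fs) = sum_mor C x z (map (\<lambda>f. comp_mor C x y z g f) fs)"
  by (induction fs) (auto simp: cat_simps sum_mor_closed)

lemma sum_mor_single:
  assumes "x \<in> Ob C" "y \<in> Ob C" "k \<in> set ls" "distinct ls" "f \<in> Mor C x y"
  shows "sum_mor C x y (map (\<lambda>l. if l = k then f else zero_mor C x y) ls) = f"
  using assms(3,4)
proof (induction ls)
  case (Cons l ls)
  show ?case
  proof (cases "l = k")
    case True
    then have "map (\<lambda>l. if l = k then f else zero_mor C x y) ls = map (\<lambda>l. zero_mor C x y) ls"
      using Cons.prems by auto
    with True show ?thesis using assms by (simp only: list.map sum_mor_Cons sum_mor_zeros) (simp add: add_simps)
  next
    case False
    with Cons assms show ?thesis by (simp add: add_simps)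
  qed
qed simp

section \<open>Biproducts and finite direct sums\<close>

lemma direct_sum_pair:
  "direct_sum C z [x, y] \<longleftrightarrow> (\<exists>i j p q. biproduct C z x y i j p q)"
proof
  assume "direct_sum C z [x, y]"
  then obtain \<iota> \<rho> where *: "z \<in> Ob C" "x \<in> Ob C" "y \<in> Ob C"
    "\<forall>i<2. \<iota> i \<in> Mor C ([x, y] ! i) z \<and> \<rho> i \<in> Mor C z ([x, y] ! i)"
    "\<forall>i<2. \<forall>j<2. comp_mor C ([x, y] ! i) z ([x, y] ! j) (\<rho> j) (\<iota> i)
       = (if i = j then id_mor C ([x, y] ! i) else zero_mor C ([x, y] ! i) ([x, y] ! j))"
    "sum_mor C z z [comp_mor C z ([x, y] ! i) z (\<iota> i) (\<rho> i). i \<leftarrow> [0..<2]] = id_mor C z"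
    unfolding direct_sum_def by (auto simp: numeral_2_eq_2)
  have 0: "(0::nat) < 2" and 1: "(1::nat) < 2" by simp_all
  have "biproduct C z x y (\<iota> 0) (\<iota> 1) (\<rho> 0) (\<rho> 1)"
    unfolding biproduct_def
    using *(1-3) *(4)[rule_format, OF 0] *(4)[rule_format, OF 1] *(5)[rule_format, OF 0 0]
      *(5)[rule_format, OF 0 1] *(5)[rule_format, OF 1 0] *(5)[rule_format, OF 1 1] *(6)
    by (simp add: numeral_2_eq_2 cat_simps)
  then show "\<exists>i j p q. biproduct C z x y i j p q" by blast
next
  assume "\<exists>i j p q. biproduct C z x y i j p q"
  then obtain i j p q where *: "biproduct C z x y i j p q" by blast
  let ?\<iota> = "\<lambda>n::nat. if n = 0 then i else j" and ?\<rho> = "\<lambda>n::nat. if n = 0 then p else q"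
  have "\<forall>l<2. ?\<iota> l \<in> Mor C ([x, y] ! l) z \<and> ?\<rho> l \<in> Mor C z ([x, y] ! l)"
    "\<forall>l<2. \<forall>m<2. comp_mor C ([x, y] ! l) z ([x, y] ! m) (?\<rho> m) (?\<iota> l)
       = (if l = m then id_mor C ([x, y] ! l) else zero_mor C ([x, y] ! l) ([x, y] ! m))"
    "sum_mor C z z [comp_mor C z ([x, y] ! l) z (?\<iota> l) (?\<rho> l). l \<leftarrow> [0..<2]] = id_mor C z"
    using * by (auto simp: biproduct_def less_Suc_eq cat_simps numeral_2_eq_2)
  with * show "direct_sum C z [x, y]"
    unfolding direct_sum_def by (intro conjI exI[of _ ?\<iota>] exI[of _ ?\<rho>]) (auto simp: biproduct_def numeral_2_eq_2)
qed

end

text \<open>Composites are kept bracketed to the right, so a known composite \<open>g f\<close>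
  occurs as \<open>g (f k)\<close>. In this form an equation for \<open>g f\<close> rewrites it
  there.\<close>

lemma (in preadditive_category) comp_reassoc:
  assumes "comp_mor C x y z g f = h" "w \<in> Ob C" "x \<in> Ob C" "y \<in> Ob C" "z \<in> Ob C"
    "g \<in> Mor C y z" "f \<in> Mor C x y" "k \<in> Mor C w x"
  shows "comp_mor C w y z g (comp_mor C w x y f k) = comp_mor C w x z h k"
  using comp_assoc[of w x y z g f k] assms by simp

lemma (in preadditive_category) direct_sum_Nil:
  "direct_sum C x [] \<longleftrightarrow> x \<in> Ob C \<and> id_mor C x = zero_mor C x x"
  by (auto simp: direct_sum_def)

lemma (in preadditive_category) direct_sum_single:
  assumes "x \<in> Ob C" shows "direct_sum C x [x]"
  unfolding direct_sum_def using assms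
  by (auto simp: cat_simps intro!: exI[of _ "\<lambda>_. id_mor C x"])

text \<open>The injections are followed and the projections preceded by the two halves of the
  isomorphism, which cancel in the middle of every composite.\<close>

lemma (in preadditive_category) direct_sum_iso:
  assumes "direct_sum C x ys" "isomorphic C x z" "z \<in> Ob C"
  shows "direct_sum C z ys"
proof -
  from assms(1) obtain \<iota> \<rho> where *: "x \<in> Ob C" "set ys \<subseteq> Ob C"
    and t: "\<And>i. i < length ys \<Longrightarrow> \<iota> i \<in> Mor C (ys ! i) x" "\<And>i. i < length ys \<Longrightarrow> \<rho> i \<in> Mor C x (ys ! i)"
    and o: "\<And>i j. \<lbrakk>i < length ys; j < length ys\<rbrakk> \<Longrightarrow> comp_mor C (ys ! i) x (ys ! j) (\<rho> j) (\<iota> i)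
          = (if i = j then id_mor C (ys ! i) else zero_mor C (ys ! i) (ys ! j))"
    and s: "sum_mor C x x [comp_mor C x (ys ! i) x (\<iota> i) (\<rho> i). i \<leftarrow> [0..<length ys]] = id_mor C x"
    unfolding direct_sum_def by blast
  from assms(2) obtain f g where fg: "f \<in> Mor C x z" "g \<in> Mor C z x"
    "comp_mor C x z x g f = id_mor C x" "comp_mor C z x z f g = id_mor C z"
    unfolding isomorphic_def iso_mor_def by blast
  have y: "ys ! i \<in> Ob C" if "i < length ys" for i using that *(2) by auto
  let ?\<iota> = "\<lambda>i. comp_mor C (ys ! i) x z f (\<iota> i)" and ?\<rho> = "\<lambda>i. comp_mor C z x (ys ! i) (\<rho> i) g"
  have "comp_mor C (ys ! i) z (ys ! j) (?\<rho> j) (?\<iota> i)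
      = (if i = j then id_mor C (ys ! i) else zero_mor C (ys ! i) (ys ! j))"
    if "i < length ys" "j < length ys" for i j
    using that y * t fg assms(3) o[of i j] by (simp add: comp_assoc cat_simps comp_reassoc[OF fg(3)])
  moreover have "sum_mor C z z [comp_mor C z (ys ! i) z (?\<iota> i) (?\<rho> i). i \<leftarrow> [0..<length ys]] = id_mor C z"
  proof -
    have "map (\<lambda>i. comp_mor C z (ys ! i) z (?\<iota> i) (?\<rho> i)) [0..<length ys]
      = map (\<lambda>h. comp_mor C z x z f (comp_mor C z x x h g))
          (map (\<lambda>i. comp_mor C x (ys ! i) x (\<iota> i) (\<rho> i)) [0..<length ys])"
      using y * t fg assms(3) by (simp add: comp_assoc cat_simps)
    also have "sum_mor C z z \<dots> = comp_mor C z x z f (comp_mor C z x x (id_mor C x) g)"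
      unfolding s[symmetric] using y * t fg assms(3)
      by (subst comp_sum_left, auto simp: cat_simps) (subst comp_sum_right, auto simp: cat_simps o_def)
    finally show ?thesis using * fg assms(3) by (simp add: cat_simps)
  qed
  ultimately show ?thesis
    unfolding direct_sum_def using assms(3) *(1,2) y t fg
    by (intro conjI exI[of _ ?\<iota>] exI[of _ ?\<rho>]) (auto simp: comp_closed)
qed

text \<open>The inner injections and projections are composed with the outer ones. The first
  \<open>length xs\<close> indices run through \<open>x\<close>, the others, shifted back by
  \<open>length xs\<close>, through \<open>y\<close>.\<close>

lemma (in preadditive_category) direct_sum_append:
  assumes "direct_sum C x xs" "direct_sum C y ys" "direct_sum C z [x, y]"
  shows "direct_sum C z (xs @ ys)"
proof -
  from assms(1) obtain \<iota> \<rho> where x: "x \<in> Ob C" "set xs \<subseteq> Ob C"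
    and t: "\<And>i. i < length xs \<Longrightarrow> \<iota> i \<in> Mor C (xs ! i) x" "\<And>i. i < length xs \<Longrightarrow> \<rho> i \<in> Mor C x (xs ! i)"
    and o: "\<And>i j. \<lbrakk>i < length xs; j < length xs\<rbrakk> \<Longrightarrow> comp_mor C (xs ! i) x (xs ! j) (\<rho> j) (\<iota> i)
          = (if i = j then id_mor C (xs ! i) else zero_mor C (xs ! i) (xs ! j))"
    and s: "sum_mor C x x [comp_mor C x (xs ! i) x (\<iota> i) (\<rho> i). i \<leftarrow> [0..<length xs]] = id_mor C x"
    unfolding direct_sum_def by blast
  from assms(2) obtain \<kappa> \<sigma> where y: "y \<in> Ob C" "set ys \<subseteq> Ob C"
    and t': "\<And>i. i < length ys \<Longrightarrow> \<kappa> i \<in> Mor C (ys ! i) y" "\<And>i. i < length ys \<Longrightarrow> \<sigma> i \<in> Mor C y (ys ! i)"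
    and o': "\<And>i j. \<lbrakk>i < length ys; j < length ys\<rbrakk> \<Longrightarrow> comp_mor C (ys ! i) y (ys ! j) (\<sigma> j) (\<kappa> i)
          = (if i = j then id_mor C (ys ! i) else zero_mor C (ys ! i) (ys ! j))"
    and s': "sum_mor C y y [comp_mor C y (ys ! i) y (\<kappa> i) (\<sigma> i). i \<leftarrow> [0..<length ys]] = id_mor C y"
    unfolding direct_sum_def by blast
  from assms(3) obtain i j p q where z: "z \<in> Ob C" "i \<in> Mor C x z" "j \<in> Mor C y z" "p \<in> Mor C z x" "q \<in> Mor C z y"
    and b: "comp_mor C x z x p i = id_mor C x" "comp_mor C y z y q j = id_mor C y"
      "comp_mor C y z x p j = zero_mor C y x" "comp_mor C x z y q i = zero_mor C x y"
      "add_mor C z z (comp_mor C z x z i p) (comp_mor C z y z j q) = id_mor C z"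
    unfolding direct_sum_pair biproduct_def by blast
  let ?n = "length xs"
  define \<alpha> where "\<alpha> l = (if l < ?n then comp_mor C (xs ! l) x z i (\<iota> l)
      else comp_mor C (ys ! (l - ?n)) y z j (\<kappa> (l - ?n)))" for l
  define \<beta> where "\<beta> l = (if l < ?n then comp_mor C z x (xs ! l) (\<rho> l) p
      else comp_mor C z y (ys ! (l - ?n)) (\<sigma> (l - ?n)) q)" for l
  have xi: "l < ?n \<Longrightarrow> xs ! l \<in> Ob C" and yi: "l < length ys \<Longrightarrow> ys ! l \<in> Ob C" for l
    using x(2) y(2) by auto
  have 1: "\<alpha> l \<in> Mor C ((xs @ ys) ! l) z \<and> \<beta> l \<in> Mor C z ((xs @ ys) ! l)" if "l < ?n + length ys" for l
    using that xi[of l] yi[of "l - ?n"] t[of l] t'[of "l - ?n"] x y z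
    by (auto simp: \<alpha>_def \<beta>_def nth_append comp_closed)
  have 2: "comp_mor C ((xs @ ys) ! l) z ((xs @ ys) ! m) (\<beta> m) (\<alpha> l)
      = (if l = m then id_mor C ((xs @ ys) ! l) else zero_mor C ((xs @ ys) ! l) ((xs @ ys) ! m))"
    if "l < ?n + length ys" "m < ?n + length ys" for l m
    using that xi[of l] yi[of "l - ?n"] t[of l] t'[of "l - ?n"] xi[of m] yi[of "m - ?n"] t[of m] t'[of "m - ?n"]
      x y z o[of l m] o'[of "l - ?n" "m - ?n"]
    by (cases "l < ?n"; cases "m < ?n")
       (simp_all add: \<alpha>_def \<beta>_def nth_append comp_assoc cat_simps b comp_reassoc[OF b(1)] comp_reassoc[OF b(2)]
         comp_reassoc[OF b(3)] comp_reassoc[OF b(4)], linarith?)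
  \<comment> \<open>Each term is \<open>i h p\<close> for a term \<open>h\<close> of the identity of
    \<open>x\<close>, so by linearity the first block adds up to \<open>i p\<close>.\<close>
  have m1: "map (\<lambda>l. comp_mor C z ((xs @ ys) ! l) z (\<alpha> l) (\<beta> l)) [0..<?n]
      = map (\<lambda>h. comp_mor C z x z i (comp_mor C z x x h p)) (map (\<lambda>l. comp_mor C x (xs ! l) x (\<iota> l) (\<rho> l)) [0..<?n])"
    using xi x y z t by (simp add: \<alpha>_def \<beta>_def nth_append comp_assoc cat_simps)
  have s1: "sum_mor C z z (map (\<lambda>l. comp_mor C z ((xs @ ys) ! l) z (\<alpha> l) (\<beta> l)) [0..<?n]) = comp_mor C z x z i p"
  proof -
    have "comp_mor C z x z i (comp_mor C z x x (id_mor C x) p) = comp_mor C z x z i p"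
      using x z by (simp add: cat_simps)
    then show ?thesis
      unfolding m1 s[symmetric] using xi x y z t
      by (subst (asm) comp_sum_left, auto simp: cat_simps) (subst (asm) comp_sum_right, auto simp: cat_simps o_def)
  qed
  have m2: "map (\<lambda>l. comp_mor C z ((xs @ ys) ! l) z (\<alpha> l) (\<beta> l)) [?n..<?n + length ys]
      = map (\<lambda>h. comp_mor C z y z j (comp_mor C z y y h q)) (map (\<lambda>l. comp_mor C y (ys ! l) y (\<kappa> l) (\<sigma> l)) [0..<length ys])"
    using yi x y z t' by (intro nth_equalityI) (simp_all add: \<alpha>_def \<beta>_def nth_append comp_assoc cat_simps)
  have s2: "sum_mor C z z (map (\<lambda>l. comp_mor C z ((xs @ ys) ! l) z (\<alpha> l) (\<beta> l)) [?n..<?n + length ys]) = comp_mor C z y z j q"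
  proof -
    have "comp_mor C z y z j (comp_mor C z y y (id_mor C y) q) = comp_mor C z y z j q"
      using y z by (simp add: cat_simps)
    then show ?thesis
      unfolding m2 s'[symmetric] using yi x y z t'
      by (subst (asm) comp_sum_left, auto simp: cat_simps) (subst (asm) comp_sum_right, auto simp: cat_simps o_def)
  qed
  have cl: "comp_mor C z ((xs @ ys) ! l) z (\<alpha> l) (\<beta> l) \<in> Mor C z z" if "l < ?n + length ys" for l
    using 1[OF that] that z(1) xi yi by (intro comp_closed) (auto simp: nth_append)
  have "sum_mor C z z (map (\<lambda>l. comp_mor C z ((xs @ ys) ! l) z (\<alpha> l) (\<beta> l)) [0..<?n + length ys]) = id_mor C z"
    unfolding upt_add_eq_append[OF zero_le] map_append
    by (subst sum_mor_append) (use z cl s1 s2 b in \<open>auto\<close>)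
  with 1 2 x y z show ?thesis
    unfolding direct_sum_def by (intro conjI exI[of _ \<alpha>] exI[of _ \<beta>]) auto
qed

text \<open>If \<open>n < c\<close>, padding \<open>A\<close> by zero rows and \<open>B\<close> by
  zero columns to square matrices of size \<open>c\<close> keeps the product, but the padded
  \<open>A\<close> has a zero row and hence determinant 0. This is used to compare multiplicities of
  simple summands.\<close>

lemma mat_left_inverse_dim:
  fixes A B :: "'a::field mat"
  assumes A: "A \<in> carrier_mat n c" and B: "B \<in> carrier_mat c n" and BA: "B * A = 1\<^sub>m c"
  shows "c \<le> n"
proof (rule ccontr)
  assume "\<not> c \<le> n"
  then have n: "n < c" by simp
  define A' where "A' = mat c c (\<lambda>(i, j). if i < n then A $$ (i, j) else 0)"
  define B' where "B' = mat c c (\<lambda>(i, j). if j < n then B $$ (i, j) else 0)"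
  have carr: "A' \<in> carrier_mat c c" "B' \<in> carrier_mat c c" by (simp_all add: A'_def B'_def)
  have "B' * A' = 1\<^sub>m c"
  proof (rule eq_matI)
    fix i j assume ij: "i < dim_row (1\<^sub>m c :: 'a mat)" "j < dim_col (1\<^sub>m c :: 'a mat)"
    have "(\<Sum>l<c. B' $$ (i, l) * A' $$ (l, j)) = (\<Sum>l<n. B $$ (i, l) * A $$ (l, j))"
      using n ij by (intro sum.mono_neutral_cong_right) (auto simp: A'_def B'_def)
    moreover have "(B * A) $$ (i, j) = (\<Sum>l<n. B $$ (i, l) * A $$ (l, j))"
      using A B ij by (auto simp: scalar_prod_def atLeast0LessThan)
    moreover have "(B' * A') $$ (i, j) = (\<Sum>l<c. B' $$ (i, l) * A' $$ (l, j))"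
      using carr ij by (auto simp: scalar_prod_def atLeast0LessThan)
    ultimately show "(B' * A') $$ (i, j) = 1\<^sub>m c $$ (i, j)" using BA by simp
  qed (use carr in auto)
  then have "det B' * det A' = 1" using det_mult[OF carr(2,1)] by simp
  moreover have "det A' = 0"
  proof -
    have "row A' n = 0\<^sub>v c" using n by (intro eq_vecI) (auto simp: A'_def)
    then have "A' = mat\<^sub>r c c (\<lambda>i. if i = n then 0\<^sub>v c else row A' i)"
      using carr n by (intro eq_matI) (auto simp: A'_def)
    then show ?thesis
      using det_row_0[OF n, of "row A'"] carr(1) by (metis (no_types, lifting) Pi_I row_carrier_vec atLeastLessThan_iff)
  qed
  ultimately show False by simp
qed

section \<open>Categories generated by orthogonal absolutely simple objects\<close>

text \<open>The finite sums of composites \<open>x -> S i -> y\<close>. For an identity, the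
  predicate says that the object is a retract of a finite direct sum of the \<open>S i\<close>,
  without forming that sum.\<close>

inductive sum_through :: "('o, 'm, 'k, 'z) lin_moncat_scheme \<Rightarrow> ('i \<Rightarrow> 'o) \<Rightarrow> 'o \<Rightarrow> 'o \<Rightarrow> 'm \<Rightarrow> bool"
  for C S x y where
  zero: "sum_through C S x y (zero_mor C x y)"
| add: "\<lbrakk>a \<in> Mor C x (S i); b \<in> Mor C (S i) y; sum_through C S x y f\<rbrakk>
    \<Longrightarrow> sum_through C S x y (add_mor C x y (comp_mor C x (S i) y b a) f)"

locale preadditive_family = preadditive_category C
  for C :: "('o, 'm, 'k, 'z) lin_moncat_scheme" +
  fixes S :: "'i \<Rightarrow> 'o"
  assumes S_ob: "S i \<in> Ob C"
begin

lemma sum_through_closed: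
  "\<lbrakk>sum_through C S x y f; x \<in> Ob C; y \<in> Ob C\<rbrakk> \<Longrightarrow> f \<in> Mor C x y"
  by (induction rule: sum_through.induct) (auto simp: cat_simps S_ob)

lemma sum_through_add:
  "\<lbrakk>sum_through C S x y f; sum_through C S x y g; x \<in> Ob C; y \<in> Ob C\<rbrakk>
    \<Longrightarrow> sum_through C S x y (add_mor C x y f g)"
  by (induction rule: sum_through.induct)
     (auto simp: cat_simps S_ob sum_through_closed intro: sum_through.add)

lemma sum_through_comp_left:
  "\<lbrakk>sum_through C S x y f; g \<in> Mor C y z; x \<in> Ob C; y \<in> Ob C; z \<in> Ob C\<rbrakk>
    \<Longrightarrow> sum_through C S x z (comp_mor C x y z g f)"
proof (induction rule: sum_through.induct)
  case (add a i b f)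
  then have "comp_mor C x y z g (add_mor C x y (comp_mor C x (S i) y b a) f)
    = add_mor C x z (comp_mor C x (S i) z (comp_mor C (S i) y z g b) a) (comp_mor C x y z g f)"
    by (simp add: cat_simps S_ob comp_assoc sum_through_closed)
  with add show ?case by (auto intro!: sum_through.add simp: cat_simps S_ob)
qed (auto simp: cat_simps intro: sum_through.zero)

lemma sum_through_comp_right:
  "\<lbrakk>sum_through C S y z f; g \<in> Mor C x y; x \<in> Ob C; y \<in> Ob C; z \<in> Ob C\<rbrakk>
    \<Longrightarrow> sum_through C S x z (comp_mor C x y z f g)"
proof (induction rule: sum_through.induct)
  case (add a i b f)
  then have "comp_mor C x y z (add_mor C y z (comp_mor C y (S i) z b a) f) g
    = add_mor C x z (comp_mor C x (S i) z b (comp_mor C x y (S i) a g)) (comp_mor C x y z f g)"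
    by (simp add: cat_simps S_ob comp_assoc sum_through_closed)
  with add show ?case by (auto intro!: sum_through.add simp: cat_simps S_ob)
qed (auto simp: cat_simps intro: sum_through.zero)

lemma sum_through_sum:
  "\<lbrakk>x \<in> Ob C; y \<in> Ob C; \<And>f. f \<in> set fs \<Longrightarrow> sum_through C S x y f\<rbrakk> \<Longrightarrow> sum_through C S x y (sum_mor C x y fs)"
  by (induction fs) (auto intro: sum_through_add sum_through.zero)

text \<open>Expanding the identity of the middle object turns any composite through a generated
  object into a sum through \<open>S\<close>.\<close>

lemma sum_through_trans:
  assumes "sum_through C S y y (id_mor C y)" "f \<in> Mor C x y" "g \<in> Mor C y z" "x \<in> Ob C" "y \<in> Ob C" "z \<in> Ob C"
  shows "sum_through C S x z (comp_mor C x y z g f)"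
  using sum_through_comp_left[OF sum_through_comp_right[OF assms(1,2,4,5,5)] assms(3-6)] assms
  by (simp add: cat_simps)

lemma generated_simple: "sum_through C S (S i) (S i) (id_mor C (S i))"
  using sum_through.add[where a = "id_mor C (S i)" and b = "id_mor C (S i)" and i = i, OF _ _ sum_through.zero,
      of C "S i" S "S i"]
  by (simp add: cat_simps S_ob)

lemma generated_direct_sum:
  assumes "direct_sum C z [x, y]" "sum_through C S x x (id_mor C x)" "sum_through C S y y (id_mor C y)"
  shows "sum_through C S z z (id_mor C z)"
proof -
  obtain i j p q where b: "biproduct C z x y i j p q" using assms(1) direct_sum_pair by blast
  then have *: "z \<in> Ob C" "x \<in> Ob C" "y \<in> Ob C" "i \<in> Mor C x z" "j \<in> Mor C y z" "p \<in> Mor C z x" "q \<in> Mor C z y"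
    "id_mor C z = add_mor C z z (comp_mor C z x z i p) (comp_mor C z y z j q)"
    by (simp_all add: biproduct_def)
  show ?thesis
    unfolding *(8) by (intro sum_through_add sum_through_trans[OF assms(2)] sum_through_trans[OF assms(3)] *(1-7))
qed

end

text \<open>\<open>\<phi> i\<close> identifies a field with the endomorphism ring of
  \<open>S i\<close>, so that multiplicities can be compared by matrices over that field. By
  \<open>generating\<close> every object is a retract of a finite sum of the
  \<open>S i\<close>.\<close>

locale schurian_category = preadditive_family C S
  for C :: "('o, 'm, 'k, 'z) lin_moncat_scheme" and S :: "'i \<Rightarrow> 'o" +
  fixes \<phi> :: "'i \<Rightarrow> 'f::field \<Rightarrow> 'm"
  assumes zero_ob_exists: "\<exists>z\<in>Ob C. id_mor C z = zero_mor C z z"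
    and biproduct_exists: "\<lbrakk>x \<in> Ob C; y \<in> Ob C\<rbrakk> \<Longrightarrow> \<exists>z. direct_sum C z [x, y]"
    and idempotents_split: "\<lbrakk>x \<in> Ob C; e \<in> Mor C x x; comp_mor C x x x e e = e\<rbrakk>
      \<Longrightarrow> \<exists>y\<in>Ob C. \<exists>r\<in>Mor C x y. \<exists>s\<in>Mor C y x. comp_mor C y x y r s = id_mor C y \<and> comp_mor C x y x s r = e"
    and \<phi>_closed: "\<phi> i a \<in> Mor C (S i) (S i)"
    and \<phi>_surj: "f \<in> Mor C (S i) (S i) \<Longrightarrow> \<exists>a. f = \<phi> i a"
    and \<phi>_zero_imp: "\<phi> i a = zero_mor C (S i) (S i) \<Longrightarrow> a = 0"
    and \<phi>_add: "\<phi> i (a + b) = add_mor C (S i) (S i) (\<phi> i a) (\<phi> i b)"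
    and \<phi>_mult: "\<phi> i (a * b) = comp_mor C (S i) (S i) (S i) (\<phi> i a) (\<phi> i b)"
    and \<phi>_one: "\<phi> i 1 = id_mor C (S i)"
    and orthogonal: "\<lbrakk>i \<noteq> j; f \<in> Mor C (S i) (S j)\<rbrakk> \<Longrightarrow> f = zero_mor C (S i) (S j)"
    and generating: "x \<in> Ob C \<Longrightarrow> sum_through C S x x (id_mor C x)"
begin

section \<open>Scalars, splittings and quasi-inverses\<close>

lemma \<phi>_zero: "\<phi> i 0 = zero_mor C (S i) (S i)"
  using \<phi>_add[of i 0 0] by (intro add_idem_zero) (auto simp: S_ob \<phi>_closed)

lemma \<phi>_inj: "\<phi> i a = \<phi> i b \<longleftrightarrow> a = b"
proof
  assume eq: "\<phi> i a = \<phi> i b"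
  have "add_mor C (S i) (S i) (\<phi> i (a - b)) (\<phi> i b) = add_mor C (S i) (S i) (zero_mor C (S i) (S i)) (\<phi> i b)"
    using eq by (simp add: \<phi>_closed S_ob cat_simps flip: \<phi>_add)
  then have "\<phi> i (a - b) = zero_mor C (S i) (S i)"
    by (metis S_ob \<phi>_closed add_commute add_left_cancel zero_closed)
  then show "a = b" using \<phi>_zero_imp[of i "a - b"] by simp
qed simp

lemma simple_endo_invertible:
  assumes "f \<in> Mor C (S i) (S i)" "f \<noteq> zero_mor C (S i) (S i)"
  obtains g where "g \<in> Mor C (S i) (S i)" "comp_mor C (S i) (S i) (S i) g f = id_mor C (S i)"
    "comp_mor C (S i) (S i) (S i) f g = id_mor C (S i)"
proof -
  obtain a where a: "f = \<phi> i a" using \<phi>_surj assms(1) by blast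
  then have "a \<noteq> 0" using assms(2) \<phi>_zero by auto
  then show ?thesis using a by (intro that[of "\<phi> i (inverse a)"]) (simp_all add: \<phi>_closed flip: \<phi>_mult \<phi>_one)
qed

lemma id_simple_nonzero: "id_mor C (S i) \<noteq> zero_mor C (S i) (S i)"
  using \<phi>_zero_imp[of i 1] by (auto simp: \<phi>_one)

text \<open>A nonzero \<open>f\<close> survives composition with the identity of \<open>y\<close>,
  so some term \<open>b a\<close> of that identity has \<open>a f\<close> nonzero. Orthogonality
  forces its index to be \<open>i\<close>, and then \<open>a f\<close> is an invertible
  scalar.\<close>

lemma split_mono_from_simple:
  assumes y: "y \<in> Ob C" and f: "f \<in> Mor C (S i) y" "f \<noteq> zero_mor C (S i) y"
  obtains a where "a \<in> Mor C y (S i)" "comp_mor C (S i) y (S i) a f = id_mor C (S i)"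
proof -
  \<comment> \<open>An arbitrary sum \<open>e\<close> replaces the identity so that the induction
    over the terms can proceed.\<close>
  have claim: "\<exists>j. \<exists>a\<in>Mor C y (S j). comp_mor C (S i) y (S j) a f \<noteq> zero_mor C (S i) (S j)"
    if "sum_through C S y z e" "comp_mor C (S i) y z e f \<noteq> zero_mor C (S i) z" "z \<in> Ob C" for z e
    using that
  proof (induction rule: sum_through.induct)
    case zero
    then show ?case using y f(1) by (simp add: cat_simps S_ob)
  next
    case (add a j b e)
    show ?case
    proof (cases "comp_mor C (S i) y (S j) a f = zero_mor C (S i) (S j)")
      case True
      have "comp_mor C (S i) y z (add_mor C y z (comp_mor C y (S j) z b a) e) f = comp_mor C (S i) y z e f"
        using add.hyps(1,2) sum_through_closed[OF add.hyps(3) y add.prems(2)] add.prems(2) y f(1) True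
        by (simp add: cat_simps comp_assoc S_ob)
      then show ?thesis using add.IH add.prems by metis
    next
      case False
      then show ?thesis using add.hyps(1) by blast
    qed
  qed
  have "comp_mor C (S i) y y (id_mor C y) f \<noteq> zero_mor C (S i) y"
    using y f by (simp add: cat_simps S_ob)
  from claim[OF generating[OF y] this y] obtain j a where a: "a \<in> Mor C y (S j)"
    "comp_mor C (S i) y (S j) a f \<noteq> zero_mor C (S i) (S j)"
    by blast
  moreover have "comp_mor C (S i) y (S j) a f \<in> Mor C (S i) (S j)"
    using a y f by (simp add: cat_simps S_ob)
  ultimately have [simp]: "j = i" using orthogonal[of i j "comp_mor C (S i) y (S j) a f"] by metis
  have "comp_mor C (S i) y (S i) a f \<in> Mor C (S i) (S i)" "comp_mor C (S i) y (S i) a f \<noteq> zero_mor C (S i) (S i)"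
    using a y f by (simp_all add: cat_simps S_ob)
  then obtain g where g: "g \<in> Mor C (S i) (S i)" "comp_mor C (S i) (S i) (S i) g (comp_mor C (S i) y (S i) a f) = id_mor C (S i)"
    by (rule simple_endo_invertible)
  show ?thesis
    using a y f g by (intro that[of "comp_mor C y (S i) (S i) g a"]) (simp_all add: cat_simps S_ob comp_assoc)
qed

text \<open>Gaussian elimination: if \<open>f - f h f\<close> has a quasi-inverse, so does \<open>f\<close>.\<close>

lemma quasi_inverse:
  assumes x: "x \<in> Ob C" and y: "y \<in> Ob C" and f: "f \<in> Mor C x y"
  obtains g where "g \<in> Mor C y x" "comp_mor C x y y (comp_mor C y x y f g) f = f"
proof -
  \<comment> \<open>The induction is on a sum \<open>e\<close> through \<open>S\<close> with
    \<open>f e = f\<close>; it starts with the identity of \<open>x\<close>.\<close>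
  have "\<exists>g\<in>Mor C y x. comp_mor C x y y (comp_mor C y x y f g) f = f"
    if "sum_through C S x x e" "f \<in> Mor C x y" "comp_mor C x x y f e = f" for e f
    using that
  proof (induction arbitrary: f rule: sum_through.induct)
    case zero
    then have "f = zero_mor C x y" using x y by (simp add: cat_simps)
    then show ?case using x y by (intro bexI[of _ "zero_mor C y x"]) (simp_all add: cat_simps)
  next
    case (add a i b e)
    note e = sum_through_closed[OF add.hyps(3) x x]
    note ob = x y S_ob[of i]
    \<comment> \<open>If \<open>f'\<close> kills \<open>b\<close>, the first term contributes
      nothing and \<open>f'\<close> is absorbed by the shorter sum \<open>e\<close>.\<close>
    have red: "comp_mor C x x y f' e = f'"
      if "comp_mor C (S i) x y f' b = zero_mor C (S i) y" "f' \<in> Mor C x y"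
        "comp_mor C x x y f' (add_mor C x x (comp_mor C x (S i) x b a) e) = f'" for f'
      using that(3) that(2) add.hyps e ob by (simp add: cat_simps comp_reassoc[OF that(1)])
    show ?case
    proof (cases "comp_mor C (S i) x y f b = zero_mor C (S i) y")
      case True
      then show ?thesis using add.IH[OF add.prems(1) red[OF True add.prems]] by blast
    next
      case False
      moreover have "comp_mor C (S i) x y f b \<in> Mor C (S i) y" using add.hyps add.prems ob by (simp add: cat_simps)
      ultimately obtain c where c: "c \<in> Mor C y (S i)" "comp_mor C (S i) y (S i) c (comp_mor C (S i) x y f b) = id_mor C (S i)"
        using split_mono_from_simple[OF y] by blast
      \<comment> \<open>As \<open>c\<close> is a left inverse of \<open>f b\<close>, the choice
        \<open>h = b c\<close> gives \<open>f h f b = f b\<close>. Hence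
        \<open>f' = f - f h f\<close> kills \<open>b\<close>.\<close>
      define h where "h = comp_mor C y (S i) x b c"
      have h: "h \<in> Mor C y x" using add c ob by (simp add: h_def cat_simps)
      define f' where "f' = add_mor C x y f (neg_mor C x y (comp_mor C x x y f (comp_mor C x y x h f)))"
      have f': "f' \<in> Mor C x y" using add h ob by (simp add: f'_def cat_simps)
      have fb: "comp_mor C (S i) x y f' b = zero_mor C (S i) y"
        using add c ob by (simp add: f'_def h_def cat_simps comp_assoc)
      have fe: "comp_mor C x x y f' (add_mor C x x (comp_mor C x (S i) x b a) e) = f'"
      proof -
        have "add_mor C x x (comp_mor C x (S i) x b a) e \<in> Mor C x x" using add e ob by (simp add: cat_simps)
        with add.prems h ob show ?thesis
          unfolding f'_def by (simp add: comp_add_left comp_neg_left comp_assoc comp_closed neg_closed)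
      qed
      obtain g where g: "g \<in> Mor C y x" "comp_mor C x y y (comp_mor C y x y f' g) f' = f'"
        using add.IH[OF f' red[OF fb f' fe]] by blast
      define u where "u = add_mor C y y (id_mor C y) (neg_mor C y y (comp_mor C y x y f h))"
      define v where "v = add_mor C x x (id_mor C x) (neg_mor C x x (comp_mor C x y x h f))"
      have uv: "u \<in> Mor C y y" "v \<in> Mor C x x" "comp_mor C x y y u f = f'" "comp_mor C x x y f v = f'"
        using add.prems h ob by (simp_all add: u_def v_def f'_def cat_simps comp_assoc)
      \<comment> \<open>With \<open>f' = u f = f v\<close> one gets
        \<open>f G f = f h f + f' g f' = f h f + f' = f\<close>.\<close>
      define G where "G = add_mor C y x h (comp_mor C y x x v (comp_mor C y y x g u))"
      have G: "G \<in> Mor C y x" using h g uv ob by (simp add: G_def cat_simps)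
      have "comp_mor C x y y (comp_mor C y x y f G) f
          = add_mor C x y (comp_mor C x x y f (comp_mor C x y x h f)) f'"
        using g(2) g(1) h uv add.prems(1) ob f' by (simp add: G_def cat_simps comp_assoc comp_reassoc[OF uv(4)])
      also have "\<dots> = f"
        using add_left_commute[of x y "comp_mor C x x y f (comp_mor C x y x h f)" f
            "neg_mor C x y (comp_mor C x x y f (comp_mor C x y x h f))"] add.prems(1) h ob
        by (simp add: f'_def cat_simps)
      finally show ?thesis using G by blast
    qed
  qed
  from this[OF generating[OF x] f comp_id_right[OF x y f]] show ?thesis using that by blast
qed

end

section \<open>Split monomorphisms, kernels and cokernels\<close>

context schurian_category
begin

text \<open>A quasi-inverse of a monomorphism is a retraction: cancel \<open>f\<close> on the left
  in \<open>f g f = f\<close>. Dually in \<open>epi_split\<close>.\<close>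

lemma mono_split:
  assumes "x \<in> Ob C" "y \<in> Ob C" "mono_mor C x y f"
  obtains g where "g \<in> Mor C y x" "comp_mor C x y x g f = id_mor C x"
proof -
  have f: "f \<in> Mor C x y" using assms(3) by (simp add: mono_mor_def)
  obtain g where g: "g \<in> Mor C y x" "comp_mor C x y y (comp_mor C y x y f g) f = f"
    using quasi_inverse[OF assms(1,2) f] .
  have "comp_mor C x x y f (comp_mor C x y x g f) = comp_mor C x x y f (id_mor C x)"
    using g f assms(1,2) by (simp add: cat_simps comp_assoc)
  then have "comp_mor C x y x g f = id_mor C x"
    using assms f g unfolding mono_mor_def by (meson comp_closed id_closed)
  with g that show ?thesis by blast
qed

lemma epi_split:
  assumes "x \<in> Ob C" "y \<in> Ob C" "epi_mor C x y f"
  obtains g where "g \<in> Mor C y x" "comp_mor C y x y f g = id_mor C y"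
proof -
  have f: "f \<in> Mor C x y" using assms(3) by (simp add: epi_mor_def)
  obtain g where g: "g \<in> Mor C y x" "comp_mor C x y y (comp_mor C y x y f g) f = f"
    using quasi_inverse[OF assms(1,2) f] .
  have "comp_mor C x y y (comp_mor C y x y f g) f = comp_mor C x y y (id_mor C y) f"
    using g f assms(1,2) by (simp add: cat_simps)
  then have "comp_mor C y x y f g = id_mor C y"
    using assms f g unfolding epi_mor_def by (meson comp_closed id_closed)
  with g that show ?thesis by blast
qed

text \<open>Splits \<open>1 - e\<close>. Kernels, cokernels and the complements of simple summands
  are all obtained as its image.\<close>

lemma complement_idempotent:
  assumes "x \<in> Ob C" "e \<in> Mor C x x" "comp_mor C x x x e e = e"
  obtains y r s where "y \<in> Ob C" "r \<in> Mor C x y" "s \<in> Mor C y x"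
    "comp_mor C y x y r s = id_mor C y"
    "comp_mor C x y x s r = add_mor C x x (id_mor C x) (neg_mor C x x e)"
    "comp_mor C y x x e s = zero_mor C y x" "comp_mor C x x y r e = zero_mor C x y"
proof -
  let ?p = "add_mor C x x (id_mor C x) (neg_mor C x x e)"
  have p: "?p \<in> Mor C x x" "comp_mor C x x x ?p e = zero_mor C x x" "comp_mor C x x x e ?p = zero_mor C x x"
    using assms by (simp_all add: cat_simps)
  have "comp_mor C x x x ?p ?p = ?p"
    using assms by (simp add: cat_simps)
  then obtain y r s where y: "y \<in> Ob C" "r \<in> Mor C x y" "s \<in> Mor C y x"
    "comp_mor C y x y r s = id_mor C y" "comp_mor C x y x s r = ?p"
    using idempotents_split[OF assms(1) p(1)] by metis
  have "comp_mor C y x x e s = comp_mor C y x x e (comp_mor C y x x ?p s)"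
    using y assms by (simp add: comp_assoc cat_simps flip: y(5))
  also have "\<dots> = zero_mor C y x"
    using y assms p by (simp add: comp_zero_left flip: comp_assoc)
  finally have es: "comp_mor C y x x e s = zero_mor C y x" .
  have "comp_mor C x x y r e = comp_mor C x x y (comp_mor C x x y r ?p) e"
  proof -
    have "comp_mor C x x y r ?p = r"
      using y assms comp_assoc[of x y x y r s r] by (simp add: cat_simps flip: y(5))
    then show ?thesis by simp
  qed
  also have "\<dots> = zero_mor C x y"
    using y assms p by (simp add: comp_assoc comp_zero_right)
  finally show ?thesis using that y es by blast
qed

text \<open>For a quasi-inverse \<open>g\<close> of \<open>f\<close>, the image of
  \<open>1 - g f\<close> is a kernel of \<open>f\<close> and the image of \<open>1 - f g\<close> a
  cokernel. A monomorphism with retraction \<open>g\<close> is a kernel of \<open>1 - f g\<close>,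
  and an epimorphism with section \<open>g\<close> a cokernel of \<open>1 - g f\<close>.\<close>

sublocale abelian_category C
proof
  show "\<exists>x. zero_ob C x" using zero_ob_exists zero_ob_iff by blast
next
  fix x y assume "x \<in> Ob C" "y \<in> Ob C"
  then show "\<exists>z. direct_sum C z [x, y]" by (rule biproduct_exists)
next
  fix x y f assume ob: "x \<in> Ob C" "y \<in> Ob C" and f: "f \<in> Mor C x y"
  obtain g where g: "g \<in> Mor C y x" "comp_mor C x y y (comp_mor C y x y f g) f = f"
    using quasi_inverse[OF ob f] .
  have fgf: "comp_mor C x x y f (comp_mor C x y x g f) = f" using g ob f by (simp add: comp_assoc)
  have "comp_mor C x x x (comp_mor C x y x g f) (comp_mor C x y x g f) = comp_mor C x y x g f"
    using g ob f fgf by (simp add: comp_assoc comp_closed)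
  then obtain w r s where w: "w \<in> Ob C" "r \<in> Mor C x w" "s \<in> Mor C w x" "comp_mor C w x w r s = id_mor C w"
    "comp_mor C x w x s r = add_mor C x x (id_mor C x) (neg_mor C x x (comp_mor C x y x g f))"
    "comp_mor C w x x (comp_mor C x y x g f) s = zero_mor C w x"
    using complement_idempotent[of x "comp_mor C x y x g f"] ob f g by (metis comp_closed)
  have "comp_mor C w x y f s = comp_mor C w x y f (comp_mor C w x x (comp_mor C x y x g f) s)"
    using comp_assoc[of w x x y f "comp_mor C x y x g f" s] w(1-3) ob f g fgf by (simp add: comp_closed)
  then have fs: "comp_mor C w x y f s = zero_mor C w y"
    using w(1) ob f by (simp only: w(6) comp_zero_right)
  have "is_kernel C x y f w s"
    unfolding is_kernel_def
  proof (intro conjI ballI impI w fs)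
    fix z h assume z: "z \<in> Ob C" and h: "h \<in> Mor C z x" and fh: "comp_mor C z x y f h = zero_mor C z y"
    show "\<exists>!k. k \<in> Mor C z w \<and> comp_mor C z w x s k = h"
    proof (rule ex1I[of _ "comp_mor C z x w r h"])
      have "comp_mor C z w x s (comp_mor C z x w r h)
          = comp_mor C z x x (add_mor C x x (id_mor C x) (neg_mor C x x (comp_mor C x y x g f))) h"
        using w z h ob by (simp flip: comp_assoc w(5))
      also have "\<dots> = h" using z h f g ob fh by (simp add: cat_simps comp_assoc)
      finally show "comp_mor C z x w r h \<in> Mor C z w \<and> comp_mor C z w x s (comp_mor C z x w r h) = h"
        using z h w ob by (simp add: comp_closed)
    next
      fix k assume "k \<in> Mor C z w \<and> comp_mor C z w x s k = h"
      then show "k = comp_mor C z x w r h" using z w ob comp_assoc[of z w x w r s k] by (auto simp: cat_simps)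
    qed
  qed
  then show "\<exists>w k. is_kernel C x y f w k" by blast
next
  fix x y f assume ob: "x \<in> Ob C" "y \<in> Ob C" and f: "f \<in> Mor C x y"
  obtain g where g: "g \<in> Mor C y x" "comp_mor C x y y (comp_mor C y x y f g) f = f"
    using quasi_inverse[OF ob f] .
  have "comp_mor C y y y (comp_mor C y x y f g) (comp_mor C y x y f g) = comp_mor C y x y f g"
    using g ob f by (simp add: comp_closed flip: comp_assoc)
  then obtain w r s where w: "w \<in> Ob C" "r \<in> Mor C y w" "s \<in> Mor C w y" "comp_mor C w y w r s = id_mor C w"
    "comp_mor C y w y s r = add_mor C y y (id_mor C y) (neg_mor C y y (comp_mor C y x y f g))"
    "comp_mor C y y w r (comp_mor C y x y f g) = zero_mor C y w"
    using complement_idempotent[of y "comp_mor C y x y f g"] ob f g by (metis comp_closed)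
  have "comp_mor C x y w r f = comp_mor C x y w (comp_mor C y y w r (comp_mor C y x y f g)) f"
    using comp_assoc[of x y y w r "comp_mor C y x y f g" f] w(1-3) ob f g by (simp add: comp_closed)
  then have fs: "comp_mor C x y w r f = zero_mor C x w"
    using w(1) ob f by (simp only: w(6) comp_zero_left)
  have "is_cokernel C x y f w r"
    unfolding is_cokernel_def
  proof (intro conjI ballI impI w fs)
    fix z h assume z: "z \<in> Ob C" and h: "h \<in> Mor C y z" and fh: "comp_mor C x y z h f = zero_mor C x z"
    show "\<exists>!k. k \<in> Mor C w z \<and> comp_mor C y w z k r = h"
    proof (rule ex1I[of _ "comp_mor C w y z h s"])
      have "comp_mor C y w z (comp_mor C w y z h s) r
          = comp_mor C y y z h (add_mor C y y (id_mor C y) (neg_mor C y y (comp_mor C y x y f g)))"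
        using w z h ob by (simp add: comp_assoc flip: w(5))
      also have "\<dots> = h" using z h f g ob fh by (simp add: cat_simps flip: comp_assoc)
      finally show "comp_mor C w y z h s \<in> Mor C w z \<and> comp_mor C y w z (comp_mor C w y z h s) r = h"
        using z h w ob by (simp add: comp_closed)
    next
      fix k assume "k \<in> Mor C w z \<and> comp_mor C y w z k r = h"
      then show "k = comp_mor C w y z h s" using z w ob comp_assoc[of w y w z k r s] by (auto simp: cat_simps)
    qed
  qed
  then show "\<exists>w k. is_cokernel C x y f w k" by blast
next
  fix x y f assume ob: "x \<in> Ob C" "y \<in> Ob C" and mono: "mono_mor C x y f"
  have f: "f \<in> Mor C x y" using mono by (simp add: mono_mor_def)
  obtain g where g: "g \<in> Mor C y x" "comp_mor C x y x g f = id_mor C x"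
    using mono_split[OF ob mono] .
  let ?p = "add_mor C y y (id_mor C y) (neg_mor C y y (comp_mor C y x y f g))"
  have "is_kernel C y y ?p x f"
    unfolding is_kernel_def
  proof (intro conjI ballI impI ob f)
    show "comp_mor C x y y ?p f = zero_mor C x y"
      using ob f g by (simp add: cat_simps comp_assoc)
    fix z h assume z: "z \<in> Ob C" and h: "h \<in> Mor C z y" and ph: "comp_mor C z y y ?p h = zero_mor C z y"
    have "add_mor C z y h (neg_mor C z y (comp_mor C z y y (comp_mor C y x y f g) h)) = zero_mor C z y"
      using ph z h ob f g by (simp add: cat_simps)
    then have eq: "comp_mor C z y y (comp_mor C y x y f g) h = h"
      using diff_zero_iff[of z y h "comp_mor C z y y (comp_mor C y x y f g) h"] z h ob f g by (simp add: comp_closed)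
    show "\<exists>!k. k \<in> Mor C z x \<and> comp_mor C z x y f k = h"
    proof (rule ex1I[of _ "comp_mor C z y x g h"])
      show "comp_mor C z y x g h \<in> Mor C z x \<and> comp_mor C z x y f (comp_mor C z y x g h) = h"
        using eq z h ob f g by (simp add: comp_closed comp_assoc)
    next
      fix k assume "k \<in> Mor C z x \<and> comp_mor C z x y f k = h"
      then show "k = comp_mor C z y x g h" using z ob f g comp_assoc[of z x y x g f k] by (auto simp: cat_simps)
    qed
  qed
  then show "\<exists>z\<in>Ob C. \<exists>g\<in>Mor C y z. is_kernel C y z g x f"
    using ob f g by (intro bexI[of _ y] bexI[of _ ?p]) (simp_all add: cat_simps)
next
  fix x y f assume ob: "x \<in> Ob C" "y \<in> Ob C" and epi: "epi_mor C x y f"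
  have f: "f \<in> Mor C x y" using epi by (simp add: epi_mor_def)
  obtain g where g: "g \<in> Mor C y x" "comp_mor C y x y f g = id_mor C y"
    using epi_split[OF ob epi] .
  let ?p = "add_mor C x x (id_mor C x) (neg_mor C x x (comp_mor C x y x g f))"
  have "is_cokernel C x x ?p y f"
    unfolding is_cokernel_def
  proof (intro conjI ballI impI ob f)
    show "comp_mor C x x y f ?p = zero_mor C x y"
      using ob f g by (simp add: cat_simps flip: comp_assoc)
    fix z h assume z: "z \<in> Ob C" and h: "h \<in> Mor C x z" and hp: "comp_mor C x x z h ?p = zero_mor C x z"
    have "add_mor C x z h (neg_mor C x z (comp_mor C x x z h (comp_mor C x y x g f))) = zero_mor C x z"
      using hp z h ob f g by (simp add: cat_simps)
    then have eq: "comp_mor C x x z h (comp_mor C x y x g f) = h"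
      using diff_zero_iff[of x z h "comp_mor C x x z h (comp_mor C x y x g f)"] z h ob f g by (simp add: comp_closed)
    show "\<exists>!k. k \<in> Mor C y z \<and> comp_mor C x y z k f = h"
    proof (rule ex1I[of _ "comp_mor C y x z h g"])
      show "comp_mor C y x z h g \<in> Mor C y z \<and> comp_mor C x y z (comp_mor C y x z h g) f = h"
        using eq z h ob f g by (simp add: comp_closed comp_assoc)
    next
      fix k assume "k \<in> Mor C y z \<and> comp_mor C x y z k f = h"
      then show "k = comp_mor C y x z h g" using z ob f g comp_assoc[of y x y z k f g] by (auto simp: cat_simps)
    qed
  qed
  then show "\<exists>z\<in>Ob C. \<exists>g\<in>Mor C z x. is_cokernel C z x g y f"
    using ob f g by (intro bexI[of _ x] bexI[of _ ?p]) (simp_all add: cat_simps)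
qed

section \<open>Simple objects and complete decomposability\<close>

lemma irreducible_simple: "irreducible_ob C (S i)"
  unfolding irreducible_ob_def
proof (intro conjI ballI allI impI S_ob)
  show "\<not> zero_ob C (S i)" using id_simple_nonzero S_ob by (simp add: zero_ob_iff)
  fix y f assume y: "y \<in> Ob C" and mono: "mono_mor C y (S i) f"
  then have f: "f \<in> Mor C y (S i)" by (simp add: mono_mor_def)
  obtain g where g: "g \<in> Mor C (S i) y" "comp_mor C y (S i) y g f = id_mor C y"
    using mono_split[OF y S_ob mono] .
  \<comment> \<open>A retraction \<open>g\<close> makes \<open>f g\<close> an idempotent scalar. If
    it is 0, then \<open>y\<close> is a zero object; otherwise it is 1 and \<open>f\<close> is
    invertible.\<close>
  let ?e = "comp_mor C (S i) y (S i) f g"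
  have e: "?e \<in> Mor C (S i) (S i)" using y f g by (simp add: comp_closed S_ob)
  have fgf: "comp_mor C y (S i) (S i) ?e f = f" using y f g by (simp add: comp_assoc S_ob cat_simps)
  show "zero_ob C y \<or> iso_mor C y (S i) f"
  proof (cases "?e = zero_mor C (S i) (S i)")
    case True
    then have "f = zero_mor C y (S i)" using fgf y f by (simp add: cat_simps S_ob)
    then have "id_mor C y = zero_mor C y y" using g y by (simp add: cat_simps S_ob)
    then show ?thesis using y by (simp add: zero_ob_iff)
  next
    case False
    then obtain h where h: "h \<in> Mor C (S i) (S i)" "comp_mor C (S i) (S i) (S i) h ?e = id_mor C (S i)"
      using e simple_endo_invertible by metis
    have "?e = comp_mor C (S i) (S i) (S i) (comp_mor C (S i) (S i) (S i) h ?e) ?e"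
      using e h by (simp add: cat_simps S_ob)
    also have "\<dots> = comp_mor C (S i) (S i) (S i) h (comp_mor C (S i) (S i) (S i) ?e ?e)"
      by (rule comp_assoc) (use e h(1) S_ob in auto)
    also have "comp_mor C (S i) (S i) (S i) ?e ?e = comp_mor C (S i) y (S i) (comp_mor C y (S i) (S i) ?e f) g"
      by (rule comp_assoc[symmetric]) (use e f g(1) y S_ob in auto)
    finally have "?e = id_mor C (S i)" by (simp only: fgf h(2))
    then show ?thesis using y f g by (auto simp: iso_mor_def)
  qed
qed

text \<open>Peeling off one simple summand at a time gives an induction principle that fits
  additivity on binary direct sums, the form in which characters and \<open>K0\<close> provide
  it.\<close>

inductive simple_sum :: "'o \<Rightarrow> bool" where
  zero: "\<lbrakk>x \<in> Ob C; id_mor C x = zero_mor C x x\<rbrakk> \<Longrightarrow> simple_sum x"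
| add: "\<lbrakk>direct_sum C x [S i, y]; simple_sum y\<rbrakk> \<Longrightarrow> simple_sum x"

lemma simple_sum_all:
  assumes "x \<in> Ob C"
  shows "simple_sum x"
proof -
  \<comment> \<open>The claim concerns a retract \<open>y\<close> of \<open>x\<close> whose identity
    is \<open>r e s\<close>. A term \<open>b a\<close> of \<open>e\<close> either vanishes on
    \<open>y\<close> or splits a copy of \<open>S i\<close> off \<open>y\<close>, and the complement
    is again a retract, now for the shorter sum.\<close>
  have "simple_sum y"
    if "sum_through C S x x e" "y \<in> Ob C" "s \<in> Mor C y x" "r \<in> Mor C x y"
      "comp_mor C y x y r (comp_mor C y x x e s) = id_mor C y" for e y r s
    using that
  proof (induction arbitrary: y r s rule: sum_through.induct)
    case zero
    then have "id_mor C y = zero_mor C y y" using assms by (simp add: cat_simps)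
    with zero show ?case by (intro simple_sum.zero)
  next
    case (add a i b e)
    note e = sum_through_closed[OF add.hyps(3) assms assms]
    let ?a = "comp_mor C y x (S i) a s"
    have red: "comp_mor C y' x y' r' (comp_mor C y' x x e s') = id_mor C y'"
      if "comp_mor C y' x y' r' (comp_mor C y' x x (add_mor C x x (comp_mor C x (S i) x b a) e) s') = id_mor C y'"
        "comp_mor C y' x (S i) a s' = zero_mor C y' (S i)" "y' \<in> Ob C" "s' \<in> Mor C y' x" "r' \<in> Mor C x y'" for y' r' s'
      using that(1) that(2-) e add.hyps(1,2) assms by (simp add: cat_simps comp_assoc S_ob)
    show ?case
    proof (cases "?a = zero_mor C y (S i)")
      case True
      show ?thesis
        by (rule add.IH[OF add.prems(1-3) red[OF add.prems(4) True add.prems(1-3)]])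
    next
      case False
      note ob = assms add.prems(1) S_ob[of i]
      have a: "?a \<in> Mor C y (S i)" using add.hyps add.prems ob by (simp add: comp_closed)
      obtain g where g: "g \<in> Mor C (S i) y" "comp_mor C y (S i) (S i) (comp_mor C (S i) y (S i) ?a g) ?a = ?a"
        using quasi_inverse[OF ob(2,3) a] .
      let ?e = "comp_mor C (S i) y (S i) ?a g"
      have e': "?e \<in> Mor C (S i) (S i)" using g a ob by (simp add: comp_closed)
      have "?e \<noteq> zero_mor C (S i) (S i)"
      proof
        assume "?e = zero_mor C (S i) (S i)"
        then show False using g a ob False by (simp add: cat_simps)
      qed
      then obtain h where h: "h \<in> Mor C (S i) (S i)" "comp_mor C (S i) (S i) (S i) h ?e = id_mor C (S i)"
        using simple_endo_invertible[OF e'] by blast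
      have idem: "comp_mor C (S i) (S i) (S i) ?e ?e = ?e"
      proof -
        have "comp_mor C (S i) (S i) (S i) ?e ?e = comp_mor C (S i) y (S i) (comp_mor C y (S i) (S i) ?e ?a) g"
          by (rule comp_assoc[symmetric]) (use e' g(1) a ob in auto)
        then show ?thesis by (simp only: g(2))
      qed
      have e1: "?e = id_mor C (S i)"
      proof -
        have "?e = comp_mor C (S i) (S i) (S i) (comp_mor C (S i) (S i) (S i) h ?e) ?e"
          using e' h ob by (simp add: cat_simps)
        also have "\<dots> = comp_mor C (S i) (S i) (S i) h (comp_mor C (S i) (S i) (S i) ?e ?e)"
          by (rule comp_assoc) (use e' h(1) ob in auto)
        finally show ?thesis by (simp only: idem h(2))
      qed
      let ?p = "comp_mor C y (S i) y g ?a"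
      have p: "?p \<in> Mor C y y" using g a ob by (simp add: comp_closed)
      have pp: "comp_mor C y y y ?p ?p = ?p"
      proof -
        have "comp_mor C y y (S i) ?a ?p = comp_mor C y (S i) (S i) ?e ?a"
          by (rule comp_assoc[symmetric]) (use g(1) a ob in auto)
        then have "comp_mor C y y (S i) ?a ?p = ?a" using a ob by (simp add: e1 comp_id_left)
        moreover have "comp_mor C y y y ?p ?p = comp_mor C y (S i) y g (comp_mor C y y (S i) ?a ?p)"
          by (rule comp_assoc) (use g(1) a p ob in auto)
        ultimately show ?thesis by simp
      qed
      obtain w t u where w: "w \<in> Ob C" "t \<in> Mor C y w" "u \<in> Mor C w y" "comp_mor C w y w t u = id_mor C w"
        "comp_mor C y w y u t = add_mor C y y (id_mor C y) (neg_mor C y y ?p)"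
        "comp_mor C w y y ?p u = zero_mor C w y" "comp_mor C y y w t ?p = zero_mor C y w"
        using complement_idempotent[OF ob(2) p pp] .
      \<comment> \<open>Since \<open>?a\<close> kills the complement \<open>w\<close>, the term
        \<open>b a\<close> drops out of the identity of \<open>w\<close>.\<close>
      have au: "comp_mor C w y (S i) ?a u = zero_mor C w (S i)"
      proof -
        have "comp_mor C w y (S i) ?a u = comp_mor C w y (S i) (comp_mor C y y (S i) ?a ?p) u"
          using g a ob w by (simp add: e1 comp_id_left flip: comp_assoc)
        also have "\<dots> = comp_mor C w y (S i) ?a (comp_mor C w y y ?p u)"
          by (rule comp_assoc) (use a p ob w in auto)
        finally show ?thesis using a ob w by (simp only: w(6) comp_zero_right)
      qed
      have tg: "comp_mor C (S i) y w t g = zero_mor C (S i) w"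
      proof -
        have "comp_mor C (S i) y w t g = comp_mor C (S i) y w t (comp_mor C (S i) y y ?p g)"
          using g a ob w by (simp add: e1 comp_id_right comp_assoc)
        also have "\<dots> = comp_mor C (S i) y w (comp_mor C y y w t ?p) g"
          by (rule comp_assoc[symmetric]) (use g(1) p ob w in auto)
        finally show ?thesis using g ob w by (simp only: w(7) comp_zero_left)
      qed
      have "biproduct C y (S i) w g u ?a t"
        unfolding biproduct_def using g a ob w p e1 au tg by (simp add: cat_simps add_left_commute)
      then have ds: "direct_sum C y [S i, w]" unfolding direct_sum_pair by blast
      let ?s = "comp_mor C w y x s u" and ?r = "comp_mor C x y w t r"
      have "simple_sum w"
      proof (rule add.IH[OF w(1) _ _ red])
        show "?s \<in> Mor C w x" "?r \<in> Mor C x w" using add.prems w ob by (simp_all add: comp_closed)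
        then show "?s \<in> Mor C w x" "?r \<in> Mor C x w" .
        show "comp_mor C w x (S i) a ?s = zero_mor C w (S i)"
          using au add.hyps add.prems w ob by (simp add: comp_assoc)
        let ?f = "add_mor C x x (comp_mor C x (S i) x b a) e"
        have f: "?f \<in> Mor C x x" using add.hyps e ob by (simp add: cat_simps)
        have "comp_mor C w x w ?r (comp_mor C w x x ?f ?s)
            = comp_mor C w y w t (comp_mor C w y y (comp_mor C y x y r (comp_mor C y x x ?f s)) u)"
          using f add.prems(1-3) w ob by (simp add: comp_assoc comp_closed)
        also have "\<dots> = id_mor C w" using w ob by (simp only: add.prems(4)) (simp add: cat_simps)
        finally show "comp_mor C w x w ?r (comp_mor C w x x ?f ?s) = id_mor C w" .
      qed (rule w)
      with ds show ?thesis by (rule simple_sum.add)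
    qed
  qed
  from this[OF generating[OF assms] assms id_closed[OF assms] id_closed[OF assms]] show ?thesis
    using assms by (simp add: cat_simps)
qed


section \<open>Decompositions into simple objects and their multiplicities\<close>

lemma decomposition_exists:
  assumes "x \<in> Ob C"
  shows "\<exists>L. direct_sum C x (map S L)"
  using simple_sum_all[OF assms]
proof (induction rule: simple_sum.induct)
  case (zero x)
  then have "direct_sum C x (map S [])" by (simp add: direct_sum_Nil)
  then show ?case by blast
next
  case (add x i y)
  then obtain L where "direct_sum C y (map S L)" by blast
  from direct_sum_append[OF direct_sum_single[OF S_ob] this add.hyps(1)]
  have "direct_sum C x (map S (i # L))" by simp
  then show ?case by blast
qed

text \<open>Writing the summands as \<open>S (L ! l)\<close> spares every later use the
  simplification of \<open>map S L ! l\<close>.\<close>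

lemma direct_sum_simples:
  "direct_sum C x (map S L) \<longleftrightarrow> x \<in> Ob C \<and> (\<exists>\<iota> \<rho>.
    (\<forall>l<length L. \<iota> l \<in> Mor C (S (L ! l)) x \<and> \<rho> l \<in> Mor C x (S (L ! l))) \<and>
    (\<forall>l<length L. \<forall>m<length L. comp_mor C (S (L ! l)) x (S (L ! m)) (\<rho> m) (\<iota> l)
       = (if l = m then id_mor C (S (L ! l)) else zero_mor C (S (L ! l)) (S (L ! m)))) \<and>
    sum_mor C x x [comp_mor C x (S (L ! l)) x (\<iota> l) (\<rho> l). l \<leftarrow> [0..<length L]] = id_mor C x)"
proof -
  have eq: "[comp_mor C x (map S L ! l) x (\<iota> l) (\<rho> l). l \<leftarrow> [0..<length L]]
    = [comp_mor C x (S (L ! l)) x (\<iota> l) (\<rho> l). l \<leftarrow> [0..<length L]]" for \<iota> \<rho> by simp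
  have "set (map S L) \<subseteq> Ob C" using S_ob by auto
  then show ?thesis unfolding direct_sum_def length_map eq by (simp cong: conj_cong)
qed

text \<open>The first injection of a decomposition is a monomorphism from a nonzero object, so
  irreducibility makes it an isomorphism.\<close>

lemma irreducible_iso_simple:
  assumes "irreducible_ob C x"
  shows "\<exists>i. isomorphic C (S i) x"
proof -
  have x: "x \<in> Ob C" "\<not> zero_ob C x" using assms by (simp_all add: irreducible_ob_def)
  obtain L where L: "direct_sum C x (map S L)" using decomposition_exists[OF x(1)] by blast
  have "L \<noteq> []" using L x by (auto simp: direct_sum_Nil zero_ob_iff)
  then obtain i L' where [simp]: "L = i # L'" by (cases L) auto
  from L[unfolded direct_sum_simples] obtain \<iota> \<rho> where t: "\<forall>l<length L. \<iota> l \<in> Mor C (S (L ! l)) x \<and> \<rho> l \<in> Mor C x (S (L ! l))"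
    and o: "\<forall>l<length L. \<forall>m<length L. comp_mor C (S (L ! l)) x (S (L ! m)) (\<rho> m) (\<iota> l)
       = (if l = m then id_mor C (S (L ! l)) else zero_mor C (S (L ! l)) (S (L ! m)))"
    by (elim conjE exE) (rule that)
  have *: "\<iota> 0 \<in> Mor C (S i) x" "\<rho> 0 \<in> Mor C x (S i)" "comp_mor C (S i) x (S i) (\<rho> 0) (\<iota> 0) = id_mor C (S i)"
    using t[rule_format, of 0] o[rule_format, of 0 0] by simp_all
  have "mono_mor C (S i) x (\<iota> 0)"
    unfolding mono_mor_def
  proof (intro conjI ballI impI *)
    fix z g h assume z: "z \<in> Ob C" "g \<in> Mor C z (S i)" "h \<in> Mor C z (S i)"
      "comp_mor C z (S i) x (\<iota> 0) g = comp_mor C z (S i) x (\<iota> 0) h"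
    have "comp_mor C z x (S i) (\<rho> 0) (comp_mor C z (S i) x (\<iota> 0) k) = k" if "k \<in> Mor C z (S i)" for k
      unfolding comp_assoc[OF z(1) S_ob x(1) S_ob *(2,1) that, symmetric] *(3)
      by (rule comp_id_left[OF z(1) S_ob that])
    from this[OF z(2)] this[OF z(3)] show "g = h" unfolding z(4) by (rule HOL.trans[OF HOL.sym])
  qed
  then have "zero_ob C (S i) \<or> iso_mor C (S i) x (\<iota> 0)"
    using assms S_ob[of i] by (simp add: irreducible_ob_def)
  moreover have "\<not> zero_ob C (S i)" using id_simple_nonzero[of i] S_ob[of i] by (simp add: zero_ob_iff)
  ultimately have "iso_mor C (S i) x (\<iota> 0)" by (simp only: simp_thms)
  then show ?thesis unfolding isomorphic_def by (intro exI)
qed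

text \<open>The components between the copies of \<open>S i\<close> in the two decompositions are
  scalars and form matrices \<open>A\<close> and \<open>B\<close>. Terms through \<open>S j\<close>
  with \<open>j\<close> different from \<open>i\<close> vanish by orthogonality, so
  \<open>B A = 1\<close> and \<open>A\<close> has at most as many columns as rows.\<close>

lemma count_simples_le:
  assumes "direct_sum C x (map S L)" "direct_sum C x (map S L')"
  shows "count_list L i \<le> count_list L' i"
proof -
  from assms(1)[unfolded direct_sum_simples] obtain \<iota> \<rho> where x: "x \<in> Ob C"
    and t: "\<forall>l<length L. \<iota> l \<in> Mor C (S (L ! l)) x \<and> \<rho> l \<in> Mor C x (S (L ! l))"
    and o: "\<forall>l<length L. \<forall>m<length L. comp_mor C (S (L ! l)) x (S (L ! m)) (\<rho> m) (\<iota> l)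
       = (if l = m then id_mor C (S (L ! l)) else zero_mor C (S (L ! l)) (S (L ! m)))"
    by (elim conjE exE) (rule that)
  from assms(2)[unfolded direct_sum_simples] obtain \<kappa> \<sigma> where
    t': "\<forall>l<length L'. \<kappa> l \<in> Mor C (S (L' ! l)) x \<and> \<sigma> l \<in> Mor C x (S (L' ! l))"
    and s'': "sum_mor C x x [comp_mor C x (S (L' ! l)) x (\<kappa> l) (\<sigma> l). l \<leftarrow> [0..<length L']] = id_mor C x"
    by (elim conjE exE) (rule that)
  define P where "P = filter (\<lambda>l. L ! l = i) [0..<length L]"
  define P' where "P' = filter (\<lambda>l. L' ! l = i) [0..<length L']"
  have "length (filter (\<lambda>l. M ! l = i) [0..<length M]) = count_list M i" for M
  proof -
    have "count_list M i = length (filter (\<lambda>k. i = k) (map ((!) M) [0..<length M]))"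
      unfolding count_list_eq_length_filter map_nth ..
    moreover have "((\<lambda>k. i = k) \<circ> (!) M) = (\<lambda>l. M ! l = i)" by (auto simp: fun_eq_iff)
    ultimately show ?thesis by (simp only: filter_map length_map)
  qed
  then have len: "length P = count_list L i" "length P' = count_list L' i"
    by (simp_all add: P_def P'_def)
  have P: "P ! a < length L \<and> L ! (P ! a) = i" if "a < length P" for a
    using nth_mem[OF that] by (auto simp: P_def)
  have P': "P' ! a < length L' \<and> L' ! (P' ! a) = i" if "a < length P'" for a
    using nth_mem[OF that] by (auto simp: P'_def)
  define sc where "sc f = (SOME c. f = \<phi> i c)" for f
  have sc: "\<phi> i (sc f) = f" if "f \<in> Mor C (S i) (S i)" for f
    using someI_ex[OF \<phi>_surj[OF that]] by (simp add: sc_def)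
  let ?A = "\<lambda>l m. comp_mor C (S i) x (S i) (\<sigma> l) (\<iota> m)" and ?B = "\<lambda>m l. comp_mor C (S i) x (S i) (\<rho> m) (\<kappa> l)"
  define A where "A = mat (length P') (length P) (\<lambda>(a, b). sc (?A (P' ! a) (P ! b)))"
  define B where "B = mat (length P) (length P') (\<lambda>(a, b). sc (?B (P ! a) (P' ! b)))"
  have \<phi>_sum: "\<phi> i (\<Sum>l\<leftarrow>ls. f l) = sum_mor C (S i) (S i) (map (\<lambda>l. \<phi> i (f l)) ls)" for f and ls :: "nat list"
    by (induction ls) (simp_all add: \<phi>_zero \<phi>_add)
  have "B * A = 1\<^sub>m (length P)"
  proof (rule eq_matI)
    fix a b assume ab: "a < dim_row (1\<^sub>m (length P) :: 'f mat)" "b < dim_col (1\<^sub>m (length P) :: 'f mat)"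
    define m n where "m = P ! a" and "n = P ! b"
    have mn: "m < length L" "n < length L" "L ! m = i" "L ! n = i"
      using P ab by (auto simp: m_def n_def)
    have tm: "\<rho> m \<in> Mor C x (S i)" "\<iota> n \<in> Mor C (S i) x" using t[rule_format, OF mn(1)] t[rule_format, OF mn(2)] mn by simp_all
    let ?f = "\<lambda>l. comp_mor C (S i) (S (L' ! l)) (S i) (comp_mor C (S (L' ! l)) x (S i) (\<rho> m) (\<kappa> l))
        (comp_mor C (S i) x (S (L' ! l)) (\<sigma> l) (\<iota> n))"
    have zero: "?f l = zero_mor C (S i) (S i)" if "l < length L'" "L' ! l \<noteq> i" for l
    proof -
      have "comp_mor C (S i) x (S (L' ! l)) (\<sigma> l) (\<iota> n) \<in> Mor C (S i) (S (L' ! l))"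
        using tm t' that x by (simp add: comp_closed S_ob)
      then have "comp_mor C (S i) x (S (L' ! l)) (\<sigma> l) (\<iota> n) = zero_mor C (S i) (S (L' ! l))"
        using orthogonal[of i "L' ! l"] that(2) by simp
      then show ?thesis using tm t' that x by (simp add: cat_simps S_ob)
    qed
    have fcl: "?f l \<in> Mor C (S i) (S i)" if "l < length L'" for l
      using tm t' that x by (simp add: comp_closed S_ob)
    have filt: "sum_mor C (S i) (S i) (map ?f (filter (\<lambda>l. L' ! l = i) ls)) = sum_mor C (S i) (S i) (map ?f ls)"
      if "set ls \<subseteq> {..<length L'}" for ls
      using that
    proof (induction ls)
      case (Cons l ls)
      have "sum_mor C (S i) (S i) (map ?f ls) \<in> Mor C (S i) (S i)"
        using Cons.prems fcl by (intro sum_mor_closed S_ob) auto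
      then show ?case using Cons zero[of l] by (simp add: cat_simps S_ob)
    qed simp
    have "\<phi> i ((B * A) $$ (a, b)) = \<phi> i (\<Sum>l\<leftarrow>P'. sc (?B m l) * sc (?A l n))"
      using ab by (simp add: A_def B_def scalar_prod_def m_def n_def sum_list_sum_nth)
    also have "\<dots> = sum_mor C (S i) (S i) (map ?f P')"
    proof -
      have "\<phi> i (sc (?B m l) * sc (?A l n)) = ?f l" if "l \<in> set P'" for l
      proof -
        have l: "l < length L'" "L' ! l = i" using that by (auto simp: P'_def)
        have tl: "\<kappa> l \<in> Mor C (S i) x" "\<sigma> l \<in> Mor C x (S i)"
          using t'[rule_format, OF l(1)] l(2) by simp_all
        show ?thesis using tl tm x l by (simp add: \<phi>_mult sc comp_closed S_ob)
      qed
      then have "map (\<lambda>l. \<phi> i (sc (?B m l) * sc (?A l n))) P' = map ?f P'" by (rule map_cong[OF HOL.refl])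
      then show ?thesis by (simp only: \<phi>_sum)
    qed
    also have "\<dots> = sum_mor C (S i) (S i) (map ?f [0..<length L'])"
      unfolding P'_def by (rule filt) auto
    \<comment> \<open>The terms sandwich the second resolution of the identity of \<open>x\<close>
      between \<open>\<rho> m\<close> and \<open>\<iota> n\<close>, so they add up to the composite
      of these two.\<close>
    also have "map ?f [0..<length L'] = map (\<lambda>h. comp_mor C (S i) x (S i) (\<rho> m) (comp_mor C (S i) x x h (\<iota> n)))
        (map (\<lambda>l. comp_mor C x (S (L' ! l)) x (\<kappa> l) (\<sigma> l)) [0..<length L'])"
      using tm t' x by (simp add: comp_assoc S_ob comp_closed)
    also have "sum_mor C (S i) (S i) \<dots> = comp_mor C (S i) x (S i) (\<rho> m) (comp_mor C (S i) x x (id_mor C x) (\<iota> n))"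
      unfolding s''[symmetric] using tm t' x
      by (subst comp_sum_left, auto simp: cat_simps S_ob) (subst comp_sum_right, auto simp: cat_simps S_ob o_def)
    also have "\<dots> = \<phi> i (if a = b then 1 else 0)"
    proof -
      have "a = b \<longleftrightarrow> m = n"
        using ab distinct_filter[of "[0..<length L]"] by (simp add: m_def n_def P_def nth_eq_iff_index_eq)
      then show ?thesis using o[rule_format, OF mn(2,1)] mn(3,4) tm x
        by (auto simp: cat_simps S_ob \<phi>_one \<phi>_zero)
    qed
    finally show "(B * A) $$ (a, b) = 1\<^sub>m (length P) $$ (a, b)"
      using ab by (simp add: \<phi>_inj)
  qed (simp_all add: A_def B_def)
  from mat_left_inverse_dim[OF _ _ this, of "length P'"] show ?thesis
    by (simp add: A_def B_def len)
qed

lemma decomposition_unique: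
  assumes "direct_sum C x (map S L)" "direct_sum C y (map S L')" "isomorphic C x y" "y \<in> Ob C"
  shows "mset L = mset L'"
proof (rule multiset_eqI)
  fix i
  have "direct_sum C y (map S L)" using assms direct_sum_iso by blast
  then have "count_list L i = count_list L' i"
    using count_simples_le assms(2) by (meson le_antisym)
  then show "count (mset L) i = count (mset L') i" by (simp add: count_mset)
qed

lemma semisimple_abelian: "semisimple_abelian_category C"
proof
  fix x assume "x \<in> Ob C"
  then obtain L where "direct_sum C x (map S L)" using decomposition_exists by blast
  then show "\<exists>ys. (\<forall>y\<in>set ys. irreducible_ob C y) \<and> direct_sum C x ys"
    by (intro exI[of _ "map S L"]) (auto simp: irreducible_simple)
qed

end

section \<open>Strict monoidal preadditive categories\<close>

text \<open>The interchange law here carries no sign. It holds for the even morphisms of the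
  \<Pi>-envelope, and both the additive envelope and the idempotent completion preserve it.\<close>

locale monoidal_preadditive = preadditive_category C
  for C :: "('o, 'm, 'k, 'z) lin_moncat_scheme" +
  assumes unit_closed: "unit_ob C \<in> Ob C"
    and tensor_ob_closed: "\<lbrakk>x \<in> Ob C; y \<in> Ob C\<rbrakk> \<Longrightarrow> tensor_ob C x y \<in> Ob C"
    and tensor_ob_assoc: "\<lbrakk>x \<in> Ob C; y \<in> Ob C; z \<in> Ob C\<rbrakk>
      \<Longrightarrow> tensor_ob C (tensor_ob C x y) z = tensor_ob C x (tensor_ob C y z)"
    and tensor_ob_unit_left: "x \<in> Ob C \<Longrightarrow> tensor_ob C (unit_ob C) x = x"
    and tensor_ob_unit_right: "x \<in> Ob C \<Longrightarrow> tensor_ob C x (unit_ob C) = x"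
    and tensor_closed: "\<lbrakk>x \<in> Ob C; x' \<in> Ob C; y \<in> Ob C; y' \<in> Ob C; f \<in> Mor C x x'; g \<in> Mor C y y'\<rbrakk>
      \<Longrightarrow> tensor_mor C x x' y y' f g \<in> Mor C (tensor_ob C x y) (tensor_ob C x' y')"
    and tensor_comp: "\<lbrakk>x \<in> Ob C; x' \<in> Ob C; x'' \<in> Ob C; y \<in> Ob C; y' \<in> Ob C; y'' \<in> Ob C;
        f' \<in> Mor C x' x''; f \<in> Mor C x x'; g' \<in> Mor C y' y''; g \<in> Mor C y y'\<rbrakk>
      \<Longrightarrow> comp_mor C (tensor_ob C x y) (tensor_ob C x' y') (tensor_ob C x'' y'')
            (tensor_mor C x' x'' y' y'' f' g') (tensor_mor C x x' y y' f g)
          = tensor_mor C x x'' y y'' (comp_mor C x x' x'' f' f) (comp_mor C y y' y'' g' g)"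
    and tensor_id: "\<lbrakk>x \<in> Ob C; y \<in> Ob C\<rbrakk>
      \<Longrightarrow> tensor_mor C x x y y (id_mor C x) (id_mor C y) = id_mor C (tensor_ob C x y)"
    and tensor_assoc: "\<lbrakk>x \<in> Ob C; x' \<in> Ob C; y \<in> Ob C; y' \<in> Ob C; z \<in> Ob C; z' \<in> Ob C;
        f \<in> Mor C x x'; g \<in> Mor C y y'; h \<in> Mor C z z'\<rbrakk>
      \<Longrightarrow> tensor_mor C (tensor_ob C x y) (tensor_ob C x' y') z z' (tensor_mor C x x' y y' f g) h
          = tensor_mor C x x' (tensor_ob C y z) (tensor_ob C y' z') f (tensor_mor C y y' z z' g h)"
    and tensor_unit_left: "\<lbrakk>x \<in> Ob C; x' \<in> Ob C; f \<in> Mor C x x'\<rbrakk>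
      \<Longrightarrow> tensor_mor C (unit_ob C) (unit_ob C) x x' (id_mor C (unit_ob C)) f = f"
    and tensor_unit_right: "\<lbrakk>x \<in> Ob C; x' \<in> Ob C; f \<in> Mor C x x'\<rbrakk>
      \<Longrightarrow> tensor_mor C x x' (unit_ob C) (unit_ob C) f (id_mor C (unit_ob C)) = f"
    and tensor_add_left: "\<lbrakk>x \<in> Ob C; x' \<in> Ob C; y \<in> Ob C; y' \<in> Ob C;
        f \<in> Mor C x x'; f' \<in> Mor C x x'; g \<in> Mor C y y'\<rbrakk>
      \<Longrightarrow> tensor_mor C x x' y y' (add_mor C x x' f f') g
          = add_mor C (tensor_ob C x y) (tensor_ob C x' y')
              (tensor_mor C x x' y y' f g) (tensor_mor C x x' y y' f' g)"
    and tensor_add_right: "\<lbrakk>x \<in> Ob C; x' \<in> Ob C; y \<in> Ob C; y' \<in> Ob C;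
        f \<in> Mor C x x'; g \<in> Mor C y y'; g' \<in> Mor C y y'\<rbrakk>
      \<Longrightarrow> tensor_mor C x x' y y' f (add_mor C y y' g g')
          = add_mor C (tensor_ob C x y) (tensor_ob C x' y')
              (tensor_mor C x x' y y' f g) (tensor_mor C x x' y y' f g')"
begin

lemma tensor_zero_left: "\<lbrakk>x \<in> Ob C; x' \<in> Ob C; y \<in> Ob C; y' \<in> Ob C; g \<in> Mor C y y'\<rbrakk>
    \<Longrightarrow> tensor_mor C x x' y y' (zero_mor C x x') g = zero_mor C (tensor_ob C x y) (tensor_ob C x' y')"
  by (rule add_idem_zero) (simp_all add: cat_simps tensor_closed tensor_ob_closed flip: tensor_add_left)

lemma tensor_zero_right: "\<lbrakk>x \<in> Ob C; x' \<in> Ob C; y \<in> Ob C; y' \<in> Ob C; f \<in> Mor C x x'\<rbrakk>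
    \<Longrightarrow> tensor_mor C x x' y y' f (zero_mor C y y') = zero_mor C (tensor_ob C x y) (tensor_ob C x' y')"
  by (rule add_idem_zero) (simp_all add: cat_simps tensor_closed tensor_ob_closed flip: tensor_add_right)

lemmas tensor_simps = tensor_ob_closed tensor_closed tensor_zero_left tensor_zero_right
  tensor_add_left tensor_add_right

text \<open>This expansion of a product of two sums compares Kronecker products with matrix
  composition.\<close>

lemma tensor_sum:
  assumes "x \<in> Ob C" "x' \<in> Ob C" "y \<in> Ob C" "y' \<in> Ob C"
    "\<And>a. a \<in> set as \<Longrightarrow> f a \<in> Mor C x x'" "\<And>b. b \<in> set bs \<Longrightarrow> g b \<in> Mor C y y'"
  shows "tensor_mor C x x' y y' (sum_mor C x x' (map f as)) (sum_mor C y y' (map g bs))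
    = sum_mor C (tensor_ob C x y) (tensor_ob C x' y')
        (map (\<lambda>(a, b). tensor_mor C x x' y y' (f a) (g b)) (List.product as bs))"
proof -
  have g: "sum_mor C y y' (map g bs) \<in> Mor C y y'" using assms by (intro sum_mor_closed) auto
  have 1: "tensor_mor C x x' y y' h (sum_mor C y y' (map g bs))
    = sum_mor C (tensor_ob C x y) (tensor_ob C x' y') (map (\<lambda>b. tensor_mor C x x' y y' h (g b)) bs)"
    if "h \<in> Mor C x x'" for h
    using assms(6)
  proof (induction bs)
    case (Cons b bs)
    have "sum_mor C y y' (map g bs) \<in> Mor C y y'" using assms Cons.prems by (intro sum_mor_closed) auto
    with Cons that assms(1-4) show ?case by (simp add: tensor_simps)
  qed (use that assms(1-4) in \<open>simp add: tensor_simps\<close>)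
  show ?thesis
    using assms(5)
  proof (induction as)
    case (Cons a as)
    have "sum_mor C x x' (map f as) \<in> Mor C x x'" using assms Cons.prems by (intro sum_mor_closed) auto
    moreover have "sum_mor C (tensor_ob C x y) (tensor_ob C x' y')
        (map (\<lambda>(a, b). tensor_mor C x x' y y' (f a) (g b)) (map (Pair a) bs @ List.product as bs))
      = add_mor C (tensor_ob C x y) (tensor_ob C x' y')
         (sum_mor C (tensor_ob C x y) (tensor_ob C x' y') (map (\<lambda>b. tensor_mor C x x' y y' (f a) (g b)) bs))
         (sum_mor C (tensor_ob C x y) (tensor_ob C x' y') (map (\<lambda>(a, b). tensor_mor C x x' y y' (f a) (g b)) (List.product as bs)))"
      unfolding map_append
      by (subst sum_mor_append) (use assms Cons.prems in \<open>auto simp: tensor_simps o_def\<close>)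
    ultimately show ?case using Cons assms(1-4) g by (simp add: tensor_simps 1)
  qed (use g assms(1-4) in \<open>simp add: tensor_simps\<close>)
qed

end

text \<open>A composite \<open>b a\<close> through \<open>S i\<close>, tensored with the identity of
  \<open>u\<close>, factors through \<open>S i\<close> tensored with \<open>u\<close>, which is
  generated by assumption. So it is enough to tensor simple objects.\<close>

lemma generated_tensor:
  assumes "preadditive_family C S" "monoidal_preadditive C"
    and u: "u \<in> Ob C" "\<And>i. sum_through C S (tensor_ob C (S i) u) (tensor_ob C (S i) u) (id_mor C (tensor_ob C (S i) u))"
    and x: "x \<in> Ob C" "sum_through C S x x (id_mor C x)"
  shows "sum_through C S (tensor_ob C x u) (tensor_ob C x u) (id_mor C (tensor_ob C x u))"
proof -
  interpret preadditive_family C S by fact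
  interpret monoidal_preadditive C by fact
  have "sum_through C S (tensor_ob C x u) (tensor_ob C x u) (tensor_mor C x x u u f (id_mor C u))"
    if "sum_through C S x x f" for f
    using that
  proof (induction rule: sum_through.induct)
    case zero
    then show ?case using u x by (simp add: tensor_zero_left id_closed sum_through.zero)
  next
    case (add a i b f)
    note f = sum_through_closed[OF add.hyps(3) x(1) x(1)]
    have ob: "tensor_ob C x u \<in> Ob C" "tensor_ob C (S i) u \<in> Ob C" using u x S_ob by (simp_all add: tensor_ob_closed)
    have "tensor_mor C x x u u (comp_mor C x (S i) x b a) (id_mor C u)
      = comp_mor C (tensor_ob C x u) (tensor_ob C (S i) u) (tensor_ob C x u)
          (tensor_mor C (S i) x u u b (id_mor C u)) (tensor_mor C x (S i) u u a (id_mor C u))"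
      using add.hyps u x by (simp add: tensor_comp S_ob id_closed comp_id_left)
    moreover have "tensor_mor C (S i) x u u b (id_mor C u) \<in> Mor C (tensor_ob C (S i) u) (tensor_ob C x u)"
      "tensor_mor C x (S i) u u a (id_mor C u) \<in> Mor C (tensor_ob C x u) (tensor_ob C (S i) u)"
      using add.hyps u x by (simp_all add: tensor_closed S_ob id_closed)
    ultimately have "sum_through C S (tensor_ob C x u) (tensor_ob C x u)
        (tensor_mor C x x u u (comp_mor C x (S i) x b a) (id_mor C u))"
      using sum_through_trans[OF u(2)] ob by simp
    from sum_through_add[OF this add.IH ob(1) ob(1)] show ?case
      using add.hyps u x f by (simp add: tensor_add_left S_ob id_closed comp_closed)
  qed
  from this[OF x(2)] show ?thesis using u x by (simp add: tensor_id)
qed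


section \<open>The additive envelope\<close>

lemma div_mod_less:
  fixes i n m :: nat
  assumes "i < n * m" shows "i div m < n" "i mod m < m"
proof -
  have "m > 0" using assms by (cases m) auto
  then show "i div m < n" "i mod m < m" using assms by (auto simp: less_mult_imp_div_less)
qed

text \<open>A Kronecker index \<open>l\<close> encodes the pair \<open>(l div m, l mod m)\<close>,
  and counting \<open>l\<close> upwards runs through the pairs in lexicographic order.\<close>

lemma map_upt_mult: "map (\<lambda>l. F (l div m) (l mod m)) [0..<n * m] = map (\<lambda>(a, b). F a b) (List.product [0..<n] [0..<m :: nat])"
  by (intro nth_equalityI) (simp_all add: product_nth div_mod_less)

lemma tensor_list_conv: "[t x y. x \<leftarrow> xs, y \<leftarrow> ys] = map (\<lambda>(x, y). t x y) (List.product xs ys)"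
  by (induction xs) auto

lemma nth_tensor_list:
  "i < length xs * length ys \<Longrightarrow> [t x y. x \<leftarrow> xs, y \<leftarrow> ys] ! i = t (xs ! (i div length ys)) (ys ! (i mod length ys))"
  unfolding tensor_list_conv by (simp add: product_nth div_mod_less)

lemma length_tensor_list: "length [t x y. x \<leftarrow> xs, y \<leftarrow> ys] = length xs * length ys"
  unfolding tensor_list_conv by simp

lemma additive_envelope_simps:
  "Ob (additive_envelope C) = lists (Ob C)"
  "Mor (additive_envelope C) xs ys = {M \<in> carrier_mat (length ys) (length xs).
       \<forall>i<length ys. \<forall>j<length xs. M $$ (i, j) \<in> Mor C (xs ! j) (ys ! i)}"
  "id_mor (additive_envelope C) xs = mat (length xs) (length xs)
       (\<lambda>(i, j). if i = j then id_mor C (xs ! i) else zero_mor C (xs ! j) (xs ! i))"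
  "comp_mor (additive_envelope C) xs ys zs N M = mat (length zs) (length xs)
       (\<lambda>(i, j). sum_mor C (xs ! j) (zs ! i)
         [comp_mor C (xs ! j) (ys ! l) (zs ! i) (N $$ (i, l)) (M $$ (l, j)). l \<leftarrow> [0..<length ys]])"
  "zero_mor (additive_envelope C) xs ys = mat (length ys) (length xs) (\<lambda>(i, j). zero_mor C (xs ! j) (ys ! i))"
  "add_mor (additive_envelope C) xs ys M N = mat (length ys) (length xs)
       (\<lambda>(i, j). add_mor C (xs ! j) (ys ! i) (M $$ (i, j)) (N $$ (i, j)))"
  "unit_ob (additive_envelope C) = [unit_ob C]"
  "tensor_ob (additive_envelope C) xs ys = [tensor_ob C x y. x \<leftarrow> xs, y \<leftarrow> ys]"
  "tensor_mor (additive_envelope C) xs xs' ys ys' M N =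
       mat (length xs' * length ys') (length xs * length ys)
         (\<lambda>(i, j). tensor_mor C (xs ! (j div length ys)) (xs' ! (i div length ys'))
              (ys ! (j mod length ys)) (ys' ! (i mod length ys'))
              (M $$ (i div length ys', j div length ys)) (N $$ (i mod length ys', j mod length ys)))"
  by (simp_all add: additive_envelope_def Let_def)

lemma additive_envelope_preadditive:
  fixes C :: "('o, 'm, 'k) lin_moncat"
  assumes "preadditive_category C"
  shows "preadditive_category (additive_envelope C)"
proof -
  interpret preadditive_category C by fact
  have nth: "xs ! i \<in> Ob C" if "xs \<in> lists (Ob C)" "i < length xs" for xs i
    using that by auto
  note [simp] = nth cat_simps
  have entry: "comp_mor C (xs ! j) (ys ! l) (zs ! i) (N $$ (i, l)) (M $$ (l, j)) \<in> Mor C (xs ! j) (zs ! i)"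
    if "xs \<in> lists (Ob C)" "ys \<in> lists (Ob C)" "zs \<in> lists (Ob C)" "i < length zs" "j < length xs" "l < length ys"
      "N \<in> Mor (additive_envelope C) ys zs" "M \<in> Mor (additive_envelope C) xs ys" for xs ys zs i j l M N
    using that by (intro comp_closed) (auto simp: additive_envelope_simps)
  have grp: "comm_group \<lparr>carrier = Mor (additive_envelope C) xs ys,
      monoid.mult = add_mor (additive_envelope C) xs ys, one = zero_mor (additive_envelope C) xs ys\<rparr>"
    if ob: "xs \<in> Ob (additive_envelope C)" "ys \<in> Ob (additive_envelope C)" for xs ys
  proof (rule comm_groupI)
    fix M assume "M \<in> carrier \<lparr>carrier = Mor (additive_envelope C) xs ys,
      monoid.mult = add_mor (additive_envelope C) xs ys, one = zero_mor (additive_envelope C) xs ys\<rparr>"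
    then show "\<exists>N\<in>carrier \<lparr>carrier = Mor (additive_envelope C) xs ys,
      monoid.mult = add_mor (additive_envelope C) xs ys, one = zero_mor (additive_envelope C) xs ys\<rparr>.
        N \<otimes>\<^bsub>\<lparr>carrier = Mor (additive_envelope C) xs ys,
      monoid.mult = add_mor (additive_envelope C) xs ys, one = zero_mor (additive_envelope C) xs ys\<rparr>\<^esub> M
        = \<one>\<^bsub>\<lparr>carrier = Mor (additive_envelope C) xs ys,
      monoid.mult = add_mor (additive_envelope C) xs ys, one = zero_mor (additive_envelope C) xs ys\<rparr>\<^esub>"
      using ob
      by (intro bexI[of _ "mat (length ys) (length xs) (\<lambda>(i, j). neg_mor C (xs ! j) (ys ! i) (M $$ (i, j)))"])
         (auto simp: additive_envelope_simps)
  qed (use ob in \<open>auto simp: additive_envelope_simps intro!: eq_matI add_commute\<close>)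
  show ?thesis
  proof (intro preadditive_category.intro, goal_cases)
    case (1 xs)
    then show ?case by (auto simp: additive_envelope_simps)
  next
    case (2 xs ys zs N M)
    have "sum_mor C (xs ! j) (zs ! i) [comp_mor C (xs ! j) (ys ! l) (zs ! i) (N $$ (i, l)) (M $$ (l, j)). l \<leftarrow> [0..<length ys]]
      \<in> Mor C (xs ! j) (zs ! i)" if "i < length zs" "j < length xs" for i j
      using 2 that entry by (intro sum_mor_closed) (auto simp: additive_envelope_simps)
    then show ?case by (simp add: additive_envelope_simps)
  next
    case (3 ws xs ys zs P N M)
    show ?case
    proof (rule eq_matI)
      fix i j assume "i < dim_row (comp_mor (additive_envelope C) ws ys zs P (comp_mor (additive_envelope C) ws xs ys N M))"
        "j < dim_col (comp_mor (additive_envelope C) ws ys zs P (comp_mor (additive_envelope C) ws xs ys N M))"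
      then have ij: "i < length zs" "j < length ws" by (simp_all add: additive_envelope_simps)
      have o: "ws ! j \<in> Ob C" "zs ! i \<in> Ob C" "\<And>k. k < length xs \<Longrightarrow> xs ! k \<in> Ob C" "\<And>l. l < length ys \<Longrightarrow> ys ! l \<in> Ob C"
        using 3 ij by (auto simp: additive_envelope_simps)
      have m: "\<And>k. k < length xs \<Longrightarrow> M $$ (k, j) \<in> Mor C (ws ! j) (xs ! k)"
        "\<And>k l. \<lbrakk>k < length xs; l < length ys\<rbrakk> \<Longrightarrow> N $$ (l, k) \<in> Mor C (xs ! k) (ys ! l)"
        "\<And>l. l < length ys \<Longrightarrow> P $$ (i, l) \<in> Mor C (ys ! l) (zs ! i)"
        using 3 ij by (auto simp: additive_envelope_simps)
      let ?t = "\<lambda>l k. comp_mor C (ws ! j) (ys ! l) (zs ! i) (P $$ (i, l)) (comp_mor C (ws ! j) (xs ! k) (ys ! l) (N $$ (l, k)) (M $$ (k, j)))"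
      have "comp_mor (additive_envelope C) ws xs zs (comp_mor (additive_envelope C) xs ys zs P N) M $$ (i, j)
        = sum_mor C (ws ! j) (zs ! i) (map (\<lambda>k. sum_mor C (ws ! j) (zs ! i) (map (\<lambda>l. ?t l k) [0..<length ys])) [0..<length xs])"
        using ij o m by (auto simp: additive_envelope_simps comp_sum_left o_def comp_assoc image_subset_iff
            intro!: arg_cong[where f = "sum_mor C (ws ! j) (zs ! i)"])
      also have "\<dots> = sum_mor C (ws ! j) (zs ! i) (map (\<lambda>l. sum_mor C (ws ! j) (zs ! i) (map (\<lambda>k. ?t l k) [0..<length xs])) [0..<length ys])"
        using o m by (intro sum_mor_swap) auto
      also have "\<dots> = comp_mor (additive_envelope C) ws ys zs P (comp_mor (additive_envelope C) ws xs ys N M) $$ (i, j)"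
        using ij o m by (auto simp: additive_envelope_simps comp_sum_right o_def image_subset_iff
            intro!: arg_cong[where f = "sum_mor C (ws ! j) (zs ! i)"])
      finally show "comp_mor (additive_envelope C) ws xs zs (comp_mor (additive_envelope C) xs ys zs P N) M $$ (i, j)
        = comp_mor (additive_envelope C) ws ys zs P (comp_mor (additive_envelope C) ws xs ys N M) $$ (i, j)" .
    qed (simp_all add: additive_envelope_simps)
  next
    case (4 xs ys M)
    show ?case
    proof (rule eq_matI)
      fix i j assume "i < dim_row M" "j < dim_col M"
      then have ij: "i < length ys" "j < length xs" using 4 by (auto simp: additive_envelope_simps)
      have eq: "map (\<lambda>l. comp_mor C (xs ! j) (ys ! l) (ys ! i) (id_mor (additive_envelope C) ys $$ (i, l)) (M $$ (l, j))) [0..<length ys]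
        = map (\<lambda>l. if l = i then M $$ (i, j) else zero_mor C (xs ! j) (ys ! i)) [0..<length ys]"
        using 4 ij by (intro map_cong HOL.refl) (auto simp: additive_envelope_simps)
      have "sum_mor C (xs ! j) (ys ! i) (map (\<lambda>l. if l = i then M $$ (i, j) else zero_mor C (xs ! j) (ys ! i)) [0..<length ys]) = M $$ (i, j)"
        using 4 ij by (intro sum_mor_single) (auto simp: additive_envelope_simps)
      then show "comp_mor (additive_envelope C) xs ys ys (id_mor (additive_envelope C) ys) M $$ (i, j) = M $$ (i, j)"
        using ij by (simp only: additive_envelope_simps(4) eq index_mat prod.case)
    qed (use 4 in \<open>auto simp: additive_envelope_simps\<close>)
  next
    case (5 xs ys M)
    show ?case
    proof (rule eq_matI)
      fix i j assume "i < dim_row M" "j < dim_col M"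
      then have ij: "i < length ys" "j < length xs" using 5 by (auto simp: additive_envelope_simps)
      have eq: "map (\<lambda>l. comp_mor C (xs ! j) (xs ! l) (ys ! i) (M $$ (i, l)) (id_mor (additive_envelope C) xs $$ (l, j))) [0..<length xs]
        = map (\<lambda>l. if l = j then M $$ (i, j) else zero_mor C (xs ! j) (ys ! i)) [0..<length xs]"
        using 5 ij by (intro map_cong HOL.refl) (auto simp: additive_envelope_simps)
      have "sum_mor C (xs ! j) (ys ! i) (map (\<lambda>l. if l = j then M $$ (i, j) else zero_mor C (xs ! j) (ys ! i)) [0..<length xs]) = M $$ (i, j)"
        using 5 ij by (intro sum_mor_single) (auto simp: additive_envelope_simps)
      then show "comp_mor (additive_envelope C) xs xs ys M (id_mor (additive_envelope C) xs) $$ (i, j) = M $$ (i, j)"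
        using ij by (simp only: additive_envelope_simps(4) eq index_mat prod.case)
    qed (use 5 in \<open>auto simp: additive_envelope_simps\<close>)
  next
    case (6 xs ys)
    then show ?case by (rule grp)
  next
    case (7 xs ys zs N N' M)
    show ?case
    proof (rule eq_matI)
      fix i j assume "i < dim_row (add_mor (additive_envelope C) xs zs (comp_mor (additive_envelope C) xs ys zs N M) (comp_mor (additive_envelope C) xs ys zs N' M))"
        "j < dim_col (add_mor (additive_envelope C) xs zs (comp_mor (additive_envelope C) xs ys zs N M) (comp_mor (additive_envelope C) xs ys zs N' M))"
      then have ij: "i < length zs" "j < length xs" by (simp_all add: additive_envelope_simps)
      show "comp_mor (additive_envelope C) xs ys zs (add_mor (additive_envelope C) ys zs N N') M $$ (i, j)
        = add_mor (additive_envelope C) xs zs (comp_mor (additive_envelope C) xs ys zs N M) (comp_mor (additive_envelope C) xs ys zs N' M) $$ (i, j)"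
      proof -
        have eq: "map (\<lambda>l. comp_mor C (xs ! j) (ys ! l) (zs ! i) (add_mor (additive_envelope C) ys zs N N' $$ (i, l)) (M $$ (l, j))) [0..<length ys]
          = map (\<lambda>l. add_mor C (xs ! j) (zs ! i) (comp_mor C (xs ! j) (ys ! l) (zs ! i) (N $$ (i, l)) (M $$ (l, j)))
              (comp_mor C (xs ! j) (ys ! l) (zs ! i) (N' $$ (i, l)) (M $$ (l, j)))) [0..<length ys]"
          using 7 ij by (intro map_cong HOL.refl) (auto simp: additive_envelope_simps)
        have "comp_mor (additive_envelope C) xs ys zs (add_mor (additive_envelope C) ys zs N N') M $$ (i, j)
          = sum_mor C (xs ! j) (zs ! i) (map (\<lambda>l. add_mor C (xs ! j) (zs ! i) (comp_mor C (xs ! j) (ys ! l) (zs ! i) (N $$ (i, l)) (M $$ (l, j)))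
              (comp_mor C (xs ! j) (ys ! l) (zs ! i) (N' $$ (i, l)) (M $$ (l, j)))) [0..<length ys])"
          using ij by (simp only: additive_envelope_simps(4) eq index_mat prod.case)
        also have "\<dots> = add_mor C (xs ! j) (zs ! i) (comp_mor (additive_envelope C) xs ys zs N M $$ (i, j)) (comp_mor (additive_envelope C) xs ys zs N' M $$ (i, j))"
          using 7 ij by (subst sum_mor_add) (auto simp: additive_envelope_simps)
        finally show ?thesis using ij by (simp add: additive_envelope_simps(6))
      qed
    qed (simp_all add: additive_envelope_simps)
  next
    case (8 xs ys zs N M M')
    show ?case
    proof (rule eq_matI)
      fix i j assume "i < dim_row (add_mor (additive_envelope C) xs zs (comp_mor (additive_envelope C) xs ys zs N M) (comp_mor (additive_envelope C) xs ys zs N M'))"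
        "j < dim_col (add_mor (additive_envelope C) xs zs (comp_mor (additive_envelope C) xs ys zs N M) (comp_mor (additive_envelope C) xs ys zs N M'))"
      then have ij: "i < length zs" "j < length xs" by (simp_all add: additive_envelope_simps)
      show "comp_mor (additive_envelope C) xs ys zs N (add_mor (additive_envelope C) xs ys M M') $$ (i, j)
        = add_mor (additive_envelope C) xs zs (comp_mor (additive_envelope C) xs ys zs N M) (comp_mor (additive_envelope C) xs ys zs N M') $$ (i, j)"
      proof -
        have eq: "map (\<lambda>l. comp_mor C (xs ! j) (ys ! l) (zs ! i) (N $$ (i, l)) (add_mor (additive_envelope C) xs ys M M' $$ (l, j))) [0..<length ys]
          = map (\<lambda>l. add_mor C (xs ! j) (zs ! i) (comp_mor C (xs ! j) (ys ! l) (zs ! i) (N $$ (i, l)) (M $$ (l, j)))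
              (comp_mor C (xs ! j) (ys ! l) (zs ! i) (N $$ (i, l)) (M' $$ (l, j)))) [0..<length ys]"
          using 8 ij by (intro map_cong HOL.refl) (auto simp: additive_envelope_simps)
        have "comp_mor (additive_envelope C) xs ys zs N (add_mor (additive_envelope C) xs ys M M') $$ (i, j)
          = sum_mor C (xs ! j) (zs ! i) (map (\<lambda>l. add_mor C (xs ! j) (zs ! i) (comp_mor C (xs ! j) (ys ! l) (zs ! i) (N $$ (i, l)) (M $$ (l, j)))
              (comp_mor C (xs ! j) (ys ! l) (zs ! i) (N $$ (i, l)) (M' $$ (l, j)))) [0..<length ys])"
          using ij by (simp only: additive_envelope_simps(4) eq index_mat prod.case)
        also have "\<dots> = add_mor C (xs ! j) (zs ! i) (comp_mor (additive_envelope C) xs ys zs N M $$ (i, j)) (comp_mor (additive_envelope C) xs ys zs N M' $$ (i, j))"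
          using 8 ij by (subst sum_mor_add) (auto simp: additive_envelope_simps)
        finally show ?thesis using ij by (simp add: additive_envelope_simps(6))
      qed
    qed (simp_all add: additive_envelope_simps)
  qed
qed

lemma sum_mor_envelope:
  fixes C :: "('o, 'm, 'k) lin_moncat"
  assumes "i < length ys" "j < length xs"
  shows "sum_mor (additive_envelope C) xs ys Ms $$ (i, j) = sum_mor C (xs ! j) (ys ! i) (map (\<lambda>M. M $$ (i, j)) Ms)"
  using assms by (induction Ms) (simp_all add: additive_envelope_simps)

lemma additive_envelope_monoidal:
  fixes C :: "('o, 'm, 'k) lin_moncat"
  assumes "monoidal_preadditive C"
  shows "monoidal_preadditive (additive_envelope C)"
proof -
  interpret monoidal_preadditive C by fact
  interpret E: preadditive_category "additive_envelope C"
    by (rule additive_envelope_preadditive) unfold_locales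
  let ?E = "additive_envelope C"
  have nth: "xs ! i \<in> Ob C" if "xs \<in> lists (Ob C)" "i < length xs" for xs i
    using that by auto
  note [simp] = nth div_mod_less cat_simps tensor_simps unit_closed
  note simps = additive_envelope_simps length_tensor_list nth_tensor_list
  have unit_mat: "id_mor ?E (unit_ob ?E) = mat 1 1 (\<lambda>_. id_mor C (unit_ob C))"
    by (auto simp: additive_envelope_simps)
  show ?thesis
  proof (unfold_locales, goal_cases)
    case 1
    then show ?case by (simp add: simps)
  next
    case (2 xs ys)
    then show ?case by (auto simp: simps)
  next
    case (3 xs ys zs)
    have *: "map (tensor_ob C x) (concat (map (\<lambda>y. map (tensor_ob C y) zs) ys))
        = concat (map (\<lambda>w. map (tensor_ob C w) zs) (map (tensor_ob C x) ys))" if "x \<in> Ob C" for x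
      using 3 that by (auto simp: simps map_concat o_def tensor_ob_assoc intro!: arg_cong[where f = concat])
    have "xs \<in> lists (Ob C)" using 3 by (simp add: simps)
    then have "concat (map (\<lambda>w. map (tensor_ob C w) zs) (concat (map (\<lambda>x. map (tensor_ob C x) ys) xs)))
        = concat (map (\<lambda>x. map (tensor_ob C x) (concat (map (\<lambda>y. map (tensor_ob C y) zs) ys))) xs)"
      by (induction xs) (simp_all add: *)
    then show ?case by (simp add: simps)
  next
    case (4 xs)
    then show ?case by (simp add: simps tensor_ob_unit_left map_idI in_listsD)
  next
    case (5 xs)
    then show ?case by (simp add: simps) (auto simp: tensor_ob_unit_right map_idI)
  next
    case (6 xs xs' ys ys' M N)
    then show ?case by (simp add: simps)
  next
    case (7 xs xs' xs'' ys ys' ys'' M' M N' N)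
    show ?case (is "?l = ?r")
    proof (rule eq_matI)
      fix i j assume "i < dim_row ?r" "j < dim_col ?r"
      then have ij: "i < length xs'' * length ys''" "j < length xs * length ys" by (simp_all add: simps)
      define i1 i2 j1 j2 where ij_def: "i1 = i div length ys''" "i2 = i mod length ys''" "j1 = j div length ys" "j2 = j mod length ys"
      have b: "i1 < length xs''" "i2 < length ys''" "j1 < length xs" "j2 < length ys"
        using ij by (simp_all add: ij_def)
      have o: "xs ! j1 \<in> Ob C" "ys ! j2 \<in> Ob C" "xs'' ! i1 \<in> Ob C" "ys'' ! i2 \<in> Ob C"
        "\<And>k. k < length xs' \<Longrightarrow> xs' ! k \<in> Ob C" "\<And>k. k < length ys' \<Longrightarrow> ys' ! k \<in> Ob C"
        using 7 b by (simp_all add: simps)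
      have m: "\<And>k. k < length xs' \<Longrightarrow> M $$ (k, j1) \<in> Mor C (xs ! j1) (xs' ! k)"
        "\<And>k. k < length xs' \<Longrightarrow> M' $$ (i1, k) \<in> Mor C (xs' ! k) (xs'' ! i1)"
        "\<And>k. k < length ys' \<Longrightarrow> N $$ (k, j2) \<in> Mor C (ys ! j2) (ys' ! k)"
        "\<And>k. k < length ys' \<Longrightarrow> N' $$ (i2, k) \<in> Mor C (ys' ! k) (ys'' ! i2)"
        using 7 b by (simp_all add: simps)
      let ?F = "\<lambda>a b. tensor_mor C (xs ! j1) (xs'' ! i1) (ys ! j2) (ys'' ! i2)
          (comp_mor C (xs ! j1) (xs' ! a) (xs'' ! i1) (M' $$ (i1, a)) (M $$ (a, j1)))
          (comp_mor C (ys ! j2) (ys' ! b) (ys'' ! i2) (N' $$ (i2, b)) (N $$ (b, j2)))"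
      let ?s = "sum_mor C (tensor_ob C (xs ! j1) (ys ! j2)) (tensor_ob C (xs'' ! i1) (ys'' ! i2))"
      have "?l $$ (i, j) = ?s (map (\<lambda>l. ?F (l div length ys') (l mod length ys')) [0..<length xs' * length ys'])"
        using ij b o m by (simp add: simps flip: ij_def)
          (auto intro!: arg_cong[where f = ?s] simp: tensor_comp nth_tensor_list simp flip: ij_def)
      also have "\<dots> = ?s (map (\<lambda>(a, b). ?F a b) (List.product [0..<length xs'] [0..<length ys']))"
        by (simp only: map_upt_mult[of ?F "length ys'" "length xs'"])
      also have "\<dots> = ?r $$ (i, j)"
        using ij b o m by (subst tensor_sum[symmetric]) (auto simp: simps simp flip: ij_def)
      finally show "?l $$ (i, j) = ?r $$ (i, j)" .
    qed (simp_all add: simps)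
  next
    case (8 xs ys)
    show ?case (is "?l = ?r")
    proof (rule eq_matI)
      fix i j assume "i < dim_row ?r" "j < dim_col ?r"
      then have ij: "i < length xs * length ys" "j < length xs * length ys" by (simp_all add: simps)
      have "i = j \<longleftrightarrow> i div length ys = j div length ys \<and> i mod length ys = j mod length ys"
        by (metis div_mult_mod_eq)
      then show "?l $$ (i, j) = ?r $$ (i, j)"
        using ij 8 by (auto simp: simps tensor_id)
    qed (simp_all add: simps)
  next
    case (9 xs xs' ys ys' zs zs' M N P)
    \<comment> \<open>Both bracketings of a triple Kronecker product decode an index into the same
      three coordinates.\<close>
    have len: "a div (n * m) = a div m div n" "a mod (n * m) div m = a div m mod n" "a mod (n * m) mod m = a mod m"
      for a n m :: nat
      by (simp_all add: div_mult2_eq mult.commute mod_mult2_eq)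
        (metis mod_less_divisor div_less add.commute gr0I mod_0 div_mult_self1 mult_zero_left
          add_0 mod_by_0 mod_mult_self2 mod_mod_trivial mult.commute not_gr_zero div_by_0)+
    show ?case (is "?l = ?r")
    proof (rule eq_matI)
      fix i j assume "i < dim_row ?r" "j < dim_col ?r"
      then have ij: "i < length xs' * length ys' * length zs'" "j < length xs * length ys * length zs"
        by (simp_all add: simps mult.assoc)
      show "?l $$ (i, j) = ?r $$ (i, j)"
        using ij ij[unfolded mult.assoc] 9 div_mod_less[OF ij(1)] div_mod_less[OF ij(2)]
          div_mod_less[OF div_mod_less(1)[OF ij(1)]] div_mod_less[OF div_mod_less(1)[OF ij(2)]]
        by (simp add: simps len tensor_assoc)
    qed (simp_all add: simps mult.assoc)
  next
    case (10 xs xs' M)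
    then show ?case
      unfolding unit_mat by (intro eq_matI) (auto simp: simps tensor_unit_left)
  next
    case (11 xs xs' M)
    then show ?case
      unfolding unit_mat by (intro eq_matI) (auto simp: simps tensor_unit_right)
  next
    case (12 xs xs' ys ys' M M' N)
    then show ?case by (intro eq_matI) (simp_all add: simps)
  next
    case (13 xs xs' ys ys' M N N')
    then show ?case by (intro eq_matI) (simp_all add: simps)
  qed
qed

lemma additive_envelope_zero:
  "[] \<in> Ob (additive_envelope C)"
  "id_mor (additive_envelope C) [] = zero_mor (additive_envelope C) [] []"
  by (auto simp: additive_envelope_simps)

text \<open>Composition with a row of an identity matrix; \<open>sum_comp_zero\<close> treats a zero
  row. The structure maps of a concatenation consist of such rows.\<close>

lemma (in preadditive_category) sum_comp_delta:
  assumes "set ys \<subseteq> Ob C" "k < length ys" "x \<in> Ob C" "\<And>l. l < length ys \<Longrightarrow> M l \<in> Mor C x (ys ! l)"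
    "\<And>l. l < length ys \<Longrightarrow> N l = (if l = k then id_mor C (ys ! k) else zero_mor C (ys ! l) (ys ! k))"
  shows "sum_mor C x (ys ! k) (map (\<lambda>l. comp_mor C x (ys ! l) (ys ! k) (N l) (M l)) [0..<length ys]) = M k"
proof -
  have "map (\<lambda>l. comp_mor C x (ys ! l) (ys ! k) (N l) (M l)) [0..<length ys]
    = map (\<lambda>l. if l = k then M k else zero_mor C x (ys ! k)) [0..<length ys]"
    using assms by (intro map_cong HOL.refl) (auto simp: cat_simps subset_iff)
  also have "sum_mor C x (ys ! k) \<dots> = M k"
    using assms by (intro sum_mor_single) auto
  finally show ?thesis .
qed

lemma (in preadditive_category) sum_comp_zero:
  assumes "set ys \<subseteq> Ob C" "z \<in> Ob C" "x \<in> Ob C" "\<And>l. l < length ys \<Longrightarrow> M l \<in> Mor C x (ys ! l)"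
    "\<And>l. l < length ys \<Longrightarrow> N l = zero_mor C (ys ! l) z"
  shows "sum_mor C x z (map (\<lambda>l. comp_mor C x (ys ! l) z (N l) (M l)) [0..<length ys]) = zero_mor C x z"
proof -
  have "map (\<lambda>l. comp_mor C x (ys ! l) z (N l) (M l)) [0..<length ys]
    = map (\<lambda>l. zero_mor C x z) [0..<length ys]"
    using assms by (intro map_cong HOL.refl) (auto simp: cat_simps subset_iff)
  then show ?thesis using assms by (simp only: sum_mor_zeros)
qed

text \<open>The structure maps are block matrices made of one identity block and one zero
  block.\<close>

lemma additive_envelope_biproduct:
  fixes C :: "('o, 'm, 'k) lin_moncat"
  assumes "preadditive_category C" and xs: "xs \<in> Ob (additive_envelope C)" and ys: "ys \<in> Ob (additive_envelope C)"
  shows "direct_sum (additive_envelope C) (xs @ ys) [xs, ys]"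
proof -
  interpret preadditive_category C by fact
  interpret E: preadditive_category "additive_envelope C"
    by (rule additive_envelope_preadditive) fact
  let ?n = "length xs" and ?m = "length ys" and ?zs = "xs @ ys"
  define i where "i = mat (?n + ?m) ?n (\<lambda>(a, b). if a = b then id_mor C (xs ! b) else zero_mor C (xs ! b) (?zs ! a))"
  define p where "p = mat ?n (?n + ?m) (\<lambda>(a, b). if a = b then id_mor C (xs ! a) else zero_mor C (?zs ! b) (xs ! a))"
  define j where "j = mat (?n + ?m) ?m (\<lambda>(a, b). if a = ?n + b then id_mor C (ys ! b) else zero_mor C (ys ! b) (?zs ! a))"
  define q where "q = mat ?m (?n + ?m) (\<lambda>(a, b). if ?n + a = b then id_mor C (ys ! a) else zero_mor C (?zs ! b) (ys ! a))"
  note defs = i_def p_def j_def q_def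
  have ob: "set xs \<subseteq> Ob C" "set ys \<subseteq> Ob C" "set ?zs \<subseteq> Ob C" using xs ys by (auto simp: additive_envelope_simps)
  have ob': "\<And>k. k < ?n \<Longrightarrow> xs ! k \<in> Ob C" "\<And>k. k < ?m \<Longrightarrow> ys ! k \<in> Ob C" "\<And>k. k < ?n + ?m \<Longrightarrow> ?zs ! k \<in> Ob C"
    using ob by (auto simp: nth_append subset_iff)
  have mem: "i $$ (a, b) \<in> Mor C (xs ! b) (?zs ! a)" "p $$ (b, a) \<in> Mor C (?zs ! a) (xs ! b)"
    if "a < ?n + ?m" "b < ?n" for a b
    using that ob' by (auto simp: i_def p_def cat_simps nth_append)
  have mem': "j $$ (a, b) \<in> Mor C (ys ! b) (?zs ! a)" "q $$ (b, a) \<in> Mor C (?zs ! a) (ys ! b)"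
    if "a < ?n + ?m" "b < ?m" for a b
    using that ob' by (auto simp: j_def q_def cat_simps nth_append)
  note len = length_append
  have carr: "i \<in> carrier_mat (?n + ?m) ?n" "p \<in> carrier_mat ?n (?n + ?m)"
    "j \<in> carrier_mat (?n + ?m) ?m" "q \<in> carrier_mat ?m (?n + ?m)" by (simp_all add: defs)
  have ip: "sum_mor C (?zs ! b) (?zs ! a) (map (\<lambda>l. comp_mor C (?zs ! b) (xs ! l) (?zs ! a) (i $$ (a, l)) (p $$ (l, b))) [0..<?n])
      = (if a < ?n then p $$ (a, b) else zero_mor C (?zs ! b) (?zs ! a))" if "a < ?n + ?m" "b < ?n + ?m" for a b
  proof (cases "a < ?n")
    case True
    then show ?thesis
      using sum_comp_delta[of xs a "?zs ! b" "\<lambda>l. p $$ (l, b)" "\<lambda>l. i $$ (a, l)"] ob ob' that mem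
      by (simp add: nth_append i_def)
  next
    case False
    then show ?thesis
      using sum_comp_zero[of xs "?zs ! a" "?zs ! b" "\<lambda>l. p $$ (l, b)" "\<lambda>l. i $$ (a, l)"] ob ob' that mem
      by (simp add: nth_append i_def)
  qed
  have jq: "sum_mor C (?zs ! b) (?zs ! a) (map (\<lambda>l. comp_mor C (?zs ! b) (ys ! l) (?zs ! a) (j $$ (a, l)) (q $$ (l, b))) [0..<?m])
      = (if a < ?n then zero_mor C (?zs ! b) (?zs ! a) else q $$ (a - ?n, b))" if "a < ?n + ?m" "b < ?n + ?m" for a b
  proof (cases "a < ?n")
    case False
    then show ?thesis
      using sum_comp_delta[of ys "a - ?n" "?zs ! b" "\<lambda>l. q $$ (l, b)" "\<lambda>l. j $$ (a, l)"] ob ob' that mem'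
      by (simp add: nth_append j_def)
  next
    case True
    then show ?thesis
      using sum_comp_zero[of ys "?zs ! a" "?zs ! b" "\<lambda>l. q $$ (l, b)" "\<lambda>l. j $$ (a, l)"] ob ob' that mem'
      by (simp add: nth_append j_def)
  qed
  have pM: "sum_mor C x (xs ! a) (map (\<lambda>l. comp_mor C x (?zs ! l) (xs ! a) (p $$ (a, l)) (M l)) [0..<?n + ?m]) = M a"
    if "x \<in> Ob C" "\<And>l. l < ?n + ?m \<Longrightarrow> M l \<in> Mor C x (?zs ! l)" "a < ?n" for x M a
    using sum_comp_delta[OF ob(3), of a x M "\<lambda>l. p $$ (a, l)"] that by (simp add: nth_append p_def)
  have qM: "sum_mor C x (ys ! a) (map (\<lambda>l. comp_mor C x (?zs ! l) (ys ! a) (q $$ (a, l)) (M l)) [0..<?n + ?m]) = M (?n + a)"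
    if "x \<in> Ob C" "\<And>l. l < ?n + ?m \<Longrightarrow> M l \<in> Mor C x (?zs ! l)" "a < ?m" for x M a
    using sum_comp_delta[OF ob(3), of "?n + a" x M "\<lambda>l. q $$ (a, l)"] that by (simp add: nth_append q_def)
  have "biproduct (additive_envelope C) (xs @ ys) xs ys i j p q"
    unfolding biproduct_def
  proof (intro conjI)
    show "xs @ ys \<in> Ob (additive_envelope C)" using xs ys by (simp add: additive_envelope_simps)
    show "i \<in> Mor (additive_envelope C) xs (xs @ ys)" "p \<in> Mor (additive_envelope C) (xs @ ys) xs"
      "j \<in> Mor (additive_envelope C) ys (xs @ ys)" "q \<in> Mor (additive_envelope C) (xs @ ys) ys"
      using mem mem' carr by (simp_all add: additive_envelope_simps)
    show "comp_mor (additive_envelope C) xs (xs @ ys) xs p i = id_mor (additive_envelope C) xs"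
      unfolding additive_envelope_simps(3,4) len
      by (intro cong_mat HOL.refl) (use pM mem ob' in \<open>simp add: i_def nth_append\<close>)
    show "comp_mor (additive_envelope C) ys (xs @ ys) ys q j = id_mor (additive_envelope C) ys"
      unfolding additive_envelope_simps(3,4) len
      by (intro cong_mat HOL.refl) (use qM mem' ob' in \<open>simp add: j_def\<close>)
    show "comp_mor (additive_envelope C) ys (xs @ ys) xs p j = zero_mor (additive_envelope C) ys xs"
      unfolding additive_envelope_simps(4,5) len
      by (intro cong_mat HOL.refl) (use pM mem' ob' in \<open>simp add: j_def nth_append\<close>)
    show "comp_mor (additive_envelope C) xs (xs @ ys) ys q i = zero_mor (additive_envelope C) xs ys"
      unfolding additive_envelope_simps(4,5) len
      by (intro cong_mat HOL.refl) (use qM mem ob' in \<open>simp add: i_def nth_append\<close>)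
    show "add_mor (additive_envelope C) (xs @ ys) (xs @ ys) (comp_mor (additive_envelope C) (xs @ ys) xs (xs @ ys) i p)
        (comp_mor (additive_envelope C) (xs @ ys) ys (xs @ ys) j q) = id_mor (additive_envelope C) (xs @ ys)"
      unfolding additive_envelope_simps(3,4,6) len
      by (intro cong_mat HOL.refl)
         (use ip jq mem mem' ob' in \<open>auto simp: p_def q_def nth_append cat_simps\<close>)
  qed (use xs ys in auto)
  then show ?thesis unfolding E.direct_sum_pair by blast
qed

text \<open>The identity matrix is the sum of its diagonal units, and the \<open>k\<close>-th of
  them factors through \<open>[xs ! k]\<close>. This reduces generation of the envelope to one-entry
  lists.\<close>

lemma additive_envelope_id_sum:
  fixes C :: "('o, 'm, 'k) lin_moncat"
  assumes "preadditive_category C" and xs: "xs \<in> Ob (additive_envelope C)"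
  shows "\<exists>\<iota> \<rho>. (\<forall>k<length xs. \<iota> k \<in> Mor (additive_envelope C) [xs ! k] xs \<and> \<rho> k \<in> Mor (additive_envelope C) xs [xs ! k]) \<and>
    id_mor (additive_envelope C) xs = sum_mor (additive_envelope C) xs xs
      (map (\<lambda>k. comp_mor (additive_envelope C) xs [xs ! k] xs (\<iota> k) (\<rho> k)) [0..<length xs])"
proof -
  interpret preadditive_category C by fact
  interpret E: preadditive_category "additive_envelope C"
    by (rule additive_envelope_preadditive) fact
  let ?n = "length xs"
  have ob: "k < ?n \<Longrightarrow> xs ! k \<in> Ob C" for k using xs by (auto simp: additive_envelope_simps)
  define i where "i k = mat ?n 1 (\<lambda>(a, b). if a = k then id_mor C (xs ! k) else zero_mor C (xs ! k) (xs ! a))" for k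
  define p where "p k = mat 1 ?n (\<lambda>(a, b). if b = k then id_mor C (xs ! k) else zero_mor C (xs ! b) (xs ! k))" for k
  have mem: "i k \<in> Mor (additive_envelope C) [xs ! k] xs" "p k \<in> Mor (additive_envelope C) xs [xs ! k]" if "k < ?n" for k
    using that ob by (auto simp: additive_envelope_simps i_def p_def cat_simps)
  let ?t = "\<lambda>k. comp_mor (additive_envelope C) xs [xs ! k] xs (i k) (p k)"
  have "id_mor (additive_envelope C) xs = sum_mor (additive_envelope C) xs xs (map ?t [0..<?n])"
  proof (rule eq_matI)
    have "set (map ?t [0..<?n]) \<subseteq> Mor (additive_envelope C) xs xs"
      using mem xs ob by (auto intro!: E.comp_closed simp: additive_envelope_simps(1))
    then have s: "sum_mor (additive_envelope C) xs xs (map ?t [0..<?n]) \<in> Mor (additive_envelope C) xs xs"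
      using xs by (intro E.sum_mor_closed)
    then show "dim_row (id_mor (additive_envelope C) xs) = dim_row (sum_mor (additive_envelope C) xs xs (map ?t [0..<?n]))"
      "dim_col (id_mor (additive_envelope C) xs) = dim_col (sum_mor (additive_envelope C) xs xs (map ?t [0..<?n]))"
      by (auto simp: additive_envelope_simps)
    fix a b assume "a < dim_row (sum_mor (additive_envelope C) xs xs (map ?t [0..<?n]))"
      "b < dim_col (sum_mor (additive_envelope C) xs xs (map ?t [0..<?n]))"
    then have ab: "a < ?n" "b < ?n" using s by (auto simp: additive_envelope_simps)
    have e: "?t k $$ (a, b) = (if k = a then (if a = b then id_mor C (xs ! a) else zero_mor C (xs ! b) (xs ! a)) else zero_mor C (xs ! b) (xs ! a))"
      if "k < ?n" for k
      using that ab ob by (auto simp: additive_envelope_simps i_def p_def cat_simps)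
    have "sum_mor (additive_envelope C) xs xs (map ?t [0..<?n]) $$ (a, b)
      = sum_mor C (xs ! b) (xs ! a) (map (\<lambda>k. ?t k $$ (a, b)) [0..<?n])"
      using ab by (simp add: sum_mor_envelope o_def)
    also have "map (\<lambda>k. ?t k $$ (a, b)) [0..<?n] = map (\<lambda>k. if k = a then (if a = b then id_mor C (xs ! a) else zero_mor C (xs ! b) (xs ! a))
        else zero_mor C (xs ! b) (xs ! a)) [0..<?n]"
      using e by (intro map_cong HOL.refl) auto
    also have "sum_mor C (xs ! b) (xs ! a) \<dots> = (if a = b then id_mor C (xs ! a) else zero_mor C (xs ! b) (xs ! a))"
      using ab ob by (intro sum_mor_single) (auto simp: cat_simps)
    finally show "id_mor (additive_envelope C) xs $$ (a, b) = sum_mor (additive_envelope C) xs xs (map ?t [0..<?n]) $$ (a, b)"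
      using ab by (simp add: additive_envelope_simps)
  qed
  with mem show ?thesis by (intro exI[of _ i] exI[of _ p]) simp
qed


section \<open>The idempotent completion\<close>

lemma idempotent_completion_simps:
  "Ob (idempotent_completion C) = {V. fst V \<in> Ob C \<and> snd V \<in> Mor C (fst V) (fst V) \<and>
     comp_mor C (fst V) (fst V) (fst V) (snd V) (snd V) = snd V}"
  "Mor (idempotent_completion C) V Y = {f \<in> Mor C (fst V) (fst Y).
     comp_mor C (fst V) (fst Y) (fst Y) (snd Y) f = f \<and> comp_mor C (fst V) (fst V) (fst Y) f (snd V) = f}"
  "id_mor (idempotent_completion C) V = snd V"
  "comp_mor (idempotent_completion C) V Y Z = comp_mor C (fst V) (fst Y) (fst Z)"
  "zero_mor (idempotent_completion C) V Y = zero_mor C (fst V) (fst Y)"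
  "add_mor (idempotent_completion C) V Y = add_mor C (fst V) (fst Y)"
  "unit_ob (idempotent_completion C) = (unit_ob C, id_mor C (unit_ob C))"
  "tensor_ob (idempotent_completion C) V Y
     = (tensor_ob C (fst V) (fst Y), tensor_mor C (fst V) (fst V) (fst Y) (fst Y) (snd V) (snd Y))"
  "tensor_mor (idempotent_completion C) V V' Y Y' = tensor_mor C (fst V) (fst V') (fst Y) (fst Y')"
  by (auto simp: idempotent_completion_def split: prod.splits)

lemma sum_mor_idempotent_completion:
  "sum_mor (idempotent_completion C) V Y = sum_mor C (fst V) (fst Y)"
  by (intro ext) (simp add: sum_mor_def idempotent_completion_simps)

lemma idempotent_completion_preadditive:
  fixes C :: "('o, 'm, 'k) lin_moncat"
  assumes "preadditive_category C"
  shows "preadditive_category (idempotent_completion C)"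
proof -
  interpret preadditive_category C by fact
  note simps = idempotent_completion_simps
  have comp: "comp_mor C x y z g f \<in> {h \<in> Mor C x z. comp_mor C x z z e h = h \<and> comp_mor C x x z h d = h}"
    if "x \<in> Ob C" "y \<in> Ob C" "z \<in> Ob C" "g \<in> Mor C y z" "f \<in> Mor C x y" "e \<in> Mor C z z" "d \<in> Mor C x x"
      "comp_mor C y z z e g = g" "comp_mor C x x y f d = f" for x y z f g e d
    using that comp_assoc[of x y z z e g f] comp_assoc[of x x y z g f d] by (simp add: comp_closed)
  show ?thesis
  proof (intro preadditive_category.intro, goal_cases)
    case (2 x y z g f)
    then show ?case using comp[of "fst x" "fst y" "fst z" g f "snd z" "snd x"] by (simp add: simps)
  next
    case (6 x y)
    show ?case
    proof (rule comm_groupI)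
      fix f assume "f \<in> carrier \<lparr>carrier = Mor (idempotent_completion C) x y,
          monoid.mult = add_mor (idempotent_completion C) x y, one = zero_mor (idempotent_completion C) x y\<rparr>"
      then show "\<exists>g\<in>carrier \<lparr>carrier = Mor (idempotent_completion C) x y,
          monoid.mult = add_mor (idempotent_completion C) x y, one = zero_mor (idempotent_completion C) x y\<rparr>.
          g \<otimes>\<^bsub>\<lparr>carrier = Mor (idempotent_completion C) x y,
          monoid.mult = add_mor (idempotent_completion C) x y, one = zero_mor (idempotent_completion C) x y\<rparr>\<^esub> f
          = \<one>\<^bsub>\<lparr>carrier = Mor (idempotent_completion C) x y,
          monoid.mult = add_mor (idempotent_completion C) x y, one = zero_mor (idempotent_completion C) x y\<rparr>\<^esub>"
        using 6 by (intro bexI[of _ "neg_mor C (fst x) (fst y) f"]) (auto simp: simps cat_simps)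
    qed (use 6 in \<open>auto simp: simps cat_simps intro: add_commute\<close>)
  qed (auto simp: simps comp_assoc comp_add_left comp_add_right)
qed

lemma idempotent_completion_monoidal:
  fixes C :: "('o, 'm, 'k) lin_moncat"
  assumes "monoidal_preadditive C"
  shows "monoidal_preadditive (idempotent_completion C)"
proof -
  interpret monoidal_preadditive C by fact
  note simps = idempotent_completion_simps
  interpret K: preadditive_category "idempotent_completion C"
    by (rule idempotent_completion_preadditive) unfold_locales
  show ?thesis
    by (intro monoidal_preadditive.intro monoidal_preadditive_axioms.intro K.preadditive_category_axioms)
       (auto simp: simps tensor_simps unit_closed tensor_ob_assoc tensor_ob_unit_left tensor_ob_unit_right
         tensor_comp tensor_assoc tensor_unit_left tensor_unit_right cat_simps intro!: prod_eqI)
qed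

text \<open>An idempotent \<open>e\<close> on an object over \<open>x\<close> is split by the object
  \<open>(x, e)\<close>, with \<open>e\<close> itself as both \<open>r\<close> and
  \<open>s\<close>.\<close>

lemma idempotent_completion_split:
  fixes C :: "('o, 'm, 'k) lin_moncat"
  assumes "preadditive_category C" "V \<in> Ob (idempotent_completion C)" "e \<in> Mor (idempotent_completion C) V V"
    "comp_mor (idempotent_completion C) V V V e e = e"
  shows "\<exists>Y\<in>Ob (idempotent_completion C). \<exists>r\<in>Mor (idempotent_completion C) V Y. \<exists>s\<in>Mor (idempotent_completion C) Y V.
    comp_mor (idempotent_completion C) Y V Y r s = id_mor (idempotent_completion C) Y \<and>
    comp_mor (idempotent_completion C) V Y V s r = e"
  using assms by (intro bexI[of _ "(fst V, e)"] bexI[of _ e]) (auto simp: idempotent_completion_simps)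

text \<open>The sum of \<open>(x, e)\<close> and \<open>(y, d)\<close> is cut out of a biproduct of
  \<open>x\<close> and \<open>y\<close> by the idempotent \<open>i e p + j d q\<close>, with
  structure maps \<open>i e\<close>, \<open>j d\<close>, \<open>e p\<close> and
  \<open>d q\<close>.\<close>

lemma idempotent_completion_biproduct:
  fixes C :: "('o, 'm, 'k) lin_moncat"
  assumes "preadditive_category C" "\<And>x y. \<lbrakk>x \<in> Ob C; y \<in> Ob C\<rbrakk> \<Longrightarrow> \<exists>z. direct_sum C z [x, y]"
    and V: "V \<in> Ob (idempotent_completion C)" and Y: "Y \<in> Ob (idempotent_completion C)"
  shows "\<exists>Z. direct_sum (idempotent_completion C) Z [V, Y]"
proof -
  interpret preadditive_category C by fact
  interpret K: preadditive_category "idempotent_completion C"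
    by (rule idempotent_completion_preadditive) fact
  obtain x e where [simp]: "V = (x, e)" by (cases V)
  obtain y d where [simp]: "Y = (y, d)" by (cases Y)
  have x: "x \<in> Ob C" "e \<in> Mor C x x" and ee: "comp_mor C x x x e e = e" using V by (auto simp: idempotent_completion_simps)
  have y: "y \<in> Ob C" "d \<in> Mor C y y" and dd: "comp_mor C y y y d d = d" using Y by (auto simp: idempotent_completion_simps)
  obtain z i j p q where z: "biproduct C z x y i j p q" using assms(2)[OF x(1) y(1)] direct_sum_pair by blast
  then have t: "z \<in> Ob C" "i \<in> Mor C x z" "j \<in> Mor C y z" "p \<in> Mor C z x" "q \<in> Mor C z y"
    and b: "comp_mor C x z x p i = id_mor C x" "comp_mor C y z y q j = id_mor C y"
      "comp_mor C y z x p j = zero_mor C y x" "comp_mor C x z y q i = zero_mor C x y"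
    by (simp_all add: biproduct_def)
  note r = comp_reassoc[OF b(1)] comp_reassoc[OF b(2)] comp_reassoc[OF b(3)] comp_reassoc[OF b(4)]
    comp_reassoc[OF ee] comp_reassoc[OF dd]
  let ?ie = "comp_mor C x x z i e" and ?jd = "comp_mor C y y z j d" and ?ep = "comp_mor C z x x e p" and ?dq = "comp_mor C z y y d q"
  let ?E = "add_mor C z z (comp_mor C z x z i ?ep) (comp_mor C z y z j ?dq)"
  have "biproduct (idempotent_completion C) (z, ?E) V Y ?ie ?jd ?ep ?dq"
    unfolding biproduct_def idempotent_completion_simps
    using x y t by (simp add: cat_simps comp_assoc ee dd b r)
  then show ?thesis unfolding K.direct_sum_pair by blast
qed

section \<open>Even morphisms of the \<open>\<Pi>\<close>-envelope\<close>

declare add_bit_eq_xor [simp del] mult_bit_eq_and [simp del]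

lemma koszul_zero [simp]: "koszul 0 = 1"
  by (simp add: koszul_def)

lemma (in linear_category) scale_zero:
  assumes "x \<in> Ob C" "y \<in> Ob C"
  shows "scale_mor C x y a (zero_mor C x y) = zero_mor C x y"
  using assms by (intro add_idem_zero) (simp_all add: add_simps scale_closed flip: scale_add)

section \<open>Parity components\<close>

context supercategory
begin

lemma homog_closed: "\<lbrakk>x \<in> Ob A; y \<in> Ob A; f \<in> homog A x y p\<rbrakk> \<Longrightarrow> f \<in> Mor A x y"
  using homog_subset by blast

lemma homog_decomp_ex:
  assumes "x \<in> Ob A" "y \<in> Ob A" "f \<in> Mor A x y"
  shows "\<exists>g\<in>homog A x y 0. \<exists>h\<in>homog A x y 1. f = add_mor A x y g h"
  using ex1_implies_ex[OF homog_decomp[OF assms]] by auto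

lemma homog_decomp_unique:
  assumes "x \<in> Ob A" "y \<in> Ob A" "g \<in> homog A x y p" "h \<in> homog A x y (p + 1)"
    "g' \<in> homog A x y p" "h' \<in> homog A x y (p + 1)" "add_mor A x y g h = add_mor A x y g' h'"
  shows "g = g'" "h = h'"
proof -
  have ex1: "\<lbrakk>\<exists>!P. Q P; Q P; Q P'\<rbrakk> \<Longrightarrow> P = P'" for Q and P P' :: "'m \<times> 'm" by blast
  have *: "u = u' \<and> v = v'"
    if uv: "u \<in> homog A x y 0" "v \<in> homog A x y 1" "u' \<in> homog A x y 0" "v' \<in> homog A x y 1"
      "add_mor A x y u v = add_mor A x y u' v'" for u v u' v'
  proof -
    have "add_mor A x y u v \<in> Mor A x y" using uv(1,2) assms(1,2) by (simp add: add_closed homog_closed)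
    from ex1[OF homog_decomp[OF assms(1,2) this], of "(u, v)" "(u', v')"] show ?thesis
      using uv by simp
  qed
  have m: "g \<in> Mor A x y" "h \<in> Mor A x y" "g' \<in> Mor A x y" "h' \<in> Mor A x y"
    using assms(3-6) homog_closed[OF assms(1,2)] by blast+
  have "g = g' \<and> h = h'"
  proof (cases p)
    case zero
    then show ?thesis using assms(3-6) by (intro *[OF _ _ _ _ assms(7)]) simp_all
  next
    \<comment> \<open>The axiom lists the even part first, so for \<open>p = 1\<close> the two
      summands change places.\<close>
    case one
    have "add_mor A x y h g = add_mor A x y h' g'"
      using assms(7) m by (simp only: add_commute[OF assms(1,2) m(1,2)] add_commute[OF assms(1,2) m(3,4)])
    with one assms(3-6) show ?thesis using *[of h g h' g'] by simp
  qed
  then show "g = g'" "h = h'" by simp_all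
qed

lemma homog_part_same:
  assumes "x \<in> Ob A" "y \<in> Ob A" "f \<in> homog A x y p"
  shows "homog_part A x y p f = f"
  unfolding homog_part_def
proof (rule the_equality)
  show "f \<in> homog A x y p \<and> (\<exists>h\<in>homog A x y (p + 1). f = add_mor A x y f h)"
    using assms homog_zero[OF assms(1,2), of "p + 1"] homog_closed[OF assms]
    by (intro conjI bexI[of _ "zero_mor A x y"]) (simp_all add: add_zero_right)
  fix g assume "g \<in> homog A x y p \<and> (\<exists>h\<in>homog A x y (p + 1). f = add_mor A x y g h)"
  then obtain h where "g \<in> homog A x y p" "h \<in> homog A x y (p + 1)" "f = add_mor A x y g h" by blast
  moreover have "add_mor A x y f (zero_mor A x y) = f"
    using assms homog_closed[OF assms] by (simp add: add_zero_right)
  ultimately show "g = f"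
    using homog_decomp_unique(1)[OF assms(1,2) _ _ assms(3) homog_zero[OF assms(1,2)]] by simp
qed

lemma homog_part_other:
  assumes "x \<in> Ob A" "y \<in> Ob A" "f \<in> homog A x y p" "q \<noteq> p"
  shows "homog_part A x y q f = zero_mor A x y"
proof -
  have q: "q + 1 = p" using assms(4) by (cases p; cases q) auto
  show ?thesis
    unfolding homog_part_def q
  proof (rule the_equality)
    show "zero_mor A x y \<in> homog A x y q \<and> (\<exists>h\<in>homog A x y p. f = add_mor A x y (zero_mor A x y) h)"
      using assms homog_closed[OF assms(1-3)]
      by (intro conjI bexI[of _ f]) (simp_all add: add_zero_left homog_zero)
    fix g assume "g \<in> homog A x y q \<and> (\<exists>h\<in>homog A x y p. f = add_mor A x y g h)"
    then obtain h where gh: "g \<in> homog A x y q" "h \<in> homog A x y p" and eq: "f = add_mor A x y g h" by blast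
    have "add_mor A x y (zero_mor A x y) f = f"
      using assms homog_closed[OF assms(1-3)] by (simp add: add_zero_left)
    then have eq': "add_mor A x y g h = add_mor A x y (zero_mor A x y) f" using eq by simp
    show "g = zero_mor A x y"
      by (rule homog_decomp_unique(1)[OF assms(1,2) gh(1) _ homog_zero[OF assms(1,2)] _ eq'])
         (unfold q, fact gh(2), fact assms(3))
  qed
qed

end

text \<open>The parity of \<open>f_a^b\<close> is that of \<open>f\<close> plus
  \<open>a + b\<close>. Even morphisms of the envelope are therefore the homogeneous morphisms of
  parity \<open>a + b\<close>.\<close>

lemma even_envelope_simps:
  fixes A :: "('o, 'm, 'k::field) supercat"
  shows "Ob (underlying (Pi_envelope A)) = {U. snd U \<in> Ob A}"
  "Mor (underlying (Pi_envelope A)) U V = homog A (snd U) (snd V) (fst U + fst V)"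
  "id_mor (underlying (Pi_envelope A)) U = id_mor A (snd U)"
  "comp_mor (underlying (Pi_envelope A)) U V W = comp_mor A (snd U) (snd V) (snd W)"
  "zero_mor (underlying (Pi_envelope A)) U V = zero_mor A (snd U) (snd V)"
  "add_mor (underlying (Pi_envelope A)) U V = add_mor A (snd U) (snd V)"
  "unit_ob (underlying (Pi_envelope A)) = (0, unit_ob A)"
  "tensor_ob (underlying (Pi_envelope A)) U V = (fst U + fst V, tensor_ob A (snd U) (snd V))"
  by (auto simp: underlying_def Pi_envelope_def lin_moncat.truncate_def split: prod.splits)

context strict_monoidal_supercategory
begin

text \<open>The axioms locate tensor products of homogeneous morphisms only, so both factors are
  first split by parity.\<close>

lemma tensor_closed: 
  assumes "x \<in> Ob A" "x' \<in> Ob A" "y \<in> Ob A" "y' \<in> Ob A" "f \<in> Mor A x x'" "g \<in> Mor A y y'"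
  shows "tensor_mor A x x' y y' f g \<in> Mor A (tensor_ob A x y) (tensor_ob A x' y')"
proof -
  obtain u v where f: "u \<in> homog A x x' 0" "v \<in> homog A x x' 1" "f = add_mor A x x' u v"
    using homog_decomp_ex[OF assms(1,2,5)] by blast
  obtain u' v' where g: "u' \<in> homog A y y' 0" "v' \<in> homog A y y' 1" "g = add_mor A y y' u' v'"
    using homog_decomp_ex[OF assms(3,4,6)] by blast
  have *: "tensor_mor A x x' y y' s t \<in> Mor A (tensor_ob A x y) (tensor_ob A x' y')"
    if "s \<in> homog A x x' p" "t \<in> homog A y y' q" for s t p q
    using tensor_homog[OF assms(1-4) that] assms by (auto intro: homog_closed tensor_ob_closed)
  have m: "u \<in> Mor A x x'" "v \<in> Mor A x x'" "u' \<in> Mor A y y'" "v' \<in> Mor A y y'"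
    using f g assms homog_closed by blast+
  show ?thesis
    unfolding f(3) g(3) using assms(1-4) m f(1,2) g(1,2)
    by (simp add: tensor_add_left tensor_add_right add_closed tensor_ob_closed *)
qed

lemma tensor_zero_left: "\<lbrakk>x \<in> Ob A; x' \<in> Ob A; y \<in> Ob A; y' \<in> Ob A; g \<in> Mor A y y'\<rbrakk>
    \<Longrightarrow> tensor_mor A x x' y y' (zero_mor A x x') g = zero_mor A (tensor_ob A x y) (tensor_ob A x' y')"
  by (rule add_idem_zero) (simp_all add: cat_simps tensor_closed tensor_ob_closed flip: tensor_add_left)

lemma tensor_zero_right: "\<lbrakk>x \<in> Ob A; x' \<in> Ob A; y \<in> Ob A; y' \<in> Ob A; f \<in> Mor A x x'\<rbrakk>
    \<Longrightarrow> tensor_mor A x x' y y' f (zero_mor A y y') = zero_mor A (tensor_ob A x y) (tensor_ob A x' y')"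
  by (rule add_idem_zero) (simp_all add: cat_simps tensor_closed tensor_ob_closed flip: tensor_add_right)

end

text \<open>Of the four terms only the one with \<open>p = a + b\<close> and
  \<open>q = c + d\<close> survives, and there the exponent \<open>a q + p d + a d + a c\<close>
  reduces to \<open>(a + b) d\<close> modulo 2.\<close>

lemma even_envelope_tensor:
  fixes A :: "('o, 'm, 'k::field) supercat"
  assumes "strict_monoidal_supercategory A"
    "snd U \<in> Ob A" "snd U' \<in> Ob A" "snd V \<in> Ob A" "snd V' \<in> Ob A"
    "f \<in> homog A (snd U) (snd U') (fst U + fst U')" "g \<in> homog A (snd V) (snd V') (fst V + fst V')"
  shows "tensor_mor (underlying (Pi_envelope A)) U U' V V' f g
    = scale_mor A (tensor_ob A (snd U) (snd V)) (tensor_ob A (snd U') (snd V'))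
        (koszul ((fst U + fst U') * fst V')) (tensor_mor A (snd U) (snd U') (snd V) (snd V') f g)"
proof -
  interpret strict_monoidal_supercategory A by fact
  note ob = assms(2-5)
  have f: "f \<in> Mor A (snd U) (snd U')" and g: "g \<in> Mor A (snd V) (snd V')"
    using assms homog_closed by blast+
  obtain a x b x' c y d y' where UV: "U = (a, x)" "U' = (b, x')" "V = (c, y)" "V' = (d, y')"
    by (cases U; cases U'; cases V; cases V') blast
  have part: "homog_part A x x' p f = (if p = a + b then f else zero_mor A x x')"
    "homog_part A y y' p g = (if p = c + d then g else zero_mor A y y')" for p
    using homog_part_same[of x x' f "a + b"] homog_part_other[of x x' f "a + b" p]
      homog_part_same[of y y' g "c + d"] homog_part_other[of y y' g "c + d" p] assms(2-) UV by auto
  have t: "tensor_mor (underlying (Pi_envelope A)) U U' V V' f g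
     = sum_mor A (tensor_ob A x y) (tensor_ob A x' y')
         [scale_mor A (tensor_ob A x y) (tensor_ob A x' y') (koszul (a * q + p * d + a * d + a * c))
            (tensor_mor A x x' y y' (homog_part A x x' p f) (homog_part A y y' q g)).
          p \<leftarrow> [0, 1], q \<leftarrow> [0, 1]]"
    by (simp add: underlying_def Pi_envelope_def lin_moncat.truncate_def UV)
  show ?thesis
    unfolding t part using ob f g UV
    by (cases a; cases b; cases c; cases d)
       (simp_all add: tensor_zero_left tensor_zero_right cat_simps scale_zero scale_closed tensor_closed tensor_ob_closed)
qed

lemma even_envelope_monoidal:
  fixes A :: "('o, 'm, 'k::field) supercat"
  assumes "strict_monoidal_supercategory A"
  shows "monoidal_preadditive (underlying (Pi_envelope A))"
proof -
  interpret strict_monoidal_supercategory A by fact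
  let ?D = "underlying (Pi_envelope A)"
  note simps = even_envelope_simps even_envelope_tensor[OF assms]
  have b: "(0::bit) + a = a" "a + a = (0::bit)" "a + b + b = (a::bit)" "a + (b + b) = (a::bit)" for a b :: bit
    by (cases a; cases b; simp)+
  have comp: "comp_mor A x y z g f \<in> homog A x z (a + c)"
    if "x \<in> Ob A" "y \<in> Ob A" "z \<in> Ob A" "g \<in> homog A y z (b + c)" "f \<in> homog A x y (a + b)" for x y z g f a b c
  proof -
    have "b + c + (a + b) = a + c" by (cases a; cases b; cases c) simp_all
    with homog_comp[OF that] show ?thesis by simp
  qed
  \<comment> \<open>Negation is scaling by -1, which preserves parity.\<close>
  have neg: "neg_mor A x y f \<in> homog A x y p" if "x \<in> Ob A" "y \<in> Ob A" "f \<in> homog A x y p" for x y f p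
  proof -
    have f: "f \<in> Mor A x y" using that homog_closed by blast
    have "scale_mor A x y 0 f = zero_mor A x y"
      using that f by (intro add_idem_zero) (simp_all add: scale_closed flip: scale_add_scalar)
    then have "add_mor A x y f (scale_mor A x y (- 1) f) = zero_mor A x y"
      using scale_add_scalar[OF that(1,2) f, of 1 "- 1"] that f by (simp add: scale_one)
    then have "scale_mor A x y (- 1) f = neg_mor A x y f"
      using that f by (intro neg_unique) (simp_all add: scale_closed)
    then show ?thesis using homog_scale[OF that, of "- 1"] by simp
  qed
  have grp: "comm_group \<lparr>carrier = Mor ?D U V, monoid.mult = add_mor ?D U V, one = zero_mor ?D U V\<rparr>"
    if "U \<in> Ob ?D" "V \<in> Ob ?D" for U V
  proof (rule comm_groupI)
    have ob: "snd U \<in> Ob A" "snd V \<in> Ob A" using that by (simp_all add: simps)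
    fix f g h
    assume *: "f \<in> carrier \<lparr>carrier = Mor ?D U V, monoid.mult = add_mor ?D U V, one = zero_mor ?D U V\<rparr>"
    then have "f \<in> homog A (snd U) (snd V) (fst U + fst V)" by (simp add: simps)
    then show "\<exists>g\<in>carrier \<lparr>carrier = Mor ?D U V, monoid.mult = add_mor ?D U V, one = zero_mor ?D U V\<rparr>.
       g \<otimes>\<^bsub>\<lparr>carrier = Mor ?D U V, monoid.mult = add_mor ?D U V, one = zero_mor ?D U V\<rparr>\<^esub> f
         = \<one>\<^bsub>\<lparr>carrier = Mor ?D U V, monoid.mult = add_mor ?D U V, one = zero_mor ?D U V\<rparr>\<^esub>"
      using ob neg homog_closed[OF ob]
      by (intro bexI[of _ "neg_mor A (snd U) (snd V) f"]) (auto simp: simps add_neg_left)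
  qed (use that homog_closed in \<open>auto simp: simps homog_add homog_zero add_zero_left intro: add_commute add_assoc\<close>)
  have pre: "preadditive_category ?D"
  proof (intro preadditive_category.intro grp, goal_cases)
    case (1 x)
    then show ?case using homog_id[of "snd x"] by (simp add: simps b)
  next
    case (2 x y z g f)
    then show ?case by (simp add: simps comp)
  next
    case (3 w x y z h g f)
    then show ?case by (auto simp: simps intro!: comp_assoc homog_closed)
  next
    case (4 x y f)
    then show ?case by (auto simp: simps intro!: comp_id_left homog_closed)
  next
    case (5 x y f)
    then show ?case by (auto simp: simps intro!: comp_id_right homog_closed)
  next
    case (8 x y z g g' f)
    then show ?case by (auto simp: simps intro!: comp_add_left homog_closed)
  next
    case (9 x y z g f f')
    then show ?case by (auto simp: simps intro!: comp_add_right homog_closed)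
  qed
  note th = tensor_homog[THEN homog_scale[rotated 2]]
  have T: "tensor_mor A x x' y y' f g \<in> homog A (tensor_ob A x y) (tensor_ob A x' y') (a + c + (b + d))"
    if "x \<in> Ob A" "x' \<in> Ob A" "y \<in> Ob A" "y' \<in> Ob A"
      "f \<in> homog A x x' (a + b)" "g \<in> homog A y y' (c + d)" for x x' y y' f g a b c d
    using tensor_homog[OF that] by (simp add: ac_simps)
  have mon: "monoidal_preadditive_axioms ?D"
  proof (intro monoidal_preadditive_axioms.intro, goal_cases)
    case (6 x x' y y' f g)
    then show ?case by (auto simp: simps intro!: homog_scale T tensor_ob_closed)
  next
    case (7 x x' x'' y y' y'' f' f g' g)
    then have ob: "snd x \<in> Ob A" "snd x' \<in> Ob A" "snd x'' \<in> Ob A" "snd y \<in> Ob A" "snd y' \<in> Ob A" "snd y'' \<in> Ob A"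
      and m: "f' \<in> homog A (snd x') (snd x'') (fst x' + fst x'')" "f \<in> homog A (snd x) (snd x') (fst x + fst x')"
        "g' \<in> homog A (snd y') (snd y'') (fst y' + fst y'')" "g \<in> homog A (snd y) (snd y') (fst y + fst y')"
      by (simp_all add: simps)
    note M = m[THEN homog_closed[rotated 2]]
    \<comment> \<open>The Koszul sign of the super interchange law cancels against the signs of the
      two tensor products. The sign left over is the one that belongs to the tensor product of the
      composites, so the ordinary law holds.\<close>
    have sgn: "koszul ((fst x + fst x') * fst y') * (koszul ((fst x' + fst x'') * fst y'') * koszul ((fst y' + fst y'') * (fst x + fst x')))
      = (koszul ((fst x + fst x'') * fst y'') :: 'k)"
      by (cases "fst x"; cases "fst x'"; cases "fst x''"; cases "fst y'"; cases "fst y''") (simp_all add: koszul_def)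
    show ?case
      using ob m M comp[OF ob(1-3) m(1,2)] comp[OF ob(4-6) m(3,4)]
        super_interchange[OF ob M(1) m(3) m(2) M(4)]
      by (simp add: simps comp_scale_left comp_scale_right tensor_ob_closed tensor_closed scale_closed comp_closed
          scale_scale sgn)
  next
    case (8 x y)
    then show ?case
      using homog_id[of "snd x"] homog_id[of "snd y"]
      by (simp add: simps b tensor_id scale_one tensor_ob_closed id_closed)
  next
    case (9 x x' y y' z z' f g h)
    then have ob: "snd x \<in> Ob A" "snd x' \<in> Ob A" "snd y \<in> Ob A" "snd y' \<in> Ob A" "snd z \<in> Ob A" "snd z' \<in> Ob A"
      and m: "f \<in> homog A (snd x) (snd x') (fst x + fst x')" "g \<in> homog A (snd y) (snd y') (fst y + fst y')"
        "h \<in> homog A (snd z) (snd z') (fst z + fst z')"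
      by (simp_all add: simps)
    note M = m[THEN homog_closed[rotated 2]]
    \<comment> \<open>The signs of the two bracketings agree because the exponent is bilinear in the
      total parity of the left factor and the target label of the right one.\<close>
    have sgn: "koszul ((fst x + fst y + (fst x' + fst y')) * fst z') * koszul ((fst x + fst x') * fst y')
      = (koszul ((fst x + fst x') * (fst y' + fst z')) * koszul ((fst y + fst y') * fst z') :: 'k)"
      by (cases "fst x"; cases "fst x'"; cases "fst y"; cases "fst y'"; cases "fst z'") (simp_all add: koszul_def)
    have 1: "scale_mor A (tensor_ob A (snd x) (snd y)) (tensor_ob A (snd x') (snd y')) s (tensor_mor A (snd x) (snd x') (snd y) (snd y') f g)
      \<in> homog A (tensor_ob A (snd x) (snd y)) (tensor_ob A (snd x') (snd y')) (fst x + fst y + (fst x' + fst y'))" for s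
      using ob m by (intro homog_scale T tensor_ob_closed)
    have 2: "scale_mor A (tensor_ob A (snd y) (snd z)) (tensor_ob A (snd y') (snd z')) s (tensor_mor A (snd y) (snd y') (snd z) (snd z') g h)
      \<in> homog A (tensor_ob A (snd y) (snd z)) (tensor_ob A (snd y') (snd z')) (fst y + fst z + (fst y' + fst z'))" for s
      using ob m by (intro homog_scale T tensor_ob_closed)
    show ?case
      using ob m M 1 2
      by (simp add: simps tensor_ob_closed tensor_scale_left tensor_scale_right tensor_closed scale_scale sgn
          tensor_assoc[symmetric] tensor_ob_assoc[symmetric])
  next
    case (10 x x' f)
    then show ?case
      using homog_id[OF unit_closed] homog_closed[of "snd x" "snd x'" f]
      by (simp add: simps b unit_closed tensor_unit_left tensor_ob_unit scale_one)
  next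
    case (11 x x' f)
    then show ?case
      using homog_id[OF unit_closed] homog_closed[of "snd x" "snd x'" f]
      by (simp add: simps b unit_closed tensor_unit_right tensor_ob_unit scale_one)
  next
    case (12 x x' y y' f f' g)
    then show ?case
      using homog_closed[of "snd x" "snd x'" f] homog_closed[of "snd x" "snd x'" f'] homog_closed[of "snd y" "snd y'" g]
      by (simp add: simps homog_add tensor_add_left scale_add tensor_ob_closed tensor_closed)
  next
    case (13 x x' y y' f g g')
    then show ?case
      using homog_closed[of "snd x" "snd x'" f] homog_closed[of "snd y" "snd y'" g] homog_closed[of "snd y" "snd y'" g']
      by (simp add: simps homog_add tensor_add_right scale_add tensor_ob_closed tensor_closed)
  qed (auto simp: simps unit_closed tensor_ob_closed tensor_ob_assoc tensor_ob_unit add.assoc)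
  show ?thesis using pre mon by (rule monoidal_preadditive.intro)
qed

section \<open>Integral linear combinations\<close>

text \<open>Basis statements are phrased through this evaluation map: spanning is surjectivity onto
  the ring in question, independence is a trivial kernel.\<close>

definition int_comb :: "('i \<Rightarrow> 'r::comm_ring_1) \<Rightarrow> ('i \<Rightarrow>\<^sub>0 int) \<Rightarrow> 'r" where
  "int_comb v n = (\<Sum>i\<in>Poly_Mapping.keys n. of_int (Poly_Mapping.lookup n i) * v i)"

lemma int_comb_superset:
  assumes "finite A" "Poly_Mapping.keys n \<subseteq> A"
  shows "int_comb v n = (\<Sum>i\<in>A. of_int (Poly_Mapping.lookup n i) * v i)"
  unfolding int_comb_def using assms by (intro sum.mono_neutral_left) (auto simp: in_keys_iff)

lemma int_comb_zero [simp]: "int_comb v 0 = 0"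
  by (simp add: int_comb_def)

lemma int_comb_of [simp]: "int_comb v (frag_of i) = v i"
  by (simp add: int_comb_def)

lemma int_comb_diff: "int_comb v (m - n) = int_comb v m - int_comb v n"
proof -
  let ?A = "Poly_Mapping.keys m \<union> Poly_Mapping.keys n"
  have "Poly_Mapping.keys (m - n) \<subseteq> ?A" by (auto simp: in_keys_iff lookup_minus)
  then show ?thesis
    by (simp add: int_comb_superset[of ?A] lookup_minus left_diff_distrib sum_subtractf)
qed

lemma int_comb_minus: "int_comb v (- n) = - int_comb v n"
  using int_comb_diff[of v 0 n] by simp

lemma int_comb_add: "int_comb v (m + n) = int_comb v m + int_comb v n"
  using int_comb_diff[of v m "- n"] by (simp add: int_comb_minus)

lemma int_comb_extend: "int_comb v (frag_extend (\<lambda>i. frag_of (g i)) n) = int_comb (v \<circ> g) n"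
  by (induction n rule: frag_induction[OF subset_UNIV]) (simp_all add: int_comb_diff frag_extend_diff)

text \<open>Here and in \<open>hom_finsum_add_pow\<close> an additive map carries multiples and sums
  from a ring given as a record to a type-class ring, where they are computed.\<close>

lemma hom_add_pow:
  fixes R (structure) and h :: "'a \<Rightarrow> 'r::comm_ring_1" and k :: int
  assumes "abelian_group R" and add: "\<And>x y. \<lbrakk>x \<in> carrier R; y \<in> carrier R\<rbrakk> \<Longrightarrow> h (x \<oplus> y) = h x + h y"
    and x: "x \<in> carrier R"
  shows "[k] \<cdot> x \<in> carrier R" "h ([k] \<cdot> x) = of_int k * h x"
proof -
  interpret abelian_group R by fact
  have h0: "h \<zero> = 0" using add[of \<zero> \<zero>] by simp
  have nat: "[m] \<cdot> x \<in> carrier R \<and> h ([m] \<cdot> x) = of_nat m * h x" for m :: nat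
    using x by (induction m) (auto simp: h0 add algebra_simps)
  have "h (\<ominus> y) = - h y" if "y \<in> carrier R" for y
    using add[of y "\<ominus> y"] that h0 by (simp add: r_neg eq_neg_iff_add_eq_0 add.commute)
  then show "[k] \<cdot> x \<in> carrier R" "h ([k] \<cdot> x) = of_int k * h x"
    using nat by (cases "k \<ge> 0"; simp add: add_pow_int_ge add_pow_int_lt)+
qed

lemma hom_finsum_add_pow:
  fixes R (structure) and h :: "'a \<Rightarrow> 'r::comm_ring_1"
  assumes "abelian_group R" and add: "\<And>x y. \<lbrakk>x \<in> carrier R; y \<in> carrier R\<rbrakk> \<Longrightarrow> h (x \<oplus> y) = h x + h y"
    and "Poly_Mapping.keys c \<subseteq> carrier R"
  shows "(\<Oplus>b\<in>Poly_Mapping.keys c. [Poly_Mapping.lookup c b] \<cdot> b) \<in> carrier R"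
    "h (\<Oplus>b\<in>Poly_Mapping.keys c. [Poly_Mapping.lookup c b] \<cdot> b) = int_comb h c"
proof -
  interpret abelian_group R by fact
  have pow: "[k] \<cdot> x \<in> carrier R" "h ([k] \<cdot> x) = of_int k * h x" if "x \<in> carrier R" for k :: int and x
    by (rule hom_add_pow[OF assms(1) _ that]; erule (1) add)+
  have h0: "h \<zero> = 0" using add[of \<zero> \<zero>] by simp
  have "(\<Oplus>b\<in>A. [Poly_Mapping.lookup c b] \<cdot> b) \<in> carrier R \<and>
     h (\<Oplus>b\<in>A. [Poly_Mapping.lookup c b] \<cdot> b) = (\<Sum>b\<in>A. of_int (Poly_Mapping.lookup c b) * h b)"
    if "finite A" "A \<subseteq> carrier R" for A
    using that
  proof (induction A rule: finite_induct)
    case (insert a A)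
    then have "(\<lambda>b. [Poly_Mapping.lookup c b] \<cdot> b) \<in> A \<rightarrow> carrier R" "[Poly_Mapping.lookup c a] \<cdot> a \<in> carrier R"
      using pow(1) by auto
    with insert show ?case using pow by (simp add: add)
  qed (simp add: h0)
  from this[OF finite_keys assms(3)]
  show "(\<Oplus>b\<in>Poly_Mapping.keys c. [Poly_Mapping.lookup c b] \<cdot> b) \<in> carrier R"
    "h (\<Oplus>b\<in>Poly_Mapping.keys c. [Poly_Mapping.lookup c b] \<cdot> b) = int_comb h c"
    by (simp_all add: int_comb_def)
qed

text \<open>Coefficients are compared in the target of the injective additive map \<open>h\<close>:
  \<open>span\<close> yields their existence and \<open>indep\<close> their uniqueness.\<close>

lemma based_ringI:
  fixes R (structure) and h :: "'a \<Rightarrow> 'r::comm_ring_1" and g :: "'i \<Rightarrow> 'a"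
  assumes "ring R" and add: "\<And>x y. \<lbrakk>x \<in> carrier R; y \<in> carrier R\<rbrakk> \<Longrightarrow> h (x \<oplus> y) = h x + h y"
    and inj: "inj_on h (carrier R)" and g: "\<And>i. g i \<in> carrier R"
    and span: "\<And>x. x \<in> carrier R \<Longrightarrow> \<exists>n. h x = int_comb (h \<circ> g) n"
    and indep: "\<And>n. int_comb (h \<circ> g) n = 0 \<Longrightarrow> n = 0"
  shows "based_ring R (range g)"
  unfolding based_ring_def
proof (intro conjI ballI)
  interpret ring R by fact
  have fin: "(\<Oplus>b\<in>Poly_Mapping.keys c. [Poly_Mapping.lookup c b] \<cdot> b) \<in> carrier R"
    "h (\<Oplus>b\<in>Poly_Mapping.keys c. [Poly_Mapping.lookup c b] \<cdot> b) = int_comb h c"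
    if "Poly_Mapping.keys c \<subseteq> carrier R" for c
    by (rule hom_finsum_add_pow[OF abelian_group_axioms _ that]; erule (1) add)+
  show "range g \<subseteq> carrier R" using g by auto
  have zero_imp: "d = 0" if d: "Poly_Mapping.keys d \<subseteq> range g" "int_comb h d = 0" for d
  proof -
    \<comment> \<open>A combination of basis elements is lifted to a combination of indices by
      choosing preimages under \<open>g\<close>.\<close>
    define n where "n = frag_extend (\<lambda>b. frag_of (inv_into UNIV g b)) d"
    have dn: "d = frag_extend (\<lambda>i. frag_of (g i)) n"
      unfolding n_def using d(1)
      by (induction d rule: frag_induction) (auto simp: frag_extend_diff f_inv_into_f)
    then have "int_comb (h \<circ> g) n = 0" using d(2) by (simp add: int_comb_extend)
    then have "n = 0" by (rule indep)
    then show ?thesis by (simp add: dn)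
  qed
  fix r assume r: "r \<in> carrier R"
  obtain n where n: "h r = int_comb (h \<circ> g) n" using span[OF r] by blast
  define c where "c = frag_extend (\<lambda>i. frag_of (g i)) n"
  have c: "Poly_Mapping.keys c \<subseteq> range g"
    unfolding c_def using keys_frag_extend[of "\<lambda>i. frag_of (g i)" n] by auto
  have eq: "r = (\<Oplus>b\<in>Poly_Mapping.keys d. [Poly_Mapping.lookup d b] \<cdot> b) \<longleftrightarrow> int_comb h r' = int_comb h d"
    if "Poly_Mapping.keys d \<subseteq> range g" "h r = int_comb h r'" for d r'
  proof -
    have "Poly_Mapping.keys d \<subseteq> carrier R" using that(1) g by auto
    note f = fin[OF this]
    have "r = (\<Oplus>b\<in>Poly_Mapping.keys d. [Poly_Mapping.lookup d b] \<cdot> b)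
        \<longleftrightarrow> h r = h (\<Oplus>b\<in>Poly_Mapping.keys d. [Poly_Mapping.lookup d b] \<cdot> b)"
      using inj_on_eq_iff[OF inj r f(1)] by simp
    then show ?thesis by (simp only: f(2) that(2))
  qed
  have hr: "h r = int_comb h c" by (simp add: n c_def int_comb_extend)
  show "\<exists>!c :: 'a \<Rightarrow>\<^sub>0 int. Poly_Mapping.keys c \<subseteq> range g \<and> r = (\<Oplus>b\<in>Poly_Mapping.keys c. [Poly_Mapping.lookup c b] \<cdot> b)"
  proof (rule ex1I[of _ c])
    show "Poly_Mapping.keys c \<subseteq> range g \<and> r = (\<Oplus>b\<in>Poly_Mapping.keys c. [Poly_Mapping.lookup c b] \<cdot> b)"
      using c eq[OF c hr] by simp
    fix d :: "'a \<Rightarrow>\<^sub>0 int" assume d: "Poly_Mapping.keys d \<subseteq> range g \<and> r = (\<Oplus>b\<in>Poly_Mapping.keys d. [Poly_Mapping.lookup d b] \<cdot> b)"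
    then have "int_comb h c = int_comb h d" using eq[OF _ hr] by blast
    then have "int_comb h (d - c) = 0" by (simp add: int_comb_diff)
    moreover have "Poly_Mapping.keys (d - c) \<subseteq> range g"
    proof -
      have "Poly_Mapping.keys (d - c) \<subseteq> Poly_Mapping.keys d \<union> Poly_Mapping.keys c"
        by (auto simp: in_keys_iff lookup_minus)
      then show ?thesis using c d by blast
    qed
    ultimately have "d - c = 0" using zero_imp by blast
    then show "d = c" by simp
  qed
qed fact


section \<open>Characters of schurian monoidal categories\<close>

context preadditive_category
begin

lemma isomorphic_refl: "x \<in> Ob C \<Longrightarrow> isomorphic C x x"
  unfolding isomorphic_def iso_mor_def
  by (intro exI[of _ "id_mor C x"] conjI bexI[of _ "id_mor C x"]) (simp_all add: cat_simps)

lemma isomorphic_sym: "isomorphic C x y \<Longrightarrow> isomorphic C y x"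
  unfolding isomorphic_def iso_mor_def by blast

lemma isomorphic_trans:
  assumes "isomorphic C x y" "isomorphic C y z" and ob: "x \<in> Ob C" "y \<in> Ob C" "z \<in> Ob C"
  shows "isomorphic C x z"
proof -
  obtain f g where f: "f \<in> Mor C x y" "g \<in> Mor C y x" "comp_mor C x y x g f = id_mor C x" "comp_mor C y x y f g = id_mor C y"
    using assms(1) unfolding isomorphic_def iso_mor_def by blast
  obtain h k where h: "h \<in> Mor C y z" "k \<in> Mor C z y" "comp_mor C y z y k h = id_mor C y" "comp_mor C z y z h k = id_mor C z"
    using assms(2) unfolding isomorphic_def iso_mor_def by blast
  show ?thesis
    unfolding isomorphic_def iso_mor_def using f h ob
    by (intro exI[of _ "comp_mor C x y z h f"] conjI bexI[of _ "comp_mor C z y x g k"])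
       (simp_all add: cat_simps comp_assoc comp_reassoc[OF f(4)] comp_reassoc[OF h(3)])
qed

lemma iso_class_eq_iff: "\<lbrakk>x \<in> Ob C; y \<in> Ob C\<rbrakk> \<Longrightarrow> iso_class C x = iso_class C y \<longleftrightarrow> isomorphic C x y"
  unfolding iso_class_def using isomorphic_refl isomorphic_sym isomorphic_trans by blast

text \<open>With this the relations for binary sums already force the class of a zero object to be
  0.\<close>

lemma zero_biproduct:
  assumes "x \<in> Ob C" "id_mor C x = zero_mor C x x"
  shows "direct_sum C x [x, x]"
proof -
  have "biproduct C x x x (id_mor C x) (id_mor C x) (id_mor C x) (id_mor C x)"
    unfolding biproduct_def using assms by (simp add: cat_simps)
  then show ?thesis unfolding direct_sum_pair by blast
qed

end

context monoidal_preadditive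
begin

lemma isomorphic_tensor:
  assumes "isomorphic C x x'" "isomorphic C y y'" and ob: "x \<in> Ob C" "x' \<in> Ob C" "y \<in> Ob C" "y' \<in> Ob C"
  shows "isomorphic C (tensor_ob C x y) (tensor_ob C x' y')"
proof -
  obtain f g where f: "f \<in> Mor C x x'" "g \<in> Mor C x' x" "comp_mor C x x' x g f = id_mor C x" "comp_mor C x' x x' f g = id_mor C x'"
    using assms(1) unfolding isomorphic_def iso_mor_def by blast
  obtain h k where h: "h \<in> Mor C y y'" "k \<in> Mor C y' y" "comp_mor C y y' y k h = id_mor C y" "comp_mor C y' y y' h k = id_mor C y'"
    using assms(2) unfolding isomorphic_def iso_mor_def by blast
  show ?thesis
    unfolding isomorphic_def iso_mor_def using f h ob
    by (intro exI[of _ "tensor_mor C x x' y y' f h"] conjI bexI[of _ "tensor_mor C x' x y' y g k"])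
       (simp_all add: tensor_comp tensor_id tensor_closed)
qed

lemma direct_sum_tensor_right:
  assumes "direct_sum C z [x, y]" "u \<in> Ob C"
  shows "direct_sum C (tensor_ob C z u) [tensor_ob C x u, tensor_ob C y u]"
proof -
  obtain i j p q where "biproduct C z x y i j p q" using assms(1) direct_sum_pair by blast
  then have "biproduct C (tensor_ob C z u) (tensor_ob C x u) (tensor_ob C y u)
    (tensor_mor C x z u u i (id_mor C u)) (tensor_mor C y z u u j (id_mor C u))
    (tensor_mor C z x u u p (id_mor C u)) (tensor_mor C z y u u q (id_mor C u))"
    unfolding biproduct_def using assms(2)
    by (simp add: tensor_comp tensor_id tensor_closed tensor_ob_closed cat_simps tensor_zero_left flip: tensor_add_left)
  then show ?thesis unfolding direct_sum_pair by blast
qed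

lemma direct_sum_tensor_left:
  assumes "direct_sum C z [x, y]" "u \<in> Ob C"
  shows "direct_sum C (tensor_ob C u z) [tensor_ob C u x, tensor_ob C u y]"
proof -
  obtain i j p q where "biproduct C z x y i j p q" using assms(1) direct_sum_pair by blast
  then have "biproduct C (tensor_ob C u z) (tensor_ob C u x) (tensor_ob C u y)
    (tensor_mor C u u x z (id_mor C u) i) (tensor_mor C u u y z (id_mor C u) j)
    (tensor_mor C u u z x (id_mor C u) p) (tensor_mor C u u z y (id_mor C u) q)"
    unfolding biproduct_def using assms(2)
    by (simp add: tensor_comp tensor_id tensor_closed tensor_ob_closed cat_simps tensor_zero_right flip: tensor_add_right)
  then show ?thesis unfolding direct_sum_pair by blast
qed

section \<open>The free ring on isomorphism classes\<close>

lemma tensor_class_iso_class: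
  assumes "x \<in> Ob C" "y \<in> Ob C"
  shows "tensor_class C (iso_class C x) (iso_class C y) = iso_class C (tensor_ob C x y)"
proof
  show "tensor_class C (iso_class C x) (iso_class C y) \<subseteq> iso_class C (tensor_ob C x y)"
  proof
    fix z assume "z \<in> tensor_class C (iso_class C x) (iso_class C y)"
    then obtain x' y' where *: "z \<in> Ob C" "x' \<in> Ob C" "isomorphic C x x'" "y' \<in> Ob C" "isomorphic C y y'"
      "isomorphic C (tensor_ob C x' y') z"
      unfolding tensor_class_def iso_class_def by blast
    have "isomorphic C (tensor_ob C x y) z"
      by (rule isomorphic_trans[OF isomorphic_tensor[OF *(3,5)] *(6)]) (use * assms in \<open>auto intro: tensor_ob_closed\<close>)
    then show "z \<in> iso_class C (tensor_ob C x y)" using * by (simp add: iso_class_def)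
  qed
  show "iso_class C (tensor_ob C x y) \<subseteq> tensor_class C (iso_class C x) (iso_class C y)"
    unfolding tensor_class_def iso_class_def using assms isomorphic_refl by blast
qed

text \<open>\<open>frag_extend\<close> is linear extension from generators, so this form exhibits
  the product as bilinear.\<close>

lemma K0_free_mult:
  "monoid.mult (K0_free C) c d = frag_extend (\<lambda>V. frag_extend (\<lambda>W. frag_of (tensor_class C V W)) d) c"
  by (simp add: K0_free_def frag_extend_def frag_cmul_sum)
     (intro sum.cong HOL.refl poly_mapping_eqI, simp add: lookup_single when_def)

lemma K0_free_simps:
  "carrier (K0_free C) = {c. Poly_Mapping.keys c \<subseteq> iso_class C ` Ob C}"
  "one (K0_free C) = frag_of (iso_class C (unit_ob C))"
  "ring.zero (K0_free C) = 0" "add (K0_free C) = (+)"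
  by (simp_all add: K0_free_def)

text \<open>The laws of multiplication are additive in each variable and can be checked on classes
  of objects. There they follow from the strict associativity and unitality of the tensor
  product.\<close>

lemma K0_free_ring: "ring (K0_free C)"
proof -
  let ?R = "K0_free C"
  have diff: "c \<in> carrier ?R \<Longrightarrow> d \<in> carrier ?R \<Longrightarrow> c - d \<in> carrier ?R" for c d
    by (auto simp: K0_free_simps in_keys_iff lookup_minus subset_iff) metis
  have neg: "c \<in> carrier ?R \<Longrightarrow> - c \<in> carrier ?R" for c using diff[of 0 c] by (simp add: K0_free_simps)
  have plus: "c \<in> carrier ?R \<Longrightarrow> d \<in> carrier ?R \<Longrightarrow> c + d \<in> carrier ?R" for c d using diff[of c "- d"] neg by simp
  have mult_diff: "monoid.mult ?R (c - c') d = monoid.mult ?R c d - monoid.mult ?R c' d"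
    "monoid.mult ?R c (d - d') = monoid.mult ?R c d - monoid.mult ?R c d'" for c c' d d'
  proof -
    show "monoid.mult ?R (c - c') d = monoid.mult ?R c d - monoid.mult ?R c' d"
      by (simp add: K0_free_mult frag_extend_diff)
    have "frag_extend (\<lambda>V. f V - g V) c = frag_extend f c - frag_extend g c" for f g :: "'o set \<Rightarrow> 'o set \<Rightarrow>\<^sub>0 int"
      by (induction c rule: frag_induction[OF subset_UNIV]) (simp_all add: frag_extend_diff)
    then show "monoid.mult ?R c (d - d') = monoid.mult ?R c d - monoid.mult ?R c d'"
      by (simp add: K0_free_mult frag_extend_diff)
  qed
  have mult_zero: "monoid.mult ?R 0 d = 0" "monoid.mult ?R c 0 = 0" for c d
    using mult_diff(1)[of 0 0 d] mult_diff(2)[of c 0 0] by simp_all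
  have mult_of: "monoid.mult ?R (frag_of V) (frag_of W) = frag_of (tensor_class C V W)" for V W
    by (simp add: K0_free_mult)
  have ind: "P c" if "c \<in> carrier ?R" "P 0" "\<And>x. x \<in> Ob C \<Longrightarrow> P (frag_of (iso_class C x))"
    "\<And>a b. \<lbrakk>P a; P b\<rbrakk> \<Longrightarrow> P (a - b)" for c P
    using that(1)[unfolded K0_free_simps, simplified] that(2-)
    by (induction c rule: frag_induction) auto
  have cl: "monoid.mult ?R c d \<in> carrier ?R" if "c \<in> carrier ?R" "d \<in> carrier ?R" for c d
    using that(1)
  proof (rule ind)
    fix x assume x: "x \<in> Ob C"
    show "monoid.mult ?R (frag_of (iso_class C x)) d \<in> carrier ?R"
      using that(2)
    proof (rule ind)
      fix y assume "y \<in> Ob C"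
      with x show "monoid.mult ?R (frag_of (iso_class C x)) (frag_of (iso_class C y)) \<in> carrier ?R"
        by (simp add: mult_of tensor_class_iso_class K0_free_simps tensor_ob_closed)
    qed (simp_all add: mult_zero mult_diff diff, simp add: K0_free_simps)
  qed (simp_all add: mult_zero mult_diff diff, simp add: K0_free_simps)
  have assoc: "monoid.mult ?R (monoid.mult ?R c d) e = monoid.mult ?R c (monoid.mult ?R d e)"
    if c: "c \<in> carrier ?R" and d: "d \<in> carrier ?R" and e: "e \<in> carrier ?R" for c d e
    using c
  proof (rule ind)
    fix x assume x: "x \<in> Ob C"
    show "monoid.mult ?R (monoid.mult ?R (frag_of (iso_class C x)) d) e
        = monoid.mult ?R (frag_of (iso_class C x)) (monoid.mult ?R d e)"
      using d
    proof (rule ind)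
      fix y assume y: "y \<in> Ob C"
      show "monoid.mult ?R (monoid.mult ?R (frag_of (iso_class C x)) (frag_of (iso_class C y))) e
          = monoid.mult ?R (frag_of (iso_class C x)) (monoid.mult ?R (frag_of (iso_class C y)) e)"
        using e
      proof (rule ind)
        fix z assume "z \<in> Ob C"
        with x y show "monoid.mult ?R (monoid.mult ?R (frag_of (iso_class C x)) (frag_of (iso_class C y))) (frag_of (iso_class C z))
          = monoid.mult ?R (frag_of (iso_class C x)) (monoid.mult ?R (frag_of (iso_class C y)) (frag_of (iso_class C z)))"
          by (simp add: mult_of tensor_class_iso_class tensor_ob_closed tensor_ob_assoc)
      qed (simp_all add: mult_zero mult_diff)
    qed (simp_all add: mult_zero mult_diff)
  qed (simp_all add: mult_zero mult_diff)
  have one_left: "monoid.mult ?R (one ?R) c = c" if "c \<in> carrier ?R" for c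
    using that
  proof (rule ind)
    fix x assume "x \<in> Ob C"
    then show "monoid.mult ?R (one ?R) (frag_of (iso_class C x)) = frag_of (iso_class C x)"
      by (simp add: K0_free_simps(2) mult_of tensor_class_iso_class unit_closed tensor_ob_unit_left)
  qed (simp_all add: mult_zero mult_diff)
  have one_right: "monoid.mult ?R c (one ?R) = c" if "c \<in> carrier ?R" for c
    using that
  proof (rule ind)
    fix x assume "x \<in> Ob C"
    then show "monoid.mult ?R (frag_of (iso_class C x)) (one ?R) = frag_of (iso_class C x)"
      by (simp add: K0_free_simps(2) mult_of tensor_class_iso_class unit_closed tensor_ob_unit_right)
  qed (simp_all add: mult_zero mult_diff)
  have mult_add: "monoid.mult ?R (c + c') d = monoid.mult ?R c d + monoid.mult ?R c' d"
    "monoid.mult ?R c (d + d') = monoid.mult ?R c d + monoid.mult ?R c d'" for c c' d d'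
    using mult_diff(1)[of c "- c'" d] mult_diff(1)[of 0 c' d] mult_diff(2)[of c d "- d'"] mult_diff(2)[of c 0 d'] mult_zero
    by simp_all
  show ?thesis
  proof (rule ringI)
    show "abelian_group ?R"
    proof (rule abelian_groupI)
      fix c assume "c \<in> carrier ?R"
      then show "\<exists>d\<in>carrier ?R. d \<oplus>\<^bsub>?R\<^esub> c = \<zero>\<^bsub>?R\<^esub>"
        using neg by (intro bexI[of _ "- c"]) (simp_all add: K0_free_simps(3,4))
    qed (use plus in \<open>simp_all add: K0_free_simps(3,4) ac_simps\<close>, simp add: K0_free_simps(1))
    show "monoid ?R"
    proof (rule monoidI)
      show "\<one>\<^bsub>?R\<^esub> \<in> carrier ?R" by (simp add: K0_free_simps(1,2) unit_closed)
    qed (use cl assoc one_left one_right in auto)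
  qed (simp_all add: K0_free_simps(4) mult_add)
qed

end

section \<open>Characters extended additively from the simple objects\<close>

locale schurian_monoidal_category = schurian_category C S \<phi> + monoidal_preadditive C
  for C :: "('o, 'm, 'k, 'z) lin_moncat_scheme" and S :: "'i \<Rightarrow> 'o" and \<phi> :: "'i \<Rightarrow> 'f::field \<Rightarrow> 'm" +
  fixes w :: "'i \<Rightarrow> 'r::comm_ring_1"
begin

text \<open>The value does not depend on the chosen decomposition because multiplicities of simple
  summands are unique; see \<open>char_iso_eq\<close>.\<close>

definition char :: "'o \<Rightarrow> 'r" where
  "char x = sum_list (map w (SOME L. direct_sum C x (map S L)))"

lemma char_iso_eq:
  assumes "direct_sum C x (map S L)" "isomorphic C x y" "x \<in> Ob C" "y \<in> Ob C"
  shows "char y = sum_list (map w L)"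
proof -
  have "direct_sum C y (map S (SOME L. direct_sum C y (map S L)))"
    using someI_ex[OF decomposition_exists[OF assms(4)]] .
  from decomposition_unique[OF assms(1) this assms(2,4)]
  have "mset L = mset (SOME L. direct_sum C y (map S L))" .
  moreover have "sum_list (map w K) = sum_mset (image_mset w (mset K))" for K
    by (simp only: sum_mset_sum_list mset_map[symmetric])
  ultimately show ?thesis unfolding char_def by (simp only:)
qed

lemma char_eq:
  assumes "direct_sum C x (map S L)"
  shows "char x = sum_list (map w L)"
proof -
  have "x \<in> Ob C" using assms unfolding direct_sum_def by (rule conjunct1)
  then show ?thesis using char_iso_eq[OF assms isomorphic_refl] by simp
qed

lemma char_simple: "char (S i) = w i"
  using char_eq[of "S i" "[i]"] direct_sum_single[OF S_ob] by simp

lemma char_iso: "\<lbrakk>isomorphic C x y; x \<in> Ob C; y \<in> Ob C\<rbrakk> \<Longrightarrow> char x = char y"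
proof -
  assume *: "isomorphic C x y" "x \<in> Ob C" "y \<in> Ob C"
  obtain L where "direct_sum C x (map S L)" using decomposition_exists[OF *(2)] by blast
  from char_eq[OF this] char_iso_eq[OF this *] show ?thesis by simp
qed

lemma char_zero: "\<lbrakk>x \<in> Ob C; id_mor C x = zero_mor C x x\<rbrakk> \<Longrightarrow> char x = 0"
  using char_eq[of x "[]"] by (simp add: direct_sum_Nil)

lemma direct_sum_pair_ob: "direct_sum C z [x, y] \<Longrightarrow> z \<in> Ob C \<and> x \<in> Ob C \<and> y \<in> Ob C"
  by (simp add: direct_sum_def)

lemma char_add:
  assumes "direct_sum C z [x, y]"
  shows "char z = char x + char y"
proof -
  note ob = direct_sum_pair_ob[OF assms]
  obtain L where L: "direct_sum C x (map S L)" using decomposition_exists ob by blast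
  obtain M where M: "direct_sum C y (map S M)" using decomposition_exists ob by blast
  from direct_sum_append[OF L M assms] have "direct_sum C z (map S (L @ M))" by simp
  from char_eq[OF this] char_eq[OF L] char_eq[OF M] show ?thesis by simp
qed

text \<open>Both sides are additive in \<open>x\<close>, so the simple case suffices.\<close>

lemma char_tensor_right:
  assumes u: "u \<in> Ob C" and simple: "\<And>i. char (tensor_ob C (S i) u) = w i * r" and "x \<in> Ob C"
  shows "char (tensor_ob C x u) = char x * r"
  using simple_sum_all[OF \<open>x \<in> Ob C\<close>]
proof (induction rule: simple_sum.induct)
  case (zero x)
  have "id_mor C (tensor_ob C x u) = tensor_mor C x x u u (zero_mor C x x) (id_mor C u)"
    using zero u by (simp flip: tensor_id)
  then have "id_mor C (tensor_ob C x u) = zero_mor C (tensor_ob C x u) (tensor_ob C x u)"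
    using zero u by (simp add: tensor_zero_left id_closed)
  then show ?case using zero u by (simp add: char_zero tensor_ob_closed)
next
  case (add x i y)
  then show ?case
    using char_add[OF add.hyps(1)] char_add[OF direct_sum_tensor_right[OF add.hyps(1) u]]
    by (simp add: simple char_simple distrib_right)
qed

text \<open>The condition varies the left factor only: for fixed \<open>u\<close> both sides are
  additive in \<open>x\<close>, so it can be tested on simple \<open>x\<close>.\<close>

definition multiplicative :: "'o \<Rightarrow> bool" where
  "multiplicative u \<longleftrightarrow> (\<forall>x\<in>Ob C. char (tensor_ob C x u) = char x * char u)"

lemma multiplicative_tensor:
  assumes "multiplicative u" "multiplicative v" "u \<in> Ob C" "v \<in> Ob C"
  shows "multiplicative (tensor_ob C u v)"
  using assms unfolding multiplicative_def
  by (simp add: tensor_ob_closed mult.assoc flip: tensor_ob_assoc)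

text \<open>The second part subtracts in the target ring: multiplicativity of a sum and of one
  summand gives that of the other. This is how it reaches simple objects that are only known as
  complements.\<close>

lemma multiplicative_add:
  assumes "direct_sum C z [x, y]"
  shows "\<lbrakk>multiplicative x; multiplicative y\<rbrakk> \<Longrightarrow> multiplicative z"
    and "\<lbrakk>multiplicative z; multiplicative y\<rbrakk> \<Longrightarrow> multiplicative x"
  using char_add[OF direct_sum_tensor_left[OF assms]] char_add[OF assms]
  unfolding multiplicative_def by (simp_all add: distrib_left)

lemma multiplicative_all:
  assumes "\<And>i. multiplicative (S i)" "x \<in> Ob C"
  shows "multiplicative x"
  using simple_sum_all[OF assms(2)]
proof (induction rule: simple_sum.induct)
  case (zero x)
  show ?case
    unfolding multiplicative_def
  proof
    fix y assume y: "y \<in> Ob C"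
    have "id_mor C (tensor_ob C y x) = tensor_mor C y y x x (id_mor C y) (zero_mor C x x)"
      using zero y by (simp flip: tensor_id)
    then have "id_mor C (tensor_ob C y x) = zero_mor C (tensor_ob C y x) (tensor_ob C y x)"
      using zero y by (simp add: tensor_zero_right id_closed)
    then show "char (tensor_ob C y x) = char y * char x" using zero y by (simp add: char_zero tensor_ob_closed)
  qed
next
  case (add x i y)
  then show ?case using multiplicative_add(1)[OF add.hyps(1) assms(1)] by blast
qed

end

section \<open>The Grothendieck ring of a schurian monoidal category\<close>

text \<open>With these properties \<open>char\<close> identifies \<open>K0\<close> with the subring
  of the target spanned by the values of \<open>w\<close>.\<close>

locale schurian_character = schurian_monoidal_category C S \<phi> w
  for C :: "('o, 'm, 'k, 'z) lin_moncat_scheme" and S :: "'i \<Rightarrow> 'o" and \<phi> :: "'i \<Rightarrow> 'f::field \<Rightarrow> 'm"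
    and w :: "'i \<Rightarrow> 'r::comm_ring_1" +
  assumes char_tensor: "\<lbrakk>x \<in> Ob C; y \<in> Ob C\<rbrakk> \<Longrightarrow> char (tensor_ob C x y) = char x * char y"
    and char_unit: "char (unit_ob C) = 1"
    and independent: "int_comb w n = 0 \<Longrightarrow> n = 0"
begin

definition class_char :: "'o set \<Rightarrow> 'r" where "class_char V = char (SOME x. x \<in> V)"

lemma class_char_iso_class: "x \<in> Ob C \<Longrightarrow> class_char (iso_class C x) = char x"
proof -
  assume x: "x \<in> Ob C"
  then have "\<exists>y. y \<in> iso_class C x" using isomorphic_refl by (auto simp: iso_class_def)
  then have "(SOME y. y \<in> iso_class C x) \<in> iso_class C x" by (rule someI_ex)
  then show ?thesis using x char_iso by (auto simp: class_char_def iso_class_def)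
qed

abbreviation T :: "'r ring" where "T \<equiv> ring_of_type_algebra"

lemma T_simps: "carrier T = UNIV" "monoid.mult T = (*)" "one T = 1" "ring.zero T = 0" "add T = (+)"
  by (simp_all add: ring_of_type_algebra_def)

abbreviation H :: "('o set \<Rightarrow>\<^sub>0 int) \<Rightarrow> 'r" where "H \<equiv> int_comb class_char"

lemma H_mult:
  assumes "c \<in> carrier (K0_free C)" "d \<in> carrier (K0_free C)"
  shows "H (monoid.mult (K0_free C) c d) = H c * H d"
proof -
  have *: "H (frag_extend (\<lambda>W. frag_of (tensor_class C (iso_class C x) W)) d) = char x * H d" if x: "x \<in> Ob C" for x
    using assms(2)[unfolded K0_free_simps, simplified]
  proof (induction d rule: frag_induction)
    case (one V)
    then show ?case using x
      by (auto simp: tensor_class_iso_class class_char_iso_class tensor_ob_closed char_tensor)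
  qed (simp_all add: frag_extend_diff int_comb_diff right_diff_distrib)
  show ?thesis
    unfolding K0_free_mult using assms(1)[unfolded K0_free_simps, simplified]
  proof (induction c rule: frag_induction)
    case (one V)
    then show ?case using * by (auto simp: class_char_iso_class)
  qed (simp_all add: frag_extend_diff int_comb_diff left_diff_distrib)
qed

sublocale H: ring_hom_ring "K0_free C" T H
proof (intro ring_hom_ringI2 K0_free_ring ring_from_type_algebra ring_hom_memI)
  show "H \<one>\<^bsub>K0_free C\<^esub> = \<one>\<^bsub>T\<^esub>"
    by (simp add: K0_free_simps T_simps class_char_iso_class unit_closed char_unit)
qed (simp_all add: T_simps H_mult, simp add: K0_free_simps int_comb_add)

section \<open>The relations of direct sums as the kernel of the character\<close>

abbreviation cls :: "'o \<Rightarrow> 'o set \<Rightarrow>\<^sub>0 int" where "cls x \<equiv> frag_of (iso_class C x)"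

lemma K0_relations_subgroup: "subgroup (K0_relations C) (add_monoid (K0_free C))"
  unfolding K0_relations_def
proof (rule group.generate_is_subgroup)
  show "group (add_monoid (K0_free C))" using H.R.a_group .
  show "{cls x + cls y - cls z |x y z. direct_sum C z [x, y]} \<subseteq> carrier (add_monoid (K0_free C))"
  proof
    fix c assume "c \<in> {cls x + cls y - cls z |x y z. direct_sum C z [x, y]}"
    then obtain x y z where c: "c = cls x + cls y - cls z" and ds: "direct_sum C z [x, y]" by blast
    have "Poly_Mapping.keys c \<subseteq> {iso_class C x, iso_class C y, iso_class C z}"
      unfolding c by (auto simp: in_keys_iff lookup_minus lookup_add split: if_splits)
    then show "c \<in> carrier (add_monoid (K0_free C))"
      using direct_sum_pair_ob[OF ds] by (auto simp: K0_free_simps)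
  qed
qed

lemma K0_relations_add: "\<lbrakk>c \<in> K0_relations C; d \<in> K0_relations C\<rbrakk> \<Longrightarrow> c + d \<in> K0_relations C"
  using subgroup.m_closed[OF K0_relations_subgroup] by (simp add: K0_free_simps)

lemma K0_relations_zero: "0 \<in> K0_relations C"
  using subgroup.one_closed[OF K0_relations_subgroup] by (simp add: K0_free_simps)

lemma K0_relations_minus: "c \<in> K0_relations C \<Longrightarrow> - c \<in> K0_relations C"
proof -
  assume c: "c \<in> K0_relations C"
  then have c': "c \<in> carrier (K0_free C)" using subgroup.subset[OF K0_relations_subgroup] by auto
  have *: "\<ominus>\<^bsub>K0_free C\<^esub> c \<in> K0_relations C"
    using subgroup.m_inv_closed[OF K0_relations_subgroup c] by (simp add: a_inv_def)
  have "\<ominus>\<^bsub>K0_free C\<^esub> c + c = 0"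
    using H.R.l_neg[OF c'] by (simp add: K0_free_simps)
  then have "\<ominus>\<^bsub>K0_free C\<^esub> c = - c" by (simp only: eq_neg_iff_add_eq_0)
  with * show ?thesis by (simp only:)
qed

lemma K0_relations_diff: "\<lbrakk>c \<in> K0_relations C; d \<in> K0_relations C\<rbrakk> \<Longrightarrow> c - d \<in> K0_relations C"
  using K0_relations_add[of c "- d"] K0_relations_minus by simp

lemma K0_relation: "direct_sum C z [x, y] \<Longrightarrow> cls x + cls y - cls z \<in> K0_relations C"
  unfolding K0_relations_def by (rule generate.incl) blast

text \<open>Each relation trades an object for one simple summand and a complement.\<close>

lemma mod_simples:
  assumes "c \<in> carrier (K0_free C)"
  shows "\<exists>n. c - frag_extend (\<lambda>i. cls (S i)) n \<in> K0_relations C"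
  using assms[unfolded K0_free_simps, simplified]
proof (induction c rule: frag_induction)
  case zero
  show ?case using K0_relations_zero by (intro exI[of _ 0]) simp
next
  case (one V)
  then obtain x where x: "x \<in> Ob C" "V = iso_class C x" by blast
  have "\<exists>n. cls x - frag_extend (\<lambda>i. cls (S i)) n \<in> K0_relations C"
    using simple_sum_all[OF x(1)]
  proof (induction rule: simple_sum.induct)
    case (zero x)
    show ?case using K0_relation[OF zero_biproduct[OF zero]] by (intro exI[of _ 0]) simp
  next
    case (add x i y)
    then obtain n where n: "cls y - frag_extend (\<lambda>i. cls (S i)) n \<in> K0_relations C" by blast
    from K0_relations_diff[OF this K0_relation[OF add.hyps(1)]]
    have "cls x - frag_extend (\<lambda>i. cls (S i)) (frag_of i + n) \<in> K0_relations C"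
      by (simp add: frag_extend_add algebra_simps)
    then show ?case by blast
  qed
  then show ?case using x by simp
next
  case (diff a b)
  then obtain m n where "a - frag_extend (\<lambda>i. cls (S i)) m \<in> K0_relations C"
    "b - frag_extend (\<lambda>i. cls (S i)) n \<in> K0_relations C" by blast
  from K0_relations_diff[OF this]
  have "a - b - frag_extend (\<lambda>i. cls (S i)) (m - n) \<in> K0_relations C"
    by (simp add: frag_extend_diff algebra_simps)
  then show ?case by blast
qed

lemma kernel_eq: "a_kernel (K0_free C) T H = {c \<in> carrier (K0_free C). H c = 0}"
  unfolding a_kernel_def kernel_def ring_of_type_algebra_def by simp

lemma H_relations: "c \<in> K0_relations C \<Longrightarrow> H c = 0"
proof -
  assume c: "c \<in> K0_relations C"
  have "K0_relations C \<subseteq> {c \<in> carrier (K0_free C). H c = 0}"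
    unfolding K0_relations_def
  proof (rule group.generate_subgroup_incl[OF H.R.a_group])
    show "subgroup {c \<in> carrier (K0_free C). H c = 0} (add_monoid (K0_free C))"
      using additive_subgroup.a_subgroup[OF ideal.axioms(1)[OF H.kernel_is_ideal]] unfolding kernel_eq .
    show "{cls x + cls y - cls z |x y z. direct_sum C z [x, y]} \<subseteq> {c \<in> carrier (K0_free C). H c = 0}"
    proof
      fix c assume "c \<in> {cls x + cls y - cls z |x y z. direct_sum C z [x, y]}"
      then obtain x y z where c: "c = cls x + cls y - cls z" and ds: "direct_sum C z [x, y]" by blast
      have "c \<in> K0_relations C" unfolding c by (rule K0_relation[OF ds])
      then have "c \<in> carrier (K0_free C)" using subgroup.subset[OF K0_relations_subgroup] by auto
      moreover have "H c = 0"
      proof -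
        have "H c = char x + char y - char z"
          using direct_sum_pair_ob[OF ds] by (simp add: c int_comb_diff int_comb_add class_char_iso_class)
        then show ?thesis by (simp only: char_add[OF ds]) simp
      qed
      ultimately show "c \<in> {c \<in> carrier (K0_free C). H c = 0}" by simp
    qed
  qed
  from subsetD[OF this c] show ?thesis by simp
qed

lemma H_simples: "H (frag_extend (\<lambda>i. cls (S i)) n) = int_comb w n"
  by (simp add: int_comb_extend o_def class_char_iso_class S_ob char_simple)

text \<open>Modulo the relations every element is a combination of simple classes, on which
  \<open>H\<close> is injective by \<open>independent\<close>. Being a kernel, the subgroup of
  relations is an ideal, so the quotient is a ring.\<close>

lemma kernel_H: "a_kernel (K0_free C) T H = K0_relations C"
proof
  show "K0_relations C \<subseteq> a_kernel (K0_free C) T H"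
    unfolding kernel_eq using H_relations subgroup.subset[OF K0_relations_subgroup] by auto
  show "a_kernel (K0_free C) T H \<subseteq> K0_relations C"
  proof
    fix c assume "c \<in> a_kernel (K0_free C) T H"
    then have c: "c \<in> carrier (K0_free C)" "H c = 0" unfolding kernel_eq by simp_all
    obtain n where n: "c - frag_extend (\<lambda>i. cls (S i)) n \<in> K0_relations C" using mod_simples[OF c(1)] by blast
    have "H c - int_comb w n = 0" using H_relations[OF n] by (simp only: int_comb_diff H_simples)
    then have "int_comb w n = 0" unfolding c(2) by simp
    then have "n = 0" by (rule independent)
    with n show "c \<in> K0_relations C" by simp
  qed
qed

lemma H_image: "H ` carrier (K0_free C) = {int_comb w n | n. True}"
proof
  show "H ` carrier (K0_free C) \<subseteq> {int_comb w n | n. True}"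
  proof
    fix r assume "r \<in> H ` carrier (K0_free C)"
    then obtain c where c: "c \<in> carrier (K0_free C)" "r = H c" by blast
    obtain n where n: "c - frag_extend (\<lambda>i. cls (S i)) n \<in> K0_relations C" using mod_simples[OF c(1)] by blast
    have "H c - int_comb w n = 0" using H_relations[OF n] by (simp only: int_comb_diff H_simples)
    then have "r = int_comb w n" unfolding c(2) by (rule eq_iff_diff_eq_0[THEN iffD2])
    then show "r \<in> {int_comb w n | n. True}" by blast
  qed
  show "{int_comb w n | n. True} \<subseteq> H ` carrier (K0_free C)"
  proof
    fix r assume "r \<in> {int_comb w n | n. True}"
    then obtain n where n: "r = int_comb w n" by blast
    have "frag_extend (\<lambda>i. cls (S i)) n \<in> carrier (K0_free C)"
      using keys_frag_extend[of "\<lambda>i. cls (S i)" n] S_ob by (auto simp: K0_free_simps keys_frag_of)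
    then have "H (frag_extend (\<lambda>i. cls (S i)) n) \<in> H ` carrier (K0_free C)" by (rule imageI)
    then show "r \<in> H ` carrier (K0_free C)" by (simp only: H_simples n)
  qed
qed

section \<open>The induced isomorphism and the basis of irreducible classes\<close>

definition ind :: "('o set \<Rightarrow>\<^sub>0 int) set \<Rightarrow> 'r" where "ind = (\<lambda>V. the_elem (H ` V))"

text \<open>The first isomorphism theorem for \<open>H\<close>, with kernel and image taken from
  \<open>kernel_H\<close> and \<open>H_image\<close>.\<close>

lemma ind_iso: "ind \<in> ring_iso (K0 C) (T\<lparr>carrier := {int_comb w n | n. True}\<rparr>)"
  unfolding ind_def K0_def using H.FactRing_iso_set_aux[unfolded kernel_H H_image] .

lemma cls_carrier: "x \<in> Ob C \<Longrightarrow> cls x \<in> carrier (K0_free C)"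
  by (auto simp: K0_free_simps keys_frag_of)

lemma ind_class: "x \<in> Ob C \<Longrightarrow> ind (K0_class C x) = char x"
  unfolding ind_def K0_class_def using H.the_elem_simp[of "cls x"] cls_carrier[of x]
  by (simp add: kernel_H class_char_iso_class)

lemma K0_ring: "ring (K0 C)"
  unfolding K0_def using ideal.quotient_is_ring[OF H.kernel_is_ideal] by (simp add: kernel_H)

lemma K0_class_carrier: "x \<in> Ob C \<Longrightarrow> K0_class C x \<in> carrier (K0 C)"
  unfolding K0_class_def K0_def FactRing_def A_RCOSETS_def' using cls_carrier[of x] by auto

lemma w_inj: "inj w"
proof (rule injI)
  fix i j assume "w i = w j"
  then have "int_comb w (frag_of i - frag_of j) = 0" by (simp add: int_comb_diff)
  from independent[OF this] show "i = j" by (simp add: frag_of_eq)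
qed

lemma class_of_irreducible:
  assumes "irreducible_ob C x"
  obtains i where "isomorphic C (S i) x" "x \<in> Ob C" "K0_class C x = K0_class C (S i)" "char x = w i"
proof -
  obtain i where i: "isomorphic C (S i) x" using irreducible_iso_simple[OF assms] by blast
  have x: "x \<in> Ob C" using assms by (simp add: irreducible_ob_def)
  have "iso_class C (S i) = iso_class C x" using iso_class_eq_iff[OF S_ob x] i by simp
  then have "K0_class C x = K0_class C (S i)" by (simp add: K0_class_def)
  moreover have "char x = w i" using char_iso[OF i S_ob x] char_simple by simp
  ultimately show ?thesis using that i x by blast
qed

lemma irreducible_classes: "{K0_class C x | x. irreducible_ob C x} = range (\<lambda>i. K0_class C (S i))"
proof
  show "{K0_class C x | x. irreducible_ob C x} \<subseteq> range (\<lambda>i. K0_class C (S i))"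
    using class_of_irreducible by blast
  show "range (\<lambda>i. K0_class C (S i)) \<subseteq> {K0_class C x | x. irreducible_ob C x}"
    using irreducible_simple by blast
qed

text \<open>The character takes irreducible objects to values of \<open>w\<close>, and
  \<open>w\<close> is injective by independence. So the basis elements of \<open>K0\<close>
  correspond one to one to isomorphism classes of irreducible objects.\<close>

lemma irreducible_class_inj:
  assumes "irreducible_ob C x" "irreducible_ob C y" "K0_class C x = K0_class C y"
  shows "isomorphic C x y"
proof -
  obtain i where i: "isomorphic C (S i) x" "x \<in> Ob C" "char x = w i" using class_of_irreducible[OF assms(1)] by metis
  obtain j where j: "isomorphic C (S j) y" "y \<in> Ob C" "char y = w j" using class_of_irreducible[OF assms(2)] by metis
  have "w i = w j" using ind_class[OF i(2)] ind_class[OF j(2)] assms(3) i j by simp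
  then have "i = j" using w_inj by (simp add: inj_eq)
  then show ?thesis using isomorphic_trans[OF isomorphic_sym[OF i(1)] _ i(2) S_ob j(2)] j(1) by blast
qed

lemma K0_based_ring: "based_ring (K0 C) {K0_class C x | x. irreducible_ob C x}"
  unfolding irreducible_classes
proof (rule based_ringI[where h = ind])
  note iso = ind_iso[unfolded ring_iso_def, simplified]
  have w: "ind \<circ> (\<lambda>i. K0_class C (S i)) = w" by (auto simp: ind_class S_ob char_simple)
  show "ring (K0 C)" by (rule K0_ring)
  show "ind (x \<oplus>\<^bsub>K0 C\<^esub> y) = ind x + ind y" if "x \<in> carrier (K0 C)" "y \<in> carrier (K0 C)" for x y
    using ring_hom_add[OF conjunct1[OF iso] that] by (simp add: T_simps)
  show "inj_on ind (carrier (K0 C))" using iso by (simp add: bij_betw_def)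
  show "K0_class C (S i) \<in> carrier (K0 C)" for i by (rule K0_class_carrier[OF S_ob])
  show "\<exists>n. ind x = int_comb (ind \<circ> (\<lambda>i. K0_class C (S i))) n" if "x \<in> carrier (K0 C)" for x
    unfolding w using iso that by (auto simp: bij_betw_def)
  show "int_comb (ind \<circ> (\<lambda>i. K0_class C (S i))) n = 0 \<Longrightarrow> n = 0" for n unfolding w by (rule independent)
qed

section \<open>The subring spanned by the character values\<close>

lemma combinations_subring: "subring {int_comb w n | n. True} T"
  using H.img_is_subring[OF ring.carrier_is_subring[OF K0_free_ring]] by (simp only: H_image)

lemma combinations_generate: "generate (add_monoid T) (range w) = {int_comb w n | n. True}"
proof -
  have sub: "subgroup {int_comb w n | n. True} (add_monoid T)"
    using subring.axioms(1)[OF combinations_subring] .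
  have neg: "a_inv T r = - r" for r :: 'r
  proof -
    have "a_inv T r + r = 0" using H.S.l_neg[of r] by (simp add: T_simps)
    then show ?thesis by (simp add: eq_neg_iff_add_eq_0)
  qed
  have gen: "subgroup (generate (add_monoid T) (range w)) (add_monoid T)"
    using group.generate_is_subgroup[OF H.S.a_group] by (simp add: T_simps)
  show ?thesis
  proof
    have "range w \<subseteq> {int_comb w n | n. True}"
    proof
      fix r assume "r \<in> range w"
      then obtain i where "r = int_comb w (frag_of i)" by auto
      then show "r \<in> {int_comb w n | n. True}" by blast
    qed
    then show "generate (add_monoid T) (range w) \<subseteq> {int_comb w n | n. True}"
      by (rule group.generate_subgroup_incl[OF H.S.a_group _ sub])
    have "int_comb w n \<in> generate (add_monoid T) (range w)" for n
    proof (induction n rule: frag_induction[OF subset_UNIV])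
      case 1
      then show ?case using subgroup.one_closed[OF gen] by (simp add: T_simps)
    next
      case (2 i)
      then show ?case by (auto intro: generate.incl)
    next
      case (3 a b)
      have "a_inv T (int_comb w b) \<in> generate (add_monoid T) (range w)"
        using subgroup.m_inv_closed[OF gen 3(2)] by (simp add: a_inv_def)
      from subgroup.m_closed[OF gen 3(1) this] show ?case by (simp add: T_simps neg int_comb_diff)
    qed
    then show "{int_comb w n | n. True} \<subseteq> generate (add_monoid T) (range w)" by blast
  qed
qed

lemma combinations_based_ring: "based_ring (T\<lparr>carrier := {int_comb w n | n. True}\<rparr>) (range w)"
proof (rule based_ringI[where h = "\<lambda>x. x"])
  show "ring (T\<lparr>carrier := {int_comb w n | n. True}\<rparr>)"
    using ring.subring_is_ring[OF ring_from_type_algebra combinations_subring] .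
  show "w i \<in> carrier (T\<lparr>carrier := {int_comb w n | n. True}\<rparr>)" for i
    using int_comb_of[of w i] by (simp del: int_comb_of) metis
qed (auto simp: T_simps o_def dest: independent)

lemma K0_based_iso:
  "based_ring_isomorphic (K0 C) {K0_class C x | x. irreducible_ob C x}
     (T\<lparr>carrier := {int_comb w n | n. True}\<rparr>) (range w)"
  unfolding based_ring_isomorphic_def
proof (intro bexI[OF _ ind_iso])
  show "bij_betw ind {K0_class C x | x. irreducible_ob C x} (range w)"
    unfolding irreducible_classes bij_betw_def
  proof
    show "inj_on ind (range (\<lambda>i. K0_class C (S i)))"
      using w_inj by (auto simp: inj_on_def ind_class S_ob char_simple)
    show "ind ` range (\<lambda>i. K0_class C (S i)) = range w"
      by (simp add: image_image ind_class S_ob char_simple)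
  qed
qed

end

section \<open>Diagrammatic calculus in the odd Temperley--Lieb supercategory\<close>

text \<open>Bundling a morphism with its source and target makes the operations total functions that need
  no object arguments.\<close>

type_synonym 'k arrow = "nat \<times> nat \<times> 'k stl_term set"

abbreviation src :: "'k arrow \<Rightarrow> nat" where "src f \<equiv> fst f"
abbreviation trg :: "'k arrow \<Rightarrow> nat" where "trg f \<equiv> fst (snd f)"
abbreviation und :: "'k arrow \<Rightarrow> 'k stl_term set" where "und f \<equiv> snd (snd f)"

locale odd_temperley_lieb =
  fixes \<delta> :: "'k::field"
begin

sublocale STL: strict_monoidal_supercategory "STL \<delta>"
  by (rule STL_strict_monoidal_supercategory)

definition arr :: "'k arrow \<Rightarrow> bool" where
  "arr f \<longleftrightarrow> und f \<in> Mor (STL \<delta>) (src f) (trg f)"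

definition acomp :: "'k arrow \<Rightarrow> 'k arrow \<Rightarrow> 'k arrow" (infixr "\<cdot>" 70) where
  "g \<cdot> f = (src f, trg g, comp_mor (STL \<delta>) (src f) (trg f) (trg g) (und g) (und f))"

definition atens :: "'k arrow \<Rightarrow> 'k arrow \<Rightarrow> 'k arrow" (infixr "\<star>" 75) where
  "f \<star> g = (src f + src g, trg f + trg g, tensor_mor (STL \<delta>) (src f) (trg f) (src g) (trg g) (und f) (und g))"

definition aadd :: "'k arrow \<Rightarrow> 'k arrow \<Rightarrow> 'k arrow" (infixr "\<boxplus>" 65) where
  "f \<boxplus> g = (src f, trg f, add_mor (STL \<delta>) (src f) (trg f) (und f) (und g))"

definition ascale :: "'k \<Rightarrow> 'k arrow \<Rightarrow> 'k arrow" (infixr "\<diamondop>" 72) where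
  "c \<diamondop> f = (src f, trg f, scale_mor (STL \<delta>) (src f) (trg f) c (und f))"

definition aid :: "nat \<Rightarrow> 'k arrow" where "aid n = (n, n, id_mor (STL \<delta>) n)"
definition azero :: "nat \<Rightarrow> nat \<Rightarrow> 'k arrow" where "azero m n = (m, n, zero_mor (STL \<delta>) m n)"
definition cup :: "'k arrow" where "cup = (0, 2, stl_class \<delta> 0 2 Cup)"
definition cap :: "'k arrow" where "cap = (2, 0, stl_class \<delta> 2 0 Cap)"

lemma src_trg [simp]:
  "src (g \<cdot> f) = src f" "trg (g \<cdot> f) = trg g"
  "src (f \<star> g) = src f + src g" "trg (f \<star> g) = trg f + trg g"
  "src (f \<boxplus> g) = src f" "trg (f \<boxplus> g) = trg f"
  "src (c \<diamondop> f) = src f" "trg (c \<diamondop> f) = trg f"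
  "src (aid n) = n" "trg (aid n) = n" "src (azero m n) = m" "trg (azero m n) = n"
  "src cup = 0" "trg cup = 2" "src cap = 2" "trg cap = 0"
  by (simp_all add: acomp_def atens_def aadd_def ascale_def aid_def azero_def cup_def cap_def)

lemma Ob_STL [simp]: "n \<in> Ob (STL \<delta>)"
  by (simp add: STL_simps)

lemma arr_simps [simp]:
  "\<lbrakk>arr g; arr f; trg f = src g\<rbrakk> \<Longrightarrow> arr (g \<cdot> f)"
  "\<lbrakk>arr f; arr g\<rbrakk> \<Longrightarrow> arr (f \<star> g)"
  "\<lbrakk>arr f; arr g; src g = src f; trg g = trg f\<rbrakk> \<Longrightarrow> arr (f \<boxplus> g)"
  "arr f \<Longrightarrow> arr (c \<diamondop> f)"
  "arr (aid n)" "arr (azero m n)" "arr cup" "arr cap"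
proof -
  show "\<lbrakk>arr f; arr g\<rbrakk> \<Longrightarrow> arr (f \<star> g)"
    using STL.tensor_closed[of "src f" "trg f" "src g" "trg g" "und f" "und g"]
    by (simp add: arr_def atens_def STL_simps(6))
  show "arr cup" "arr cap"
    by (auto simp: arr_def cup_def cap_def STL_simps(2) intro: stl_typed.intros)
qed (auto simp: arr_def acomp_def aadd_def ascale_def aid_def azero_def
      intro!: STL.comp_closed STL.add_closed STL.scale_closed STL.id_closed STL.zero_closed)

lemma acomp_assoc [simp]:
  "\<lbrakk>arr h; arr g; arr f; trg g = src h; trg f = src g\<rbrakk> \<Longrightarrow> (h \<cdot> g) \<cdot> f = h \<cdot> g \<cdot> f"
  by (simp add: arr_def acomp_def STL.comp_assoc)

lemma acomp_id [simp]:
  "\<lbrakk>arr f; trg f = n\<rbrakk> \<Longrightarrow> aid n \<cdot> f = f"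
  "\<lbrakk>arr f; src f = n\<rbrakk> \<Longrightarrow> f \<cdot> aid n = f"
  by (auto simp: arr_def acomp_def aid_def STL.comp_id_left STL.comp_id_right)

lemma acomp_linear:
  "\<lbrakk>arr g; arr g'; arr f; src g' = src g; trg g' = trg g; trg f = src g\<rbrakk> \<Longrightarrow> (g \<boxplus> g') \<cdot> f = g \<cdot> f \<boxplus> g' \<cdot> f"
  "\<lbrakk>arr g; arr f; arr f'; src f' = src f; trg f' = trg f; trg f = src g\<rbrakk> \<Longrightarrow> g \<cdot> (f \<boxplus> f') = g \<cdot> f \<boxplus> g \<cdot> f'"
  "\<lbrakk>arr g; arr f; trg f = src g\<rbrakk> \<Longrightarrow> (c \<diamondop> g) \<cdot> f = c \<diamondop> (g \<cdot> f)"
  "\<lbrakk>arr g; arr f; trg f = src g\<rbrakk> \<Longrightarrow> g \<cdot> (c \<diamondop> f) = c \<diamondop> (g \<cdot> f)"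
  by (simp_all add: arr_def acomp_def aadd_def ascale_def STL.comp_add_left STL.comp_add_right
      STL.comp_scale_left STL.comp_scale_right)

lemma atens_linear:
  "\<lbrakk>arr g; arr g'; arr f; src g' = src g; trg g' = trg g\<rbrakk> \<Longrightarrow> (g \<boxplus> g') \<star> f = g \<star> f \<boxplus> g' \<star> f"
  "\<lbrakk>arr g; arr f; arr f'; src f' = src f; trg f' = trg f\<rbrakk> \<Longrightarrow> g \<star> (f \<boxplus> f') = g \<star> f \<boxplus> g \<star> f'"
  "\<lbrakk>arr g; arr f\<rbrakk> \<Longrightarrow> (c \<diamondop> g) \<star> f = c \<diamondop> (g \<star> f)"
  "\<lbrakk>arr g; arr f\<rbrakk> \<Longrightarrow> g \<star> (c \<diamondop> f) = c \<diamondop> (g \<star> f)"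
  by (simp_all add: arr_def atens_def aadd_def ascale_def STL.tensor_add_left STL.tensor_add_right
      STL.tensor_scale_left STL.tensor_scale_right STL_simps(6))

lemma atens_assoc [simp]: "\<lbrakk>arr f; arr g; arr h\<rbrakk> \<Longrightarrow> (f \<star> g) \<star> h = f \<star> g \<star> h"
  using STL.tensor_assoc[of "src f" "trg f" "src g" "trg g" "src h" "trg h" "und f" "und g" "und h"]
  by (simp add: arr_def atens_def STL_simps(6) add.assoc)

lemma atens_unit [simp]: "arr f \<Longrightarrow> aid 0 \<star> f = f" "arr f \<Longrightarrow> f \<star> aid 0 = f"
  using STL.tensor_unit_left[of "src f" "trg f" "und f"] STL.tensor_unit_right[of "src f" "trg f" "und f"]
  by (simp_all add: arr_def atens_def aid_def STL_simps(5))

lemma atens_id [simp]: "aid m \<star> aid n = aid (m + n)"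
  using STL.tensor_id[of m n] by (simp add: atens_def aid_def STL_simps(6))

lemma atens_id_assoc [simp]: "arr f \<Longrightarrow> aid m \<star> aid n \<star> f = aid (m + n) \<star> f"
  by (simp flip: atens_assoc)

text \<open>Cup and cap are odd and change the number of strands by 2, so source and target
  determine the parity. Every morphism between objects of the given degree is homogeneous.\<close>

lemma homog_iff_degree:
  assumes "F \<in> Mor (STL \<delta>) m n" "stl_degree m n p"
  shows "F \<in> homog (STL \<delta>) m n p"
proof -
  obtain f where f: "stl_typed f m n" "F = stl_class \<delta> m n f" using assms(1) by (auto simp: STL_simps)
  from stl_homogeneous[OF f(1), of \<delta>] show ?thesis
  proof (elim disjE exE conjE)
    fix q g assume g: "stl_degree m n q" "stl_parity g q" "stl_eq \<delta> m n f g"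
    then have "q = p" using assms(2) stl_degree_unique by blast
    moreover have "stl_typed g m n" using g(3) stl_eq_typed by blast
    ultimately show ?thesis using g f(2) stl_class_eqI[OF g(3)] by (auto simp: STL_simps)
  next
    assume "stl_eq \<delta> m n f (Zero m n)"
    then have "F = zero_mor (STL \<delta>) m n" using f(2) stl_class_eqI by (simp add: STL_simps)
    then show ?thesis by (simp add: STL.homog_zero)
  qed
qed

section \<open>Koszul signs, interchange and whiskering\<close>

abbreviation even_deg :: "'k arrow \<Rightarrow> bool" where "even_deg f \<equiv> stl_degree (src f) (trg f) 0"
abbreviation odd_deg :: "'k arrow \<Rightarrow> bool" where "odd_deg f \<equiv> stl_degree (src f) (trg f) 1"

lemma degrees [simp]: "stl_degree n n 0" "stl_degree (Suc (Suc n)) n 1" "stl_degree n (Suc (Suc n)) 1"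
  by (simp_all add: stl_degree_def)

text \<open>If no parity fits the two strand numbers, the morphism is zero and so homogeneous of
  every parity.\<close>

lemma homog_exists:
  assumes "arr f"
  obtains p where "und f \<in> homog (STL \<delta>) (src f) (trg f) p"
proof (cases "\<exists>p. stl_degree (src f) (trg f) p")
  case True
  then obtain p where "stl_degree (src f) (trg f) p" by blast
  then have "und f \<in> homog (STL \<delta>) (src f) (trg f) p"
    using homog_iff_degree assms unfolding arr_def by metis
  then show ?thesis by (rule that)
next
  case False
  obtain t where t: "stl_typed t (src f) (trg f)" "und f = stl_class \<delta> (src f) (trg f) t"
    using assms by (auto simp: arr_def STL_simps)
  then have "stl_eq \<delta> (src f) (trg f) t (Zero (src f) (trg f))"
    using stl_homogeneous[OF t(1), of \<delta>] False by blast
  then have "und f = zero_mor (STL \<delta>) (src f) (trg f)" using t(2) stl_class_eqI by (simp add: STL_simps)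
  then show ?thesis by (intro that[of 0]) (simp add: STL.homog_zero)
qed

lemma interchange_homog:
  assumes "arr f" "arr k" "trg h = src f" "trg k = src g"
    "und g \<in> homog (STL \<delta>) (src g) (trg g) p" "und h \<in> homog (STL \<delta>) (src h) (trg h) q"
  shows "(f \<star> g) \<cdot> (h \<star> k) = koszul (p * q) \<diamondop> ((f \<cdot> h) \<star> (g \<cdot> k))"
  using STL.super_interchange[of "src h" "src f" "trg f" "src k" "src g" "trg g" "und f" "und g" p "und h" q "und k"] assms
  by (simp add: arr_def acomp_def atens_def ascale_def STL_simps(6))

lemma interchange_sign:
  assumes "arr f" "arr g" "arr h" "arr k" "trg h = src f" "trg k = src g"
    "stl_degree (src g) (trg g) p" "stl_degree (src h) (trg h) q"
  shows "(f \<star> g) \<cdot> (h \<star> k) = koszul (p * q) \<diamondop> ((f \<cdot> h) \<star> (g \<cdot> k))"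
  using assms by (intro interchange_homog homog_iff_degree) (simp_all add: arr_def)

lemma ascale_one [simp]: "arr f \<Longrightarrow> 1 \<diamondop> f = f"
  by (simp add: arr_def ascale_def STL.scale_one)

lemma interchange_id_right:
  assumes "arr f" "arr h" "arr k" "trg h = src f" "trg k = n"
  shows "(f \<star> aid n) \<cdot> (h \<star> k) = (f \<cdot> h) \<star> k"
proof -
  obtain q where "und h \<in> homog (STL \<delta>) (src h) (trg h) q" using homog_exists[OF assms(2)] .
  moreover have "und (aid n) \<in> homog (STL \<delta>) (src (aid n)) (trg (aid n)) 0"
    by (simp add: aid_def STL.homog_id)
  ultimately have "(f \<star> aid n) \<cdot> (h \<star> k) = koszul (0 * q) \<diamondop> ((f \<cdot> h) \<star> (aid n \<cdot> k))"
    using assms by (intro interchange_homog) simp_all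
  with assms show ?thesis by simp
qed

text \<open>An endomorphism \<open>h\<close> is even, so no sign arises whatever the parity of
  \<open>g\<close>.\<close>

lemma interchange_even:
  assumes "arr f" "arr g" "arr h" "arr k" "trg h = src f" "trg k = src g" "src h = trg h"
  shows "(f \<star> g) \<cdot> (h \<star> k) = (f \<cdot> h) \<star> (g \<cdot> k)"
proof -
  obtain p where "und g \<in> homog (STL \<delta>) (src g) (trg g) p" using homog_exists[OF assms(2)] .
  moreover have "und h \<in> homog (STL \<delta>) (src h) (trg h) 0"
    using assms by (intro homog_iff_degree) (simp_all add: arr_def)
  ultimately have "(f \<star> g) \<cdot> (h \<star> k) = koszul (p * 0) \<diamondop> ((f \<cdot> h) \<star> (g \<cdot> k))"
    using assms by (intro interchange_homog) simp_all
  with assms show ?thesis by simp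
qed

text \<open>The form taken by a cup or a cap in a given position. Whiskering commutes with
  composition without signs, by \<open>whisker_comp\<close>.\<close>

definition whisker :: "nat \<Rightarrow> nat \<Rightarrow> 'k arrow \<Rightarrow> 'k arrow" where
  "whisker i j f = aid i \<star> f \<star> aid j"

lemma whisker_src_trg [simp]: "src (whisker i j f) = i + src f + j" "trg (whisker i j f) = i + trg f + j"
  by (simp_all add: whisker_def)

lemma arr_whisker [simp]: "arr f \<Longrightarrow> arr (whisker i j f)"
  by (simp add: whisker_def)

lemma whisker_comp: "\<lbrakk>arr f; arr g; trg f = src g\<rbrakk> \<Longrightarrow> whisker i j (g \<cdot> f) = whisker i j g \<cdot> whisker i j f"
  by (simp add: whisker_def interchange_even interchange_id_right)

lemma whisker_whisker [simp]: "arr f \<Longrightarrow> whisker i j (whisker i' j' f) = whisker (i + i') (j' + j) f"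
  by (simp add: whisker_def)

lemma whisker_id [simp]: "whisker i j (aid n) = aid (i + n + j)"
  by (simp add: whisker_def add.assoc)

lemma whisker_zero [simp]: "arr f \<Longrightarrow> whisker 0 0 f = f"
  by (simp add: whisker_def)

lemma whisker_linear:
  "\<lbrakk>arr f; arr g; src g = src f; trg g = trg f\<rbrakk> \<Longrightarrow> whisker i j (f \<boxplus> g) = whisker i j f \<boxplus> whisker i j g"
  "arr f \<Longrightarrow> whisker i j (c \<diamondop> f) = c \<diamondop> whisker i j f"
  by (simp_all add: whisker_def atens_linear)

text \<open>Applying the right factor first is the order without a Koszul sign; \<open>slide\<close>
  computes the other order.\<close>

lemma tens_whisker: "\<lbrakk>arr f; arr g\<rbrakk> \<Longrightarrow> f \<star> g = whisker 0 (trg g) f \<cdot> whisker (src f) 0 g"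
  by (simp add: whisker_def interchange_even)

lemma slide:
  assumes "arr f" "arr g" "stl_degree (src f) (trg f) p" "stl_degree (src g) (trg g) q"
  shows "whisker (trg f) 0 g \<cdot> whisker 0 (src g) f = koszul (q * p) \<diamondop> (whisker 0 (trg g) f \<cdot> whisker (src f) 0 g)"
  using interchange_sign[of "aid (trg f)" g f "aid (src g)" q p] assms
  by (simp add: whisker_def flip: tens_whisker) (simp add: whisker_def interchange_even)

section \<open>The defining relations in terms of arrows\<close>

lemma stl_typed_generators:
  "stl_typed (Ident 1) 1 1" "stl_typed Cup 0 2" "stl_typed Cap 2 0"
  "stl_typed (Tens Cap (Ident 1)) 3 1" "stl_typed (Tens (Ident 1) Cup) 1 3"
  "stl_typed (Tens (Ident 1) Cap) 3 1" "stl_typed (Tens Cup (Ident 1)) 1 3"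
  by (auto intro: stl_typed.intros stl_typed_TensI)

lemma zigzag: "whisker 0 1 cap \<cdot> whisker 1 0 cup = aid 1"
proof -
  note t = stl_typed_generators
  have "tensor_mor (STL \<delta>) 2 0 1 1 (stl_class \<delta> 2 0 Cap) (stl_class \<delta> 1 1 (Ident 1)) = stl_class \<delta> 3 1 (Tens Cap (Ident 1))"
    "tensor_mor (STL \<delta>) 1 1 0 2 (stl_class \<delta> 1 1 (Ident 1)) (stl_class \<delta> 0 2 Cup) = stl_class \<delta> 1 3 (Tens (Ident 1) Cup)"
    using STL_ops(4)[OF t(3,1), of \<delta>] STL_ops(4)[OF t(1,2), of \<delta>] by (simp_all add: numeral_3_eq_3)
  moreover have "comp_mor (STL \<delta>) 1 3 1 (stl_class \<delta> 3 1 (Tens Cap (Ident 1))) (stl_class \<delta> 1 3 (Tens (Ident 1) Cup))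
    = stl_class \<delta> 1 1 (Ident 1)"
    unfolding STL_ops(1)[OF t(4,5)] by (rule stl_class_eqI[OF stl_eq.zigzag])
  ultimately have "comp_mor (STL \<delta>) 1 3 1 (tensor_mor (STL \<delta>) 2 0 1 1 (stl_class \<delta> 2 0 Cap) (stl_class \<delta> 1 1 (Ident 1)))
    (tensor_mor (STL \<delta>) 1 1 0 2 (stl_class \<delta> 1 1 (Ident 1)) (stl_class \<delta> 0 2 Cup)) = stl_class \<delta> 1 1 (Ident 1)"
    by simp
  then show ?thesis
    by (simp add: whisker_def) (simp add: acomp_def atens_def aid_def cup_def cap_def STL_simps numeral_3_eq_3)
qed

lemma zigzag': "whisker 1 0 cap \<cdot> whisker 0 1 cup = (- 1) \<diamondop> aid 1"
proof -
  note t = stl_typed_generators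
  have "tensor_mor (STL \<delta>) 1 1 2 0 (stl_class \<delta> 1 1 (Ident 1)) (stl_class \<delta> 2 0 Cap) = stl_class \<delta> 3 1 (Tens (Ident 1) Cap)"
    "tensor_mor (STL \<delta>) 0 2 1 1 (stl_class \<delta> 0 2 Cup) (stl_class \<delta> 1 1 (Ident 1)) = stl_class \<delta> 1 3 (Tens Cup (Ident 1))"
    using STL_ops(4)[OF t(1,3), of \<delta>] STL_ops(4)[OF t(2,1), of \<delta>] by (simp_all add: numeral_3_eq_3)
  moreover have "comp_mor (STL \<delta>) 1 3 1 (stl_class \<delta> 3 1 (Tens (Ident 1) Cap)) (stl_class \<delta> 1 3 (Tens Cup (Ident 1)))
    = scale_mor (STL \<delta>) 1 1 (- 1) (stl_class \<delta> 1 1 (Ident 1))"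
    unfolding STL_ops(1)[OF t(6,7)] STL_ops(3)[OF t(1)] by (rule stl_class_eqI[OF stl_eq.zigzag'])
  ultimately have "comp_mor (STL \<delta>) 1 3 1 (tensor_mor (STL \<delta>) 1 1 2 0 (stl_class \<delta> 1 1 (Ident 1)) (stl_class \<delta> 2 0 Cap))
    (tensor_mor (STL \<delta>) 0 2 1 1 (stl_class \<delta> 0 2 Cup) (stl_class \<delta> 1 1 (Ident 1)))
    = scale_mor (STL \<delta>) 1 1 (- 1) (stl_class \<delta> 1 1 (Ident 1))"
    by simp
  then show ?thesis
    by (simp add: whisker_def) (simp add: acomp_def atens_def aid_def ascale_def cup_def cap_def STL_simps numeral_3_eq_3)
qed

lemma circle: "cap \<cdot> cup = \<delta> \<diamondop> aid 0"
proof -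
  have "comp_mor (STL \<delta>) 0 2 0 (stl_class \<delta> 2 0 Cap) (stl_class \<delta> 0 2 Cup) = scale_mor (STL \<delta>) 0 0 \<delta> (stl_class \<delta> 0 0 (Ident 0))"
    unfolding STL_ops(1)[OF stl_typed_generators(3,2)] STL_ops(3)[OF stl_typed.intros(1)]
    by (rule stl_class_eqI[OF stl_eq.circle])
  then show ?thesis by (simp add: acomp_def cap_def cup_def aid_def ascale_def STL_simps)
qed

lemma azero_linear [simp]:
  "\<lbrakk>arr f; src f = m; trg f = n\<rbrakk> \<Longrightarrow> azero m n \<boxplus> f = f"
  "\<lbrakk>arr f; src f = m; trg f = n\<rbrakk> \<Longrightarrow> f \<boxplus> azero m n = f"
  "c \<diamondop> azero m n = azero m n"
  "\<lbrakk>arr f; trg f = m\<rbrakk> \<Longrightarrow> azero m n \<cdot> f = azero (src f) n"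
  "\<lbrakk>arr f; src f = n\<rbrakk> \<Longrightarrow> f \<cdot> azero m n = azero m (trg f)"
  "whisker i j (azero m n) = azero (i + m + j) (i + n + j)"
  "arr f \<Longrightarrow> 0 \<diamondop> f = azero (src f) (trg f)"
proof -
  show "0 \<diamondop> f = azero (src f) (trg f)" if "arr f" for f
  proof -
    have "scale_mor (STL \<delta>) (src f) (trg f) 0 (und f) = zero_mor (STL \<delta>) (src f) (trg f)"
      using that by (intro STL.add_idem_zero) (simp_all add: arr_def STL.scale_closed flip: STL.scale_add_scalar)
    then show ?thesis by (simp add: ascale_def azero_def)
  qed
  show "whisker i j (azero m n) = azero (i + m + j) (i + n + j)"
    using STL.tensor_zero_left[of m n j j "id_mor (STL \<delta>) j"] STL.tensor_zero_right[of i i "m + j" "n + j" "id_mor (STL \<delta>) i"]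
    by (simp add: whisker_def atens_def azero_def aid_def STL_simps(6) STL.id_closed add.assoc)
qed (auto simp: arr_def aadd_def ascale_def acomp_def azero_def STL.add_zero_left STL.add_zero_right STL.scale_zero
    STL.comp_zero_left STL.comp_zero_right)

lemma aadd_scale:
  "arr f \<Longrightarrow> a \<diamondop> b \<diamondop> f = (a * b) \<diamondop> f"
  "arr f \<Longrightarrow> a \<diamondop> f \<boxplus> b \<diamondop> f = (a + b) \<diamondop> f"
  "\<lbrakk>arr f; arr g; src g = src f; trg g = trg f\<rbrakk> \<Longrightarrow> a \<diamondop> (f \<boxplus> g) = a \<diamondop> f \<boxplus> a \<diamondop> g"
  "\<lbrakk>arr f; arr g; arr h; src g = src f; trg g = trg f; src h = src f; trg h = trg f\<rbrakk> \<Longrightarrow> (f \<boxplus> g) \<boxplus> h = f \<boxplus> g \<boxplus> h"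
  by (auto simp: arr_def aadd_def ascale_def STL.scale_scale STL.scale_add_scalar STL.scale_add STL.add_assoc)

text \<open>A normal form of morphisms: a cap that follows a cup is straightened, closed to a loop or slid past it.\<close>

inductive caps :: "nat \<Rightarrow> nat \<Rightarrow> 'k arrow \<Rightarrow> bool" where
  "caps n n (aid n)"
| "caps m (i + 2 + j) d \<Longrightarrow> caps m (i + j) (whisker i j cap \<cdot> d)"

inductive comb :: "nat \<Rightarrow> nat \<Rightarrow> 'k arrow \<Rightarrow> bool" where
  comb_zero: "comb m n (azero m n)"
| comb_add: "\<lbrakk>comb m n f; comb m n g\<rbrakk> \<Longrightarrow> comb m n (f \<boxplus> g)"
| comb_scale: "comb m n f \<Longrightarrow> comb m n (c \<diamondop> f)"
| comb_caps: "caps m n d \<Longrightarrow> comb m n d"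
| comb_cup: "comb m (i + j) f \<Longrightarrow> comb m (i + 2 + j) (whisker i j cup \<cdot> f)"

lemma caps_arr: "caps m n d \<Longrightarrow> arr d \<and> src d = m \<and> trg d = n"
  by (induction rule: caps.induct) auto

lemma comb_arr: "comb m n f \<Longrightarrow> arr f \<and> src f = m \<and> trg f = n"
  by (induction rule: comb.induct) (auto simp: caps_arr)

text \<open>A cap and a cup in the same position close a loop, in neighbouring positions they form a
  zigzag, and at a distance they slide past each other with the sign -1 of two odd
  morphisms.\<close>

lemma cap_cup:
  assumes "i + 2 + j = k + 2 + l"
  shows "(\<exists>c. whisker i j cap \<cdot> whisker k l cup = c \<diamondop> aid (i + j)) \<or>
    (\<exists>c i' j' k' l'. whisker i j cap \<cdot> whisker k l cup = c \<diamondop> (whisker k' l' cup \<cdot> whisker i' j' cap)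
       \<and> k + l = i' + 2 + j' \<and> i + j = k' + 2 + l' \<and> i' + j' = k' + l')"
proof -
  consider (same) "i = k" "j = l" | (right) "k = i + 1" "j = l + 1" | (left) "i = k + 1" "l = j + 1"
    | (far_right) d where "k = i + 2 + d" "j = d + 2 + l" | (far_left) d where "i = k + 2 + d" "l = d + 2 + j"
  proof -
    have "i = k \<and> j = l \<or> k = i + 1 \<and> j = l + 1 \<or> i = k + 1 \<and> l = j + 1 \<or>
      k = i + 2 + (k - i - 2) \<and> j = (k - i - 2) + 2 + l \<or> i = k + 2 + (i - k - 2) \<and> l = (i - k - 2) + 2 + j"
      using assms by presburger
    then show ?thesis using that by blast
  qed
  then show ?thesis
  proof cases
    case same
    have "whisker i j (cap \<cdot> cup) = whisker i j cap \<cdot> whisker i j cup" by (rule whisker_comp) simp_all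
    then show ?thesis unfolding same by (intro disjI1 exI[of _ \<delta>]) (simp add: circle whisker_linear)
  next
    case right
    have "whisker i l (whisker 0 1 cap \<cdot> whisker 1 0 cup) = whisker i (1 + l) cap \<cdot> whisker (i + 1) l cup"
      by (simp add: whisker_comp)
    then show ?thesis unfolding right by (intro disjI1 exI[of _ 1]) (simp add: zigzag[unfolded One_nat_def])
  next
    case left
    have "whisker k j (whisker 1 0 cap \<cdot> whisker 0 1 cup) = whisker (k + 1) j cap \<cdot> whisker k (1 + j) cup"
      by (simp add: whisker_comp)
    then show ?thesis unfolding left
      by (intro disjI1 exI[of _ "- 1"]) (simp add: zigzag'[unfolded One_nat_def] whisker_linear)
  next
    case far_right
    have "stl_degree d (Suc (Suc d)) 1" by (simp add: stl_degree_def)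
    \<comment> \<open>The \<open>d\<close> strands in between are attached to the cap, so that two
      adjacent odd morphisms are exchanged; the outer strands are whiskered on afterwards.\<close>
    have "whisker d 0 cup \<cdot> whisker 0 d cap = (- 1) \<diamondop> (whisker 0 (d + 2) cap \<cdot> whisker (2 + d) 0 cup)"
    proof -
      have "whisker (trg (whisker 0 d cap)) 0 cup \<cdot> whisker 0 (src cup) (whisker 0 d cap)
        = koszul (1 * 1) \<diamondop> (whisker 0 (trg cup) (whisker 0 d cap) \<cdot> whisker (src (whisker 0 d cap)) 0 cup)"
        by (rule slide) (simp_all add: stl_degree_def numeral_2_eq_2)
      then show ?thesis by (simp add: koszul_def)
    qed
    then have "(- 1) \<diamondop> (whisker d 0 cup \<cdot> whisker 0 d cap) = whisker 0 (d + 2) cap \<cdot> whisker (2 + d) 0 cup"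
      by (simp add: aadd_scale)
    then have "whisker i l ((- 1) \<diamondop> (whisker d 0 cup \<cdot> whisker 0 d cap)) = whisker i l (whisker 0 (d + 2) cap \<cdot> whisker (2 + d) 0 cup)"
      by simp
    then have "whisker i j cap \<cdot> whisker k l cup = (- 1) \<diamondop> (whisker (i + d) l cup \<cdot> whisker i (d + l) cap)"
      by (simp add: whisker_linear whisker_comp far_right ac_simps)
    then show ?thesis using far_right by (intro disjI2 exI conjI) (assumption, simp_all)
  next
    case far_left
    have "whisker (2 + d) 0 cap \<cdot> whisker 0 (d + 2) cup = (- 1) \<diamondop> (whisker 0 d cup \<cdot> whisker d 0 cap)"
    proof -
      have "whisker (trg (whisker 0 d cup)) 0 cap \<cdot> whisker 0 (src cap) (whisker 0 d cup)
        = koszul (1 * 1) \<diamondop> (whisker 0 (trg cap) (whisker 0 d cup) \<cdot> whisker (src (whisker 0 d cup)) 0 cap)"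
        by (rule slide) (simp_all add: stl_degree_def numeral_2_eq_2)
      then show ?thesis by (simp add: koszul_def)
    qed
    then have "whisker k j (whisker (2 + d) 0 cap \<cdot> whisker 0 (d + 2) cup) = whisker k j ((- 1) \<diamondop> (whisker 0 d cup \<cdot> whisker d 0 cap))"
      by simp
    then have "whisker i j cap \<cdot> whisker k l cup = (- 1) \<diamondop> (whisker k (d + j) cup \<cdot> whisker (k + d) j cap)"
      by (simp add: whisker_linear whisker_comp far_left ac_simps)
    then show ?thesis using far_left by (intro disjI2 exI conjI) (assumption, simp_all)
  qed
qed

text \<open>The new cap meets the outermost cup. By \<open>cap_cup\<close> it either disappears
  together with that cup or passes it, and then the induction hypothesis applies to what lies
  below.\<close>

lemma comb_cap:
  "comb m n f \<Longrightarrow> n = i + 2 + j \<Longrightarrow> comb m (i + j) (whisker i j cap \<cdot> f)"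
proof (induction arbitrary: i j rule: comb.induct)
  case (comb_zero m n)
  then show ?case by (simp add: comb.comb_zero)
next
  case (comb_add m n f g)
  then have "arr f" "src f = m" "trg f = n" "arr g" "src g = m" "trg g = n" using comb_arr by blast+
  then have "whisker i j cap \<cdot> (f \<boxplus> g) = whisker i j cap \<cdot> f \<boxplus> whisker i j cap \<cdot> g"
    using comb_add.prems by (intro acomp_linear) simp_all
  then show ?case using comb_add by (simp add: comb.comb_add)
next
  case (comb_scale m n f c)
  then have "arr f" "src f = m" "trg f = n" using comb_arr by blast+
  then have "whisker i j cap \<cdot> (c \<diamondop> f) = c \<diamondop> (whisker i j cap \<cdot> f)"
    using comb_scale.prems by (intro acomp_linear) simp_all
  then show ?case using comb_scale by (simp add: comb.comb_scale)
next
  case (comb_caps m n d)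
  then show ?case by (intro comb.comb_caps caps.intros) simp
next
  case (comb_cup m k l f)
  then have f: "arr f" "src f = m" "trg f = k + l" using comb_arr by blast+
  have assoc: "whisker i j cap \<cdot> whisker k l cup \<cdot> f = (whisker i j cap \<cdot> whisker k l cup) \<cdot> f"
    using f comb_cup.prems by (intro acomp_assoc[symmetric]) simp_all
  from cap_cup[OF comb_cup.prems[symmetric]] show ?case
  proof (elim disjE exE conjE)
    fix c assume eq: "whisker i j cap \<cdot> whisker k l cup = c \<diamondop> aid (i + j)"
    have ij: "i + j = k + l" using comb_cup.prems by simp
    show ?thesis unfolding assoc eq ij using f comb_cup.hyps by (simp add: acomp_linear comb.comb_scale)
  next
    fix c i' j' k' l' assume eq: "whisker i j cap \<cdot> whisker k l cup = c \<diamondop> (whisker k' l' cup \<cdot> whisker i' j' cap)"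
      and kl: "k + l = i' + 2 + j'" and ij: "i + j = k' + 2 + l'" and e: "i' + j' = k' + l'"
    have "comb m (k' + 2 + l') (whisker k' l' cup \<cdot> whisker i' j' cap \<cdot> f)"
      using comb_cup.IH[OF kl] unfolding e by (rule comb.comb_cup)
    moreover have "(whisker i j cap \<cdot> whisker k l cup) \<cdot> f = c \<diamondop> (whisker k' l' cup \<cdot> whisker i' j' cap \<cdot> f)"
      unfolding eq using f kl e by (simp add: acomp_linear)
    ultimately show ?thesis unfolding assoc ij by (simp add: comb.comb_scale)
  qed
qed

text \<open>The term occurs whiskered and applied to some \<open>h\<close> so that the induction
  reaches inside tensor products, which become two successive whiskered factors.\<close>

lemma comb_whisker:
  "stl_typed t m n \<Longrightarrow> comb l (i + m + j) h \<Longrightarrow> comb l (i + n + j) (whisker i j (m, n, stl_class \<delta> m n t) \<cdot> h)"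
proof (induction arbitrary: i j h rule: stl_typed.induct)
  case (1 n)
  have "(n, n, stl_class \<delta> n n (Ident n)) = aid n" by (simp add: aid_def STL_simps)
  then show ?case using 1 comb_arr[OF 1] by simp
next
  case 2
  then show ?case using comb_cup[of l i j h] by (simp add: cup_def)
next
  case 3
  then show ?case using comb_cap[OF 3] by (simp add: cap_def)
next
  case (4 g m n f k)
  note h = comb_arr[OF 4(5)]
  have a: "arr (m, n, stl_class \<delta> m n g)" "arr (k, m, stl_class \<delta> k m f)"
    using 4(1,2) by (simp_all add: arr_def STL_simps)
  have "(k, n, stl_class \<delta> k n (Comp g f)) = (m, n, stl_class \<delta> m n g) \<cdot> (k, m, stl_class \<delta> k m f)"
    using 4(1,2) by (simp add: acomp_def STL_ops)
  then show ?case using 4(3)[OF 4(4)[OF 4(5)]] a h by (simp add: whisker_comp)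
next
  case (5 f m m' g n n')
  note h = comb_arr[OF 5(5)]
  let ?f = "(m, m', stl_class \<delta> m m' f)" and ?g = "(n, n', stl_class \<delta> n n' g)"
  have a: "arr ?f" "arr ?g" using 5(1,2) by (simp_all add: arr_def STL_simps)
  have eq: "(m + n, m' + n', stl_class \<delta> (m + n) (m' + n') (Tens f g)) = ?f \<star> ?g"
    using 5(1,2) by (simp add: atens_def STL_ops)
  have "comb l (i + m + n + j) h" using 5(5) by (simp add: add.assoc)
  then have "comb l (i + m + (n' + j)) (whisker (i + m) j ?g \<cdot> h)"
    using 5(4)[of "i + m" j h] by (simp add: add.assoc)
  then have "comb l (i + m' + (n' + j)) (whisker i (n' + j) ?f \<cdot> whisker (i + m) j ?g \<cdot> h)"
    by (rule 5(3))
  moreover have "whisker i j (?f \<star> ?g) = whisker i (n' + j) ?f \<cdot> whisker (i + m) j ?g"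
    using a by (simp add: tens_whisker whisker_comp)
  ultimately show ?case using a h unfolding eq by (simp add: add.assoc)
next
  case (6 m n)
  have "(m, n, stl_class \<delta> m n (Zero m n)) = azero m n" by (simp add: azero_def STL_simps)
  then show ?case using comb_arr[OF 6] by (simp add: comb_zero)
next
  case (7 f m n g)
  note h = comb_arr[OF 7(5)]
  let ?f = "(m, n, stl_class \<delta> m n f)" and ?g = "(m, n, stl_class \<delta> m n g)"
  have a: "arr ?f" "arr ?g" using 7(1,2) by (simp_all add: arr_def STL_simps)
  have "(m, n, stl_class \<delta> m n (Add f g)) = ?f \<boxplus> ?g" using 7(1,2) by (simp add: aadd_def STL_ops)
  then show ?case using a h comb_add[OF 7(3,4)[OF 7(5)]] by (simp add: whisker_linear acomp_linear)
next
  case (8 f m n a)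
  note h = comb_arr[OF 8(3)]
  let ?f = "(m, n, stl_class \<delta> m n f)"
  have b: "arr ?f" using 8(1) by (simp add: arr_def STL_simps)
  have "(m, n, stl_class \<delta> m n (Scale a f)) = a \<diamondop> ?f" using 8(1) by (simp add: ascale_def STL_ops)
  then show ?case using b h comb_scale[OF 8(2)[OF 8(3)]] by (simp add: whisker_linear acomp_linear)
qed

text \<open>A morphism is itself applied to the identity, which is the composite of no caps.\<close>

lemma arr_comb:
  assumes "arr f" shows "comb (src f) (trg f) f"
proof -
  obtain t where t: "stl_typed t (src f) (trg f)" "f = (src f, trg f, stl_class \<delta> (src f) (trg f) t)"
    using assms by (cases f) (auto simp: arr_def STL_simps)
  have "comb (src f) (0 + src f + 0) (aid (src f))" by (simp add: comb_caps caps.intros)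
  from comb_whisker[OF t(1) this] show ?thesis using assms t(2) by simp
qed

end

section \<open>Odd Jones--Wenzl projectors\<close>

locale generic_odd_temperley_lieb = odd_temperley_lieb \<delta>
  for \<delta> :: "'k::field" +
  fixes q :: 'k
  assumes q_nonzero: "q \<noteq> 0"
    and q_not_root: "\<And>n. n > 0 \<Longrightarrow> q ^ n \<noteq> 1"
    and \<delta>_eq: "\<delta> = - (q - inverse q)"
begin

text \<open>The quotients of consecutive solutions of \<open>s\<^sub>n\<^sub>+\<^sub>1 = \<delta> s\<^sub>n + s\<^sub>n\<^sub>-\<^sub>1\<close>, the loop values of the projectors.\<close>

primrec loop :: "nat \<Rightarrow> 'k" where
  "loop 0 = \<delta>"
| "loop (Suc n) = \<delta> + inverse (loop n)"

text \<open>The difference of the \<open>n\<close>-th powers of the two characteristic roots, hence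
  the solution that vanishes at 0.\<close>

definition sol :: "nat \<Rightarrow> 'k" where "sol n = inverse q ^ n - (- q) ^ n"

text \<open>A zero would give \<open>(- q^2)^n = 1\<close>, and squaring removes the sign:
  \<open>q^(4 n) = 1\<close>.\<close>

lemma sol_nonzero:
  assumes "n > 0" shows "sol n \<noteq> 0"
proof
  assume "sol n = 0"
  then have "inverse q ^ n * q ^ n = (- q) ^ n * q ^ n" by (simp add: sol_def)
  then have "(- q * q) ^ n = 1"
    using q_nonzero by (simp only: power_mult_distrib[symmetric]) simp
  then have "((- q * q) ^ n) ^ 2 = 1" by simp
  moreover have "((- q * q) ^ n) ^ 2 = ((- q * q) ^ 2) ^ n" by (simp only: power_mult[symmetric] mult.commute)
  moreover have "(- q * q) ^ 2 = q ^ 4" by (simp add: power2_eq_square power4_eq_xxxx)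
  ultimately have "q ^ (4 * n) = 1" by (simp only: power_mult)
  with q_not_root[of "4 * n"] assms show False by simp
qed

lemma sol_rec: "sol (Suc (Suc n)) = \<delta> * sol (Suc n) + sol n"
proof -
  \<comment> \<open>Applied with \<open>1/q\<close> for \<open>p\<close>; \<open>u\<close> and
    \<open>v\<close> stand for the \<open>n\<close>-th powers of \<open>1/q\<close> and
    \<open>-q\<close>.\<close>
  have *: "p * p * u - q * q * v = (p - q) * (p * u + q * v) + (u - v)" if "p * q = 1" for p u v
  proof -
    have "(p - q) * (p * u + q * v) + (u - v) = p * p * u - q * q * v + (p * q) * (v - u) + (u - v)"
      by (simp add: algebra_simps)
    then show ?thesis by (simp add: that)
  qed
  have "inverse q * q = 1" using q_nonzero by simp
  from *[OF this, of "inverse q ^ n" "(- q) ^ n"] show ?thesis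
    by (simp add: sol_def \<delta>_eq mult.assoc)
qed

text \<open>The quotient of consecutive solutions is stated as a product, and nonvanishing is
  carried along because the next step inverts \<open>loop n\<close>.\<close>

lemma loop_sol: "loop n * sol (Suc n) = sol (Suc (Suc n)) \<and> loop n \<noteq> 0"
proof (induction n)
  case 0
  have "\<delta> * sol (Suc 0) = sol (Suc (Suc 0))" using sol_rec[of 0] by (simp add: sol_def[of 0])
  then show ?case using sol_nonzero[of "Suc (Suc 0)"] by auto
next
  case (Suc n)
  have "inverse (loop n) * sol (Suc (Suc n)) = inverse (loop n) * loop n * sol (Suc n)"
    using Suc by (simp only: mult.assoc)
  then have "inverse (loop n) * sol (Suc (Suc n)) = sol (Suc n)" using Suc by simp
  then have "loop (Suc n) * sol (Suc (Suc n)) = sol (Suc (Suc (Suc n)))"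
    by (simp add: distrib_right sol_rec[of "Suc n"])
  then show ?case using sol_nonzero[of "Suc (Suc (Suc n))"] by auto
qed

lemma loop_nonzero: "loop n \<noteq> 0"
  using loop_sol by blast

text \<open>The correction removes the unwanted summand, whose idempotent is
  \<open>1 / loop n\<close> times the composite shown. Note the offset: \<open>loop n\<close> is the
  factor that appears on closing the last strand of \<open>jw (Suc n)\<close>, not of
  \<open>jw n\<close>.\<close>

fun jw :: "nat \<Rightarrow> 'k arrow" where
  "jw 0 = aid 0"
| "jw (Suc 0) = aid (Suc 0)"
| "jw (Suc (Suc n)) = whisker 0 (Suc 0) (jw (Suc n)) \<boxplus> (- inverse (loop n)) \<diamondop>
     ((whisker 0 (Suc 0) (jw (Suc n)) \<cdot> whisker n 0 cup) \<cdot> (whisker n 0 cap \<cdot> whisker 0 (Suc 0) (jw (Suc n))))"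

text \<open>Up to the factor \<open>loop n\<close>, \<open>jw_cap n\<close> and
  \<open>jw_cup n\<close> are the projection to and the inclusion of a copy of the image of
  \<open>jw n\<close> in that of \<open>jw (Suc n)\<close> with one strand added.\<close>

definition jw_cap :: "nat \<Rightarrow> 'k arrow" where "jw_cap n = whisker n 0 cap \<cdot> whisker 0 (Suc 0) (jw (Suc n))"
definition jw_cup :: "nat \<Rightarrow> 'k arrow" where "jw_cup n = whisker 0 (Suc 0) (jw (Suc n)) \<cdot> whisker n 0 cup"

lemma jw_arr [simp]: "arr (jw n)" "src (jw n) = n" "trg (jw n) = n"
proof -
  have "arr (jw n) \<and> src (jw n) = n \<and> trg (jw n) = n"
    by (induction n rule: jw.induct) simp_all
  then show "arr (jw n)" "src (jw n) = n" "trg (jw n) = n" by simp_all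
qed

lemma jw_cap_cup_arr [simp]:
  "arr (jw_cap n)" "src (jw_cap n) = Suc (Suc n)" "trg (jw_cap n) = n"
  "arr (jw_cup n)" "src (jw_cup n) = n" "trg (jw_cup n) = Suc (Suc n)"
  by (simp_all add: jw_cap_def jw_cup_def)

lemma jw_Suc: "jw (Suc (Suc n)) = whisker 0 (Suc 0) (jw (Suc n)) \<boxplus> (- inverse (loop n)) \<diamondop> (jw_cup n \<cdot> jw_cap n)"
  by (simp add: jw_cap_def jw_cup_def)

declare jw.simps(3) [simp del]

lemma acomp_reassoc:
  assumes "g \<cdot> f = h" "arr g" "arr f" "arr k" "trg f = src g" "trg k = src f"
  shows "g \<cdot> f \<cdot> k = h \<cdot> k"
  unfolding acomp_assoc[OF assms(2-6), symmetric] assms(1) ..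

lemma slide_even:
  assumes "arr f" "arr g" "src f = n" "trg f = n"
  shows "whisker n 0 g \<cdot> whisker 0 (src g) f = whisker 0 (trg g) f \<cdot> whisker n 0 g"
proof -
  have "whisker n 0 g \<cdot> whisker 0 (src g) f = f \<star> g"
    using assms interchange_even[of "aid n" g f "aid (src g)"] by (simp add: whisker_def)
  then show ?thesis using assms tens_whisker[of f g] by simp
qed

lemma slide_cup:
  "\<lbrakk>arr f; src f = n; trg f = n\<rbrakk> \<Longrightarrow> whisker n 0 cup \<cdot> f = whisker 0 (Suc (Suc 0)) f \<cdot> whisker n 0 cup"
  using slide_even[of f cup n] by (simp add: numeral_2_eq_2)

lemma slide_cap:
  "\<lbrakk>arr f; src f = n; trg f = n\<rbrakk> \<Longrightarrow> f \<cdot> whisker n 0 cap = whisker n 0 cap \<cdot> whisker 0 (Suc (Suc 0)) f"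
  using slide_even[of f cap n] by (simp add: numeral_2_eq_2)

lemmas zigzags = zigzag[unfolded One_nat_def] zigzag'[unfolded One_nat_def]

text \<open>The four facts support each other: the value of \<open>jw_cap n\<close> after
  \<open>jw_cup n\<close> makes the next projector idempotent, and this idempotence is used to
  compute the next such value.\<close>

lemma jw_properties:
  "jw (Suc n) \<cdot> jw (Suc n) = jw (Suc n) \<and> whisker 0 (Suc 0) (jw n) \<cdot> jw (Suc n) = jw (Suc n) \<and>
   jw (Suc n) \<cdot> whisker 0 (Suc 0) (jw n) = jw (Suc n) \<and> jw_cap n \<cdot> jw_cup n = loop n \<diamondop> jw n"
proof (induction n)
  case 0
  then show ?case by (simp add: jw_cap_def jw_cup_def circle)
next
  case (Suc n)
  define E e where "E = whisker 0 (Suc 0) (jw (Suc n))" and "e = jw (Suc n)"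
  have E [simp]: "arr E" "src E = Suc (Suc n)" "trg E = Suc (Suc n)" by (simp_all add: E_def)
  have e [simp]: "arr e" "src e = Suc n" "trg e = Suc n" by (simp_all add: e_def)
  have ee: "e \<cdot> e = e" and we: "whisker 0 (Suc 0) (jw n) \<cdot> e = e" "e \<cdot> whisker 0 (Suc 0) (jw n) = e"
    and AB: "jw_cap n \<cdot> jw_cup n = loop n \<diamondop> jw n"
    using Suc by (simp_all add: e_def)
  have EE: "E \<cdot> E = E" using whisker_comp[of e e 0 "Suc 0"] by (simp add: E_def ee flip: e_def)
  have A: "jw_cap n = whisker n 0 cap \<cdot> E" and B: "jw_cup n = E \<cdot> whisker n 0 cup"
    by (simp_all add: jw_cap_def jw_cup_def E_def)
  have AE: "jw_cap n \<cdot> E = jw_cap n" and EB: "E \<cdot> jw_cup n = jw_cup n"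
    by (simp_all add: A B EE acomp_reassoc[OF EE])
  have wE: "whisker 0 (Suc (Suc 0)) (jw n) \<cdot> E = E" "E \<cdot> whisker 0 (Suc (Suc 0)) (jw n) = E"
    using whisker_comp[of e "whisker 0 (Suc 0) (jw n)" 0 "Suc 0"] whisker_comp[of "whisker 0 (Suc 0) (jw n)" e 0 "Suc 0"]
    by (simp_all add: we E_def flip: e_def)
  have eA: "jw n \<cdot> jw_cap n = jw_cap n"
  proof -
    have "jw n \<cdot> whisker n 0 cap = whisker n 0 cap \<cdot> whisker 0 (Suc (Suc 0)) (jw n)"
      by (rule slide_cap) simp_all
    then have "jw n \<cdot> whisker n 0 cap \<cdot> E = (whisker n 0 cap \<cdot> whisker 0 (Suc (Suc 0)) (jw n)) \<cdot> E"
      by (simp flip: acomp_assoc)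
    then show ?thesis by (simp add: A wE)
  qed
  have Be: "jw_cup n \<cdot> jw n = jw_cup n"
  proof -
    have "whisker n 0 cup \<cdot> jw n = whisker 0 (Suc (Suc 0)) (jw n) \<cdot> whisker n 0 cup"
      by (rule slide_cup) simp_all
    then have "E \<cdot> whisker n 0 cup \<cdot> jw n = E \<cdot> whisker 0 (Suc (Suc 0)) (jw n) \<cdot> whisker n 0 cup" by simp
    then show ?thesis by (simp add: B acomp_reassoc[OF wE(2)])
  qed
  let ?c = "- inverse (loop n)"
  have ABA: "jw_cap n \<cdot> jw_cup n \<cdot> jw_cap n = loop n \<diamondop> jw_cap n"
    by (simp add: acomp_reassoc[OF AB] acomp_linear eA)
  have F: "jw (Suc (Suc n)) = E \<boxplus> ?c \<diamondop> (jw_cup n \<cdot> jw_cap n)" by (simp add: jw_Suc E_def)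
  have EF: "E \<cdot> jw (Suc (Suc n)) = jw (Suc (Suc n))"
    unfolding F by (simp add: acomp_linear EE acomp_reassoc[OF EB])
  have FE: "jw (Suc (Suc n)) \<cdot> E = jw (Suc (Suc n))"
    unfolding F by (simp add: acomp_linear EE AE)
  have AF: "jw_cap n \<cdot> jw (Suc (Suc n)) = azero (Suc (Suc n)) n"
  proof -
    have "jw_cap n \<cdot> jw (Suc (Suc n)) = 1 \<diamondop> jw_cap n \<boxplus> (- 1) \<diamondop> jw_cap n"
      unfolding F using loop_nonzero[of n] by (simp add: acomp_linear AE ABA aadd_scale)
    also have "\<dots> = 0 \<diamondop> jw_cap n" by (subst aadd_scale(2)) simp_all
    finally show ?thesis by simp
  qed
  have FF: "jw (Suc (Suc n)) \<cdot> jw (Suc (Suc n)) = jw (Suc (Suc n))"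
  proof -
    have "jw (Suc (Suc n)) \<cdot> jw (Suc (Suc n)) = (E \<boxplus> ?c \<diamondop> (jw_cup n \<cdot> jw_cap n)) \<cdot> jw (Suc (Suc n))"
      by (simp only: F)
    also have "\<dots> = jw (Suc (Suc n))" by (simp add: acomp_linear EF AF)
    finally show ?thesis .
  qed
  \<comment> \<open>The middle projector is expanded by the recursion. Its first term closes a loop
    and gives \<delta>; in the second both zigzags straighten, one of them with sign -1, so the
    coefficient \<open>- 1 / loop n\<close> contributes \<open>+ 1 / loop n\<close>.\<close>
  have "jw_cap (Suc n) \<cdot> jw_cup (Suc n) = loop (Suc n) \<diamondop> jw (Suc n)"
  proof -
    let ?u = "whisker (Suc n) 0 cup" and ?a = "whisker (Suc n) 0 cap" and ?F = "whisker 0 (Suc 0) (jw (Suc (Suc n)))"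
    have FF': "?F \<cdot> ?F = ?F" using whisker_comp[of "jw (Suc (Suc n))" "jw (Suc (Suc n))" 0 "Suc 0"] by (simp add: FF)
    have "jw_cap (Suc n) \<cdot> jw_cup (Suc n) = ?a \<cdot> ?F \<cdot> ?u"
      by (simp add: jw_cap_def jw_cup_def acomp_reassoc[OF FF'])
    also have "?F = whisker 0 (Suc (Suc 0)) e \<boxplus> ?c \<diamondop> (whisker 0 (Suc 0) (jw_cup n) \<cdot> whisker 0 (Suc 0) (jw_cap n))"
      unfolding F by (simp add: whisker_linear whisker_comp E_def e_def)
    also have "?a \<cdot> \<dots> \<cdot> ?u = ?a \<cdot> whisker 0 (Suc (Suc 0)) e \<cdot> ?u \<boxplus> ?c \<diamondop> (?a \<cdot> whisker 0 (Suc 0) (jw_cup n) \<cdot> whisker 0 (Suc 0) (jw_cap n) \<cdot> ?u)"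
      by (simp add: acomp_linear)
    also have "?a \<cdot> whisker 0 (Suc (Suc 0)) e \<cdot> ?u = \<delta> \<diamondop> e"
    proof -
      have "whisker 0 (Suc (Suc 0)) e \<cdot> ?u = ?u \<cdot> e" by (simp add: slide_cup)
      moreover have au: "?a \<cdot> ?u = \<delta> \<diamondop> aid (Suc n)"
        using whisker_comp[of cup cap "Suc n" 0] by (simp add: circle whisker_linear)
      ultimately show ?thesis by (simp add: acomp_reassoc[OF au] acomp_linear)
    qed
    also have "whisker 0 (Suc 0) (jw_cap n) \<cdot> ?u = e"
    proof -
      have "whisker 0 (Suc 0) (jw_cap n) = whisker n (Suc 0) cap \<cdot> whisker 0 (Suc (Suc 0)) e"
        by (simp add: jw_cap_def whisker_comp e_def)
      moreover have "whisker 0 (Suc (Suc 0)) e \<cdot> ?u = ?u \<cdot> e" by (simp add: slide_cup)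
      moreover have z: "whisker n (Suc 0) cap \<cdot> ?u = aid (Suc n)"
        using whisker_comp[of "whisker (Suc 0) 0 cup" "whisker 0 (Suc 0) cap" n 0] by (simp add: zigzags)
      ultimately show ?thesis by (simp add: acomp_reassoc[OF z])
    qed
    also have "?a \<cdot> whisker 0 (Suc 0) (jw_cup n) \<cdot> e = (- 1) \<diamondop> e"
    proof -
      have "whisker 0 (Suc 0) (jw_cup n) = whisker 0 (Suc (Suc 0)) e \<cdot> whisker n (Suc 0) cup"
        by (simp add: jw_cup_def whisker_comp e_def)
      moreover have s: "?a \<cdot> whisker 0 (Suc (Suc 0)) e = e \<cdot> ?a" by (simp add: slide_cap)
      moreover have z: "?a \<cdot> whisker n (Suc 0) cup = (- 1) \<diamondop> aid (Suc n)"
        using whisker_comp[of "whisker 0 (Suc 0) cup" "whisker (Suc 0) 0 cap" n 0] by (simp add: zigzags whisker_linear)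
      ultimately show ?thesis by (simp add: acomp_reassoc[OF s] acomp_reassoc[OF z] acomp_linear ee)
    qed
    finally show ?thesis by (simp add: aadd_scale e_def)
  qed
  then show ?case using FF EF FE by (simp add: E_def)
qed

lemma jw_idem: "jw n \<cdot> jw n = jw n"
  using jw_properties by (cases n) auto

lemma jw_absorb: "whisker 0 (Suc 0) (jw n) \<cdot> jw (Suc n) = jw (Suc n)" "jw (Suc n) \<cdot> whisker 0 (Suc 0) (jw n) = jw (Suc n)"
  using jw_properties by blast+

lemma jw_cap_cup: "jw_cap n \<cdot> jw_cup n = loop n \<diamondop> jw n"
  using jw_properties by blast

lemma whisker_jw_idem: "whisker 0 (Suc 0) (jw n) \<cdot> whisker 0 (Suc 0) (jw n) = whisker 0 (Suc 0) (jw n)"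
  using whisker_comp[of "jw n" "jw n" 0 "Suc 0"] by (simp add: jw_idem)

lemma jw_cap_absorb: "jw_cap n \<cdot> whisker 0 (Suc 0) (jw (Suc n)) = jw_cap n" "jw n \<cdot> jw_cap n = jw_cap n"
proof -
  show "jw_cap n \<cdot> whisker 0 (Suc 0) (jw (Suc n)) = jw_cap n"
    by (simp add: jw_cap_def whisker_jw_idem)
  have w: "whisker 0 (Suc (Suc 0)) (jw n) \<cdot> whisker 0 (Suc 0) (jw (Suc n)) = whisker 0 (Suc 0) (jw (Suc n))"
    using whisker_comp[of "jw (Suc n)" "whisker 0 (Suc 0) (jw n)" 0 "Suc 0"] by (simp add: jw_absorb)
  have "jw n \<cdot> whisker n 0 cap = whisker n 0 cap \<cdot> whisker 0 (Suc (Suc 0)) (jw n)"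
    by (rule slide_cap) simp_all
  then have "jw n \<cdot> jw_cap n = (whisker n 0 cap \<cdot> whisker 0 (Suc (Suc 0)) (jw n)) \<cdot> whisker 0 (Suc 0) (jw (Suc n))"
    by (simp add: jw_cap_def flip: acomp_assoc)
  then show "jw n \<cdot> jw_cap n = jw_cap n" using w by (simp add: jw_cap_def)
qed

lemma jw_cup_absorb: "whisker 0 (Suc 0) (jw (Suc n)) \<cdot> jw_cup n = jw_cup n" "jw_cup n \<cdot> jw n = jw_cup n"
proof -
  show "whisker 0 (Suc 0) (jw (Suc n)) \<cdot> jw_cup n = jw_cup n"
    by (simp add: jw_cup_def acomp_reassoc[OF whisker_jw_idem])
  have w: "whisker 0 (Suc 0) (jw (Suc n)) \<cdot> whisker 0 (Suc (Suc 0)) (jw n) = whisker 0 (Suc 0) (jw (Suc n))"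
    using whisker_comp[of "whisker 0 (Suc 0) (jw n)" "jw (Suc n)" 0 "Suc 0"] by (simp add: jw_absorb)
  have "whisker n 0 cup \<cdot> jw n = whisker 0 (Suc (Suc 0)) (jw n) \<cdot> whisker n 0 cup"
    by (rule slide_cup) simp_all
  then show "jw_cup n \<cdot> jw n = jw_cup n" by (simp add: jw_cup_def acomp_reassoc[OF w])
qed

text \<open>The branching rule at the level of morphisms: the two terms are the orthogonal
  idempotents into which the identity of the image with an added strand splits.\<close>

lemma jw_split:
  "whisker 0 (Suc 0) (jw (Suc n)) = jw (Suc (Suc n)) \<boxplus> inverse (loop n) \<diamondop> (jw_cup n \<cdot> jw_cap n)"
  by (simp add: jw_Suc aadd_scale)

lemma jw_cap_jw: "jw_cap n \<cdot> jw (Suc (Suc n)) = azero (Suc (Suc n)) n"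
  and jw_jw_cup: "jw (Suc (Suc n)) \<cdot> jw_cup n = azero n (Suc (Suc n))"
proof -
  have "jw_cap n \<cdot> jw (Suc (Suc n)) = 1 \<diamondop> jw_cap n \<boxplus> (- 1) \<diamondop> jw_cap n"
    unfolding jw_Suc using loop_nonzero[of n]
    by (simp add: acomp_linear jw_cap_absorb acomp_reassoc[OF jw_cap_cup] aadd_scale)
  also have "\<dots> = 0 \<diamondop> jw_cap n" by (subst aadd_scale(2)) simp_all
  finally show "jw_cap n \<cdot> jw (Suc (Suc n)) = azero (Suc (Suc n)) n" by simp
  have "jw (Suc (Suc n)) \<cdot> jw_cup n = 1 \<diamondop> jw_cup n \<boxplus> (- 1) \<diamondop> jw_cup n"
    unfolding jw_Suc using loop_nonzero[of n]
    by (simp add: acomp_linear jw_cup_absorb jw_cap_cup aadd_scale)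
  also have "\<dots> = 0 \<diamondop> jw_cup n" by (subst aadd_scale(2)) simp_all
  finally show "jw (Suc (Suc n)) \<cdot> jw_cup n = azero n (Suc (Suc n))" by simp
qed

text \<open>For \<open>j = 0\<close> the cap meets the last two strands and \<open>jw_cap_jw\<close>
  applies. Otherwise it already kills a smaller projector, which the larger one absorbs.\<close>

lemma cap_jw: "whisker i j cap \<cdot> jw (i + 2 + j) = azero (i + 2 + j) (i + j)"
proof (induction j)
  case 0
  have "whisker i 0 cap \<cdot> jw (Suc (Suc i)) = whisker i 0 cap \<cdot> whisker 0 (Suc 0) (jw (Suc i)) \<cdot> jw (Suc (Suc i))"
    using jw_absorb(1)[of "Suc i"] by simp
  also have "\<dots> = jw_cap i \<cdot> jw (Suc (Suc i))" by (simp add: jw_cap_def)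
  finally show ?case by (simp add: jw_cap_jw numeral_2_eq_2)
next
  case (Suc j)
  have z: "whisker i (Suc j) cap \<cdot> whisker 0 (Suc 0) (jw (i + 2 + j)) = azero (i + 2 + j + 1) (i + j + 1)"
    using whisker_comp[of "jw (i + 2 + j)" "whisker i j cap" 0 "Suc 0"] Suc by simp
  have "whisker i (Suc j) cap \<cdot> jw (i + 2 + Suc j) = whisker i (Suc j) cap \<cdot> whisker 0 (Suc 0) (jw (i + 2 + j)) \<cdot> jw (i + 2 + Suc j)"
    using jw_absorb(1)[of "i + 2 + j"] by simp
  also have "\<dots> = azero (i + 2 + Suc j) (i + Suc j)"
    by (subst acomp_reassoc[OF z]) simp_all
  finally show ?case .
qed

text \<open>The mirror image of \<open>cap_jw\<close>, with absorption on the other side of the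
  projector.\<close>

lemma jw_cup_zero: "jw (i + 2 + j) \<cdot> whisker i j cup = azero (i + j) (i + 2 + j)"
proof (induction j)
  case 0
  have "jw (Suc (Suc i)) \<cdot> whisker i 0 cup = (jw (Suc (Suc i)) \<cdot> whisker 0 (Suc 0) (jw (Suc i))) \<cdot> whisker i 0 cup"
    using jw_absorb(2)[of "Suc i"] by simp
  also have "\<dots> = jw (Suc (Suc i)) \<cdot> jw_cup i" by (simp add: jw_cup_def)
  finally show ?case by (simp add: jw_jw_cup numeral_2_eq_2)
next
  case (Suc j)
  have z: "whisker 0 (Suc 0) (jw (i + 2 + j)) \<cdot> whisker i (Suc j) cup = azero (i + j + 1) (i + 2 + j + 1)"
    using whisker_comp[of "whisker i j cup" "jw (i + 2 + j)" 0 "Suc 0"] Suc by simp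
  have "jw (i + 2 + Suc j) \<cdot> whisker i (Suc j) cup = (jw (i + 2 + Suc j) \<cdot> whisker 0 (Suc 0) (jw (i + 2 + j))) \<cdot> whisker i (Suc j) cup"
    using jw_absorb(2)[of "i + 2 + j"] by simp
  also have "\<dots> = jw (i + 2 + Suc j) \<cdot> whisker 0 (Suc 0) (jw (i + 2 + j)) \<cdot> whisker i (Suc j) cup"
    by (rule acomp_assoc) simp_all
  also have "\<dots> = azero (i + Suc j) (i + 2 + Suc j)" unfolding z by simp
  finally show ?case .
qed

section \<open>Compression of morphisms by projectors\<close>

lemma caps_jw: "caps m n d \<Longrightarrow> m = n \<and> d = aid n \<or> d \<cdot> jw m = azero m n"
proof (induction rule: caps.induct)
  case (2 m i j d)
  note d = caps_arr[OF 2(1)]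
  show ?case
  proof (cases "m = i + 2 + j \<and> d = aid (i + 2 + j)")
    case True
    then show ?thesis using cap_jw[of i j] by simp
  next
    case False
    then have "d \<cdot> jw m = azero m (i + 2 + j)" using 2(2) by blast
    then show ?thesis using d by simp
  qed
qed simp

text \<open>In a normal form a cup comes last and a cap first, so it meets a projector and the
  diagram dies. Only the multiples of an identity survive.\<close>

lemma comb_jw: "comb m n f \<Longrightarrow> \<exists>c. jw n \<cdot> f \<cdot> jw m = (if m = n then c \<diamondop> jw n else azero m n)"
proof (induction rule: comb.induct)
  case (comb_zero m n)
  then show ?case by (intro exI[of _ 0]) simp
next
  case (comb_add m n f g)
  note f = comb_arr[OF comb_add.hyps(1)] comb_arr[OF comb_add.hyps(2)]
  obtain a b where "jw n \<cdot> f \<cdot> jw m = (if m = n then a \<diamondop> jw n else azero m n)"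
    "jw n \<cdot> g \<cdot> jw m = (if m = n then b \<diamondop> jw n else azero m n)"
    using comb_add.IH by blast
  then show ?case using f by (intro exI[of _ "a + b"]) (simp add: acomp_linear aadd_scale)
next
  case (comb_scale m n f c)
  note f = comb_arr[OF comb_scale.hyps(1)]
  obtain a where "jw n \<cdot> f \<cdot> jw m = (if m = n then a \<diamondop> jw n else azero m n)"
    using comb_scale.IH by blast
  then show ?case using f by (intro exI[of _ "c * a"]) (simp add: acomp_linear aadd_scale)
next
  case (comb_caps m n d)
  note d = caps_arr[OF this]
  from caps_jw[OF comb_caps] show ?case
  proof
    assume "m = n \<and> d = aid n"
    then show ?thesis by (intro exI[of _ 1]) (simp add: jw_idem)
  next
    assume "d \<cdot> jw m = azero m n"
    then show ?thesis by (intro exI[of _ 0]) simp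
  qed
next
  case (comb_cup m i j f)
  note f = comb_arr[OF comb_cup.hyps]
  have "jw (i + 2 + j) \<cdot> (whisker i j cup \<cdot> f) \<cdot> jw m = (jw (i + 2 + j) \<cdot> whisker i j cup) \<cdot> f \<cdot> jw m"
    using f by simp
  then have "jw (i + 2 + j) \<cdot> (whisker i j cup \<cdot> f) \<cdot> jw m = azero m (i + 2 + j)"
    unfolding jw_cup_zero using f by simp
  then show ?case by (intro exI[of _ 0]) simp
qed

lemma jw_schur:
  assumes "arr f"
  shows "\<exists>c. jw (trg f) \<cdot> f \<cdot> jw (src f) = (if src f = trg f then c \<diamondop> jw (trg f) else azero (src f) (trg f))"
  using comb_jw[OF arr_comb[OF assms]] .

text \<open>The composite of \<open>jw_cap n\<close> and \<open>jw_cup n\<close> contains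
  \<open>jw (Suc n)\<close> and is a nonzero multiple of \<open>jw n\<close>, so vanishing passes
  down to the unit object.\<close>

lemma jw_zero_imp: "jw n = azero n n \<Longrightarrow> aid 0 = azero 0 0"
proof (induction n)
  case (Suc n)
  have "loop n \<diamondop> jw n = jw_cap n \<cdot> jw_cup n" by (simp add: jw_cap_cup)
  also have "\<dots> = azero n n" using Suc.prems by (simp add: jw_cap_def)
  finally have "inverse (loop n) \<diamondop> loop n \<diamondop> jw n = azero n n" by simp
  then have "jw n = azero n n" using loop_nonzero[of n] by (simp add: aadd_scale)
  then show ?case by (rule Suc.IH)
qed simp

end

section \<open>The representation on tensor powers of a super plane\<close>

text \<open>Matrices over words in a letter of parity 0 (\<open>False\<close>) and one of parity 1 (\<open>True\<close>).
  The entry \<open>rep r t u v\<close> is the coefficient of \<open>u\<close> in the image of \<open>v\<close>; the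
  sign in the tensor product is the Koszul sign for moving the second factor past \<open>v\<^sub>1\<close>.\<close>

definition wpar :: "bool list \<Rightarrow> bit" where "wpar u = (\<Sum>b\<leftarrow>u. if b then 1 else 0)"

abbreviation words :: "nat \<Rightarrow> bool list set" where "words n \<equiv> {u. length u = n}"

text \<open>Terms do not record the boundaries of their parts, while \<open>rep\<close> has to know
  over which words to sum in \<open>Comp\<close> and where to cut words in
  \<open>Tens\<close>.\<close>

fun tsrc :: "'k stl_term \<Rightarrow> nat" and ttrg :: "'k stl_term \<Rightarrow> nat" where
  "tsrc (Ident n) = n" | "ttrg (Ident n) = n"
| "tsrc Cup = 0" | "ttrg Cup = 2" | "tsrc Cap = 2" | "ttrg Cap = 0"
| "tsrc (Comp g f) = tsrc f" | "ttrg (Comp g f) = ttrg g"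
| "tsrc (Tens f g) = tsrc f + tsrc g" | "ttrg (Tens f g) = ttrg f + ttrg g"
| "tsrc (Zero m n) = m" | "ttrg (Zero m n) = n"
| "tsrc (Add f g) = tsrc f" | "ttrg (Add f g) = ttrg f"
| "tsrc (Scale a f) = tsrc f" | "ttrg (Scale a f) = ttrg f"

text \<open>Cup and cap pair letters of opposite parity and are therefore odd. The coefficients
  satisfy both zigzag relations with their Koszul signs, and the loop evaluates to
  \<open>inverse r - r\<close>.\<close>

fun rep :: "'k::field \<Rightarrow> 'k stl_term \<Rightarrow> bool list \<Rightarrow> bool list \<Rightarrow> 'k" where
  "rep r (Ident n) u v = (if u = v then 1 else 0)"
| "rep r Cup u v = (if u = [False, True] then inverse r else if u = [True, False] then 1 else 0)"
| "rep r Cap u v = (if v = [False, True] then 1 else if v = [True, False] then - r else 0)"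
| "rep r (Comp g f) u v = (\<Sum>w\<in>words (ttrg f). rep r g u w * rep r f w v)"
| "rep r (Tens f g) u v = koszul ((wpar (drop (ttrg f) u) + wpar (drop (tsrc f) v)) * wpar (take (tsrc f) v))
     * rep r f (take (ttrg f) u) (take (tsrc f) v) * rep r g (drop (ttrg f) u) (drop (tsrc f) v)"
| "rep r (Zero m n) u v = 0"
| "rep r (Add f g) u v = rep r f u v + rep r g u v"
| "rep r (Scale a f) u v = a * rep r f u v"

section \<open>Parities of matrix entries and soundness of the representation\<close>

lemma typed_src_trg: "stl_typed t m n \<Longrightarrow> tsrc t = m \<and> ttrg t = n"
  by (induction rule: stl_typed.induct) auto

lemma finite_words [simp]: "finite (words n)"
  using finite_lists_length_eq[of "UNIV :: bool set" n] by simp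

lemma wpar_append [simp]: "wpar (u @ v) = wpar u + wpar v"
  by (simp add: wpar_def)

lemma sum_words_add:
  "(\<Sum>w\<in>words (m + n). F (take m w) (drop m w)) = (\<Sum>u\<in>words m. \<Sum>v\<in>words n. (F u v :: 'k::comm_monoid_add))"
proof -
  have "(\<Sum>w\<in>words (m + n). F (take m w) (drop m w)) = (\<Sum>(u, v)\<in>words m \<times> words n. F u v)"
    by (rule sum.reindex_bij_witness[of _ "\<lambda>(u, v). u @ v" "\<lambda>w. (take m w, drop m w)"]) auto
  then show ?thesis by (simp add: sum.cartesian_product)
qed

text \<open>In the super interchange law this converts Koszul signs of individual words into the
  single sign given by the parities of the two terms.\<close>

lemma rep_parity:
  "\<lbrakk>stl_typed t m n; stl_parity t p; length u = n; length v = m; rep r t u v \<noteq> 0\<rbrakk> \<Longrightarrow> wpar u + wpar v = p"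
proof (induction arbitrary: p u v rule: stl_typed.induct)
  case (1 n)
  then have "p = 0" "u = v" by (auto elim: stl_parity.cases split: if_splits)
  then show ?case by (cases "wpar v") auto
next
  case 2
  then have "p = 1" by (auto elim: stl_parity.cases)
  with 2 show ?case by (auto simp: wpar_def split: if_splits)
next
  case 3
  then have "p = 1" by (auto elim: stl_parity.cases)
  with 3 show ?case by (auto simp: wpar_def split: if_splits)
next
  case (4 g m n f l)
  from 4(5) obtain a b where ab: "stl_parity g a" "stl_parity f b" "p = a + b" by cases auto
  have "\<exists>w\<in>words m. rep r g u w * rep r f w v \<noteq> 0"
  proof (rule ccontr)
    assume "\<not> ?thesis"
    then have "rep r (Comp g f) u v = 0" using typed_src_trg[OF 4(2)] by (simp add: sum.neutral)
    with 4(8) show False by simp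
  qed
  then obtain w where w: "length w = m" "rep r g u w \<noteq> 0" "rep r f w v \<noteq> 0" by auto
  have "wpar u + wpar w = a" "wpar w + wpar v = b"
    using 4(3)[OF ab(1) 4(6) w(1,2)] 4(4)[OF ab(2) w(1) 4(7) w(3)] by simp_all
  then show ?case using ab(3) by (cases "wpar u"; cases "wpar v"; cases "wpar w") auto
next
  case (5 f m m' g n n')
  from 5(5) obtain a b where ab: "stl_parity f a" "stl_parity g b" "p = a + b" by cases auto
  note t = typed_src_trg[OF 5(1)] typed_src_trg[OF 5(2)]
  have "rep r f (take m' u) (take m v) \<noteq> 0" "rep r g (drop m' u) (drop m v) \<noteq> 0" using 5(8) t by auto
  then have "wpar (take m' u) + wpar (take m v) = a" "wpar (drop m' u) + wpar (drop m v) = b"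
    using 5(3)[OF ab(1), of "take m' u" "take m v"] 5(4)[OF ab(2), of "drop m' u" "drop m v"] 5(6,7) by simp_all
  moreover have "wpar u = wpar (take m' u) + wpar (drop m' u)" "wpar v = wpar (take m v) + wpar (drop m v)"
    by (simp_all flip: wpar_append)
  ultimately show ?case using ab(3) by (simp add: ac_simps)
next
  case (7 f m n g)
  from 7(5) have p: "stl_parity f p" "stl_parity g p" by (cases, auto)+
  from 7(8) have "rep r f u v \<noteq> 0 \<or> rep r g u v \<noteq> 0" by auto
  then show ?case using 7(3)[OF p(1) 7(6,7)] 7(4)[OF p(2) 7(6,7)] by blast
next
  case (8 f m n a)
  from 8(3) have "stl_parity f p" by cases auto
  with 8 show ?case by auto
qed simp

lemma words_zero: "words 0 = {[]}"
  by auto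

lemma words_Suc: "words (Suc n) = Cons False ` words n \<union> Cons True ` words n"
  by (auto simp: length_Suc_conv image_iff)

lemma words_numeral:
  "words 1 = {[False], [True]}"
  "words 2 = {[False, False], [False, True], [True, False], [True, True]}"
  "words 3 = {[False, False, False], [False, False, True], [False, True, False], [False, True, True],
     [True, False, False], [True, False, True], [True, True, False], [True, True, True]}"
  unfolding numeral_2_eq_2 numeral_3_eq_3 One_nat_def words_Suc words_zero by (simp_all add: insert_commute)

text \<open>Since the matrices satisfy every rule generating the congruence, one differing matrix
  entry certifies that two morphisms are different.\<close>

lemma rep_sound:
  assumes "r \<noteq> 0" "\<delta> = inverse r - r"
  shows "stl_eq \<delta> m n f g \<Longrightarrow> \<forall>u v. length u = n \<longrightarrow> length v = m \<longrightarrow> rep r f u v = rep r g u v"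
proof (induction rule: stl_eq.induct)
  case (comp_cong m n g g' l f f')
  then have "ttrg f = m" "ttrg f' = m" using stl_eq_typed typed_src_trg by blast+
  then show ?case using comp_cong.IH by (auto intro!: sum.cong)
next
  case (tens_cong m m' f f' n n' g g')
  then have "ttrg f = m'" "ttrg f' = m'" "tsrc f = m" "tsrc f' = m" using stl_eq_typed typed_src_trg by blast+
  then show ?case using tens_cong.IH by auto
next
  case (comp_assoc h n k g m f l)
  then have t: "ttrg f = m" "ttrg g = n" using typed_src_trg by blast+
  show ?case
    by (simp add: t sum_distrib_left sum_distrib_right mult.assoc) (auto intro!: sum.swap)
next
  case (comp_id_left f m n)
  then have "ttrg f = n" using typed_src_trg by blast
  then show ?case by (auto simp: if_distrib[of "\<lambda>c. c * _"] cong: if_cong)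
next
  case (comp_id_right f m n)
  then show ?case by (auto simp: if_distrib[of "\<lambda>c. _ * c"] cong: if_cong)
next
  case (comp_add_left g m n g' f l)
  then show ?case by (simp add: sum.distrib distrib_right)
next
  case (comp_add_right g m n f l f')
  then have "ttrg f = m" "ttrg f' = m" using typed_src_trg by blast+
  then show ?case by (simp add: sum.distrib distrib_left)
next
  case (comp_scale_left g m n f l a)
  then show ?case by (simp add: sum_distrib_left mult.assoc)
next
  case (comp_scale_right g m n f l a)
  then show ?case by (simp add: sum_distrib_left mult.left_commute)
next
  case (tens_assoc f l l' g m m' h n n')
  then have t: "ttrg f = l'" "ttrg g = m'" "tsrc f = l" "tsrc g = m" using typed_src_trg by blast+
  \<comment> \<open>The Koszul exponents of the two bracketings; \<open>a\<close> and
    \<open>b\<close> are the parities of the first two blocks of the source word.\<close>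
  have k: "koszul ((x + y) * (a + b)) * koszul ((c + d) * a) = (koszul ((c + x + (d + y)) * a) * koszul ((x + y) * b) :: 'a)"
    for x y a b c d :: bit
    by (cases x; cases y; cases a; cases b; cases c; cases d) (simp_all add: koszul_def)
  show ?case
  proof (intro allI impI)
    fix u v :: "bool list"
    have w: "wpar (drop l' u) = wpar (take m' (drop l' u)) + wpar (drop m' (drop l' u))"
      "wpar (drop l v) = wpar (take m (drop l v)) + wpar (drop m (drop l v))"
      "wpar (take (l + m) v) = wpar (take l v) + wpar (take m (drop l v))"
      by (metis append_take_drop_id wpar_append, metis append_take_drop_id wpar_append, simp add: take_add)
    have d: "take m' (drop l' u) = drop l' (take (l' + m') u)" "take m (drop l v) = drop l (take (l + m) v)"
      "drop m' (drop l' u) = drop (l' + m') u" "drop m (drop l v) = drop (l + m) v"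
      by (simp_all add: drop_take add.commute)
    show "rep r (Tens (Tens f g) h) u v = rep r (Tens f (Tens g h)) u v"
      using k[of "wpar (drop m' (drop l' u))" "wpar (drop m (drop l v))" "wpar (take l v)" "wpar (take m (drop l v))"
          "wpar (take m' (drop l' u))" "wpar (take m (drop l v))"]
      by (simp add: t w(3)) (simp add: w(1,2) d[symmetric] min_def mult_ac flip: d(1,2))
  qed
next
  case (tens_unit_left f m n)
  then show ?case by (simp add: wpar_def)
next
  case (tens_unit_right f m n)
  then have "ttrg f = n" "tsrc f = m" using typed_src_trg by blast+
  then show ?case by (simp add: wpar_def)
next
  case (tens_id m n)
  have k: "koszul ((wpar a + wpar a) * b) = (1 :: 'a)" for a b by (cases "wpar a"; cases b) simp_all
  show ?case
  proof (intro allI impI)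
    fix u v :: "bool list"
    show "rep r (Tens (Ident m) (Ident n)) u v = rep r (Ident (m + n)) u v"
    proof (cases "u = v")
      case False
      then have "take m u \<noteq> take m v \<or> drop m u \<noteq> drop m v" by (metis append_take_drop_id)
      with False show ?thesis by auto
    qed (simp add: k)
  qed
next
  case (tens_add_left f m m' f' g n n')
  then have "ttrg f = m'" "tsrc f = m" "ttrg f' = m'" "tsrc f' = m" using typed_src_trg by blast+
  then show ?case by (simp add: algebra_simps)
next
  case (tens_add_right f m m' g n n' g')
  then show ?case by (simp add: algebra_simps)
next
  case (tens_scale_left f m m' g n n' a)
  then show ?case by (simp add: algebra_simps)
next
  case (tens_scale_right f m m' g n n' a)
  then show ?case by (simp add: algebra_simps)
next
  case (super_interchange f m' m'' g n' n'' h m k n p q)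
  then have t: "ttrg f = m''" "tsrc f = m'" "ttrg h = m'" "tsrc h = m" "ttrg k = n'" using typed_src_trg by blast+
  show ?case
  proof (intro allI impI)
    fix u v :: "bool list" assume u: "length u = m'' + n''" and v: "length v = m + n"
    define u1 u2 v1 v2 where uv: "u1 = take m'' u" "u2 = drop m'' u" "v1 = take m v" "v2 = drop m v"
    have len: "length u1 = m''" "length u2 = n''" "length v1 = m" "length v2 = n" using u v by (simp_all add: uv)
    let ?F = "\<lambda>w1 w2. koszul ((wpar u2 + wpar w2) * wpar w1) * rep r f u1 w1 * rep r g u2 w2 *
        (koszul ((wpar w2 + wpar v2) * wpar v1) * rep r h w1 v1 * rep r k w2 v2)"
    have "rep r (Comp (Tens f g) (Tens h k)) u v = (\<Sum>w\<in>words (m' + n'). ?F (take m' w) (drop m' w))"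
      by (simp add: t uv)
    also have "\<dots> = (\<Sum>w1\<in>words m'. \<Sum>w2\<in>words n'. ?F w1 w2)" by (rule sum_words_add)
    also have "\<dots> = (\<Sum>w1\<in>words m'. \<Sum>w2\<in>words n'. koszul (p * q) * koszul ((wpar u2 + wpar v2) * wpar v1) *
        (rep r f u1 w1 * rep r h w1 v1) * (rep r g u2 w2 * rep r k w2 v2))"
    proof (intro sum.cong HOL.refl)
      fix w1 w2 :: "bool list" assume w: "w1 \<in> words m'" "w2 \<in> words n'"
      show "?F w1 w2 = koszul (p * q) * koszul ((wpar u2 + wpar v2) * wpar v1) *
        (rep r f u1 w1 * rep r h w1 v1) * (rep r g u2 w2 * rep r k w2 v2)"
      \<comment> \<open>Terms with an entry of the wrong parity vanish. In the others
        \<open>p\<close> is the sum of the parities of \<open>u2\<close> and \<open>w2\<close>, and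
        \<open>q\<close> that of \<open>w1\<close> and \<open>v1\<close>; then the signs on both
        sides agree.\<close>
      proof (cases "rep r g u2 w2 = 0 \<or> rep r h w1 v1 = 0")
        case True
        then show ?thesis by auto
      next
        case False
        then have "wpar u2 + wpar w2 = p" "wpar w1 + wpar v1 = q"
          using rep_parity[OF super_interchange(2,5)] rep_parity[OF super_interchange(3,6)] len w by auto
        then have "koszul ((wpar u2 + wpar w2) * wpar w1) * koszul ((wpar w2 + wpar v2) * wpar v1)
          = (koszul (p * q) * koszul ((wpar u2 + wpar v2) * wpar v1) :: 'a)"
          by (cases "wpar u2"; cases "wpar w2"; cases "wpar w1"; cases "wpar v1"; cases "wpar v2") (auto simp: koszul_def)
        then show ?thesis by (simp add: mult_ac)
      qed
    qed
    also have "\<dots> = rep r (Scale (koszul (p * q)) (Tens (Comp f h) (Comp g k))) u v"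
      by (simp add: t uv sum_product sum_distrib_left mult_ac)
    finally show "rep r (Comp (Tens f g) (Tens h k)) u v = rep r (Scale (koszul (p * q)) (Tens (Comp f h) (Comp g k))) u v" .
  qed
next
  case zigzag
  have c: "rep r (Comp (Tens Cap (Ident 1)) (Tens (Ident 1) Cup)) u v
    = (\<Sum>w\<in>words 3. rep r (Tens Cap (Ident 1)) u w * rep r (Tens (Ident 1) Cup) w v)" for u v
    unfolding rep.simps(4) by (simp del: rep.simps add: numeral_3_eq_3)
  have "u \<in> words 1 \<Longrightarrow> v \<in> words 1 \<Longrightarrow> rep r (Comp (Tens Cap (Ident 1)) (Tens (Ident 1) Cup)) u v = rep r (Ident 1) u v" for u v
    unfolding c words_numeral using assms by (auto simp: wpar_def koszul_def)
  then show ?case by simp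
next
  case zigzag'
  have c: "rep r (Comp (Tens (Ident 1) Cap) (Tens Cup (Ident 1))) u v
    = (\<Sum>w\<in>words 3. rep r (Tens (Ident 1) Cap) u w * rep r (Tens Cup (Ident 1)) w v)" for u v
    unfolding rep.simps(4) by (simp del: rep.simps)
  have "u \<in> words 1 \<Longrightarrow> v \<in> words 1 \<Longrightarrow> rep r (Comp (Tens (Ident 1) Cap) (Tens Cup (Ident 1))) u v = rep r (Scale (- 1) (Ident 1)) u v" for u v
    unfolding c words_numeral using assms by (auto simp: wpar_def koszul_def)
  then show ?case by simp
next
  case circle
  show ?case using assms by (auto simp: words_numeral)
qed (auto simp: algebra_simps)

text \<open>By \<open>jw_zero_imp\<close> a zero projector would make the identity of the unit
  object zero, but for \<open>r = q\<close> this identity is represented by the 1-by-1 matrix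
  1.\<close>

lemma (in generic_odd_temperley_lieb) jw_nonzero: "jw n \<noteq> azero n n"
proof
  assume "jw n = azero n n"
  then have "aid 0 = azero 0 0" by (rule jw_zero_imp)
  then have "stl_class \<delta> 0 0 (Ident 0) = stl_class \<delta> 0 0 (Zero 0 0)"
    by (simp add: aid_def azero_def STL_simps)
  then have "stl_eq \<delta> 0 0 (Ident 0) (Zero 0 0)" by (rule stl_class_eqD) (rule stl_typed.intros)
  from rep_sound[OF q_nonzero _ this] have "rep q (Ident 0) [] [] = rep q (Zero 0 0) [] []"
    using \<delta>_eq by simp
  then show False by simp
qed

section \<open>The ring spanned by the quantum integers\<close>

lemma of_int_zpi: "(of_int k :: zpi) = abs_zpi [:k:]"
proof -
  have nat: "(of_nat m :: zpi) = abs_zpi [:int m:]" for m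
  proof (induction m)
    case 0
    then show ?case by (simp add: zero_zpi_def)
  next
    case (Suc m)
    then show ?case by (simp add: one_zpi_def plus_zpi.abs_eq one_pCons)
  qed
  show ?thesis
  proof (cases k rule: int_cases2)
    case (nonpos m)
    then show ?thesis using nat[of m] by (simp add: uminus_zpi.abs_eq)
  qed (use nat in simp)
qed

text \<open>A polynomial of degree at most 1 that is divisible by the quadratic
  \<open>\<pi>^2 - 1\<close> is zero.\<close>

lemma zpi_independent:
  assumes "(of_int a :: zpi) + of_int b * zpi_pi = 0"
  shows "a = 0 \<and> b = 0"
proof -
  have "abs_zpi ([:a:] + [:b:] * [:0, 1:]) = abs_zpi 0"
    using assms by (simp only: of_int_zpi zpi_pi_def times_zpi.abs_eq plus_zpi.abs_eq zero_zpi_def)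
  then have "[:- 1, 0, 1:] dvd [:a, b:]" by (simp add: zpi.abs_eq_iff)
  then have "[:a, b:] = 0 \<or> 2 \<le> degree [:a, b:]" using dvd_imp_degree_le[of "[:- 1, 0, 1:]" "[:a, b:]"] by fastforce
  then show ?thesis by (auto split: if_splits)
qed

lemma zpi_pi_square: "zpi_pi * zpi_pi = 1"
  by transfer (simp add: one_pCons)

lemma lookup_of_int_mult:
  fixes p :: zpi_laurent
  shows "Poly_Mapping.lookup (of_int k * p) N = of_int k * Poly_Mapping.lookup p N"
proof -
  have nat: "Poly_Mapping.lookup (of_nat m * p) N = of_nat m * Poly_Mapping.lookup p N" for m
    by (induction m) (simp_all add: distrib_right lookup_add)
  show ?thesis
    by (cases k rule: int_cases2) (simp_all add: nat)
qed

section \<open>Quantum integers attached to the simple objects\<close>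

definition pi_power :: "bit \<Rightarrow> zpi_laurent" where
  "pi_power a = (if a = 0 then 1 else Poly_Mapping.single 0 zpi_pi)"

lemma pi_power_add: "pi_power a * pi_power b = pi_power (a + b)"
  by (cases a; cases b) (simp_all add: pi_power_def mult_single zpi_pi_square)

text \<open>The intended class of the simple object with label \<open>(a, n)\<close>: a parity shift
  acts as multiplication by \<pi>, and the image of \<open>jw n\<close> corresponds to
  \<open>[n + 1]\<close>.\<close>

definition quantum_simple :: "bit \<times> nat \<Rightarrow> zpi_laurent" where
  "quantum_simple i = pi_power (fst i) * qint (snd i)"

lemma qint_basis_eq: "qint_basis = range quantum_simple"
proof -
  have "range quantum_simple = (\<lambda>n. quantum_simple (0, n)) ` UNIV \<union> (\<lambda>n. quantum_simple (1, n)) ` UNIV"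
  proof
    show "range quantum_simple \<subseteq> (\<lambda>n. quantum_simple (0, n)) ` UNIV \<union> (\<lambda>n. quantum_simple (1, n)) ` UNIV"
    proof
      fix y assume "y \<in> range quantum_simple"
      then obtain a n where "y = quantum_simple (a, n)" by auto
      then show "y \<in> (\<lambda>n. quantum_simple (0, n)) ` UNIV \<union> (\<lambda>n. quantum_simple (1, n)) ` UNIV"
        by (cases a) auto
    qed
  qed auto
  then show ?thesis by (auto simp: qint_basis_def quantum_simple_def pi_power_def)
qed

text \<open>Only the leading term \<open>i = 0\<close> has an exponent as large as \<open>n\<close>.
  Independence follows from this triangularity.\<close>

lemma lookup_quantum_simple:
  "Poly_Mapping.lookup (quantum_simple (a, n)) (int N)
    = (if n = N then (if a = 0 then 1 else zpi_pi) else 0)" if "n \<le> N"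
proof -
  have "quantum_simple (a, n) = (\<Sum>i\<le>n. Poly_Mapping.single (int n - 2 * int i) ((if a = 0 then 1 else zpi_pi) * zpi_pi ^ i))"
    by (simp add: quantum_simple_def pi_power_def qint_def sum_distrib_left mult_single)
  then have "Poly_Mapping.lookup (quantum_simple (a, n)) (int N)
    = (\<Sum>i\<le>n. if i = 0 \<and> n = N then (if a = 0 then 1 else zpi_pi) else 0)"
    using that by (auto simp: lookup_sum lookup_single when_def intro!: sum.cong)
  also have "\<dots> = (if n = N then (if a = 0 then 1 else zpi_pi) else 0)"
    by (cases "n = N") simp_all
  finally show ?thesis .
qed

text \<open>The coefficient of the highest leading power \<open>x^N\<close> is
  \<open>a + b \<pi>\<close>, where \<open>a\<close> and \<open>b\<close> are the multiplicities of
  the two elements of index \<open>N\<close>. Both vanish by \<open>zpi_independent\<close>.\<close>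

lemma quantum_simple_independent:
  assumes "int_comb quantum_simple n = 0"
  shows "n = 0"
proof (rule ccontr)
  assume "n \<noteq> 0"
  let ?K = "Poly_Mapping.keys n"
  define N where "N = Max (snd ` ?K)"
  have K: "finite (snd ` ?K)" "snd ` ?K \<noteq> {}" using \<open>n \<noteq> 0\<close> by auto
  have "N \<in> snd ` ?K" unfolding N_def by (rule Max_in[OF K])
  then obtain a where a: "(a, N) \<in> ?K" by auto
  have le: "snd i \<le> N" if "i \<in> ?K" for i unfolding N_def using K that by simp
  \<comment> \<open>Both elements of index \<open>N\<close> are adjoined, since perhaps only one of
    them occurs in \<open>n\<close>.\<close>
  let ?A = "?K \<union> {(0, N), (1, N)}"
  have "int_comb quantum_simple n = (\<Sum>i\<in>?A. of_int (Poly_Mapping.lookup n i) * quantum_simple i)"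
    by (rule int_comb_superset) auto
  then have "0 = (\<Sum>i\<in>?A. of_int (Poly_Mapping.lookup n i) * Poly_Mapping.lookup (quantum_simple i) (int N))"
    using assms by (metis (no_types, lifting) lookup_of_int_mult lookup_sum lookup_zero sum.cong)
  also have "\<dots> = (\<Sum>i\<in>{(0, N), (1, N)}. of_int (Poly_Mapping.lookup n i) * Poly_Mapping.lookup (quantum_simple i) (int N))"
  proof (rule sum.mono_neutral_right)
    show "\<forall>i\<in>?A - {(0, N), (1, N)}. of_int (Poly_Mapping.lookup n i) * Poly_Mapping.lookup (quantum_simple i) (int N) = 0"
    proof
      fix i assume i: "i \<in> ?A - {(0, N), (1, N)}"
      obtain b m where [simp]: "i = (b, m)" by (cases i)
      have "m \<noteq> N" using i by (cases b) auto
      moreover have "m \<le> N" using i le[of i] by auto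
      ultimately show "of_int (Poly_Mapping.lookup n i) * Poly_Mapping.lookup (quantum_simple i) (int N) = 0"
        by (simp add: lookup_quantum_simple)
    qed
  qed auto
  also have "\<dots> = of_int (Poly_Mapping.lookup n (0, N)) + of_int (Poly_Mapping.lookup n (1, N)) * zpi_pi"
    by (simp add: lookup_quantum_simple)
  finally have "Poly_Mapping.lookup n (0, N) = 0 \<and> Poly_Mapping.lookup n (1, N) = 0"
    by (intro zpi_independent) simp
  with a show False by (cases a) (auto simp: in_keys_iff)
qed

lemma qint_zero: "qint 0 = 1"
  by (simp add: qint_def)

lemma qint_one: "qint 1 = Poly_Mapping.single 1 1 + Poly_Mapping.single (- 1) zpi_pi"
  by (simp add: qint_def)

lemma qint_rec: "qint (Suc n) * qint 1 = qint (Suc (Suc n)) + Poly_Mapping.single 0 zpi_pi * qint n"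
proof -
  \<comment> \<open>The last term of \<open>qint (Suc (Suc n))\<close>. It is missing from the
    product of \<open>qint (Suc n)\<close> with \<open>x\<close> and is what the product with
    \<open>\<pi> x^(-1)\<close> has beyond \<open>\<pi>\<close> times \<open>qint n\<close>, so it
    cancels.\<close>
  let ?t = "Poly_Mapping.single (- 2 - int n) (zpi_pi ^ (n + 2))"
  have 1: "qint (Suc n) * Poly_Mapping.single 1 1 + ?t = qint (Suc (Suc n))"
  proof -
    have "qint (Suc n) * Poly_Mapping.single 1 1 = (\<Sum>i\<le>Suc n. Poly_Mapping.single (int (Suc (Suc n)) - 2 * int i) (zpi_pi ^ i))"
      unfolding qint_def sum_distrib_right by (intro sum.cong HOL.refl) (simp add: mult_single algebra_simps)
    moreover have "qint (Suc (Suc n)) = (\<Sum>i\<le>Suc n. Poly_Mapping.single (int (Suc (Suc n)) - 2 * int i) (zpi_pi ^ i))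
        + Poly_Mapping.single (int (Suc (Suc n)) - 2 * int (Suc (Suc n))) (zpi_pi ^ Suc (Suc n))"
      unfolding qint_def by (rule sum.atMost_Suc)
    moreover have "int (Suc (Suc n)) - 2 * int (Suc (Suc n)) = - 2 - int n" by simp
    ultimately show ?thesis by (simp only: add_2_eq_Suc')
  qed
  have 2: "qint (Suc n) * Poly_Mapping.single (- 1) zpi_pi = Poly_Mapping.single 0 zpi_pi * qint n + ?t"
  proof -
    have "qint (Suc n) * Poly_Mapping.single (- 1) zpi_pi
        = (\<Sum>i\<le>Suc n. Poly_Mapping.single (int n - 2 * int i) (zpi_pi ^ Suc i))"
      unfolding qint_def sum_distrib_right by (intro sum.cong HOL.refl) (simp add: mult_single algebra_simps)
    also have "\<dots> = (\<Sum>i\<le>n. Poly_Mapping.single (int n - 2 * int i) (zpi_pi ^ Suc i)) + ?t"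
    proof -
      have "int n - 2 * int (Suc n) = - 2 - int n" by simp
      then show ?thesis by (simp only: sum.atMost_Suc add_2_eq_Suc')
    qed
    also have "(\<Sum>i\<le>n. Poly_Mapping.single (int n - 2 * int i) (zpi_pi ^ Suc i)) = Poly_Mapping.single 0 zpi_pi * qint n"
      unfolding qint_def sum_distrib_left by (simp add: mult_single)
    finally show ?thesis .
  qed
  show ?thesis unfolding qint_one distrib_left 2 1[symmetric] by simp
qed

lemma quantum_simple_rec:
  "quantum_simple (a, Suc n) * quantum_simple (0, 1) = quantum_simple (a, Suc (Suc n)) + quantum_simple (a + 1, n)"
proof -
  have "quantum_simple (a, Suc n) * quantum_simple (0, 1) = pi_power a * (qint (Suc n) * qint 1)"
    by (simp add: quantum_simple_def pi_power_def)
  also have "\<dots> = pi_power a * qint (Suc (Suc n)) + (pi_power a * pi_power 1) * qint n"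
    unfolding qint_rec by (simp add: pi_power_def distrib_left mult.assoc)
  finally show ?thesis by (simp add: pi_power_add quantum_simple_def)
qed

section \<open>Images of projectors\<close>

definition one_mat :: "'m \<Rightarrow> 'm mat" where "one_mat f = mat 1 1 (\<lambda>_. f)"

lemma one_mat_inject [simp]: "one_mat f = one_mat g \<longleftrightarrow> f = g"
proof
  assume "one_mat f = one_mat g"
  then have "one_mat f $$ (0, 0) = one_mat g $$ (0, 0)" by (rule arg_cong)
  then show "f = g" by (simp add: one_mat_def)
qed simp

text \<open>Computing with one-entry lists is computing in \<open>C\<close>; the zero added to the
  composite is the empty tail of a one-term sum.\<close>

lemma one_mat_envelope:
  shows "one_mat f \<in> Mor (additive_envelope C) [u] [v] \<longleftrightarrow> f \<in> Mor C u v"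
    and "id_mor (additive_envelope C) [u] = one_mat (id_mor C u)"
    and "comp_mor (additive_envelope C) [u] [v] [w] (one_mat g) (one_mat f)
       = one_mat (add_mor C u w (comp_mor C u v w g f) (zero_mor C u w))"
    and "zero_mor (additive_envelope C) [u] [v] = one_mat (zero_mor C u v)"
    and "add_mor (additive_envelope C) [u] [v] (one_mat f) (one_mat g) = one_mat (add_mor C u v f g)"
    and "tensor_mor (additive_envelope C) [u] [u'] [v] [v'] (one_mat f) (one_mat g) = one_mat (tensor_mor C u u' v v' f g)"
  unfolding additive_envelope_simps one_mat_def by (auto intro!: eq_matI)

lemma one_mat_cases:
  assumes "M \<in> Mor (additive_envelope C) [u] [v]"
  obtains f where "f \<in> Mor C u v" "M = one_mat f"
proof
  show "M $$ (0, 0) \<in> Mor C u v" "M = one_mat (M $$ (0, 0))"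
    using assms by (auto simp: additive_envelope_simps one_mat_def intro!: eq_matI)
qed

section \<open>Images of idempotents in the super Karoubi envelope\<close>

context odd_temperley_lieb
begin

abbreviation D :: "(bit \<times> nat, 'k stl_term set, 'k) lin_moncat" where "D \<equiv> underlying (Pi_envelope (STL \<delta>))"
abbreviation K :: "((bit \<times> nat) list \<times> 'k stl_term set mat, 'k stl_term set mat, 'k) lin_moncat" where "K \<equiv> SKar (STL \<delta>)"

sublocale D: monoidal_preadditive D
  by (rule even_envelope_monoidal) (rule STL_strict_monoidal_supercategory)

sublocale E: monoidal_preadditive "additive_envelope D"
  by (rule additive_envelope_monoidal) (rule D.monoidal_preadditive_axioms)

lemma K_eq: "K = idempotent_completion (additive_envelope D)"
  by (simp add: SKar_def Kar_def)

sublocale K: monoidal_preadditive K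
  unfolding K_eq by (rule idempotent_completion_monoidal) (rule E.monoidal_preadditive_axioms)

definition projector :: "'k arrow \<Rightarrow> bool" where
  "projector e \<longleftrightarrow> arr e \<and> trg e = src e \<and> e \<cdot> e = e"

definition mor :: "'k arrow \<Rightarrow> 'k stl_term set mat" where "mor f = one_mat (und f)"

text \<open>The summand that \<open>e\<close> cuts out of the tensor power with \<open>src e\<close>
  strands, shifted by \<open>a\<close>. The simple objects and their tensor products with the
  generator have this form.\<close>

definition im :: "bit \<Rightarrow> 'k arrow \<Rightarrow> (bit \<times> nat) list \<times> 'k stl_term set mat" where
  "im a e = ([(a, src e)], mor e)"

lemma projector_homog:
  assumes "projector e"
  shows "und e \<in> homog (STL \<delta>) (src e) (src e) 0"
proof (rule homog_iff_degree)
  have "trg e = src e" "arr e" using assms by (simp_all add: projector_def)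
  then show "und e \<in> Mor (STL \<delta>) (src e) (src e)" unfolding arr_def by (simp only:)
qed simp

lemma mor_inject: "\<lbrakk>src f = src g; trg f = trg g\<rbrakk> \<Longrightarrow> mor f = mor g \<longleftrightarrow> f = g"
  by (auto simp: mor_def prod_eq_iff)

lemma envelope_comp:
  "\<lbrakk>arr g; arr f; src f = l; trg f = m; src g = m; trg g = n\<rbrakk>
    \<Longrightarrow> comp_mor (additive_envelope D) [(a, l)] [(b, m)] [(c, n)] (mor g) (mor f) = mor (g \<cdot> f)"
  by (simp add: mor_def one_mat_envelope even_envelope_simps)
     (simp add: acomp_def arr_def STL.add_zero_right STL.comp_closed)

lemma im_Mor:
  assumes "projector e" "projector e'" "arr f" "src f = src e" "trg f = src e'"
  shows "mor f \<in> Mor K (im a e) (im b e') \<longleftrightarrow>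
    und f \<in> homog (STL \<delta>) (src e) (src e') (a + b) \<and> e' \<cdot> f = f \<and> f \<cdot> e = f"
proof -
  have "src (e' \<cdot> f) = src f" "trg (e' \<cdot> f) = trg f" "src (f \<cdot> e) = src f" "trg (f \<cdot> e) = trg f"
    using assms by (auto simp: projector_def)
  with assms show ?thesis
    unfolding K_eq idempotent_completion_simps
    by (simp add: im_def projector_def envelope_comp mor_inject)
       (simp add: mor_def one_mat_envelope even_envelope_simps)
qed

lemma im_MorI:
  assumes "projector e" "projector e'" "arr f" "src f = src e" "trg f = src e'" "e' \<cdot> f = f" "f \<cdot> e = f"
    "stl_degree (src e) (src e') (a + b)"
  shows "mor f \<in> Mor K (im a e) (im b e')"
  unfolding im_Mor[OF assms(1-5)] using assms(3-8) homog_iff_degree[of "und f"] by (simp add: arr_def)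

lemma im_Mor_cases:
  assumes "M \<in> Mor K (im a e) (im b e')" "projector e" "projector e'"
  obtains f where "M = mor f" "arr f" "src f = src e" "trg f = src e'"
    "und f \<in> homog (STL \<delta>) (src e) (src e') (a + b)" "e' \<cdot> f = f" "f \<cdot> e = f"
proof -
  have "M \<in> Mor (additive_envelope D) [(a, src e)] [(b, src e')]"
    using assms(1) unfolding K_eq idempotent_completion_simps by (simp add: im_def)
  then obtain F where F: "F \<in> Mor D (a, src e) (b, src e')" "M = one_mat F" by (rule one_mat_cases)
  let ?f = "(src e, src e', F)"
  have M: "M = mor ?f" using F(2) by (simp add: mor_def)
  have a: "arr ?f"
    using F(1) STL.homog_closed by (simp add: arr_def even_envelope_simps)
  show ?thesis
    using im_Mor[OF assms(2,3) a, of a b] assms(1) by (intro that[OF M a]) (simp_all add: M)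
qed

lemma im_Ob: "projector e \<Longrightarrow> im a e \<in> Ob K"
  unfolding K_eq idempotent_completion_simps
  by (simp add: im_def envelope_comp projector_def)
     (simp add: mor_def one_mat_envelope even_envelope_simps additive_envelope_simps(1) projector_homog projector_def
       flip: One_nat_def)

lemma im_comp:
  "\<lbrakk>arr g; arr f; src f = src e; trg f = src e'; src g = src e'; trg g = src e''\<rbrakk>
    \<Longrightarrow> comp_mor K (im a e) (im b e') (im c e'') (mor g) (mor f) = mor (g \<cdot> f)"
  unfolding K_eq idempotent_completion_simps by (simp add: im_def envelope_comp)

lemma im_add:
  "\<lbrakk>src f = src e; trg f = src e'; src g = src e; trg g = src e'\<rbrakk>
    \<Longrightarrow> add_mor K (im a e) (im b e') (mor f) (mor g) = mor (f \<boxplus> g)"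
  unfolding K_eq idempotent_completion_simps
  by (simp add: im_def mor_def one_mat_envelope even_envelope_simps aadd_def)

lemma im_zero: "zero_mor K (im a e) (im b e') = mor (azero (src e) (src e'))"
  unfolding K_eq idempotent_completion_simps
  by (simp add: im_def mor_def one_mat_envelope even_envelope_simps azero_def)

lemma im_id: "id_mor K (im a e) = mor e"
  unfolding K_eq idempotent_completion_simps by (simp add: im_def)

lemma im_unit: "unit_ob K = im 0 (aid 0)"
  unfolding K_eq idempotent_completion_simps
  by (simp add: im_def mor_def additive_envelope_simps(7) one_mat_envelope even_envelope_simps aid_def STL_simps(5))

text \<open>An endomorphism has the same label at source and target, so the sign exponent
  \<open>(a + a) * b\<close> vanishes.\<close>

lemma im_tensor:
  assumes "projector e" "projector e'"
  shows "tensor_ob K (im a e) (im b e') = im (a + b) (e \<star> e')"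
proof -
  have "und e \<in> homog (STL \<delta>) (src e) (src e) (a + a)" "und e' \<in> homog (STL \<delta>) (src e') (src e') (b + b)"
    using assms by (simp_all add: projector_homog)
  then have "tensor_mor D (a, src e) (a, src e) (b, src e') (b, src e') (und e) (und e')
    = scale_mor (STL \<delta>) (src e + src e') (src e + src e') 1 (und (e \<star> e'))"
    using assms
    by (subst even_envelope_tensor[OF STL_strict_monoidal_supercategory])
       (simp_all add: projector_def atens_def STL_simps(6))
  moreover have "arr (e \<star> e')" using assms by (simp add: projector_def)
  ultimately have "tensor_mor D (a, src e) (a, src e) (b, src e') (b, src e') (und e) (und e') = und (e \<star> e')"
    using assms by (simp add: arr_def projector_def STL.scale_one)
  then show ?thesis
    unfolding K_eq idempotent_completion_simps
    by (simp add: im_def additive_envelope_simps(8) even_envelope_simps mor_def one_mat_envelope STL_simps(6))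
qed

lemma projector_aid [simp]: "projector (aid n)"
  by (simp add: projector_def)

text \<open>An object \<open>(xs, e)\<close> is a retract of \<open>(xs, 1)\<close>, whose identity
  is a sum through one-entry lists. So only the shifted tensor powers have to be generated.\<close>

lemma K_generated:
  assumes "preadditive_family K S"
    and power: "\<And>a n. sum_through K S (im a (aid n)) (im a (aid n)) (id_mor K (im a (aid n)))"
    and "x \<in> Ob K"
  shows "sum_through K S x x (id_mor K x)"
proof -
  interpret preadditive_family K S by fact
  obtain xs e where x: "x = (xs, e)" by (cases x)
  note simps = idempotent_completion_simps[where C = "additive_envelope D", folded K_eq]
  have xs: "xs \<in> Ob (additive_envelope D)" and e: "e \<in> Mor (additive_envelope D) xs xs"
    "comp_mor (additive_envelope D) xs xs xs e e = e"
    using assms(3) unfolding simps x by simp_all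
  let ?Y = "(xs, id_mor (additive_envelope D) xs)"
  have Y: "?Y \<in> Ob K" using xs by (simp add: simps E.id_closed E.comp_id_left)
  have single: "([u], id_mor (additive_envelope D) [u]) = im (fst u) (aid (snd u))" for u
    by (simp add: im_def mor_def one_mat_envelope even_envelope_simps aid_def)
  obtain \<iota> \<rho> where *: "\<And>k. k < length xs \<Longrightarrow> \<iota> k \<in> Mor (additive_envelope D) [xs ! k] xs \<and> \<rho> k \<in> Mor (additive_envelope D) xs [xs ! k]"
    "id_mor (additive_envelope D) xs = sum_mor (additive_envelope D) xs xs
      (map (\<lambda>k. comp_mor (additive_envelope D) xs [xs ! k] xs (\<iota> k) (\<rho> k)) [0..<length xs])"
    using additive_envelope_id_sum[OF D.preadditive_category_axioms xs] by blast
  let ?y = "\<lambda>k. ([xs ! k], id_mor (additive_envelope D) [xs ! k])"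
  have "id_mor K ?Y = sum_mor K ?Y ?Y (map (\<lambda>k. comp_mor K ?Y (?y k) ?Y (\<iota> k) (\<rho> k)) [0..<length xs])"
    unfolding simps sum_mor_idempotent_completion[where C = "additive_envelope D", folded K_eq] fst_conv snd_conv by (rule *(2))
  moreover have "sum_through K S ?Y ?Y (comp_mor K ?Y (?y k) ?Y (\<iota> k) (\<rho> k))" if k: "k < length xs" for k
  proof (rule sum_through_trans)
    have o: "[xs ! k] \<in> Ob (additive_envelope D)" using xs k by (auto simp: additive_envelope_simps(1))
    show "sum_through K S (?y k) (?y k) (id_mor K (?y k))" unfolding single by (rule power)
    show "\<rho> k \<in> Mor K ?Y (?y k)" "\<iota> k \<in> Mor K (?y k) ?Y"
      using *(1)[OF k] xs o by (simp_all add: simps E.comp_id_left E.comp_id_right)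
    show "?y k \<in> Ob K" unfolding single by (rule im_Ob) simp
  qed (fact Y)+
  ultimately have gen: "sum_through K S ?Y ?Y (id_mor K ?Y)"
    using sum_through_sum[OF Y Y] by (metis (no_types, lifting) atLeastLessThan_iff imageE set_map set_upt)
  \<comment> \<open>The idempotent \<open>e\<close> itself serves as inclusion and as
    retraction.\<close>
  have "e \<in> Mor K x ?Y" "e \<in> Mor K ?Y x"
    unfolding simps x using xs e by (simp_all add: E.comp_id_left E.comp_id_right)
  from sum_through_trans[OF gen this assms(3) Y assms(3)] show ?thesis
    unfolding x simps using e by simp
qed

end

section \<open>Semisimplicity and the Grothendieck ring\<close>

context generic_odd_temperley_lieb
begin

definition simple :: "bit \<times> nat \<Rightarrow> (bit \<times> nat) list \<times> 'k stl_term set mat" where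
  "simple i = im (fst i) (jw (snd i))"

definition endo :: "bit \<times> nat \<Rightarrow> 'k \<Rightarrow> 'k stl_term set mat" where
  "endo i c = mor (c \<diamondop> jw (snd i))"

lemma projector_jw [simp]: "projector (jw n)"
  by (simp add: projector_def jw_idem)

sublocale S: preadditive_family K simple
  by unfold_locales (simp add: simple_def im_Ob)

text \<open>A morphism between images equals its own compression by the two projectors, so
  \<open>jw_schur\<close> applies.\<close>

lemma simple_Mor:
  assumes M: "M \<in> Mor K (simple i) (simple j)"
  shows "if i = j then \<exists>c. M = endo i c else M = zero_mor K (simple i) (simple j)"
proof -
  obtain a m b n where ij: "i = (a, m)" "j = (b, n)" by (cases i; cases j)
  obtain f where f: "M = mor f" "arr f" "src f = m" "trg f = n"
    "und f \<in> homog (STL \<delta>) m n (a + b)" "jw n \<cdot> f = f" "f \<cdot> jw m = f"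
    using im_Mor_cases[OF M[unfolded simple_def] projector_jw projector_jw] by (simp add: ij) blast
  from jw_schur[OF f(2)] obtain c where c: "f = (if m = n then c \<diamondop> jw n else azero m n)" using f by auto
  show ?thesis
  proof (cases "m = n")
    case True
    \<comment> \<open>For different labels the morphism is odd, whereas every endomorphism of a
      tensor power is even. Only zero is both, so an object and its parity shift are
      orthogonal.\<close>
    have "f = azero m n" if "a \<noteq> b"
    proof -
      have "a + b \<noteq> 0" using that by (cases a; cases b) simp_all
      have "und f \<in> homog (STL \<delta>) m n 0" using f(2-4) True homog_iff_degree[of "und f" m n 0] by (simp add: arr_def)
      from STL.homog_part_same[OF _ _ this] STL.homog_part_other[OF _ _ f(5), of 0] \<open>a + b \<noteq> 0\<close>
      have "und f = zero_mor (STL \<delta>) m n" by simp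
      then show ?thesis using f(3,4) by (simp add: azero_def prod_eq_iff)
    qed
    then show ?thesis using True c f(1) by (auto simp: ij endo_def simple_def im_zero)
  next
    case False
    then show ?thesis using c f(1) by (simp add: ij simple_def im_zero)
  qed
qed

lemma simple_unit: "unit_ob K = simple (0, 0)"
  by (simp add: im_unit simple_def)

lemma simple_shift: "tensor_ob K (simple (a, n)) (simple (b, 0)) = simple (a + b, n)"
  by (simp add: simple_def im_tensor)

lemma simple_zero_tensor: "tensor_ob K (simple (a, 0)) (simple (0, 1)) = simple (a, 1)"
  by (simp add: simple_def im_tensor)

text \<open>\<open>jw_split\<close> gives the resolution of the identity; \<open>jw_cap_jw\<close>
  and \<open>jw_jw_cup\<close> give the orthogonality of the summands.\<close>

lemma simple_Suc_tensor:
  "direct_sum K (tensor_ob K (simple (a, Suc n)) (simple (0, 1))) [simple (a, Suc (Suc n)), simple (a + 1, n)]"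
proof -
  \<comment> \<open>The factor \<open>inverse (loop n)\<close> normalises the projection:
    \<open>?c\<close> after \<open>jw_cup n\<close> is \<open>jw n\<close>.\<close>
  let ?w = "whisker 0 (Suc 0) (jw (Suc n))" and ?j = "jw (Suc (Suc n))" and ?c = "inverse (loop n) \<diamondop> jw_cap n"
  have T: "tensor_ob K (simple (a, Suc n)) (simple (0, 1)) = im a ?w"
    by (simp add: simple_def im_tensor whisker_def)
  have w: "projector ?w" by (simp add: projector_def whisker_jw_idem)
  have d: "stl_degree (Suc (Suc n)) n (a + (a + 1))" "stl_degree n (Suc (Suc n)) (a + 1 + a)"
    "stl_degree (Suc (Suc n)) (Suc (Suc n)) (a + a)" by (cases a; simp)+
  have "biproduct K (im a ?w) (im a ?j) (im (a + 1) (jw n)) (mor ?j) (mor (jw_cup n)) (mor ?j) (mor ?c)"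
    unfolding biproduct_def
  proof (intro conjI im_Ob im_MorI)
    show "add_mor K (im a ?w) (im a ?w) (comp_mor K (im a ?w) (im a ?j) (im a ?w) (mor ?j) (mor ?j))
      (comp_mor K (im a ?w) (im (a + 1) (jw n)) (im a ?w) (mor (jw_cup n)) (mor ?c)) = id_mor K (im a ?w)"
      by (simp add: im_comp im_add im_id acomp_linear jw_idem flip: jw_split)
  qed (use d loop_nonzero[of n] in \<open>simp_all add: w im_comp im_id im_zero acomp_linear jw_idem jw_absorb
      jw_cap_absorb jw_cup_absorb jw_cap_jw jw_jw_cup jw_cap_cup aadd_scale\<close>)
  then show ?thesis unfolding T unfolding simple_def fst_conv snd_conv K.direct_sum_pair by blast
qed

text \<open>Strands are added one at a time. By \<open>generated_tensor\<close> only simple objects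
  have to be tensored with the generator; the result is simple for index 0 and otherwise splits by
  \<open>simple_Suc_tensor\<close>.\<close>

lemma power_generated: "sum_through K simple (im a (aid n)) (im a (aid n)) (id_mor K (im a (aid n)))"
proof (induction n)
  case 0
  show ?case using S.generated_simple[of "(a, 0)"] by (simp add: simple_def[of "(a, 0)"])
next
  case (Suc n)
  have "im a (aid (Suc n)) = tensor_ob K (im a (aid n)) (simple (0, 1))"
    by (simp add: simple_def im_tensor)
  moreover have "sum_through K simple (tensor_ob K (simple i) (simple (0, 1))) (tensor_ob K (simple i) (simple (0, 1)))
    (id_mor K (tensor_ob K (simple i) (simple (0, 1))))" for i
  proof (cases i)
    case (Pair b m)
    show ?thesis
    proof (cases m)
      case 0
      show ?thesis unfolding Pair 0 simple_zero_tensor by (rule S.generated_simple)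
    next
      case (Suc m')
      show ?thesis unfolding Pair Suc
        by (rule S.generated_direct_sum[OF simple_Suc_tensor S.generated_simple S.generated_simple])
    qed
  qed
  ultimately show ?case
    using generated_tensor[OF S.preadditive_family_axioms K.monoidal_preadditive_axioms S.S_ob _ im_Ob[OF projector_aid] Suc.IH]
    by simp
qed

text \<open>Zero object, biproducts and splittings come from the Karoubi construction. Specific to
  \<open>STL\<close> are the orthogonality and nonvanishing of the projectors and the generation by
  their images.\<close>

sublocale K: schurian_monoidal_category K simple endo quantum_simple
proof (intro schurian_monoidal_category.intro schurian_category.intro schurian_category_axioms.intro
    S.preadditive_family_axioms K.monoidal_preadditive_axioms)
  \<comment> \<open>The empty formal sum is a zero object.\<close>
  show "\<exists>z\<in>Ob K. id_mor K z = zero_mor K z z"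
    unfolding K_eq using additive_envelope_zero[of D] E.id_closed[of "[]"] E.comp_id_left[of "[]" "[]" "id_mor (additive_envelope D) []"]
    by (intro bexI[of _ "([], id_mor (additive_envelope D) [])"]) (simp_all add: idempotent_completion_simps)
  show "\<exists>z. direct_sum K z [x, y]" if "x \<in> Ob K" "y \<in> Ob K" for x y
    using that additive_envelope_biproduct[OF D.preadditive_category_axioms] unfolding K_eq
    by (intro idempotent_completion_biproduct E.preadditive_category_axioms) blast+
  show "\<exists>y\<in>Ob K. \<exists>r\<in>Mor K x y. \<exists>s\<in>Mor K y x. comp_mor K y x y r s = id_mor K y \<and> comp_mor K x y x s r = e"
    if "x \<in> Ob K" "e \<in> Mor K x x" "comp_mor K x x x e e = e" for x e
    using that unfolding K_eq by (intro idempotent_completion_split E.preadditive_category_axioms)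
  show "endo i a \<in> Mor K (simple i) (simple i)" for i a
    unfolding simple_def endo_def by (rule im_MorI) (simp_all add: acomp_linear jw_idem)
  show "\<exists>a. f = endo i a" if "f \<in> Mor K (simple i) (simple i)" for f i
    using simple_Mor[OF that] by simp
  show "f = zero_mor K (simple i) (simple j)" if "i \<noteq> j" "f \<in> Mor K (simple i) (simple j)" for f i j
    using simple_Mor[OF that(2)] that(1) by simp
  \<comment> \<open>Dividing by a nonzero \<open>a\<close> would make the projector itself
    zero.\<close>
  show "a = 0" if "endo i a = zero_mor K (simple i) (simple i)" for a i
  proof (rule ccontr)
    assume "a \<noteq> 0"
    have "a \<diamondop> jw (snd i) = azero (snd i) (snd i)"
      using that by (simp add: endo_def simple_def im_zero mor_inject)
    then have "inverse a \<diamondop> a \<diamondop> jw (snd i) = azero (snd i) (snd i)" by simp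
    then show False using \<open>a \<noteq> 0\<close> jw_nonzero by (simp add: aadd_scale)
  qed
  show "endo i (a + b) = add_mor K (simple i) (simple i) (endo i a) (endo i b)" for i a b
    by (simp add: endo_def simple_def im_add aadd_scale)
  show "endo i (a * b) = comp_mor K (simple i) (simple i) (simple i) (endo i a) (endo i b)" for i a b
    by (simp add: endo_def simple_def im_comp acomp_linear jw_idem aadd_scale mult.commute)
  show "endo i 1 = id_mor K (simple i)" for i
    by (simp add: endo_def simple_def im_id)
  show "sum_through K simple x x (id_mor K x)" if "x \<in> Ob K" for x
    using K_generated[OF S.preadditive_family_axioms power_generated that] .
qed

section \<open>Multiplicativity of the character\<close>

lemma multiplicative_shift: "K.multiplicative (simple (b, 0))"
  unfolding K.multiplicative_def K.char_simple
  by (intro ballI K.char_tensor_right S.S_ob, unfold split_paired_all simple_shift K.char_simple)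
     (simp add: quantum_simple_def qint_zero mult.commute mult.left_commute flip: pi_power_add)

text \<open>On simple left factors the branching rule matches \<open>quantum_simple_rec\<close>.
  Index 0 is separate because there the tensor product stays simple.\<close>

lemma multiplicative_one: "K.multiplicative (simple (0, 1))"
  unfolding K.multiplicative_def K.char_simple
proof (intro ballI K.char_tensor_right S.S_ob)
  fix i :: "bit \<times> nat"
  obtain a n where i: "i = (a, n)" by (cases i)
  show "K.char (tensor_ob K (simple i) (simple (0, 1))) = quantum_simple i * quantum_simple (0, 1)"
  proof (cases n)
    case 0
    then show ?thesis unfolding i 0 simple_zero_tensor K.char_simple by (simp add: quantum_simple_def qint_zero pi_power_def)
  next
    case (Suc m)
    show ?thesis unfolding i Suc K.char_add[OF simple_Suc_tensor] K.char_simple quantum_simple_rec ..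
  qed
qed

text \<open>Strong induction: the simple object of index \<open>n + 2\<close> is the complement of
  one of index \<open>n\<close> in the tensor product of one of index \<open>n + 1\<close> with the
  generator, so \<open>multiplicative_add(2)\<close> applies.\<close>

lemma multiplicative_simple: "K.multiplicative (simple (a, n))"
proof (induction n arbitrary: a rule: less_induct)
  case (less n)
  consider "n = 0" | "n = Suc 0" | m where "n = Suc (Suc m)" by (metis not0_implies_Suc)
  then show ?case
  proof cases
    case 1
    then show ?thesis using multiplicative_shift by simp
  next
    case 2
    have "simple (a, n) = tensor_ob K (simple (a, 0)) (simple (0, 1))" unfolding 2 simple_zero_tensor by simp
    then show ?thesis using K.multiplicative_tensor[OF multiplicative_shift multiplicative_one S.S_ob S.S_ob] by simp
  next
    case (3 m)
    have "K.multiplicative (simple (a, Suc m))" "K.multiplicative (simple (a + 1, m))" using less.IH 3 by simp_all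
    with K.multiplicative_add(2)[OF simple_Suc_tensor] K.multiplicative_tensor[OF _ multiplicative_one S.S_ob S.S_ob] 3
    show ?thesis by blast
  qed
qed

sublocale K: schurian_character K simple endo quantum_simple
proof unfold_locales
  show "K.char (tensor_ob K x y) = K.char x * K.char y" if "x \<in> Ob K" "y \<in> Ob K" for x y
    using K.multiplicative_all[OF _ that(2)] multiplicative_simple that(1)
    unfolding K.multiplicative_def by (metis surj_pair)
  show "K.char (unit_ob K) = 1"
    unfolding simple_unit K.char_simple by (simp add: quantum_simple_def qint_zero pi_power_def)
qed (rule quantum_simple_independent)

end

theorem theorem1p18:
  fixes q \<delta> :: "'k::field"
  assumes "CHAR('k) \<noteq> 2"
    and "q \<noteq> 0"
    and "\<And>n. n > 0 \<Longrightarrow> q ^ n \<noteq> 1"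
    and "\<delta> = - (q - inverse q)"
  defines "C \<equiv> SKar (STL \<delta>)"
  shows "semisimple_abelian_category C \<and>
    (\<forall>x y. irreducible_ob C x \<and> irreducible_ob C y \<and> K0_class C x = K0_class C y
       \<longrightarrow> isomorphic C x y) \<and>
    based_ring (K0 C) {K0_class C x | x. irreducible_ob C x} \<and>
    subring qint_span ring_of_type_algebra \<and>
    based_ring qint_ring qint_basis \<and>
    based_ring_isomorphic (K0 C) {K0_class C x | x. irreducible_ob C x} qint_ring qint_basis"
proof -
  interpret generic_odd_temperley_lieb \<delta> q
    by unfold_locales fact+
  have span: "qint_span = {int_comb quantum_simple n | n. True}"
    unfolding qint_span_def qint_basis_eq by (rule K.combinations_generate)
  show ?thesis
    unfolding C_def qint_ring_def span qint_basis_eq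
    by (intro conjI allI impI K.semisimple_abelian K.K0_based_ring K.combinations_subring
        K.combinations_based_ring K.K0_based_iso) (blast intro: K.irreducible_class_inj)
qed

end
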